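(* Let $\mathbb B$ be a non-collinear class of conjugate bars of $T(f,g)$. Then $$I(C_f,P_{\mathbb B})=\nu_f(\mathbb B)\,m^*(\mathbb B),\qquad I(C_g,P_{\mathbb B})=\nu_g(\mathbb B)\,m^*(\mathbb B),$$ $$I(C,P_{\mathbb B})=[\nu_f(\mathbb B)+\nu_g(\mathbb B)]\,m^*(\mathbb B),$$ where $C_f=f^{-1}(0)$, $C_g=g^{-1}(0)$ and $C=C_f\cup C_g$. These intersection multiplicities are tree-invariants of $(f,g)$. Similarly, the orders (in $x$) of the factors in the decomposition $$J_{(f,g)}(x,y)=\text{unit}\cdot y^E\cdot Q_{B_*}(x,y)\cdot\prod_{\mathbb B}P_{\mathbb B}(x,y)\cdot Q_{\mathbb B}(x,y),\qquad E\ge 0,$$ in $\mathbb C\{x,y\}$ (the product being over all non-collinear classes $\mathbb B$ with $h(\mathbb B)>0$) are tree-invariants.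
   Context: SETTING. Let $f,g:(\mathbb C^2,O)\to(\mathbb C,O)$ be holomorphic germs in coordinates $(x,y)$, with Newton–Puiseux factorisations $f=u\,y^{E_1}\prod_{i=1}^p[x-\alpha_i(y)]$, $g=u'\,y^{E_2}\prod_{j=1}^q[x-\beta_j(y)]$, where $E_1,E_2\ge 0$, $u,u'$ are units and $\alpha_i,\beta_j$ are fractional power series in $y$ of positive order $O_y$. Write $\lambda_1,\dots,\lambda_N$ ($N=p+q$) for $\alpha_1,\dots,\alpha_p,\beta_1,\dots,\beta_q$; they are assumed pairwise distinct. Put $O(\lambda,\mu):=O_y(\lambda(y)-\mu(y))$ (contact order). An arc is a fractional power series in $y$. Let $J=J_{(f,g)}=f_yg_x-f_xg_y$. A polar root is a Newton–Puiseux root $x=\gamma(y)$ of $J$ with $O_y(\gamma)>0$ and $f(\gamma(y),y)g(\gamma(y),y)\ne0$; let $\gamma_j$ be the polar roots, listed with multiplicity. TREE $T(f,g)$. The ground bar $B_*$ has height $h(B_* )=0$ and carries one trunk (the main trunk), consisting of all $\lambda_k$. On top of each trunk there is one bar $B$ whose height $h(B)$ is the minimum of the contact orders between members of the trunk ($\infty$ if the trunk has one member); the members of the trunk are divided into classes by $\lambda\equiv\mu$ iff $O(\lambda,\mu)>h(B)$, and each class is a trunk growing on $B$; continue recursively. Bars of infinite height are omitted: "bar" means bar of finite height. A trunk consisting of $s$ of the $\alpha_i$ and $t$ of the $\beta_j$ has bimultiplicity $[s,t]$. For a bar $B$ and a root $\lambda_k$ in a trunk on $B$, let $\lambda_B$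 be $\lambda_k$ with all terms $y^e$, $e\ge h(B)$, omitted (independent of the choice of $\lambda_k$; $\lambda_{B_*}=0$). Then $\lambda_k=\lambda_B+cy^{h(B)}+\cdots$ ($\cdots$ meaning higher order terms), and the trunk containing $\lambda_k$ is said to grow on $B$ at $c\in\mathbb C$ (the main trunk grows on $B_*$ at $0$). If $B'$ is the bar on top of a trunk growing on $B$ at $c$, then $B'$ is a postbar of $B$ supported at $c$, written $B\perp_cB'$ or $B\perp B'$. If $B\perp_c B_1\perp\cdots\perp B'$ (or $B\perp_cB'$), then $B'$ lies over $c$. An arc $\xi$ climbs over $B$ at $a\in\mathbb C$ if $\xi=\lambda_B+ay^{h(B)}+\cdots$; if moreover no trunk grows on $B$ at $a$, then $\xi$ leaves the tree on $B$ at $a$. $\xi$ is bounded by $B$ if $O(\xi,\lambda_B)<h(B)$. RATIONAL FUNCTION. For a bar $B$ and $F\in\{f,g\}$ let $\nu_F(B):=O_y(F(\lambda_B(y)+zy^{h(B)},y))$ for generic $z\in\mathbb C$ (in particular $\nu_f(B_* )=E_1$, $\nu_g(B_* )=E_2$). Let the trunks on $B$ grow at $z_1,\dots,z_l$ with bimultiplicities $[p_k,q_k]$. Put $\Delta_B(z_k):=\nu_f(B)q_k-\nu_g(B)p_k$ and $\mathcal M_B(z):=\sum_{k}\frac{\Delta_B(z_k)}{z-z_k}$. The point $z_k$ is collinear if $\Delta_B(z_k)=0$ and non-collinear otherwise; $C(B)$, $N(B)$ are the sets of collinear and non-collinear points. $B$ is collinear if $\Delta_B(z_k)=0$ for all $k$,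 non-collinear otherwise, purely non-collinear if $C(B)=\emptyset\neq N(B)$. For non-collinear $B$, $m_B(z)$ is the multiplicity of $z\in\mathbb C$ as a zero of $\mathcal M_B$ ($0$ if not a zero), $m(B)=\sum_zm_B(z)$; a zero of $\mathcal M_B$ not in $C(B)$ is a pure mero-zero, and $m^*(B)$ is the number of pure mero-zeros on $B$ counted with multiplicity. COVER. For $c\in C(B)$, a set of non-collinear bars $\{\bar B_1,\dots,\bar B_l\}$ is a cover of $c$ if: (i) each $\bar B_s$ lies over $c$ and is minimal in the sense that there is a sequence $B\perp B_1^*\perp\cdots\perp B^*_{r(s)}\perp\bar B_s$ with $B\perp_cB_1^*$, where either $r(s)=0$ (i.e. $B\perp_c\bar B_s$) or all $B_i^*$ are collinear; (ii) each root $\lambda_k$ climbing over $B$ at $c$ also climbs over a (unique) $\bar B_s$. Every $c\in C(B)$ has a unique cover. CONJUGATE BARS AND FACTORS. Bars $B,\bar B$ are conjugate if $h(B)=h(\bar B)$ and there is an irreducible $p(x,y)\in\mathbb C\{x,y\}$ one of whose Newton–Puiseux roots climbs over $B$ and one of whose roots climbs over $\bar B$. This is an equivalence relation. The bars of a class $\mathbb B$ have common values of $h,\nu_f,\nu_g$, denoted $h(\mathbb B),\nu_f(\mathbb B),\nu_g(\mathbb B)$, and are all collinear or all non-collinear; $\mathbb B$ is called accordingly. For non-collinear $\mathbb B$: $m^*(\mathbb B):=\sum_{B\in\mathbb B}m^*(B)$, and $P_{\mathbb B}(x,y):=\prod_j[x-\gamma_j(y)]$ over all $j$ such that $\gamma_j$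 leaves the tree on some $B\in\mathbb B$; $P_{\mathbb B}$ also denotes the curve germ defined by $P_{\mathbb B}(x,y)=0$. For non-collinear $\mathbb B$ with $h(\mathbb B)>0$: $Q_{\mathbb B}(x,y):=\prod_j[x-\gamma_j(y)]$ over all $j$ such that $\gamma_j$ climbs over some $B\in\mathbb B$ at some $c\in C(B)$ and is bounded by every bar of the cover of $c$ ($Q_{\mathbb B}:=1$ if $\mathbb B$ is purely non-collinear). For the ground bar $B_*$ (collinear or not): $Q_{B_*}(x,y):=\prod_j[x-\gamma_j(y)]$ over all $j$ such that $\gamma_j$ is bounded by every non-collinear bar of minimal height. All $P_{\mathbb B}$, $Q_{\mathbb B}$ and $Q_{B_*}$ lie in $\mathbb C\{x,y\}$, and they give the decomposition of $J_{(f,g)}$ displayed in the claim. $I(\cdot,\cdot)$ is the intersection multiplicity at $O$, computed with the equations $f$, $g$, $fg$ for $C_f$, $C_g$, $C$. EQUIVALENCE. $(f,g)$ and $(f',g')$ (both as in the setting) are equivalent if the following two conditions hold. (1) The roots of $f$ and $f'$, and of $g$ and $g'$, are in one-one correspondence $\alpha_i\mapsto\alpha_i'$, $\beta_j\mapsto\beta_j'$, preserving all contact orders $O(\alpha_i,\alpha_k)$, $O(\alpha_i,\beta_j)$, $O(\beta_j,\beta_s)$. Equivalently, there is a bijection between the bars and trunks of $T(f,g)$ and those of $T(f',g')$ preserving heights and bimultiplicities; if $B$ corresponds to $B'$ then $\nu_f(B)=\nu_{f'}(B')$ and $\nu_g(B)=\nu_{g'}(B')$, so $B$ is collinear iff $B'$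 is, and the points where trunks grow on $B$ correspond to those on $B'$ with equal values of $\Delta$. (2) If $B$ corresponds to $B'$, non-collinear, then $m(B)=m(B')$, and if $c\in C(B)$ corresponds to $c'\in C(B')$ then $m_B(c)=m_{B'}(c')$. An equivalence induces a bijection between the classes of conjugate bars of $T(f,g)$ and of $T(f',g')$. An object associated to $(f,g)$ is a tree-invariant of $(f,g)$ if it depends only on the equivalence class of $(f,g)$ (for objects attached to a class $\mathbb B$, the comparison is with the corresponding class $\mathbb B'$).
   Formalization: The order of Q_{B_*} is not invariant in general; it is claimed only if the ground bar is non-collinear or both pairs have equally many polar roots. Minimal height in Q_{B_*} means minimal along the tree; equivalence includes equal E_1, E_2; at least one root λ_k is required. *)

theory Defs
  imports
    "HOL-Complex_Analysis.Complex_Analysis"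
    "HOL-Library.Extended"
    "HOL-Library.Extended_Nat"
begin

section \<open>Fractional power series in \<open>y\<close>\<close>

definition has_denom :: "nat \<Rightarrow> (rat \<Rightarrow> complex) \<Rightarrow> bool" where
  "has_denom n a \<longleftrightarrow> n > 0 \<and> (\<forall>r. a r \<noteq> 0 \<longrightarrow> (\<exists>k::nat. r = of_nat k / of_nat n))"

lemma has_denom_mult:
  assumes "has_denom n a" "m > 0" shows "has_denom (n * m) a"
  unfolding has_denom_def
proof (intro conjI allI impI)
  show "n * m > 0" using assms by (simp add: has_denom_def)
  fix r assume "a r \<noteq> 0"
  then obtain k :: nat where k: "r = of_nat k / of_nat n" using assms by (auto simp: has_denom_def)
  have "r = of_nat (k * m) / of_nat (n * m)" using k assms by (simp add: has_denom_def)
  then show "\<exists>k::nat. r = of_nat k / of_nat (n * m)" by blast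
qed

lemma has_denom_common:
  assumes "has_denom n a" "has_denom m b"
  shows "has_denom (n * m) a" "has_denom (n * m) b"
proof -
  have "n > 0" "m > 0" using assms by (auto simp: has_denom_def)
  then show "has_denom (n * m) a" "has_denom (n * m) b"
    using has_denom_mult[OF assms(1), of m] has_denom_mult[OF assms(2), of n]
    by (auto simp: mult.commute)
qed

text \<open>The element \<open>a\<close> stands for the fractional power series whose coefficient of \<open>y\<^sup>r\<close>
  is \<open>a r\<close>; all exponents are nonnegative and have a common denominator.\<close>

typedef puiseux = "{a :: rat \<Rightarrow> complex. \<exists>n. has_denom n a}"
  morphisms pcoeff Abs_puiseux
  by (rule exI[of _ "\<lambda>_. 0"]) (auto simp: has_denom_def)

setup_lifting type_definition_puiseux

lemma puiseux_eqI: "(\<And>r. pcoeff a r = pcoeff b r) \<Longrightarrow> a = b"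
  by transfer auto

definition conv_product :: "(rat \<Rightarrow> complex) \<Rightarrow> (rat \<Rightarrow> complex) \<Rightarrow> rat \<Rightarrow> complex" where
  "conv_product a b r = (\<Sum>(s, t) \<in> {(s, t). s + t = r \<and> a s \<noteq> 0 \<and> b t \<noteq> 0}. a s * b t)"

lemma has_denom_conv_product:
  assumes "has_denom n a" "has_denom n b" shows "has_denom n (conv_product a b)"
  unfolding has_denom_def
proof (intro conjI allI impI)
  show "n > 0" using assms by (simp add: has_denom_def)
  fix r assume "conv_product a b r \<noteq> 0"
  then have "{(s, t). s + t = r \<and> a s \<noteq> 0 \<and> b t \<noteq> 0} \<noteq> {}"
    unfolding conv_product_def by (metis sum.empty)
  then obtain s t where st: "s + t = r" "a s \<noteq> 0" "b t \<noteq> 0" by auto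
  obtain k l :: nat where "s = of_nat k / of_nat n" "t = of_nat l / of_nat n"
    using st assms by (meson has_denom_def)
  then have "r = of_nat (k + l) / of_nat n" using st by (simp add: add_divide_distrib)
  then show "\<exists>k::nat. r = of_nat k / of_nat n" by blast
qed

lemma has_denom_plus:
  assumes "has_denom n a" "has_denom n b"
  shows "has_denom n (\<lambda>r. a r + b r)" "has_denom n (\<lambda>r. a r - b r)"
proof -
  have *: "has_denom n c" if "\<And>r. c r \<noteq> 0 \<Longrightarrow> a r \<noteq> 0 \<or> b r \<noteq> 0" for c
    using assms that unfolding has_denom_def by meson
  show "has_denom n (\<lambda>r. a r + b r)" "has_denom n (\<lambda>r. a r - b r)"
    by (rule *; auto)+
qed

instantiation puiseux :: comm_ring_1
begin

lift_definition zero_puiseux :: puiseux is "\<lambda>_. 0"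
  by (auto simp: has_denom_def)

lift_definition one_puiseux :: puiseux is "\<lambda>r. if r = 0 then 1 else 0"
  by (rule exI[of _ 1]) (auto simp: has_denom_def)

lift_definition plus_puiseux :: "puiseux \<Rightarrow> puiseux \<Rightarrow> puiseux" is "\<lambda>a b r. a r + b r"
  by (blast intro: has_denom_plus has_denom_common)

lift_definition minus_puiseux :: "puiseux \<Rightarrow> puiseux \<Rightarrow> puiseux" is "\<lambda>a b r. a r - b r"
  by (blast intro: has_denom_plus has_denom_common)

lift_definition uminus_puiseux :: "puiseux \<Rightarrow> puiseux" is "\<lambda>a r. - a r"
  by (simp add: has_denom_def)

lift_definition times_puiseux :: "puiseux \<Rightarrow> puiseux \<Rightarrow> puiseux" is conv_product
  by (blast intro: has_denom_conv_product has_denom_common)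

definition root_fps :: "nat \<Rightarrow> puiseux \<Rightarrow> complex fps" where
  "root_fps n a = Abs_fps (\<lambda>k. pcoeff a (of_nat k / of_nat n))"

lemma root_fps_inject:
  assumes "has_denom n (pcoeff a)" "has_denom n (pcoeff b)" "root_fps n a = root_fps n b"
  shows "a = b"
proof (rule puiseux_eqI)
  fix r
  have eq: "pcoeff a (of_nat k / of_nat n) = pcoeff b (of_nat k / of_nat n)" for k
    using assms(3) unfolding root_fps_def by (metis fps_nth_Abs_fps)
  show "pcoeff a r = pcoeff b r"
  proof (cases "\<exists>k::nat. r = of_nat k / of_nat n")
    case True
    then show ?thesis using eq by auto
  next
    case False
    then have "pcoeff a r = 0" "pcoeff b r = 0"
      using assms(1,2) by (auto simp: has_denom_def)
    then show ?thesis by simp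
  qed
qed

lemma root_fps_times:
  assumes "has_denom n (pcoeff a)" "has_denom n (pcoeff b)"
  shows "root_fps n (a * b) = root_fps n a * root_fps n b"
proof (rule fps_ext)
  fix k :: nat
  have n: "n > 0" using assms by (simp add: has_denom_def)
  let ?S = "{(s, t). s + t = (of_nat k / of_nat n :: rat) \<and> pcoeff a s \<noteq> 0 \<and> pcoeff b t \<noteq> 0}"
  let ?h = "\<lambda>i. (of_nat i / of_nat n, of_nat (k - i) / of_nat n) :: rat \<times> rat"
  have inj: "inj_on ?h {0..k}" using n by (auto simp: inj_on_def)
  have sub: "?S \<subseteq> ?h ` {0..k}"
  proof clarify
    fix s t assume st: "s + t = of_nat k / of_nat n" "pcoeff a s \<noteq> 0" "pcoeff b t \<noteq> 0"
    obtain i l :: nat where il: "s = of_nat i / of_nat n" "t = of_nat l / of_nat n"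
      using st assms by (meson has_denom_def)
    have "(of_nat (i + l) :: rat) = of_nat k"
      using st(1) il n by (simp add: add_divide_distrib[symmetric])
    then have "i + l = k" using of_nat_eq_iff by blast
    then have "i \<in> {0..k}" "l = k - i" by auto
    then show "(s, t) \<in> ?h ` {0..k}" using il by blast
  qed
  have "fps_nth (root_fps n (a * b)) k = (\<Sum>(s, t)\<in>?S. pcoeff a s * pcoeff b t)"
    by (simp add: root_fps_def times_puiseux.rep_eq conv_product_def)
  also have "\<dots> = (\<Sum>(s, t)\<in>?h ` {0..k}. pcoeff a s * pcoeff b t)"
  proof (rule sum.mono_neutral_left)
    have "s + t = of_nat k / of_nat n" if "(s, t) \<in> ?h ` {0..k}" for s t
      using that n by (auto simp: add_divide_distrib[symmetric] of_nat_diff)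
    then show "\<forall>i\<in>?h ` {0..k} - ?S. (case i of (s, t) \<Rightarrow> pcoeff a s * pcoeff b t) = 0"
      by fastforce
  qed (use sub in auto)
  also have "\<dots> = (\<Sum>i=0..k. pcoeff a (of_nat i / of_nat n) * pcoeff b (of_nat (k - i) / of_nat n))"
    by (subst sum.reindex[OF inj]) simp
  finally show "fps_nth (root_fps n (a * b)) k = fps_nth (root_fps n a * root_fps n b) k"
    by (simp add: root_fps_def fps_mult_nth)
qed

lemma root_fps_simps:
  "root_fps n (a + b) = root_fps n a + root_fps n b"
  by (rule fps_ext) (simp add: root_fps_def plus_puiseux.rep_eq)

lemma root_fps_one: "n > 0 \<Longrightarrow> root_fps n 1 = 1"
  by (rule fps_ext) (auto simp: root_fps_def one_puiseux.rep_eq)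

lemma denom_puiseux: "\<exists>n. has_denom n (pcoeff a)"
  using pcoeff[of a] by simp

lemma denom_times: "has_denom n (pcoeff a) \<Longrightarrow> has_denom n (pcoeff b) \<Longrightarrow> has_denom n (pcoeff (a * b))"
  by (simp add: times_puiseux.rep_eq has_denom_conv_product)

lemma denom_plus: "has_denom n (pcoeff a) \<Longrightarrow> has_denom n (pcoeff b) \<Longrightarrow> has_denom n (pcoeff (a + b))"
  by (simp add: plus_puiseux.rep_eq has_denom_plus)

lemma denom_one: "n > 0 \<Longrightarrow> has_denom n (pcoeff 1)"
  by (auto simp: one_puiseux.rep_eq has_denom_def)

lemma denom_three: "\<exists>n. has_denom n (pcoeff a) \<and> has_denom n (pcoeff b) \<and> has_denom n (pcoeff c)"
proof -
  obtain i j k where ij: "has_denom i (pcoeff a)" "has_denom j (pcoeff b)" "has_denom k (pcoeff c)"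
    using denom_puiseux by meson
  note ab = has_denom_common[OF ij(1,2)]
  show ?thesis
    using has_denom_common[OF ab(1) ij(3)] has_denom_common[OF ab(2) ij(3)] by blast
qed

instance
proof
  fix a b c :: puiseux
  obtain n where n: "has_denom n (pcoeff a)" "has_denom n (pcoeff b)" "has_denom n (pcoeff c)"
    using denom_three by blast
  have n0: "n > 0" using n by (simp add: has_denom_def)
  note d = n denom_times denom_plus denom_one[OF n0]
  show "a * b * c = a * (b * c)"
    by (rule root_fps_inject[of n]) (simp_all add: d root_fps_times mult.assoc)
  show "a * b = b * a"
    by (rule root_fps_inject[of n]) (simp_all add: d root_fps_times mult.commute)
  show "1 * a = a"
    by (rule root_fps_inject[of n]) (simp_all add: d root_fps_times root_fps_one n0)
  show "(a + b) * c = a * c + b * c"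
    by (rule root_fps_inject[of n]) (simp_all add: d root_fps_times root_fps_simps algebra_simps)
  show "a + b + c = a + (b + c)" by transfer (auto simp: add.assoc)
  show "a + b = b + a" by transfer (auto simp: add.commute)
  show "0 + a = a" by transfer auto
  show "- a + a = 0" by transfer auto
  show "a - b = a + - b" by transfer auto
  show "(0 :: puiseux) \<noteq> 1" by transfer (auto simp: fun_eq_iff)
qed

end

lift_definition ymonom :: "rat \<Rightarrow> complex \<Rightarrow> puiseux" is
  "\<lambda>h c r. if r = h \<and> h \<ge> 0 then c else 0"
proof -
  fix h :: rat and c :: complex
  obtain a b where ab: "quotient_of h = (a, b)" by (cases "quotient_of h")
  have b: "b > 0" and h: "h = of_int a / of_int b"
    using quotient_of_denom_pos[OF ab] quotient_of_div[OF ab] by auto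
  have "h = of_nat (nat a) / of_nat (nat b)" if "h \<ge> 0"
  proof -
    have "a \<ge> 0" using that b h by (simp add: zero_le_divide_iff)
    then show ?thesis using b h by simp
  qed
  then have "has_denom (nat b) (\<lambda>r. if r = h \<and> h \<ge> 0 then c else 0)"
    using b by (auto simp: has_denom_def)
  then show "\<exists>n. has_denom n (\<lambda>r. if r = h \<and> h \<ge> 0 then c else 0)" by blast
qed

lift_definition ytrunc :: "rat \<Rightarrow> puiseux \<Rightarrow> puiseux" is
  "\<lambda>h a r. if r < h then a r else 0"
  by (auto simp: has_denom_def)

lift_definition puiseux_of_fps :: "complex fps \<Rightarrow> puiseux" is
  "\<lambda>a r. if r \<in> \<nat> then fps_nth a (nat \<lfloor>r\<rfloor>) else 0"
  by (rule exI[of _ 1]) (auto simp: has_denom_def elim: Nats_cases)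

text \<open>The order \<open>O\<^sub>y\<close>; the support is well-ordered, so the \<open>LEAST\<close> exists for a nonzero series.\<close>

definition yord :: "puiseux \<Rightarrow> rat extended" where
  "yord a = (if a = 0 then Pinf else Fin (LEAST r. pcoeff a r \<noteq> 0))"

abbreviation contact :: "puiseux \<Rightarrow> puiseux \<Rightarrow> rat extended" where
  "contact \<xi> \<eta> \<equiv> yord (\<xi> - \<eta>)"


section \<open>The ring \<open>\<complex>{x, y}\<close>\<close>

text \<open>A double series is stored as a power series in \<open>x\<close> whose coefficients are power series in
  \<open>y\<close>: the coefficient of \<open>x\<^sup>iy\<^sup>j\<close> in \<open>F\<close> is \<open>fps_nth (fps_nth F i) j\<close>.  A holomorphic germ at
  the origin of \<open>\<complex>\<^sup>2\<close> is identified with its Taylor series.\<close>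

definition convergent2 :: "complex fps fps \<Rightarrow> bool" where
  "convergent2 F \<longleftrightarrow>
     (\<exists>r>0. (\<lambda>(i, j). norm (fps_nth (fps_nth F i) j) * r ^ (i + j)) summable_on UNIV)"

lemma convergent2_iff:
  "convergent2 F \<longleftrightarrow> (\<exists>C R. R > 0 \<and> (\<forall>i j. norm (fps_nth (fps_nth F i) j) \<le> C * R ^ (i + j)))"
proof
  assume "convergent2 F"
  then obtain r where r: "r > 0"
    and s: "(\<lambda>(i, j). norm (fps_nth (fps_nth F i) j) * r ^ (i + j)) summable_on UNIV"
    by (auto simp: convergent2_def)
  let ?g = "\<lambda>(i, j). norm (fps_nth (fps_nth F i) j) * r ^ (i + j)"
  have le: "?g (i, j) \<le> infsum ?g UNIV" for i j
  proof -
    have "sum ?g {(i, j)} \<le> infsum ?g UNIV"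
      by (rule finite_sum_le_infsum[OF s]) (use r in auto)
    then show ?thesis by simp
  qed
  have "norm (fps_nth (fps_nth F i) j) \<le> infsum ?g UNIV * (1 / r) ^ (i + j)" for i j
    using le[of i j] r by (simp add: field_simps power_one_over)
  then show "\<exists>C R. R > 0 \<and> (\<forall>i j. norm (fps_nth (fps_nth F i) j) \<le> C * R ^ (i + j))"
    using r by (intro exI[of _ "infsum ?g UNIV"] exI[of _ "1 / r"]) auto
next
  assume "\<exists>C R. R > 0 \<and> (\<forall>i j. norm (fps_nth (fps_nth F i) j) \<le> C * R ^ (i + j))"
  then obtain C R where R: "R > 0" and le: "\<And>i j. norm (fps_nth (fps_nth F i) j) \<le> C * R ^ (i + j)"
    by blast
  define r where "r = 1 / (2 * R)"
  have r: "r > 0" using R by (simp add: r_def)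
  have geo: "(\<lambda>n. (1 / 2 :: real) ^ n) summable_on UNIV"
    by (rule norm_summable_imp_summable_on) (simp add: summable_geometric)
  have sm: "(\<lambda>(i, j). (1 / 2 :: real) ^ i * (1 / 2) ^ j) summable_on UNIV \<times> UNIV"
  proof (rule summable_on_SigmaI)
    show "((\<lambda>j. case (i, j) of (i, j) \<Rightarrow> (1 / 2 :: real) ^ i * (1 / 2) ^ j)
            has_sum (1 / 2) ^ i * infsum (\<lambda>j. (1 / 2) ^ j) UNIV) UNIV" for i :: nat
      using has_sum_cmult_right[OF has_sum_infsum[OF geo]] by simp
    show "(\<lambda>i::nat. (1 / 2) ^ i * infsum (\<lambda>j::nat. (1 / 2 :: real) ^ j) UNIV) summable_on UNIV"
      using summable_on_cmult_left[OF geo] by simp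
  qed auto
  then have sm': "(\<lambda>(i, j). C * ((1 / 2 :: real) ^ (i + j))) summable_on UNIV"
    using summable_on_cmult_right[OF sm, of C] by (simp add: case_prod_unfold power_add)
  have "(\<lambda>(i, j). norm (fps_nth (fps_nth F i) j) * r ^ (i + j)) summable_on UNIV"
  proof (rule summable_on_comparison_test[OF sm'], goal_cases)
    case (1 p)
    obtain i j where p: "p = (i, j)" by fastforce
    have "norm (fps_nth (fps_nth F i) j) * r ^ (i + j) \<le> C * R ^ (i + j) * r ^ (i + j)"
      using le r by (intro mult_right_mono) auto
    also have "\<dots> = C * (1 / 2) ^ (i + j)"
      using R by (simp add: r_def power_mult_distrib[symmetric] mult.assoc)
    finally show ?case by (simp add: p)
  qed (use r in auto)
  then show "convergent2 F" using r by (auto simp: convergent2_def)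
qed

lemma convergent2I:
  assumes "R > 0" "\<And>i j. norm (fps_nth (fps_nth F i) j) \<le> C * R ^ (i + j)"
  shows "convergent2 F"
  using assms unfolding convergent2_iff by blast

lemma convergent2_common_bound:
  assumes "convergent2 F" "convergent2 G"
  obtains C D R where "R > 0" "C \<ge> 0" "D \<ge> 0"
    "\<And>i j. norm (fps_nth (fps_nth F i) j) \<le> C * R ^ (i + j)"
    "\<And>i j. norm (fps_nth (fps_nth G i) j) \<le> D * R ^ (i + j)"
proof -
  obtain C S where S: "S > 0" and F: "\<And>i j. norm (fps_nth (fps_nth F i) j) \<le> C * S ^ (i + j)"
    using assms(1) unfolding convergent2_iff by blast
  obtain D T where T: "T > 0" and G: "\<And>i j. norm (fps_nth (fps_nth G i) j) \<le> D * T ^ (i + j)"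
    using assms(2) unfolding convergent2_iff by blast
  have C: "C \<ge> 0" using order_trans[OF norm_ge_zero F[of 0 0]] by simp
  have D: "D \<ge> 0" using order_trans[OF norm_ge_zero G[of 0 0]] by simp
  have "norm (fps_nth (fps_nth F i) j) \<le> C * (max S T) ^ (i + j)" for i j
    by (rule order_trans[OF F]) (use C S in \<open>auto intro!: mult_left_mono power_mono\<close>)
  moreover have "norm (fps_nth (fps_nth G i) j) \<le> D * (max S T) ^ (i + j)" for i j
    by (rule order_trans[OF G]) (use D T in \<open>auto intro!: mult_left_mono power_mono\<close>)
  moreover have "max S T > 0" using S by simp
  ultimately show ?thesis using that C D by blast
qed

lemma convergent2_finite_support:
  assumes "\<And>i j. i > 1 \<or> j > 1 \<Longrightarrow> fps_nth (fps_nth F i) j = 0"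
  shows "convergent2 F"
proof (rule convergent2I)
  let ?C = "\<Sum>i\<le>1. \<Sum>j\<le>1. norm (fps_nth (fps_nth F i) j)"
  show "norm (fps_nth (fps_nth F i) j) \<le> ?C * 1 ^ (i + j)" for i j
  proof (cases "i > 1 \<or> j > 1")
    case True
    then have "norm (fps_nth (fps_nth F i) j) = 0" using assms by simp
    also have "\<dots> \<le> ?C" by (intro sum_nonneg) auto
    finally show ?thesis by simp
  next
    case False
    have "norm (fps_nth (fps_nth F i) j) \<le> (\<Sum>j\<le>1. norm (fps_nth (fps_nth F i) j))"
      using False by (intro member_le_sum) auto
    also have "\<dots> \<le> ?C"
      using False by (intro member_le_sum[of i _ "\<lambda>i. \<Sum>j\<le>1. norm (fps_nth (fps_nth F i) j)"])
        (auto intro: sum_nonneg)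
    finally show ?thesis by simp
  qed
qed simp

lemma Suc_le_two_power: "real (Suc n) \<le> 2 ^ n"
  using Suc_leI[OF less_exp[of n]] by (metis of_nat_le_iff of_nat_numeral of_nat_power)

lemma convergent2_plus: "convergent2 F \<Longrightarrow> convergent2 G \<Longrightarrow> convergent2 (F + G)"
proof -
  assume FG: "convergent2 F" "convergent2 G"
  obtain C D R where R: "R > 0" "C \<ge> 0" "D \<ge> 0"
    "\<And>i j. norm (fps_nth (fps_nth F i) j) \<le> C * R ^ (i + j)"
    "\<And>i j. norm (fps_nth (fps_nth G i) j) \<le> D * R ^ (i + j)"
    using convergent2_common_bound[OF FG] by metis
  show "convergent2 (F + G)"
  proof (rule convergent2I[OF R(1)])
    show "norm (fps_nth (fps_nth (F + G) i) j) \<le> (C + D) * R ^ (i + j)" for i j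
      using norm_triangle_ineq[of "fps_nth (fps_nth F i) j" "fps_nth (fps_nth G i) j"]
        R(4)[of i j] R(5)[of i j] by (simp add: algebra_simps)
  qed
qed

lemma convergent2_uminus: "convergent2 F \<Longrightarrow> convergent2 (- F)"
  unfolding convergent2_def by simp

lemma convergent2_minus: "convergent2 F \<Longrightarrow> convergent2 G \<Longrightarrow> convergent2 (F - G)"
  using convergent2_plus[of F "- G"] convergent2_uminus[of G] by simp

lemma convergent2_times: "convergent2 F \<Longrightarrow> convergent2 G \<Longrightarrow> convergent2 (F * G)"
proof -
  assume FG: "convergent2 F" "convergent2 G"
  obtain C D R where R: "R > 0" "C \<ge> 0" "D \<ge> 0"
    and F: "\<And>i j. norm (fps_nth (fps_nth F i) j) \<le> C * R ^ (i + j)"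
    and G: "\<And>i j. norm (fps_nth (fps_nth G i) j) \<le> D * R ^ (i + j)"
    using convergent2_common_bound[OF FG] by metis
  show "convergent2 (F * G)"
  proof (rule convergent2I)
    show "2 * R > 0" using R by simp
    fix i j
    have "norm (fps_nth (fps_nth (F * G) i) j) =
      norm (\<Sum>a=0..i. \<Sum>b=0..j. fps_nth (fps_nth F a) b * fps_nth (fps_nth G (i - a)) (j - b))"
      by (simp add: fps_mult_nth fps_sum_nth)
    also have "\<dots> \<le> (\<Sum>a=0..i. \<Sum>b=0..j. C * D * R ^ (i + j))"
    proof (intro sum_norm_le)
      fix a b assume ab: "a \<in> {0..i}" "b \<in> {0..j}"
      have "norm (fps_nth (fps_nth F a) b * fps_nth (fps_nth G (i - a)) (j - b))
          \<le> (C * R ^ (a + b)) * (D * R ^ (i - a + (j - b)))"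
        unfolding norm_mult using F G R by (intro mult_mono) auto
      also have "\<dots> = C * D * R ^ (a + b + (i - a + (j - b)))" by (simp add: power_add)
      also have "a + b + (i - a + (j - b)) = i + j" using ab by auto
      finally show "norm (fps_nth (fps_nth F a) b * fps_nth (fps_nth G (i - a)) (j - b))
          \<le> C * D * R ^ (i + j)" .
    qed
    also have "\<dots> = (real (Suc i) * real (Suc j)) * (C * D * R ^ (i + j))" by simp
    also have "\<dots> \<le> (2 ^ i * 2 ^ j) * (C * D * R ^ (i + j))"
      using R by (intro mult_right_mono mult_mono Suc_le_two_power) auto
    also have "\<dots> = C * D * (2 * R) ^ (i + j)" by (simp add: power_add power_mult_distrib)
    finally show "norm (fps_nth (fps_nth (F * G) i) j) \<le> C * D * (2 * R) ^ (i + j)" .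
  qed
qed

lemma convergent2_deriv:
  assumes "convergent2 F"
  shows "convergent2 (fps_deriv F)" "convergent2 (Abs_fps (\<lambda>i. fps_deriv (fps_nth F i)))"
proof -
  obtain C R where R: "R > 0" "C \<ge> 0" and F: "\<And>i j. norm (fps_nth (fps_nth F i) j) \<le> C * R ^ (i + j)"
    using convergent2_common_bound[OF assms assms] by metis
  have *: "real (Suc k) * (C * R ^ Suc (i + j)) \<le> (C * R) * (2 * R) ^ (i + j)" if "k \<le> i + j" for i j k
  proof -
    have "real (Suc k) \<le> 2 ^ (i + j)"
      using Suc_le_two_power[of k] power_increasing[OF that, of "2::real"] by linarith
    then have "real (Suc k) * (C * R ^ Suc (i + j)) \<le> 2 ^ (i + j) * (C * R ^ Suc (i + j))"
      using R by (intro mult_right_mono) auto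
    then show ?thesis by (simp add: power_mult_distrib mult_ac)
  qed
  have "norm (fps_nth (fps_nth (fps_deriv F) i) j) \<le> (C * R) * (2 * R) ^ (i + j)" for i j
  proof -
    have e: "fps_nth (fps_nth (fps_deriv F) i) j = of_nat (Suc i) * fps_nth (fps_nth F (Suc i)) j"
      by (simp add: fps_of_nat[symmetric] del: fps_of_nat of_nat_Suc)
    have "norm (fps_nth (fps_nth (fps_deriv F) i) j) = real (Suc i) * norm (fps_nth (fps_nth F (Suc i)) j)"
      unfolding e norm_mult norm_of_nat ..
    also have "\<dots> \<le> real (Suc i) * (C * R ^ Suc (i + j))"
      using F[of "Suc i" j] by (intro mult_left_mono) auto
    finally show ?thesis using *[of i i j] by linarith
  qed
  then show "convergent2 (fps_deriv F)" using R by (intro convergent2I[of "2 * R"]) auto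
  have "norm (fps_nth (fps_deriv (fps_nth F i)) j) \<le> (C * R) * (2 * R) ^ (i + j)" for i j
  proof -
    have "norm (fps_nth (fps_deriv (fps_nth F i)) j) = real (Suc j) * norm (fps_nth (fps_nth F i) (Suc j))"
      by (simp add: norm_mult del: of_nat_Suc)
    also have "\<dots> \<le> real (Suc j) * (C * R ^ Suc (i + j))"
      using F[of i "Suc j"] by (intro mult_left_mono) auto
    finally show ?thesis using *[of j i j] by linarith
  qed
  then show "convergent2 (Abs_fps (\<lambda>i. fps_deriv (fps_nth F i)))"
    using R by (intro convergent2I[of "2 * R"]) auto
qed

typedef germ = "{F. convergent2 F}"
  morphisms series Abs_germ
  by (rule exI[of _ 0]) (auto intro: convergent2_finite_support)

setup_lifting type_definition_germ

instantiation germ :: comm_ring_1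
begin

lift_definition zero_germ :: germ is 0 by (auto intro: convergent2_finite_support)
lift_definition one_germ :: germ is 1 by (auto intro: convergent2_finite_support)
lift_definition plus_germ :: "germ \<Rightarrow> germ \<Rightarrow> germ" is "(+)" by (rule convergent2_plus)
lift_definition minus_germ :: "germ \<Rightarrow> germ \<Rightarrow> germ" is "(-)" by (rule convergent2_minus)
lift_definition uminus_germ :: "germ \<Rightarrow> germ" is uminus by (rule convergent2_uminus)
lift_definition times_germ :: "germ \<Rightarrow> germ \<Rightarrow> germ" is "(*)" by (rule convergent2_times)

instance
  by (standard; transfer) (auto simp: algebra_simps)

end

lift_definition germ_const :: "complex \<Rightarrow> germ" is "\<lambda>c. fps_const (fps_const c)"
  by (auto intro: convergent2_finite_support)

lift_definition germ_y :: germ is "fps_const fps_X"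
  by (auto intro: convergent2_finite_support)

lift_definition germ_dx :: "germ \<Rightarrow> germ" is fps_deriv
  by (rule convergent2_deriv)

lift_definition germ_dy :: "germ \<Rightarrow> germ" is "\<lambda>F. Abs_fps (\<lambda>i. fps_deriv (fps_nth F i))"
  by (rule convergent2_deriv)

definition germ_at_origin :: "germ \<Rightarrow> complex" where
  "germ_at_origin F = fps_nth (fps_nth (series F) 0) 0"

text \<open>The order of \<open>F(x, 0)\<close>.\<close>

definition x_order :: "germ \<Rightarrow> nat" where
  "x_order F = subdegree (Abs_fps (\<lambda>i. fps_nth (fps_nth (series F) i) 0))"

definition jacobian_germ :: "germ \<Rightarrow> germ \<Rightarrow> germ" where
  "jacobian_germ f g = germ_dy f * germ_dx g - germ_dx f * germ_dy g"

text \<open>Inclusion of \<open>\<complex>{x, y}\<close> into the power series in \<open>x\<close> over the fractional power series in \<open>y\<close>.\<close>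

definition germ_embed :: "germ \<Rightarrow> puiseux fps" where
  "germ_embed F = Abs_fps (\<lambda>i. puiseux_of_fps (fps_nth (series F) i))"

text \<open>The substitution \<open>F(\<xi>(y), y)\<close>.  If \<open>\<xi>\<close> has positive order, then for each \<open>r\<close> only finitely
  many terms of the series below are nonzero.  It also makes sense for \<open>\<xi> = z + \<cdots>\<close> with \<open>z\<close> a
  sufficiently small constant, which is needed for the ground bar.\<close>

definition germ_eval :: "germ \<Rightarrow> puiseux \<Rightarrow> puiseux" where
  "germ_eval F \<xi> =
     Abs_puiseux (\<lambda>r. \<Sum>k. pcoeff (puiseux_of_fps (fps_nth (series F) k) * \<xi> ^ k) r)"

lemma pcoeff_germ_eval:
  "pcoeff (germ_eval F \<xi>) r = (\<Sum>k. pcoeff (puiseux_of_fps (fps_nth (series F) k) * \<xi> ^ k) r)"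
proof -
  obtain n where n: "has_denom n (pcoeff \<xi>)" using denom_puiseux by blast
  then have n0: "n > 0" by (simp add: has_denom_def)
  have p: "has_denom n (pcoeff (\<xi> ^ k))" for k
    by (induction k) (simp_all add: denom_one denom_times n n0)
  have one: "has_denom 1 (pcoeff (puiseux_of_fps a))" for a
    by (auto simp: has_denom_def puiseux_of_fps.rep_eq elim: Nats_cases)
  have "has_denom n (pcoeff (puiseux_of_fps a))" for a
    using has_denom_mult[OF one n0] by simp
  then have t: "has_denom n (pcoeff (puiseux_of_fps (fps_nth (series F) k) * \<xi> ^ k))" for k
    using p denom_times by blast
  have "has_denom n (\<lambda>r. \<Sum>k. pcoeff (puiseux_of_fps (fps_nth (series F) k) * \<xi> ^ k) r)"
    unfolding has_denom_def
  proof (intro conjI allI impI n0)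
    fix r assume "(\<Sum>k. pcoeff (puiseux_of_fps (fps_nth (series F) k) * \<xi> ^ k) r) \<noteq> 0"
    then obtain k where "pcoeff (puiseux_of_fps (fps_nth (series F) k) * \<xi> ^ k) r \<noteq> 0"
      by fastforce
    then show "\<exists>k::nat. r = of_nat k / of_nat n" using t unfolding has_denom_def by blast
  qed
  then show ?thesis unfolding germ_eval_def by (subst Abs_puiseux_inverse) auto
qed

text \<open>\<open>dim\<^sub>\<complex> \<complex>{x, y} / (F, G)\<close>, as the largest number of elements of \<open>\<complex>{x, y}\<close> that are
  linearly independent over \<open>\<complex>\<close> modulo the ideal \<open>(F, G)\<close>.\<close>

definition intersection_mult :: "germ \<Rightarrow> germ \<Rightarrow> enat" where
  "intersection_mult F G = Sup {enat (card S) | S. finite S \<and>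
     (\<forall>c. (\<exists>A B. (\<Sum>s\<in>S. germ_const (c s) * s) = A * F + B * G) \<longrightarrow> (\<forall>s\<in>S. c s = 0))}"

definition has_intersection_mult :: "germ \<Rightarrow> germ \<Rightarrow> rat \<Rightarrow> bool" where
  "has_intersection_mult F G r \<longleftrightarrow> (\<exists>n. intersection_mult F G = enat n \<and> of_nat n = r)"


section \<open>Newton--Puiseux roots\<close>

definition np_roots :: "germ \<Rightarrow> puiseux set" where
  "np_roots F = {\<xi>. Fin 0 < yord \<xi> \<and> germ_eval F \<xi> = 0}"

definition np_factorisation :: "germ \<Rightarrow> nat \<Rightarrow> puiseux set \<Rightarrow> bool" where
  "np_factorisation F E A \<longleftrightarrow> finite A \<and> (\<forall>\<alpha>\<in>A. Fin 0 < yord \<alpha>) \<and>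
     (\<exists>u. u dvd 1 \<and> germ_embed F = germ_embed (u * germ_y ^ E) * (\<Prod>\<alpha>\<in>A. fps_X - fps_const \<alpha>))"

text \<open>The roots \<open>\<alpha>\<^sub>i\<close> are the elements of \<open>np_roots f\<close>, the roots \<open>\<beta>\<^sub>j\<close> those of \<open>np_roots g\<close>;
  since each root occurs once in the factorisation and the two sets are disjoint, the
  \<open>\<lambda>\<^sub>k\<close> are pairwise distinct.  At least one root is required, for otherwise there is no main trunk.\<close>

definition np_pair :: "germ \<Rightarrow> germ \<Rightarrow> bool" where
  "np_pair f g \<longleftrightarrow> germ_at_origin f = 0 \<and> germ_at_origin g = 0 \<and>
     (\<exists>E\<^sub>1. np_factorisation f E\<^sub>1 (np_roots f)) \<and> (\<exists>E\<^sub>2. np_factorisation g E\<^sub>2 (np_roots g)) \<and>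
     np_roots f \<inter> np_roots g = {} \<and> np_roots f \<union> np_roots g \<noteq> {}"

definition polar_roots :: "germ \<Rightarrow> germ \<Rightarrow> puiseux set" where
  "polar_roots f g = {\<gamma> \<in> np_roots (jacobian_germ f g). germ_eval f \<gamma> * germ_eval g \<gamma> \<noteq> 0}"

definition root_mult :: "germ \<Rightarrow> puiseux \<Rightarrow> nat" where
  "root_mult F \<gamma> = Max {m. (fps_X - fps_const \<gamma>) ^ m dvd germ_embed F}"

text \<open>The number of all polar roots, with multiplicity.  It is not determined by the tree: for
  \<open>f = x\<close> and \<open>g = x - y\<^sup>2\<close> there are none, for \<open>f = x\<close> and \<open>g = (x - y\<^sup>2)(1 + y)\<close> there is
  one, \<open>x = 2y + 3y\<^sup>2\<close>, and it is bounded by the only bar of positive height.\<close>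

definition polar_count :: "germ \<Rightarrow> germ \<Rightarrow> nat" where
  "polar_count f g = (\<Sum>\<gamma>\<in>polar_roots f g. root_mult (jacobian_germ f g) \<gamma>)"


section \<open>The tree\<close>

text \<open>A bar is given by its height and by the set of the roots \<open>\<lambda>\<^sub>k\<close> lying in the trunks on it,
  that is, by the trunk which it is on top of (for the ground bar: the main trunk).
  Only bars of finite height are represented.\<close>

type_synonym bar = "rat \<times> puiseux set"

abbreviation bar_height :: "bar \<Rightarrow> rat" where "bar_height \<equiv> fst"
abbreviation bar_roots :: "bar \<Rightarrow> puiseux set" where "bar_roots \<equiv> snd"

definition ground_bar :: "germ \<Rightarrow> germ \<Rightarrow> bar" where
  "ground_bar f g = (0, np_roots f \<union> np_roots g)"

text \<open>The trunks growing on a bar.  All \<open>\<lambda>\<^sub>k\<close> have positive order, so on the ground bar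
  this gives the main trunk only.\<close>

definition trunks :: "bar \<Rightarrow> puiseux set set" where
  "trunks B = {{\<mu> \<in> bar_roots B. Fin (bar_height B) < contact \<kappa> \<mu>} | \<kappa>. \<kappa> \<in> bar_roots B}"

definition trunk_height :: "puiseux set \<Rightarrow> rat" where
  "trunk_height T = Min {h. \<exists>\<kappa>\<in>T. \<exists>\<mu>\<in>T. \<kappa> \<noteq> \<mu> \<and> contact \<kappa> \<mu> = Fin h}"

definition stem :: "bar \<Rightarrow> puiseux" where
  "stem B = ytrunc (bar_height B) (SOME \<kappa>. \<kappa> \<in> bar_roots B)"

text \<open>The point of \<open>\<complex>\<close> at which the trunk \<open>T\<close> grows on \<open>B\<close>.\<close>

definition trunk_point :: "bar \<Rightarrow> puiseux set \<Rightarrow> complex" where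
  "trunk_point B T = pcoeff (SOME \<kappa>. \<kappa> \<in> T) (bar_height B)"

definition postbar_at :: "bar \<Rightarrow> complex \<Rightarrow> bar \<Rightarrow> bool" where
  "postbar_at B c B' \<longleftrightarrow>
     (\<exists>T\<in>trunks B. card T \<ge> 2 \<and> trunk_point B T = c \<and> B' = (trunk_height T, T))"

definition postbar :: "bar \<Rightarrow> bar \<Rightarrow> bool" where
  "postbar B B' \<longleftrightarrow> (\<exists>c. postbar_at B c B')"

definition bars :: "germ \<Rightarrow> germ \<Rightarrow> bar set" where
  "bars f g = {B. postbar\<^sup>*\<^sup>* (ground_bar f g) B}"

definition climbs_at :: "puiseux \<Rightarrow> bar \<Rightarrow> complex \<Rightarrow> bool" where
  "climbs_at \<xi> B a \<longleftrightarrow> Fin (bar_height B) < yord (\<xi> - (stem B + ymonom (bar_height B) a))"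

definition climbs :: "puiseux \<Rightarrow> bar \<Rightarrow> bool" where
  "climbs \<xi> B \<longleftrightarrow> (\<exists>a. climbs_at \<xi> B a)"

definition leaves_tree_on :: "puiseux \<Rightarrow> bar \<Rightarrow> bool" where
  "leaves_tree_on \<xi> B \<longleftrightarrow> (\<exists>a. climbs_at \<xi> B a \<and> a \<notin> trunk_point B ` trunks B)"

definition bounded_by :: "puiseux \<Rightarrow> bar \<Rightarrow> bool" where
  "bounded_by \<xi> B \<longleftrightarrow> contact \<xi> (stem B) < Fin (bar_height B)"


section \<open>The rational function of a bar\<close>

text \<open>Generic means: for all small \<open>z \<noteq> 0\<close>.  On a bar of positive height the order takes its
  generic value outside a finite set of \<open>z\<close>, so this gives the usual value; on the
  ground bar only small \<open>z\<close> can be substituted.\<close>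

definition nu :: "germ \<Rightarrow> bar \<Rightarrow> rat" where
  "nu F B = (THE v. \<forall>\<^sub>F z in at 0.
     yord (germ_eval F (stem B + ymonom (bar_height B) z)) = Fin v)"

definition Delta :: "germ \<Rightarrow> germ \<Rightarrow> bar \<Rightarrow> puiseux set \<Rightarrow> rat" where
  "Delta f g B T =
     nu f B * of_nat (card (T \<inter> np_roots g)) - nu g B * of_nat (card (T \<inter> np_roots f))"

definition mero :: "germ \<Rightarrow> germ \<Rightarrow> bar \<Rightarrow> complex \<Rightarrow> complex" where
  "mero f g B z = (\<Sum>T\<in>trunks B. of_rat (Delta f g B T) / (z - trunk_point B T))"

definition collinear_bar :: "germ \<Rightarrow> germ \<Rightarrow> bar \<Rightarrow> bool" where
  "collinear_bar f g B \<longleftrightarrow> (\<forall>T\<in>trunks B. Delta f g B T = 0)"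

definition collinear_points :: "germ \<Rightarrow> germ \<Rightarrow> bar \<Rightarrow> complex set" where
  "collinear_points f g B = trunk_point B ` {T \<in> trunks B. Delta f g B T = 0}"

text \<open>For non-collinear \<open>B\<close>, \<open>zorder\<close> is \<open>0\<close> at regular points which are not zeros and negative
  at poles, so that \<open>nat\<close> gives the multiplicity as a zero.\<close>

definition mero_mult :: "germ \<Rightarrow> germ \<Rightarrow> bar \<Rightarrow> complex \<Rightarrow> nat" where
  "mero_mult f g B z = nat (zorder (mero f g B) z)"

definition total_mero_mult :: "germ \<Rightarrow> germ \<Rightarrow> bar \<Rightarrow> nat" where
  "total_mero_mult f g B = (\<Sum>z | mero_mult f g B z > 0. mero_mult f g B z)"

definition pure_mero_mult :: "germ \<Rightarrow> germ \<Rightarrow> bar \<Rightarrow> nat" where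
  "pure_mero_mult f g B =
     (\<Sum>z | mero_mult f g B z > 0 \<and> z \<notin> collinear_points f g B. mero_mult f g B z)"


section \<open>Covers\<close>

text \<open>\<open>Y\<close> is reached from \<open>X\<close> by postbars, all bars before \<open>Y\<close> (including \<open>X\<close> if \<open>X \<noteq> Y\<close>)
  being collinear.\<close>

definition collinear_path :: "germ \<Rightarrow> germ \<Rightarrow> bar \<Rightarrow> bar \<Rightarrow> bool" where
  "collinear_path f g = (\<lambda>X Y. collinear_bar f g X \<and> postbar X Y)\<^sup>*\<^sup>*"

definition is_cover :: "germ \<Rightarrow> germ \<Rightarrow> bar \<Rightarrow> complex \<Rightarrow> bar set \<Rightarrow> bool" where
  "is_cover f g B c S \<longleftrightarrow>
     (\<forall>B'\<in>S. \<not> collinear_bar f g B' \<and> (\<exists>B\<^sub>1. postbar_at B c B\<^sub>1 \<and> collinear_path f g B\<^sub>1 B')) \<and>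
     (\<forall>\<kappa>\<in>np_roots f \<union> np_roots g. climbs_at \<kappa> B c \<longrightarrow> (\<exists>!B'. B' \<in> S \<and> climbs \<kappa> B'))"

definition cover :: "germ \<Rightarrow> germ \<Rightarrow> bar \<Rightarrow> complex \<Rightarrow> bar set" where
  "cover f g B c = (THE S. is_cover f g B c S)"

text \<open>The non-collinear bars of minimal height: minimality is meant along the tree, as for covers
  (the numerical heights of these bars can be different).\<close>

definition minimal_noncollinear_bars :: "germ \<Rightarrow> germ \<Rightarrow> bar set" where
  "minimal_noncollinear_bars f g =
     {B. \<not> collinear_bar f g B \<and> collinear_path f g (ground_bar f g) B}"


section \<open>Conjugate bars and the factors of the Jacobian\<close>

definition conjugate_bars :: "bar \<Rightarrow> bar \<Rightarrow> bool" where
  "conjugate_bars B B' \<longleftrightarrow> bar_height B = bar_height B' \<and>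
     (\<exists>p::germ. irreducible p \<and> (\<exists>\<xi>\<in>np_roots p. climbs \<xi> B) \<and> (\<exists>\<xi>\<in>np_roots p. climbs \<xi> B'))"

definition bar_classes :: "germ \<Rightarrow> germ \<Rightarrow> bar set set" where
  "bar_classes f g = bars f g // {(B, B'). B \<in> bars f g \<and> B' \<in> bars f g \<and> conjugate_bars B B'}"

definition noncollinear_classes :: "germ \<Rightarrow> germ \<Rightarrow> bar set set" where
  "noncollinear_classes f g = {\<BB> \<in> bar_classes f g. \<forall>B\<in>\<BB>. \<not> collinear_bar f g B}"

text \<open>The bars of a class have a common height and common values of \<open>nu\<close>.\<close>

definition class_height :: "bar set \<Rightarrow> rat" where
  "class_height \<BB> = the_elem (bar_height ` \<BB>)"

definition class_nu :: "germ \<Rightarrow> bar set \<Rightarrow> rat" where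
  "class_nu F \<BB> = the_elem (nu F ` \<BB>)"

definition class_pure_mero_mult :: "germ \<Rightarrow> germ \<Rightarrow> bar set \<Rightarrow> nat" where
  "class_pure_mero_mult f g \<BB> = (\<Sum>B\<in>\<BB>. pure_mero_mult f g B)"

definition polar_product :: "germ \<Rightarrow> germ \<Rightarrow> puiseux set \<Rightarrow> puiseux fps" where
  "polar_product f g S = (\<Prod>\<gamma>\<in>S. (fps_X - fps_const \<gamma>) ^ root_mult (jacobian_germ f g) \<gamma>)"

definition P_series :: "germ \<Rightarrow> germ \<Rightarrow> bar set \<Rightarrow> puiseux fps" where
  "P_series f g \<BB> = polar_product f g {\<gamma> \<in> polar_roots f g. \<exists>B\<in>\<BB>. leaves_tree_on \<gamma> B}"

definition Q_series :: "germ \<Rightarrow> germ \<Rightarrow> bar set \<Rightarrow> puiseux fps" where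
  "Q_series f g \<BB> = polar_product f g {\<gamma> \<in> polar_roots f g. \<exists>B\<in>\<BB>. \<exists>c\<in>collinear_points f g B.
     climbs_at \<gamma> B c \<and> (\<forall>B'\<in>cover f g B c. bounded_by \<gamma> B')}"

definition Q_ground_series :: "germ \<Rightarrow> germ \<Rightarrow> puiseux fps" where
  "Q_ground_series f g = polar_product f g
     {\<gamma> \<in> polar_roots f g. \<forall>B\<in>minimal_noncollinear_bars f g. bounded_by \<gamma> B}"

text \<open>The same factors as elements of \<open>\<complex>{x, y}\<close>; meaningful when the products above lie in the
  image of \<open>germ_embed\<close>, which is injective.\<close>

definition P_germ :: "germ \<Rightarrow> germ \<Rightarrow> bar set \<Rightarrow> germ" where
  "P_germ f g \<BB> = inv germ_embed (P_series f g \<BB>)"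

definition Q_germ :: "germ \<Rightarrow> germ \<Rightarrow> bar set \<Rightarrow> germ" where
  "Q_germ f g \<BB> = inv germ_embed (Q_series f g \<BB>)"

definition Q_ground_germ :: "germ \<Rightarrow> germ \<Rightarrow> germ" where
  "Q_ground_germ f g = inv germ_embed (Q_ground_series f g)"


section \<open>Equivalence of pairs\<close>

text \<open>The map on bars (represented as above) induced by a correspondence \<open>\<phi>\<close> of the roots; on
  trunks it is the image under \<open>\<phi>\<close>.  It need not carry conjugate bars to conjugate bars: if, for
  example, isomorphic trunks grow on a bar of height \<open>3/2\<close> at \<open>0, 1, -1\<close>, then \<open>\<phi>\<close> may permute
  them arbitrarily, but only the last two are conjugate.  Hence classes correspond under \<open>\<phi>\<close> if the
  one is the image of the other.\<close>

definition bar_map :: "(puiseux \<Rightarrow> puiseux) \<Rightarrow> bar \<Rightarrow> bar" where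
  "bar_map \<phi> B = (bar_height B, \<phi> ` bar_roots B)"

text \<open>The exponents \<open>E\<^sub>1, E\<^sub>2\<close> of \<open>y\<close> in \<open>f\<close> and \<open>g\<close> are the values of \<open>nu\<close> on the ground bar.
  They are not determined by the contact orders, and are required to correspond; then the values
  of \<open>nu\<close> on all corresponding bars agree.\<close>

definition tree_equivalence ::
    "germ \<Rightarrow> germ \<Rightarrow> germ \<Rightarrow> germ \<Rightarrow> (puiseux \<Rightarrow> puiseux) \<Rightarrow> bool" where
  "tree_equivalence f g f' g' \<phi> \<longleftrightarrow>
     bij_betw \<phi> (np_roots f) (np_roots f') \<and> bij_betw \<phi> (np_roots g) (np_roots g') \<and>
     (\<forall>\<kappa>\<in>np_roots f \<union> np_roots g. \<forall>\<mu>\<in>np_roots f \<union> np_roots g.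
        contact (\<phi> \<kappa>) (\<phi> \<mu>) = contact \<kappa> \<mu>) \<and>
     nu f (ground_bar f g) = nu f' (ground_bar f' g') \<and>
     nu g (ground_bar f g) = nu g' (ground_bar f' g') \<and>
     (\<forall>B\<in>bars f g. \<not> collinear_bar f g B \<longrightarrow>
        total_mero_mult f g B = total_mero_mult f' g' (bar_map \<phi> B) \<and>
        (\<forall>T\<in>trunks B. Delta f g B T = 0 \<longrightarrow>
           mero_mult f g B (trunk_point B T) =
           mero_mult f' g' (bar_map \<phi> B) (trunk_point (bar_map \<phi> B) (\<phi> ` T))))"

end

theory Submission
  imports Defs "HOL-Computational_Algebra.Fundamental_Theorem_Algebra"
begin

text \<open>
  \<^bold>\<open>Leading terms.\<close>  Let \<open>B\<close> be a bar of height \<open>h > 0\<close>.  Along the arcs \<open>x = \<lambda>\<^sub>B + z y\<^sup>h\<close> the germs \<open>f\<close>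
  and \<open>g\<close> have leading coefficients that are polynomials \<open>phi\<close>, \<open>psi\<close> in \<open>z\<close>, with the orders \<open>\<nu>\<^sub>f\<close>, \<open>\<nu>\<^sub>g\<close>
  of the bar; their zeros are the points at which trunks grow.  By the chain rule for \<open>y d/dy\<close> the leading
  coefficient of the Jacobian is \<open>W = \<nu>\<^sub>f phi psi' - \<nu>\<^sub>g phi' psi\<close>, unless this polynomial is zero,
  and \<open>W / (phi psi)\<close> is the rational function of the bar.  On the other hand the leading
  coefficient can be read off the Newton--Puiseux factorisation of the Jacobian: the order of \<open>W\<close> at
  \<open>a\<close> is the number of polar roots climbing over \<open>B\<close> at \<open>a\<close>, and its degree the number of those
  climbing over \<open>B\<close>.  The comparison is \<open>polar_count_at\<close>: at \<open>a\<close> there climb as many polar roots as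
  roots of \<open>f g\<close>, plus the multiplicity of \<open>a\<close> as a mero-zero, minus one if \<open>a\<close> is non-collinear.

  \<^bold>\<open>Distribution of the polar roots.\<close>  At a non-collinear point the same number of polar roots climbs
  over the bar on top of the trunk, which is non-collinear again; so none of them stops in between
  (\<open>climbs_noncollinear_point\<close>).  Consequently the highest non-collinear bar over which a polar root
  climbs is one where it leaves the tree or where it climbs at a collinear point and is bounded by the
  cover, and each polar root belongs to exactly one of the factors (\<open>polar_root_factor\<close>,
  \<open>factor_unique\<close>).  The degrees of the factors are sums of bimultiplicities and multiplicities of
  mero-zeros; that of the factor for the bars of a class \<open>\<BB>\<close> on which polar roots leave the tree is
  \<open>m\<^sup>*(\<BB>)\<close>.

  \<^bold>\<open>The factors are germs.\<close>  They are invariant under the conjugation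
  \<open>y\<^sup>1\<^sup>/\<^sup>n \<mapsto> e\<^sup>2\<^sup>\<pi>\<^sup>i\<^sup>/\<^sup>n y\<^sup>1\<^sup>/\<^sup>n\<close>, and a product of linear factors of convergent roots that is invariant has
  coefficients in \<open>\<complex>{y}\<close> (\<open>stable_product_is_germ\<close>).  This uses the Newton--Puiseux theorem with
  convergence, obtained here from Weierstrass preparation.

  \<^bold>\<open>Intersection multiplicities.\<close>  The multiplicity of the intersection of \<open>F\<close> with a product of linear
  factors is the sum of the orders of \<open>F\<close> along the roots (\<open>intersection_mult_by_roots\<close>): for roots with
  integer exponents the quotient by one factor is \<open>\<complex>{y}\<close> and dimensions add up, and a ramification
  of degree \<open>n\<close> multiplies both sides by \<open>n\<close>.  Along a root that leaves the tree on \<open>B\<close> the orders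
  of \<open>f\<close> and \<open>g\<close> are \<open>\<nu>\<^sub>f(B)\<close> and \<open>\<nu>\<^sub>g(B)\<close>, whence the three formulas.

  \<^bold>\<open>Invariance.\<close>  An equivalence transports all numbers in these formulas.  It need not map conjugate bars to
  conjugate bars; but it preserves a colouring of the roots by the data of the bars over
  which they climb, and any coloured isometry between two finite sets that are stable under the
  conjugation can be replaced by one that commutes with the conjugation (\<open>equivariant_isometry\<close>).  The
  resulting equivalence induces a bijection of the classes.
\<close>


unbundle no vec_syntax and fps_syntax

abbreviation (input) "of_fps == puiseux_of_fps"
abbreviation (input) "emb == germ_embed"
abbreviation (input) "conv2 == convergent2"
abbreviation (input) "ht == bar_height"

section \<open>Leading terms of fractional power series\<close>

text \<open>The series is \<open>c y\<^sup>r\<close> plus higher order terms; \<open>c = 0\<close> is allowed, and then the order is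
 larger than \<open>r\<close>.  Unlike the order, this notion is compatible with sums and products without
 any side condition.\<close>

definition lead_term :: "rat => complex => puiseux => bool" where
 "lead_term r c a \<longleftrightarrow> (\<forall>s<r. pcoeff a s = 0) \<and> pcoeff a r = c"

lemma pcoeff_simps [simp]:
 "pcoeff 0 r = 0" "pcoeff (a + b) r = pcoeff a r + pcoeff b r"
 "pcoeff (a - b) r = pcoeff a r - pcoeff b r" "pcoeff (- a) r = - pcoeff a r"
 by (simp_all add: zero_puiseux.rep_eq plus_puiseux.rep_eq minus_puiseux.rep_eq uminus_puiseux.rep_eq)

lemma pcoeff_one: "pcoeff 1 r = (if r = 0 then 1 else 0)"
 by (simp add: one_puiseux.rep_eq)

lemma pcoeff_sum: "pcoeff (sum f A) r = (\<Sum>x\<in>A. pcoeff (f x) r)"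
 by (induction A rule: infinite_finite_induct) auto

lemma pcoeff_neg: "r < 0 ==> pcoeff a r = 0"
proof (rule ccontr)
 assume r: "r < 0" "pcoeff a r ~= 0"
 obtain n where "has_denom n (pcoeff a)" using denom_puiseux by blast
 with r obtain k :: nat where "r = of_nat k / of_nat n" by (auto simp: has_denom_def)
 moreover have "(of_nat k / of_nat n :: rat) \<ge> 0" by simp
 ultimately show False using r by linarith
qed

lemma lead_term_exists:
 assumes "a ~= 0"
 obtains r c where "r \<ge> 0" "c ~= 0" "lead_term r c a"
proof -
 obtain n where n: "has_denom n (pcoeff a)" using denom_puiseux by blast
 hence n0: "n > 0" by (simp add: has_denom_def)
 have "\<exists>r. pcoeff a r ~= 0" using assms puiseux_eqI[of a 0] by auto
 then obtain k0 :: nat where k0: "pcoeff a (of_nat k0 / of_nat n) ~= 0"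
  using n by (auto simp: has_denom_def)
 define k where "k = (LEAST k::nat. pcoeff a (of_nat k / of_nat n) ~= 0)"
 have k: "pcoeff a (of_nat k / of_nat n) ~= 0"
  unfolding k_def by (rule LeastI[of "%k::nat. pcoeff a (of_nat k / of_nat n) ~= 0", OF k0])
 have "pcoeff a s = 0" if s: "s < of_nat k / of_nat n" for s
 proof (rule ccontr)
  assume nz: "pcoeff a s ~= 0"
  then obtain l :: nat where l: "s = of_nat l / of_nat n" using n by (auto simp: has_denom_def)
  have "k <= l" unfolding k_def by (rule Least_le) (use nz l in auto)
  with s l n0 show False by (simp add: divide_simps)
 qed
 hence "lead_term (of_nat k / of_nat n) (pcoeff a (of_nat k / of_nat n)) a"
  by (simp add: lead_term_def)
 thus ?thesis using that[of "of_nat k / of_nat n"] k by simp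
qed

lemma yord_lead_term:
 assumes "lead_term r c a" "c ~= 0" shows "yord a = Fin r"
proof -
 have "(LEAST s. pcoeff a s ~= 0) = r"
  using assms by (intro Least_equality) (auto simp: lead_term_def not_less[symmetric])
 moreover have "a ~= 0" using assms by (auto simp: lead_term_def)
 ultimately show ?thesis by (simp add: yord_def)
qed

lemma yord_eq_Fin: "yord a = Fin r \<longleftrightarrow> (\<exists>c. c ~= 0 \<and> lead_term r c a)"
proof
 assume r: "yord a = Fin r"
 hence "a ~= 0" by (auto simp: yord_def)
 then obtain s c where "c ~= 0" "lead_term s c a" by (elim lead_term_exists)
 with r show "\<exists>c. c ~= 0 \<and> lead_term r c a" using yord_lead_term by fastforce
qed (auto simp: yord_lead_term)

lemma yord_zero [simp]: "yord 0 = Pinf" by (simp add: yord_def)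

lemma yord_cases:
 obtains "a = 0" "yord a = Pinf" | r c where "r \<ge> 0" "c ~= 0" "lead_term r c a" "yord a = Fin r"
 using lead_term_exists[of a] yord_lead_term by (metis yord_zero)

lemma yord_Pinf [simp]: "yord a = Pinf \<longleftrightarrow> a = 0"
 by (cases a rule: yord_cases) auto

lemma yord_ge_iff: "Fin r <= yord a \<longleftrightarrow> (\<forall>s<r. pcoeff a s = 0)"
proof (cases a rule: yord_cases)
 case (2 s c)
 thus ?thesis by (auto simp: lead_term_def) (metis not_less)
qed simp

lemma yord_gt_iff: "Fin r < yord a \<longleftrightarrow> lead_term r 0 a"
proof (cases a rule: yord_cases)
 case 1
 thus ?thesis by (simp add: lead_term_def)
next
 case (2 s c)
 thus ?thesis
  by (auto simp: lead_term_def) (metis linorder_neqE_linordered_idom)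
qed

lemma yord_ge_lead: "Fin r <= yord a \<longleftrightarrow> lead_term r (pcoeff a r) a"
 by (simp add: yord_ge_iff lead_term_def)

lemma lead_term_pcoeff: "lead_term r c a ==> pcoeff a r = c" by (simp add: lead_term_def)

lemma lead_term_less: "lead_term r c a ==> s < r ==> lead_term s 0 a"
 by (auto simp: lead_term_def)

lemma lead_term_one [simp]: "lead_term 0 1 1" by (auto simp: lead_term_def pcoeff_one)

lemma lead_term_zero [simp]: "lead_term r 0 0" by (simp add: lead_term_def)

lemma lead_term_add: "lead_term r c a ==> lead_term r d b ==> lead_term r (c + d) (a + b)"
 by (simp add: lead_term_def)

lemma lead_term_diff: "lead_term r c a ==> lead_term r d b ==> lead_term r (c - d) (a - b)"
 by (simp add: lead_term_def)

lemma lead_term_unique: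
 assumes "lead_term r c a" "lead_term s d a" "c ~= 0" "d ~= 0" shows "r = s" "c = d"
proof -
 show "r = s" using yord_lead_term[of r c a] yord_lead_term[of s d a] assms by simp
 thus "c = d" using assms by (simp add: lead_term_def)
qed

definition mult_pairs :: "puiseux => puiseux => rat => (rat \<times> rat) set" where
 "mult_pairs a b r = {(s, t). s + t = r \<and> pcoeff a s ~= 0 \<and> pcoeff b t ~= 0}"

lemma pcoeff_times: "pcoeff (a * b) r = (\<Sum>(s, t)\<in>mult_pairs a b r. pcoeff a s * pcoeff b t)"
 by (simp add: times_puiseux.rep_eq conv_product_def mult_pairs_def)

lemma denom_two: "\<exists>n. has_denom n (pcoeff a) \<and> has_denom n (pcoeff b)"
 using denom_three[of a b b] by blast

lemma finite_mult_pairs: "finite (mult_pairs a b r)"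
proof -
 obtain n where n: "has_denom n (pcoeff a)" "has_denom n (pcoeff b)" using denom_two by blast
 hence n0: "n > 0" by (simp add: has_denom_def)
 define K where "K = nat \<lceil>r * of_nat n\<rceil>"
 have "mult_pairs a b r \<subseteq> (%k. (of_nat k / of_nat n, r - of_nat k / of_nat n)) ` {..K}"
 proof
  fix p assume "p \<in> mult_pairs a b r"
  then obtain s t where p: "p = (s, t)" "s + t = r" "pcoeff a s ~= 0" "pcoeff b t ~= 0"
   by (auto simp: mult_pairs_def)
  then obtain k where k: "s = of_nat k / of_nat n" using n(1) by (auto simp: has_denom_def)
  have "t \<ge> 0" using pcoeff_neg[of t b] p by force
  hence "s * of_nat n <= r * of_nat n" using p by (intro mult_right_mono) auto
  hence "of_nat k <= r * of_nat n" using k n0 by simp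
  hence "k <= K" unfolding K_def by linarith
  thus "p \<in> (%k. (of_nat k / of_nat n, r - of_nat k / of_nat n)) ` {..K}"
   using p k by (auto intro!: image_eqI[of _ _ k])
 qed
 thus ?thesis by (rule finite_subset) simp
qed

lemma pcoeff_times_superset:
 assumes "finite S" "mult_pairs a b r \<subseteq> S" "!!s t. (s, t) \<in> S ==> s + t = r"
 shows "pcoeff (a * b) r = (\<Sum>(s, t)\<in>S. pcoeff a s * pcoeff b t)"
 unfolding pcoeff_times
 by (rule sum.mono_neutral_left[OF assms(1,2)]) (use assms(3) in \<open>auto simp: mult_pairs_def\<close>)

lemma lead_term_mult:
 assumes "lead_term r c a" "lead_term s d b" shows "lead_term (r + s) (c * d) (a * b)"
proof -
 have ge: "t \<ge> r \<and> u \<ge> s" if "(t, u) \<in> mult_pairs a b v" for t u v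
  using that assms unfolding mult_pairs_def lead_term_def by force
 have "mult_pairs a b v = {}" if "v < r + s" for v
 proof -
  have "(t, u) \<notin> mult_pairs a b v" for t u using ge[of t u v] that
   by (metis (mono_tags, lifting) add_mono case_prodD leD mem_Collect_eq mult_pairs_def)
  thus ?thesis by auto
 qed
 moreover have "mult_pairs a b (r + s) \<subseteq> {(r, s)}"
 proof clarify
  fix t u assume tu: "(t, u) \<in> mult_pairs a b (r + s)"
  hence "t + u = r + s" by (simp add: mult_pairs_def)
  with ge[OF tu] show "t = r \<and> u = s" by auto
 qed
 hence "pcoeff (a * b) (r + s) = (\<Sum>(s, t)\<in>{(r, s)}. pcoeff a s * pcoeff b t)"
  by (intro pcoeff_times_superset) auto
 ultimately show ?thesis using assms by (simp add: lead_term_def pcoeff_times)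
qed

lemma lead_term_power: "lead_term r c a ==> lead_term (of_nat n * r) (c ^ n) (a ^ n)"
proof (induction n)
 case (Suc n)
 thus ?case using lead_term_mult[of r c a "of_nat n * r" "c ^ n" "a ^ n"]
  by (simp add: algebra_simps)
qed simp

instance puiseux :: idom
proof
 fix a b :: puiseux assume ab: "a ~= 0" "b ~= 0"
 obtain r c where a: "c ~= 0" "lead_term r c a" using ab by (metis lead_term_exists)
 obtain s d where b: "d ~= 0" "lead_term s d b" using ab by (metis lead_term_exists)
 from lead_term_mult[OF a(2) b(2)] a(1) b(1) show "a * b ~= 0" by (auto simp: lead_term_def)
qed

lemma yord_mult_Fin: "yord a = Fin r ==> yord b = Fin s ==> yord (a * b) = Fin (r + s)"
 using lead_term_mult unfolding yord_eq_Fin by (metis mult_eq_0_iff)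

lemma yord_add: "min (yord a) (yord b) <= yord (a + b)"
proof (cases "a + b" rule: yord_cases)
 case (2 r c)
 show ?thesis
 proof (rule ccontr)
  assume "\<not> ?thesis"
  hence "Fin r < yord a" "Fin r < yord b" using 2 by (auto simp: min_def split: if_splits)
  with 2 show False by (auto simp: yord_gt_iff lead_term_def)
 qed
qed simp

lemma yord_uminus [simp]: "yord (- a) = yord a"
 by (cases a rule: yord_cases) (auto intro!: yord_lead_term[where c = "- _"] simp: lead_term_def)

lemma contact_commute: "contact a b = contact b a"
 using yord_uminus[of "a - b"] by simp

lemma contact_ultra: "min (contact a b) (contact b c) <= contact a c"
 using yord_add[of "a - b" "b - c"] by simp

lemma contact_ge_trans: "h <= contact a b ==> h <= contact b c ==> h <= contact a c"
 using contact_ultra[of a b c] by (meson min.boundedI order_trans)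

lemma contact_gt_trans: "h < contact a b ==> h < contact b c ==> h < contact a c"
 using contact_ultra[of a b c] by (metis min_less_iff_conj order_less_le_trans)

lemma yord_nonneg: "Fin 0 <= yord a"
 by (simp add: yord_ge_iff pcoeff_neg)

lemma ymonom_zero [simp]: "ymonom h 0 = 0"
 by (rule puiseux_eqI) (simp add: ymonom.rep_eq)

lemma pcoeff_ymonom: "h \<ge> 0 ==> pcoeff (ymonom h c) r = (if r = h then c else 0)"
 by (simp add: ymonom.rep_eq)

lemma lead_term_ymonom: "h \<ge> 0 ==> lead_term h c (ymonom h c)"
 by (simp add: lead_term_def pcoeff_ymonom)

lemma pcoeff_ytrunc: "pcoeff (ytrunc h a) r = (if r < h then pcoeff a r else 0)"
 by (simp add: ytrunc.rep_eq)

lemma pcoeff_ymonom_times: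
 assumes "h \<ge> 0" shows "pcoeff (ymonom h c * a) r = c * pcoeff a (r - h)"
proof -
 have "pcoeff (ymonom h c * a) r = (\<Sum>(s, t)\<in>{(h, r - h)}. pcoeff (ymonom h c) s * pcoeff a t)"
  using assms by (intro pcoeff_times_superset) (auto simp: mult_pairs_def pcoeff_ymonom split: if_splits)
 thus ?thesis using assms by (simp add: pcoeff_ymonom)
qed


section \<open>Coefficientwise maps: conjugation, derivation, substitution of a power\<close>

definition ring_map :: "('a::comm_ring_1 => 'b::comm_ring_1) => bool" where
 "ring_map h \<longleftrightarrow> (\<forall>a b. h (a + b) = h a + h b) \<and> (\<forall>a b. h (a * b) = h a * h b) \<and> h 1 = 1"

lemma ring_mapD:
 assumes "ring_map h"
 shows "h (a + b) = h a + h b" "h (a * b) = h a * h b" "h 1 = 1" "h 0 = 0" "h (- a) = - h a"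
  "h (a - b) = h a - h b" "h (sum f A) = (\<Sum>x\<in>A. h (f x))" "h (prod f A) = (\<Prod>x\<in>A. h (f x))"
  "h (a ^ n) = h a ^ n" "h (of_nat n) = of_nat n"
proof -
 show 1: "h (a + b) = h a + h b" "h (a * b) = h a * h b" "h 1 = 1" for a b
  using assms by (auto simp: ring_map_def)
 show 0: "h 0 = 0" using 1(1)[of 0 0] by simp
 show m: "h (- a) = - h a" for a using 1(1)[of a "- a"] 0 by (simp add: eq_neg_iff_add_eq_0 add.commute)
 show "h (a - b) = h a - h b" using 1(1)[of a "- b"] m by simp
 show "h (sum f A) = (\<Sum>x\<in>A. h (f x))"
  by (induction A rule: infinite_finite_induct) (auto simp: 0 1)
 show "h (prod f A) = (\<Prod>x\<in>A. h (f x))"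
  by (induction A rule: infinite_finite_induct) (auto simp: 1)
 show "h (a ^ n) = h a ^ n" by (induction n) (auto simp: 1)
 show "h (of_nat n) = of_nat n" by (induction n) (auto simp: 0 1)
qed

definition coeff_map :: "('a => 'b) => 'a fps => 'b fps" where
 "coeff_map h F = Abs_fps (%i. h (F $ i))"

lemma coeff_map_nth [simp]: "(coeff_map h F) $ i = h (F $ i)"
 by (simp add: coeff_map_def)

lemma ring_map_coeff_map: assumes "ring_map h" shows "ring_map (coeff_map h)"
 unfolding ring_map_def
 by (auto intro!: fps_ext simp: ring_mapD[OF assms] fps_mult_nth)

lemma coeff_map_linear: "ring_map h ==> coeff_map h (fps_X - fps_const a) = fps_X - fps_const (h a)"
 by (rule fps_ext) (auto simp: ring_mapD fps_X_def)

lemma coeff_map_const: "ring_map h ==> coeff_map h (fps_const a) = fps_const (h a)"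
 by (rule fps_ext) (auto simp: ring_mapD)

lemma ring_map_dvd: "ring_map h ==> a dvd b ==> h a dvd h b"
 by (auto simp: dvd_def ring_mapD)

text \<open>The conjugation \<open>y\<^sup>1\<^sup>/\<^sup>n \<mapsto> e\<^sup>2\<^sup>\<pi>\<^sup>i\<^sup>/\<^sup>n y\<^sup>1\<^sup>/\<^sup>n\<close> for all \<open>n\<close> at once.\<close>

lift_definition galois :: "puiseux => puiseux" is "%a r. cis (2 * pi * of_rat r) * a r"
 by (auto simp: has_denom_def)

text \<open>The derivation \<open>y d/dy\<close>; unlike \<open>d/dy\<close> it does not lower exponents, which have to be
 nonnegative.\<close>

lift_definition ytheta :: "puiseux => puiseux" is "%a r. of_rat r * a r"
 by (auto simp: has_denom_def)

text \<open>The substitution \<open>y \<mapsto> y\<^sup>n\<close>.\<close>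

lift_definition ysub :: "nat => puiseux => puiseux" is
 "%n a r. if n = 0 then 0 else a (r / of_nat n)"
proof -
 fix n :: nat and a :: "rat => complex" assume "\<exists>m. has_denom m a"
 then obtain m where m: "has_denom m a" by blast
 have "has_denom m (%r. if n = 0 then 0 else a (r / of_nat n))"
  unfolding has_denom_def
 proof (intro conjI allI impI)
  show "m > 0" using m by (simp add: has_denom_def)
  fix r assume r: "(if n = 0 then 0 else a (r / of_nat n)) ~= 0"
  then obtain k :: nat where "r / of_nat n = of_nat k / of_nat m" "n > 0"
   using m by (auto simp: has_denom_def split: if_splits)
  hence "r = of_nat (k * n) / of_nat m" by (simp add: field_simps)
  thus "\<exists>k::nat. r = of_nat k / of_nat m" by blast
 qed
 thus "\<exists>m. has_denom m (%r. if n = 0 then 0 else a (r / of_nat n))" by blast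
qed

lemma ring_map_galois: "ring_map galois"
 unfolding ring_map_def
proof (intro conjI allI puiseux_eqI)
 fix a b :: puiseux and r
 show "pcoeff (galois (a + b)) r = pcoeff (galois a + galois b) r"
  by (simp add: galois.rep_eq algebra_simps)
 show "pcoeff (galois 1) r = pcoeff 1 r" by (auto simp: galois.rep_eq pcoeff_one)
 have "mult_pairs (galois a) (galois b) r = mult_pairs a b r"
  by (simp add: mult_pairs_def galois.rep_eq)
 moreover have "cis (2 * pi * of_rat r) * (case p of (s, t) => pcoeff a s * pcoeff b t) =
   (case p of (s, t) => pcoeff (galois a) s * pcoeff (galois b) t)" if "p \<in> mult_pairs a b r" for p
 proof -
  obtain s t where p: "p = (s, t)" by fastforce
  with that have r: "r = s + t" by (simp add: mult_pairs_def)
  show ?thesis unfolding p r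
   by (simp add: galois.rep_eq of_rat_add distrib_left cis_mult[symmetric] mult_ac)
 qed
 ultimately show "pcoeff (galois (a * b)) r = pcoeff (galois a * galois b) r"
  by (simp add: galois.rep_eq pcoeff_times sum_distrib_left)
qed

lemma ytheta_zero [simp]: "ytheta 0 = 0"
 by (rule puiseux_eqI) (simp add: ytheta.rep_eq)

lemma ytheta_add: "ytheta (a + b) = ytheta a + ytheta b"
 by (rule puiseux_eqI) (simp add: ytheta.rep_eq algebra_simps)

lemma ytheta_times: "ytheta (a * b) = a * ytheta b + ytheta a * b"
proof (rule puiseux_eqI)
 fix r
 have 1: "mult_pairs a (ytheta b) r \<subseteq> mult_pairs a b r" "mult_pairs (ytheta a) b r \<subseteq> mult_pairs a b r"
  by (auto simp: mult_pairs_def ytheta.rep_eq)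
 have 2: "s + t = r" if "(s, t) \<in> mult_pairs a b r" for s t using that by (simp add: mult_pairs_def)
 have "pcoeff (ytheta (a * b)) r = (\<Sum>p\<in>mult_pairs a b r. of_rat r * (case p of (s, t) => pcoeff a s * pcoeff b t))"
  by (simp add: ytheta.rep_eq pcoeff_times sum_distrib_left)
 also have "\<dots> = (\<Sum>p\<in>mult_pairs a b r. (case p of (s, t) => pcoeff a s * pcoeff (ytheta b) t) +
  (case p of (s, t) => pcoeff (ytheta a) s * pcoeff b t))"
 proof (rule sum.cong)
  fix p assume p: "p \<in> mult_pairs a b r"
  obtain s t where p': "p = (s, t)" by fastforce
  hence r: "r = s + t" using p 2 by auto
  show "of_rat r * (case p of (s, t) => pcoeff a s * pcoeff b t) =
    (case p of (s, t) => pcoeff a s * pcoeff (ytheta b) t) +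
    (case p of (s, t) => pcoeff (ytheta a) s * pcoeff b t)"
   unfolding p' r by (simp add: ytheta.rep_eq of_rat_add algebra_simps)
 qed simp
 also have "\<dots> = pcoeff (a * ytheta b + ytheta a * b) r"
  using pcoeff_times_superset[OF finite_mult_pairs 1(1) 2] pcoeff_times_superset[OF finite_mult_pairs 1(2) 2]
  by (simp add: sum.distrib)
 finally show "pcoeff (ytheta (a * b)) r = pcoeff (a * ytheta b + ytheta a * b) r" .
qed

lemma lead_term_ytheta: "lead_term r c a ==> lead_term r (of_rat r * c) (ytheta a)"
 by (simp add: lead_term_def ytheta.rep_eq)

lemma ring_map_ysub: assumes "n > 0" shows "ring_map (ysub n)"
 unfolding ring_map_def
proof (intro conjI allI puiseux_eqI)
 fix a b :: puiseux and r
 show "pcoeff (ysub n (a + b)) r = pcoeff (ysub n a + ysub n b) r"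
  by (simp add: ysub.rep_eq)
 show "pcoeff (ysub n 1) r = pcoeff 1 r" using assms by (auto simp: ysub.rep_eq pcoeff_one)
 have bij: "bij_betw (%(s, t). (s / of_nat n, t / of_nat n))
   (mult_pairs (ysub n a) (ysub n b) r) (mult_pairs a b (r / of_nat n))"
  using assms
  by (intro bij_betw_byWitness[where f' = "%(s, t). (s * of_nat n, t * of_nat n)"])
   (auto simp: mult_pairs_def ysub.rep_eq field_simps)
 have "pcoeff (ysub n a * ysub n b) r =
  (\<Sum>p\<in>mult_pairs (ysub n a) (ysub n b) r.
   (%(s, t). pcoeff a s * pcoeff b t) ((%(s, t). (s / of_nat n, t / of_nat n)) p))"
  using assms by (simp add: pcoeff_times ysub.rep_eq case_prod_beta)
 also have "\<dots> = pcoeff (a * b) (r / of_nat n)"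
  unfolding pcoeff_times by (rule sum.reindex_bij_betw[OF bij])
 finally show "pcoeff (ysub n (a * b)) r = pcoeff (ysub n a * ysub n b) r"
  using assms by (simp add: ysub.rep_eq)
qed

lemma ysub_inject: "n > 0 ==> ysub n a = ysub n b ==> a = b"
proof (rule puiseux_eqI)
 fix r assume "n > 0" "ysub n a = ysub n b"
 hence "pcoeff (ysub n a) (r * of_nat n) = pcoeff (ysub n b) (r * of_nat n)" by simp
 thus "pcoeff a r = pcoeff b r" using \<open>n > 0\<close> by (simp add: ysub.rep_eq)
qed

lemma lead_term_ysub: "n > 0 ==> lead_term r c a ==> lead_term (of_nat n * r) c (ysub n a)"
 by (auto simp: lead_term_def ysub.rep_eq field_simps)

lemma yord_ysub: "n > 0 ==> yord a = Fin r ==> yord (ysub n a) = Fin (of_nat n * r)"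
 using lead_term_ysub unfolding yord_eq_Fin by blast

lemma lead_term_galois: "lead_term r c a ==> lead_term r (cis (2 * pi * of_rat r) * c) (galois a)"
 by (simp add: lead_term_def galois.rep_eq)

lemma yord_galois [simp]: "yord (galois a) = yord a"
 by (cases a rule: yord_cases)
  (use lead_term_galois yord_lead_term ring_mapD[OF ring_map_galois] in fastforce)+

lemma galois_diff: "galois (a - b) = galois a - galois b"
 by (rule ring_mapD[OF ring_map_galois])

lemma contact_galois [simp]: "contact (galois a) (galois b) = contact a b"
 by (metis galois_diff yord_galois)

lemma inj_galois: "inj galois"
 by (rule injI, rule puiseux_eqI) (metis galois.rep_eq cis_neq_zero mult_cancel_left)

lemma galois_period: assumes "has_denom n (pcoeff a)" shows "(galois ^^ n) a = a"
proof (rule puiseux_eqI)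
 fix r
 have it: "pcoeff ((galois ^^ k) a) r = cis (2 * pi * of_rat r) ^ k * pcoeff a r" for k
  by (induction k) (simp_all add: galois.rep_eq)
 show "pcoeff ((galois ^^ n) a) r = pcoeff a r"
 proof (cases "pcoeff a r = 0")
  case False
  then obtain k :: nat where k: "r = of_nat k / of_nat n" "n > 0"
   using assms by (auto simp: has_denom_def)
  have "cis (2 * pi * of_rat r) ^ n = cis (2 * pi * real k)"
   using k by (simp add: Complex.DeMoivre of_rat_divide)
  also have "\<dots> = 1" by (metis cis_multiple_2pi Ints_of_nat mult.assoc)
  finally show ?thesis by (simp add: it)
 qed (simp add: it)
qed

lemma galois_fixed_iff: "galois a = a \<longleftrightarrow> (\<forall>r. pcoeff a r ~= 0 --> r \<in> \<nat>)"
proof -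
 have cis: "cis (2 * pi * of_rat r) = 1 \<longleftrightarrow> r \<in> \<int>" for r
 proof
  assume "cis (2 * pi * of_rat r) = 1"
  hence "cos (2 * pi * of_rat r) = 1" by (simp add: complex_eq_iff)
  then obtain n :: int where "2 * pi * of_rat r = of_int n * 2 * pi"
   unfolding cos_one_2pi_int by auto
  hence "of_rat r = (of_int n :: real)" by simp
  hence "r = of_int n" by (metis of_rat_eq_iff of_rat_of_int_eq)
  thus "r \<in> \<int>" by simp
 next
  assume "r \<in> \<int>"
  then obtain n :: int where "r = of_int n" by (elim Ints_cases)
  hence "cis (2 * pi * of_rat r) = cis (2 * pi * of_int n)" by simp
  thus "cis (2 * pi * of_rat r) = 1" by (metis cis_multiple_2pi Ints_of_int mult.assoc)
 qed
 have nat: "r \<in> \<nat> \<longleftrightarrow> r \<in> \<int>" if "pcoeff a r ~= 0" for r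
  using that pcoeff_neg[of r a] by (metis Nats_altdef2 Nats_subset_Ints mem_Collect_eq not_less subsetD)
 have "galois a = a \<longleftrightarrow> (\<forall>r. pcoeff a r ~= 0 --> cis (2 * pi * of_rat r) = 1)"
  by (metis (no_types, lifting) galois.rep_eq mult_cancel_right1 puiseux_eqI)
 thus ?thesis using cis nat by blast
qed

section \<open>Substituting an arc into a power series\<close>

text \<open>The value \<open>F(xi)\<close> is characterised algebraically: it is the only \<open>w\<close> for which \<open>x - xi\<close>
 divides \<open>F - w\<close>.  With this description the rules for sums and products, the behaviour under
 conjugation and the chain rule are formal consequences of divisibility.\<close>

abbreviation pos_arc :: "puiseux => bool" where "pos_arc xi \<equiv> Fin 0 < yord xi"

abbreviation lin :: "puiseux => puiseux fps" where
 "lin xi \<equiv> fps_X - fps_const xi"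

definition has_value :: "puiseux fps => puiseux => puiseux => bool" where
 "has_value F xi w \<longleftrightarrow> lin xi dvd F - fps_const w"

lemma yord_mult_ge: "Fin r <= yord a ==> Fin s <= yord b ==> Fin (r + s) <= yord (a * b)"
 using lead_term_mult unfolding yord_ge_lead by (metis lead_term_pcoeff)

lemma yord_power_ge: "Fin r <= yord a ==> Fin (of_nat k * r) <= yord (a ^ k)"
 using lead_term_power unfolding yord_ge_lead by (metis lead_term_pcoeff)

lemma yord_ge_trans: "Fin r <= yord a ==> s <= r ==> Fin s <= yord a"
 by (meson less_eq_extended.simps(1) order_trans)

lemma pos_arc_bound: assumes "pos_arc xi" obtains e where "e > 0" "Fin e <= yord xi"
proof (cases xi rule: yord_cases)
 case 1
 thus ?thesis using that[of 1] by simp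
next
 case (2 r c)
 thus ?thesis using that[of r] assms by simp
qed

lemma yord_large_zero:
 assumes "e > 0" "!!K. Fin (of_nat K * e) <= yord a" shows "a = 0"
proof (rule ccontr)
 assume "a ~= 0"
 then obtain r where r: "yord a = Fin r" by (cases a rule: yord_cases) auto
 obtain K where "of_nat K * e > r" using assms(1) ex_less_of_nat_mult by blast
 with assms(2)[of K] r show False by simp
qed

text \<open>Comparing coefficients gives \<open>c = - xi\<^sup>k\<^sup>+\<^sup>1 G\<^sub>k\<close> for every \<open>k\<close>, where \<open>G\<close> is the quotient,
 and the orders of the right-hand sides are unbounded.\<close>

lemma pos_arc_linear_not_unit:
 assumes "pos_arc xi" "lin xi dvd fps_const c" shows "c = 0"
proof -
 obtain G where G: "fps_const c = lin xi * G" using assms(2) by (auto simp: dvd_def)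
 obtain e where e: "e > 0" "Fin e <= yord xi" using assms(1) pos_arc_bound by blast
 have 0: "c = - (xi * G $ 0)"
  using arg_cong[OF G, of "%F. F $ 0"] by (simp add: left_diff_distrib)
 have S: "G $ k = xi * G $ (Suc k)" for k
  using arg_cong[OF G, of "%F. F $ (Suc k)"] by (simp add: left_diff_distrib)
 have c: "c = - (xi ^ Suc k * G $ k)" for k
 proof (induction k)
  case (Suc k)
  have "xi ^ Suc k * G $ k = xi ^ Suc (Suc k) * G $ (Suc k)"
   by (subst S) (simp add: mult_ac)
  with Suc show ?case by simp
 qed (use 0 in simp)
 have "Fin (of_nat k * e) <= yord c" for k
  using yord_mult_ge[OF yord_power_ge[OF e(2), of k] yord_nonneg[of "xi * G $ k"]] c[of k]
  by (simp add: mult_ac)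
 thus ?thesis using e(1) yord_large_zero by blast
qed

lemma has_value_unique:
 assumes "pos_arc xi" "has_value F xi v" "has_value F xi w" shows "v = w"
proof -
 have "lin xi dvd (F - fps_const w) - (F - fps_const v)"
  by (rule dvd_diff[OF assms(3,2)[unfolded has_value_def]])
 moreover have "(F - fps_const w) - (F - fps_const v) = fps_const (v - w)"
  by (rule fps_ext) auto
 ultimately have "lin xi dvd fps_const (v - w)" by simp
 thus ?thesis using pos_arc_linear_not_unit[OF assms(1)] by fastforce
qed

lemma has_value_add: "has_value F xi v ==> has_value G xi w ==> has_value (F + G) xi (v + w)"
 using dvd_add[of "lin xi" "F - fps_const v" "G - fps_const w"]
 by (simp add: has_value_def algebra_simps flip: fps_const_add)

lemma has_value_diff: "has_value F xi v ==> has_value G xi w ==> has_value (F - G) xi (v - w)"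
 using dvd_diff[of "lin xi" "F - fps_const v" "G - fps_const w"]
 by (simp add: has_value_def algebra_simps flip: fps_const_sub)

lemma has_value_mult:
 assumes "has_value F xi v" "has_value G xi w" shows "has_value (F * G) xi (v * w)"
proof -
 have "F * G - fps_const (v * w) = (F - fps_const v) * G + fps_const v * (G - fps_const w)"
  by (simp add: algebra_simps)
 thus ?thesis using assms by (simp add: has_value_def)
qed

lemma has_value_const: "has_value (fps_const c) xi c" by (simp add: has_value_def)

lemma has_value_linear: "has_value (lin al) xi (xi - al)"
proof -
 have "lin al - fps_const (xi - al) = lin xi" by (rule fps_ext) auto
 thus ?thesis by (simp only: has_value_def dvd_refl)
qed

lemma has_value_one [simp]: "has_value 1 xi 1" using has_value_const[of 1] by simp

lemma has_value_prod:
 "(!!x. x \<in> A ==> has_value (F x) xi (w x)) ==> has_value (prod F A) xi (prod w A)"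
proof (induction A rule: infinite_finite_induct)
 case (insert x A)
 thus ?case by (simp add: has_value_mult)
qed simp_all

lemma has_value_power: "has_value F xi w ==> has_value (F ^ n) xi (w ^ n)"
 by (induction n) (auto intro: has_value_mult)

lemma has_value_zero_iff: "has_value F xi 0 \<longleftrightarrow> lin xi dvd F"
 by (simp add: has_value_def)

lemma has_value_map:
 assumes "ring_map h" "has_value F xi w" shows "has_value (coeff_map h F) (h xi) (h w)"
 using ring_map_dvd[OF ring_map_coeff_map[OF assms(1)], of "lin xi" "F - fps_const w"]
  assms(2) coeff_map_linear[OF assms(1)] coeff_map_const[OF assms(1)]
  ring_mapD(6)[OF ring_map_coeff_map[OF assms(1)]]
 by (simp add: has_value_def)

text \<open>The chain rule for \<open>y d/dy\<close>: differentiate \<open>F - w = (x - xi) G\<close> with respect to \<open>x\<close> and with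
 respect to \<open>y\<close>, and compare modulo \<open>x - xi\<close>.\<close>

lemma has_value_chain_rule:
 assumes "has_value F xi w" "has_value (fps_deriv F) xi d"
 shows "has_value (coeff_map ytheta F) xi (ytheta w - ytheta xi * d)"
proof -
 obtain G where G: "F - fps_const w = lin xi * G" using assms(1) by (auto simp: has_value_def)
 have F: "F = lin xi * G + fps_const w" using G by (simp add: algebra_simps)
 have th_add: "coeff_map ytheta (A + B) = coeff_map ytheta A + coeff_map ytheta B" for A B
  by (rule fps_ext) (simp add: ytheta_add)
 have th_sum: "ytheta (sum f A) = (\<Sum>x\<in>A. ytheta (f x))" for f and A :: "nat set"
  by (induction A rule: infinite_finite_induct) (auto simp: ytheta_add)
 have th_mult: "coeff_map ytheta (A * B) = A * coeff_map ytheta B + coeff_map ytheta A * B" for A B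
  by (rule fps_ext) (simp add: ytheta_times fps_mult_nth th_sum sum.distrib)
 have one: "ytheta 1 = 0"
  by (rule puiseux_eqI) (auto simp: ytheta.rep_eq pcoeff_one)
 have th_const: "coeff_map ytheta (fps_const a) = fps_const (ytheta a)" for a
  by (rule fps_ext) auto
 have neg: "ytheta (- a) = - ytheta a" for a
  using ytheta_add[of a "-a"] by (simp add: eq_neg_iff_add_eq_0 add.commute)
 have th_lin: "coeff_map ytheta (lin xi) = - fps_const (ytheta xi)"
  by (rule fps_ext) (auto simp: one fps_X_def neg)
 have "fps_deriv F = G + lin xi * fps_deriv G"
  unfolding F by simp
 hence "lin xi dvd fps_deriv F - G" by simp
 moreover have "lin xi dvd fps_deriv F - fps_const d" using assms(2) by (simp add: has_value_def)
 moreover have "G - fps_const d = (fps_deriv F - fps_const d) - (fps_deriv F - G)"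
  by (rule fps_ext) auto
 ultimately have "lin xi dvd G - fps_const d"
  using dvd_diff by metis
 moreover have "coeff_map ytheta F - fps_const (ytheta w - ytheta xi * d) =
   lin xi * coeff_map ytheta G - fps_const (ytheta xi) * (G - fps_const d)"
  unfolding F th_add th_mult th_lin th_const
  by (simp add: algebra_simps flip: fps_const_add fps_const_sub fps_const_mult fps_const_neg)
 ultimately show ?thesis by (simp add: has_value_def)
qed

text \<open>A common denominator of the coefficients makes the sum that defines the value finite in
 every degree.\<close>

definition tame :: "puiseux fps => bool" where
 "tame F \<longleftrightarrow> (\<exists>n. \<forall>i. has_denom n (pcoeff (F $ i)))"

definition peval :: "puiseux fps => puiseux => puiseux" where
 "peval F xi = Abs_puiseux (%r. \<Sum>k. pcoeff (F $ k * xi ^ k) r)"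

lemma tame_shift: "tame F ==> tame (fps_shift m F)"
 by (auto simp: tame_def)

lemma denom_power: "has_denom n (pcoeff xi) ==> has_denom n (pcoeff (xi ^ k))"
proof (induction k)
 case 0
 thus ?case using denom_one[of n] by (simp add: has_denom_def)
qed (simp add: denom_times)

lemma pcoeff_peval:
 assumes "tame F" shows "pcoeff (peval F xi) r = (\<Sum>k. pcoeff (F $ k * xi ^ k) r)"
proof -
 obtain n where n: "!!i. has_denom n (pcoeff (F $ i))" using assms by (auto simp: tame_def)
 obtain m where m: "has_denom m (pcoeff xi)" using denom_puiseux by blast
 have t: "has_denom (n * m) (pcoeff (F $ k * xi ^ k))" for k
  by (intro denom_times has_denom_common[OF n denom_power[OF m]])
 have "has_denom (n * m) (%r. \<Sum>k. pcoeff (F $ k * xi ^ k) r)"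
  unfolding has_denom_def
 proof (intro conjI allI impI)
  show "n * m > 0" using t by (simp add: has_denom_def)
  fix r assume "(\<Sum>k. pcoeff (F $ k * xi ^ k) r) ~= 0"
  then obtain k where "pcoeff (F $ k * xi ^ k) r ~= 0" by fastforce
  thus "\<exists>k::nat. r = of_nat k / of_nat (n * m)" using t unfolding has_denom_def by blast
 qed
 thus ?thesis unfolding peval_def by (subst Abs_puiseux_inverse) auto
qed

lemma peval_truncate:
 assumes "tame F" "Fin e <= yord xi" "e > 0"
 shows "Fin (of_nat K * e) <= yord (peval F xi - (\<Sum>k<K. F $ k * xi ^ k))"
 unfolding yord_ge_iff
proof (intro allI impI)
 fix r assume r: "r < of_nat K * e"
 have "pcoeff (F $ k * xi ^ k) r = 0" if "k \<notin> {..<K}" for k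
 proof -
  have "Fin (0 + of_nat k * e) <= yord (F $ k * xi ^ k)"
   by (intro yord_mult_ge yord_nonneg yord_power_ge assms)
  moreover have "r < of_nat k * e"
   by (rule less_le_trans[OF r]) (use that assms(3) in \<open>auto intro: mult_right_mono\<close>)
  ultimately show ?thesis by (auto simp: yord_ge_iff)
 qed
 hence "(\<Sum>k. pcoeff (F $ k * xi ^ k) r) = (\<Sum>k<K. pcoeff (F $ k * xi ^ k) r)"
  by (intro suminf_finite) auto
 thus "pcoeff (peval F xi - (\<Sum>k<K. F $ k * xi ^ k)) r = 0"
  by (simp add: pcoeff_peval[OF assms(1)] pcoeff_sum)
qed

lemma peval_step:
 assumes "tame F" "pos_arc xi"
 shows "peval F xi = F $ 0 + xi * peval (fps_shift 1 F) xi"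
proof -
 obtain e where e: "e > 0" "Fin e <= yord xi" using assms(2) pos_arc_bound by blast
 let ?d = "peval F xi - (F $ 0 + xi * peval (fps_shift 1 F) xi)"
 have ring: "p - (f + x * q) = (p - (f + x * s)) + - (x * (q - s))" for p f x q s :: puiseux
  by (simp add: algebra_simps)
 have "Fin (of_nat K * e) <= yord ?d" for K
 proof -
  let ?A = "peval F xi - (\<Sum>k<Suc K. F $ k * xi ^ k)"
  let ?B = "peval (fps_shift 1 F) xi - (\<Sum>k<K. (fps_shift 1 F) $ k * xi ^ k)"
  have "Fin (of_nat K * e) <= yord ?A"
   by (rule yord_ge_trans[OF peval_truncate[OF assms(1) e(2,1)]]) (use e in simp)
  have B: "Fin (of_nat K * e) <= yord (- (xi * ?B))"
   using yord_mult_ge[OF yord_nonneg[of xi] peval_truncate[OF tame_shift[OF assms(1), of 1] e(2,1), of K]]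
   by simp
  have "(\<Sum>k<K. F $ (Suc k) * xi ^ Suc k) = xi * (\<Sum>k<K. (fps_shift 1 F) $ k * xi ^ k)"
   by (simp add: sum_distrib_left mult_ac)
  hence A: "?A = peval F xi - (F $ 0 + xi * (\<Sum>k<K. (fps_shift 1 F) $ k * xi ^ k))"
   by (simp only: sum.lessThan_Suc_shift power_0 mult_1_right)
  have "?d = ?A + - (xi * ?B)"
   unfolding A by (rule ring)
  thus ?thesis using order_trans[OF min.boundedI[OF \<open>Fin (of_nat K * e) <= yord ?A\<close> B] yord_add]
   by (simp only:)
 qed
 thus ?thesis using yord_large_zero[OF e(1)] by fastforce
qed

lemma has_value_peval:
 assumes "tame F" "pos_arc xi" shows "has_value F xi (peval F xi)"
proof -
 have "F - fps_const (peval F xi) = lin xi * Abs_fps (%i. peval (fps_shift (Suc i) F) xi)"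
  (is "_ = lin xi * ?G")
 proof (rule fps_ext)
  fix i
  show "(F - fps_const (peval F xi)) $ i = (lin xi * ?G) $ i"
  proof (cases i)
   case 0
   thus ?thesis using peval_step[OF assms] by (simp add: left_diff_distrib)
  next
   case (Suc j)
   have "peval (fps_shift (Suc j) F) xi =
     F $ (Suc j) + xi * peval (fps_shift (Suc (Suc j)) F) xi"
    using peval_step[OF tame_shift[OF assms(1)] assms(2), of "Suc j"]
    by (simp add: fps_shift_fps_shift[symmetric] del: fps_shift_fps_shift)
   thus ?thesis using Suc by (simp add: left_diff_distrib)
  qed
 qed
 thus ?thesis by (simp add: has_value_def)
qed


section \<open>Germs as power series over the fractional power series\<close>

lemma pcoeff_puiseux_of_fps: "pcoeff (of_fps a) (of_nat k) = a $ k"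
 by (simp add: puiseux_of_fps.rep_eq)

lemma pcoeff_puiseux_of_fps_not: "r \<notin> \<nat> ==> pcoeff (of_fps a) r = 0"
 by (simp add: puiseux_of_fps.rep_eq)

lemma denom_puiseux_of_fps: "has_denom 1 (pcoeff (of_fps a))"
 by (auto simp: has_denom_def puiseux_of_fps.rep_eq elim: Nats_cases)

lemma root_fps_puiseux_of_fps: "root_fps 1 (of_fps a) = a"
 by (rule fps_ext) (simp add: root_fps_def pcoeff_puiseux_of_fps)

lemma ring_map_puiseux_of_fps: "ring_map of_fps"
 unfolding ring_map_def
 by (intro conjI allI; rule root_fps_inject[of 1])
  (auto simp: root_fps_times root_fps_simps root_fps_one denom_puiseux_of_fps denom_times denom_plus
   denom_one root_fps_puiseux_of_fps[unfolded One_nat_def] denom_puiseux_of_fps[unfolded One_nat_def])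

lemma inj_puiseux_of_fps: "inj of_fps"
 by (rule injI) (metis root_fps_puiseux_of_fps)

lemma germ_embed_alt: "emb F = coeff_map of_fps (series F)"
 by (simp add: germ_embed_def coeff_map_def)

lemma ring_map_germ_embed: "ring_map emb"
 using ring_mapD(1-3)[OF ring_map_coeff_map[OF ring_map_puiseux_of_fps]]
 by (simp add: ring_map_def germ_embed_alt plus_germ.rep_eq times_germ.rep_eq one_germ.rep_eq)

lemmas germ_embed_simps = ring_mapD[OF ring_map_germ_embed]

lemma germ_embed_inject: "emb F = emb G \<longleftrightarrow> F = G"
proof
 assume "emb F = emb G"
 hence "of_fps ((series F) $ i) = of_fps ((series G) $ i)" for i
  by (metis coeff_map_nth germ_embed_alt)
 hence "series F = series G" using inj_puiseux_of_fps by (intro fps_ext[of "series F"]) (metis injD)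
 thus "F = G" by (simp add: series_inject)
qed simp

instance germ :: idom
 by standard (metis germ_embed_inject germ_embed_simps(2,4) mult_eq_0_iff)

lemma tame_germ_embed: "tame (emb F)"
 using denom_puiseux_of_fps by (auto simp: tame_def germ_embed_alt)

lemma germ_eval_peval: "germ_eval F xi = peval (emb F) xi"
 by (simp add: germ_eval_def peval_def germ_embed_alt)

lemma has_value_germ: "pos_arc xi ==> has_value (emb F) xi (germ_eval F xi)"
 by (simp add: germ_eval_peval has_value_peval tame_germ_embed)

lemma germ_evalI: "pos_arc xi ==> has_value (emb F) xi w ==> germ_eval F xi = w"
 using has_value_germ has_value_unique by blast

lemma germ_eval_zero_iff: "pos_arc xi ==> germ_eval F xi = 0 \<longleftrightarrow> lin xi dvd emb F"
 by (metis germ_evalI has_value_germ has_value_zero_iff)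

lemma germ_eval_simps:
 assumes "pos_arc xi"
 shows "germ_eval (F + G) xi = germ_eval F xi + germ_eval G xi"
  "germ_eval (F - G) xi = germ_eval F xi - germ_eval G xi"
  "germ_eval (F * G) xi = germ_eval F xi * germ_eval G xi"
  "germ_eval 1 xi = 1" "germ_eval 0 xi = 0" "germ_eval (F ^ n) xi = germ_eval F xi ^ n"
 using has_value_germ[OF assms] has_value_const[of 0 xi]
 by (auto intro!: germ_evalI[OF assms] has_value_add has_value_diff has_value_mult has_value_power
   simp: germ_embed_simps)

lemma germ_embed_y: "emb germ_y = fps_const (ymonom 1 1)"
proof (rule fps_ext)
 fix i
 have "of_fps fps_X = ymonom 1 1"
  by (rule puiseux_eqI) (auto simp: puiseux_of_fps.rep_eq pcoeff_ymonom elim!: Nats_cases)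
 thus "(emb germ_y) $ i = (fps_const (ymonom 1 1)) $ i"
  by (simp add: germ_embed_alt germ_y.rep_eq ring_mapD[OF ring_map_puiseux_of_fps])
qed

lemma germ_embed_dx: "emb (germ_dx F) = fps_deriv (emb F)"
 by (rule fps_ext)
  (simp only: germ_embed_alt germ_dx.rep_eq coeff_map_nth fps_deriv_nth
   ring_mapD(2,10)[OF ring_map_puiseux_of_fps])

lemma germ_embed_y_dy: "emb (germ_y * germ_dy F) = coeff_map ytheta (emb F)"
proof (rule fps_ext)
 fix i
 have "of_fps (fps_X * fps_deriv a) = ytheta (of_fps a)" for a
 proof (rule puiseux_eqI)
  fix r
  show "pcoeff (of_fps (fps_X * fps_deriv a)) r = pcoeff (ytheta (of_fps a)) r"
  proof (cases "r \<in> \<nat>")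
   case True
   then obtain k where r: "r = of_nat k" by (elim Nats_cases)
   show ?thesis unfolding r ytheta.rep_eq pcoeff_puiseux_of_fps of_rat_of_nat_eq by (cases k) auto
  qed (simp add: pcoeff_puiseux_of_fps_not ytheta.rep_eq)
 qed
 thus "(emb (germ_y * germ_dy F)) $ i = (coeff_map ytheta (emb F)) $ i"
  by (simp add: germ_embed_alt times_germ.rep_eq germ_y.rep_eq germ_dy.rep_eq)
qed

text \<open>When the chain rule for \<open>y d/dy\<close> is inserted for \<open>y f\<^sub>y\<close> and \<open>y g\<^sub>y\<close>, the two terms that contain
 the derivative of the arc cancel.\<close>

lemma y_jacobian_on_arc:
 assumes "pos_arc xi"
 shows "ymonom 1 1 * germ_eval (jacobian_germ f g) xi =
  ytheta (germ_eval f xi) * germ_eval (germ_dx g) xi - germ_eval (germ_dx f) xi * ytheta (germ_eval g xi)"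
proof -
 have y: "germ_eval germ_y xi = ymonom 1 1"
  using assms by (intro germ_evalI) (auto simp: germ_embed_y has_value_const)
 have c: "ymonom 1 1 * germ_eval (germ_dy F) xi = ytheta (germ_eval F xi) - ytheta xi * germ_eval (germ_dx F) xi" for F
 proof -
  have "germ_eval (germ_y * germ_dy F) xi = ytheta (germ_eval F xi) - ytheta xi * germ_eval (germ_dx F) xi"
   using assms has_value_germ[OF assms]
   by (intro germ_evalI) (auto simp: germ_embed_y_dy germ_embed_dx[symmetric] intro!: has_value_chain_rule)
  thus ?thesis using germ_eval_simps[OF assms] y by simp
 qed
 have "ymonom 1 1 * germ_eval (jacobian_germ f g) xi =
   (ymonom 1 1 * germ_eval (germ_dy f) xi) * germ_eval (germ_dx g) xi -
   germ_eval (germ_dx f) xi * (ymonom 1 1 * germ_eval (germ_dy g) xi)"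
  by (simp add: jacobian_germ_def germ_eval_simps[OF assms] algebra_simps)
 also have "\<dots> = ytheta (germ_eval f xi) * germ_eval (germ_dx g) xi - germ_eval (germ_dx f) xi * ytheta (germ_eval g xi)"
  unfolding c by (simp add: algebra_simps)
 finally show ?thesis .
qed

lemma galois_germ_embed: "coeff_map galois (emb F) = emb F"
 by (rule fps_ext) (metis coeff_map_nth galois_fixed_iff germ_embed_alt pcoeff_puiseux_of_fps_not)

lemma germ_eval_galois: "pos_arc xi ==> germ_eval F (galois xi) = galois (germ_eval F xi)"
 using has_value_map[OF ring_map_galois has_value_germ]
 by (intro germ_evalI) (auto simp: galois_germ_embed)

lemma galois_np_roots_iff: "galois xi \<in> np_roots F \<longleftrightarrow> xi \<in> np_roots F"
proof -
 have g0: "galois 0 = 0" by (rule ring_mapD(4)[OF ring_map_galois])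
 have "(galois a = galois 0) = (a = 0)" for a by (rule inj_eq[OF inj_galois])
 hence z: "galois a = 0 \<longleftrightarrow> a = 0" for a unfolding g0 .
 show ?thesis unfolding np_roots_def mem_Collect_eq yord_galois
  by (cases "pos_arc xi") (simp_all only: germ_eval_galois z simp_thms)
qed

section \<open>Weighted norms of double power series\<close>

text \<open>Convergence of a series that is given implicitly by a formal equation is proved by bounding
 the norms \<open>nrm w p q K\<close> of its truncations uniformly in \<open>K\<close>.  The equation is always brought to the
 form in which a main part, with a known norm, is a known series plus a contracted copy of the
 unknown.  The truncation counts \<open>y\<close> with weight \<open>w\<close>.\<close>

definition idx :: "nat => nat => (nat \<times> nat) set" where
 "idx w K = {(i, j). i + w * j <= K}"

definition nrm :: "nat => real => real => nat => complex fps fps => real" where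
 "nrm w p q K F = (\<Sum>(i, j)\<in>idx w K. norm (F $ i $ j) * p ^ i * q ^ j)"

definition weight_ge :: "nat => nat => complex fps fps => bool" where
 "weight_ge w m F \<longleftrightarrow> (\<forall>i j. i + w * j < m --> F $ i $ j = 0)"

lemma idx_subset: assumes "w > 0" shows "idx w K \<subseteq> {..K} \<times> {..K}"
proof
 fix x assume "x \<in> idx w K"
 then obtain i j where x: "x = (i, j)" "i + w * j <= K" by (auto simp: idx_def)
 have "j <= w * j" using assms by (cases w) auto
 hence "j <= K" using x(2) by linarith
 with x show "x \<in> {..K} \<times> {..K}" by auto
qed

lemma finite_idx: "w > 0 ==> finite (idx w K)" by (rule finite_subset[OF idx_subset]) auto

lemma nrm_nonneg: "p \<ge> 0 ==> q \<ge> 0 ==> 0 <= nrm w p q K F"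
 unfolding nrm_def by (intro sum_nonneg) auto

lemma nrm_add:
 assumes "p \<ge> 0" "q \<ge> 0" shows "nrm w p q K (F + G) <= nrm w p q K F + nrm w p q K G"
 unfolding nrm_def sum.distrib[symmetric]
proof (intro sum_mono, clarify)
 fix i j
 have "norm (((F + G) $ i) $ j) * (p ^ i * q ^ j)
   <= (norm (F $ i $ j) + norm (G $ i $ j)) * (p ^ i * q ^ j)"
  using assms by (intro mult_right_mono) (auto intro: norm_triangle_ineq)
 thus "norm (((F + G) $ i) $ j) * p ^ i * q ^ j
   <= norm (F $ i $ j) * p ^ i * q ^ j + norm (G $ i $ j) * p ^ i * q ^ j"
  by (simp add: algebra_simps)
qed

lemma nrm_mono:
 assumes "p \<ge> 0" "q \<ge> 0" "w > 0" "K <= L" shows "nrm w p q K F <= nrm w p q L F"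
 unfolding nrm_def using assms by (intro sum_mono2 finite_idx) (auto simp: idx_def)

text \<open>Terms of \<open>F G\<close> of weight at most \<open>K + m + n\<close> involve \<open>G\<close> only up to the weight \<open>K + n\<close>, as
 \<open>F\<close> starts in weight \<open>m\<close>.  This shift is what makes estimates by induction on the truncation
 possible.\<close>

lemma nrm_mult:
 assumes pq: "p \<ge> 0" "q \<ge> 0" "w > 0" and F: "weight_ge w m F" and G: "weight_ge w n G"
 shows "nrm w p q (K + m + n) (F * G) <= nrm w p q (K + m) F * nrm w p q (K + n) G"
proof -
 define f where "f = (%(i, j). norm (F $ i $ j) * p ^ i * q ^ j)"
 define g where "g = (%(i, j). norm (G $ i $ j) * p ^ i * q ^ j)"
 have fg0: "f x \<ge> 0" "g x \<ge> 0" for x using pq by (auto simp: f_def g_def split: prod.splits)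
 let ?I = "idx w (K + m + n)"
 define h where "h = (%((i, j), (a, b)). f (a, b) * g (i - a, j - b))"
 define u :: "(nat \<times> nat) \<times> (nat \<times> nat) => (nat \<times> nat) \<times> (nat \<times> nat)"
  where "u = (%((a, b), (c, d)). ((a + c, b + d), (a, b)))"
 define S where "S = Sigma ?I (%(i, j). {0..i} \<times> {0..j})"
 have fS: "finite S" unfolding S_def using finite_idx[OF pq(3)] by (intro finite_SigmaI) auto
 have "nrm w p q (K + m + n) (F * G) <= (\<Sum>x\<in>?I. \<Sum>y\<in>(case x of (i, j) => {0..i} \<times> {0..j}). h (x, y))"
  unfolding nrm_def
 proof (intro sum_mono, clarify)
  fix i j
  have "norm (((F * G) $ i) $ j) * (p ^ i * q ^ j) =
   norm (\<Sum>a=0..i. \<Sum>b=0..j. F $ a $ b * (G $ (i - a)) $ (j - b)) * (p ^ i * q ^ j)"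
   by (simp add: fps_mult_nth fps_sum_nth)
  also have "\<dots> <= (\<Sum>a=0..i. \<Sum>b=0..j. norm (F $ a $ b * (G $ (i - a)) $ (j - b))) * (p ^ i * q ^ j)"
   using pq by (intro mult_right_mono sum_norm_le order_refl) auto
  also have "\<dots> = (\<Sum>a=0..i. \<Sum>b=0..j. h ((i, j), (a, b)))"
   unfolding sum_distrib_right
  proof (intro sum.cong refl)
   fix a b assume ab: "a \<in> {0..i}" "b \<in> {0..j}"
   hence "p ^ i = p ^ a * p ^ (i - a)" "q ^ j = q ^ b * q ^ (j - b)"
    by (simp_all flip: power_add)
   thus "norm (F $ a $ b * (G $ (i - a)) $ (j - b)) * (p ^ i * q ^ j) = h ((i, j), (a, b))"
    by (simp add: h_def f_def g_def norm_mult mult_ac)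
  qed
  finally show "norm (((F * G) $ i) $ j) * p ^ i * q ^ j
    <= (\<Sum>y\<in>{0..i} \<times> {0..j}. h ((i, j), y))"
   by (simp add: sum.cartesian_product mult.assoc case_prod_unfold)
 qed
 also have "\<dots> = (\<Sum>z\<in>S. h z)"
  unfolding S_def using finite_idx[OF pq(3)] by (subst sum.Sigma) auto
 also have "\<dots> = (\<Sum>z\<in>{z\<in>S. h z ~= 0}. h z)"
  by (rule sum.mono_neutral_right) (use fS in auto)
 also have "\<dots> <= (\<Sum>z\<in>idx w (K + m) \<times> idx w (K + n). f (fst z) * g (snd z))"
 proof (rule sum_le_included[where i = u])
  show "finite {z \<in> S. h z ~= 0}" using fS by simp
  show "finite (idx w (K + m) \<times> idx w (K + n))" using finite_idx[OF pq(3)] by simp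
  show "\<forall>y\<in>idx w (K + m) \<times> idx w (K + n). 0 <= f (fst y) * g (snd y)"
   using fg0 by auto
  show "\<forall>z\<in>{z \<in> S. h z ~= 0}. \<exists>y\<in>idx w (K + m) \<times> idx w (K + n).
    u y = z \<and> h z <= f (fst y) * g (snd y)"
  proof
   fix z assume z: "z \<in> {z \<in> S. h z ~= 0}"
   then obtain i j a b where z': "z = ((i, j), (a, b))" "i + w * j <= K + m + n" "a <= i" "b <= j" "h z ~= 0"
    by (auto simp: S_def idx_def)
   have "F $ a $ b ~= 0" "(G $ (i - a)) $ (j - b) ~= 0"
    using z'(1,5) by (auto simp: h_def f_def g_def)
   hence "a + w * b \<ge> m" "(i - a) + w * (j - b) \<ge> n"
    using F G by (auto simp: weight_ge_def not_less[symmetric])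
   moreover have "i + w * j = (a + w * b) + ((i - a) + w * (j - b))"
    using z'(3) mult_le_mono2[OF z'(4), of w] unfolding diff_mult_distrib2 by linarith
   ultimately have "((a, b), (i - a, j - b)) \<in> idx w (K + m) \<times> idx w (K + n)"
    using z'(2) by (auto simp: idx_def)
   thus "\<exists>y\<in>idx w (K + m) \<times> idx w (K + n).
    u y = z \<and> h z <= f (fst y) * g (snd y)"
    using z'(1,3,4) by (intro bexI[of _ "((a, b), (i - a, j - b))"]) (auto simp: h_def u_def)
  qed
 qed
 also have "\<dots> = nrm w p q (K + m) F * nrm w p q (K + n) G"
  by (simp add: nrm_def f_def g_def sum_product sum.cartesian_product case_prod_unfold)
 finally show ?thesis .
qed

lemma nrm_mult0:
 "p \<ge> 0 ==> q \<ge> 0 ==> w > 0 ==> nrm w p q K (F * G) <= nrm w p q K F * nrm w p q K G"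
 using nrm_mult[of p q w 0 F 0 G K] by (simp add: weight_ge_def)

lemma convergent2_if_nrm:
 assumes "p > 0" "q > 0" "w > 0" "!!K. nrm w p q K F <= C" shows "conv2 F"
proof (rule convergent2I)
 define R where "R = max (1 / p) (1 / q)"
 show R: "R > 0" using assms by (simp add: R_def less_max_iff_disj)
 fix i j
 have "norm (F $ i $ j) * p ^ i * q ^ j =
   (\<Sum>(i, j)\<in>{(i, j)}. norm (F $ i $ j) * p ^ i * q ^ j)" by simp
 also have "\<dots> <= nrm w p q (i + w * j) F"
  unfolding nrm_def by (rule sum_mono2) (use assms finite_idx in \<open>auto simp: idx_def\<close>)
 finally have "norm (F $ i $ j) * p ^ i * q ^ j <= C" using assms(4) by (meson order_trans)
 hence "norm (F $ i $ j) <= C * ((1 / p) ^ i * (1 / q) ^ j)"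
  using assms by (simp add: field_simps power_divide)
 also have "\<dots> <= C * (R ^ i * R ^ j)"
 proof (rule mult_left_mono)
  show "(1 / p) ^ i * (1 / q) ^ j <= R ^ i * R ^ j"
   using assms R by (intro mult_mono power_mono) (auto simp: R_def)
  show "0 <= C" using assms(4)[of 0] nrm_nonneg[of p q w 0 F] assms(1,2) by linarith
 qed
 finally show "norm (F $ i $ j) <= C * R ^ (i + j)" by (simp add: power_add)
qed

text \<open>The bound is uniform in the truncation, so that it is one for the sum of the absolute values
 of all terms on the polydisc of radius \<open>d\<close>.\<close>

definition nrm_le :: "nat => complex fps fps => real => real => bool" where
 "nrm_le w F d e \<longleftrightarrow> (\<forall>p q K. 0 <= p --> p <= d --> 0 <= q --> q <= d --> nrm w p q K F <= e)"

lemma nrm_leD: "nrm_le w F d e ==> 0 <= p ==> p <= d ==> 0 <= q ==> q <= d ==> nrm w p q K F <= e"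
 by (simp add: nrm_le_def)

text \<open>Without a constant term, shrinking the polydisc by a factor \<open>t\<close> gains \<open>t\<close> in every term of
 the geometric majorant.\<close>

lemma nrm_small:
 assumes "conv2 F" "F $ 0 $ 0 = 0" "e > 0" "w > 0"
 obtains d where "d > 0" "nrm_le w F d e"
proof -
 obtain C R where CR: "R > 0" "C \<ge> 0" "!!i j. norm (F $ i $ j) <= C * R ^ (i + j)"
  using convergent2_common_bound[OF assms(1,1)] by metis
 (* the terms off the origin are at most C t / 2^(i + j), which sum up to at most 4 C t *)
 define t where "t = min 1 (e / (4 * (C + 1)))"
 have t: "t > 0" "t <= 1" "4 * C * t <= e"
 proof -
  show "t > 0" "t <= 1" using assms CR by (auto simp: t_def)
  have "4 * C * t <= 4 * (C + 1) * (e / (4 * (C + 1)))"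
   using CR assms by (intro mult_mono) (auto simp: t_def)
  also have "\<dots> = e" using CR by simp
  finally show "4 * C * t <= e" .
 qed
 define d where "d = t / (2 * R)"
 have d: "d > 0" "R * d = t / 2" using t CR by (auto simp: d_def)
 have geo: "(\<Sum>i\<le>K. (1 / 2 :: real) ^ i) <= 2" for K
 proof -
  have "(\<Sum>i\<le>K. (1 / 2 :: real) ^ i) = 2 - (1 / 2) ^ K" by (induction K) auto
  thus ?thesis by simp
 qed
 have "nrm w p q K F <= e" if pq: "0 <= p" "p <= d" "0 <= q" "q <= d" for p q K
 proof -
  have "norm (F $ i $ j) * p ^ i * q ^ j <= C * t * ((1 / 2) ^ i * (1 / 2) ^ j)" for i j
  proof (cases "i + j = 0")
   case True
   thus ?thesis using assms(2) CR t by simp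
  next
   case False
   have "norm (F $ i $ j) * (p ^ i * q ^ j) <= (C * R ^ (i + j)) * (d ^ i * d ^ j)"
    using CR pq by (intro mult_mono power_mono) auto
   also have "\<dots> = C * (t / 2) ^ (i + j)"
    by (simp add: d(2)[symmetric] power_mult_distrib power_add mult_ac)
   also have "\<dots> = C * t ^ (i + j) * ((1 / 2) ^ i * (1 / 2) ^ j)"
    by (simp add: power_divide power_add power_mult_distrib field_simps)
   also have "\<dots> <= C * t ^ 1 * ((1 / 2) ^ i * (1 / 2) ^ j)"
    using False t CR by (intro mult_right_mono mult_left_mono power_decreasing) auto
   finally show ?thesis by (simp add: mult_ac)
  qed
  hence "nrm w p q K F <= (\<Sum>(i, j)\<in>idx w K. C * t * ((1 / 2) ^ i * (1 / 2) ^ j))"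
   unfolding nrm_def by (intro sum_mono) auto
  also have "\<dots> <= (\<Sum>(i, j)\<in>{..K} \<times> {..K}. C * t * ((1 / 2) ^ i * (1 / 2) ^ j))"
   by (rule sum_mono2[OF _ idx_subset]) (use assms CR t in auto)
  also have "\<dots> = C * t * ((\<Sum>i\<le>K. (1 / 2) ^ i) * (\<Sum>j\<le>K. (1 / 2) ^ j))"
   by (subst sum_product, subst sum.cartesian_product, subst sum_distrib_left) (simp add: case_prod_unfold)
  also have "\<dots> <= C * t * (2 * 2)"
   using CR t geo by (intro mult_left_mono mult_mono) (auto intro: sum_nonneg)
  also have "\<dots> <= e" using t(3) by simp
  finally show ?thesis .
 qed
 with d(1) show ?thesis using that by (auto simp: nrm_le_def)
qed

lemma nrm_bound:
 assumes "conv2 F" "w > 0"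
 obtains d C where "d > 0" "nrm_le w F d C"
proof -
 define c where "c = fps_const (fps_const (F $ 0 $ 0))"
 have c: "conv2 c" unfolding c_def by (rule convergent2_finite_support) auto
 obtain d where d: "d > 0" "nrm_le w (F - c) d 1"
  using nrm_small[OF convergent2_minus[OF assms(1) c], of 1 w] assms(2) by (auto simp: c_def)
 have "nrm w p q K c = norm (F $ 0 $ 0)" for p q K
 proof -
  have "nrm w p q K c = (\<Sum>(i, j)\<in>{(0, 0)}. norm (c $ i $ j) * p ^ i * q ^ j)"
   unfolding nrm_def by (rule sum.mono_neutral_right) (use finite_idx assms in \<open>auto simp: c_def idx_def split: if_splits\<close>)
  thus ?thesis by (simp add: c_def)
 qed
 hence "nrm w p q K F <= 1 + norm (F $ 0 $ 0)"
  if "0 <= p" "p <= d" "0 <= q" "q <= d" for p q K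
  using nrm_add[of p q w K "F - c" c] nrm_leD[OF d(2) that, of K] that by simp
 thus ?thesis using that[OF d(1), of "1 + norm (F $ 0 $ 0)"] by (simp add: nrm_le_def)
qed

lemma nrm_const_x: "nrm w p q K (fps_const a) = nrm w p' q K (fps_const a)"
 unfolding nrm_def by (intro sum.cong) auto

text \<open>The two summands have no monomial in common.\<close>

lemma nrm_split:
 assumes "w > 0" "!!i. i \<ge> d ==> r $ i = 0"
 shows "nrm w p q (K + d) (fps_X ^ d * Q + r) = p ^ d * nrm w p q K Q + nrm w p q (K + d) r"
proof -
 let ?I = "idx w (K + d)"
 let ?n = "%F. %(i, j). norm (F $ i $ j) * p ^ i * q ^ j"
 have fin: "finite ?I" using finite_idx[OF assms(1)] .
 have un: "?I = {z \<in> ?I. fst z \<ge> d} \<union> {z \<in> ?I. fst z < d}" by auto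
 have "nrm w p q (K + d) (fps_X ^ d * Q + r) =
   sum (?n (fps_X ^ d * Q + r)) {z \<in> ?I. fst z \<ge> d} + sum (?n (fps_X ^ d * Q + r)) {z \<in> ?I. fst z < d}"
  unfolding nrm_def by (subst un, rule sum.union_disjoint) (use fin in auto)
 also have "sum (?n (fps_X ^ d * Q + r)) {z \<in> ?I. fst z < d} = sum (?n r) {z \<in> ?I. fst z < d}"
  by (intro sum.cong) (auto simp: fps_X_power_mult_nth)
 also have "\<dots> = nrm w p q (K + d) r"
  unfolding nrm_def
 proof (rule sum.mono_neutral_left)
  show "\<forall>z\<in>?I - {z \<in> ?I. fst z < d}. ?n r z = 0"
  proof
   fix z assume "z \<in> ?I - {z \<in> ?I. fst z < d}"
   hence "r $ (fst z) = 0" by (intro assms(2)) auto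
   thus "?n r z = 0" by (simp add: case_prod_unfold)
  qed
 qed (use fin in auto)
 also have "sum (?n (fps_X ^ d * Q + r)) {z \<in> ?I. fst z \<ge> d} = (\<Sum>z\<in>idx w K. p ^ d * ?n Q z)"
  by (rule sum.reindex_bij_witness[of _ "%(i, j). (i + d, j)" "%(i, j). (i - d, j)"])
   (auto simp: idx_def fps_X_power_mult_nth assms(2) power_add[symmetric])
 also have "\<dots> = p ^ d * nrm w p q K Q" by (simp add: nrm_def sum_distrib_left)
 finally show ?thesis .
qed


text \<open>The equation \<open>x\<^sup>d Q + r = F + N Q\<close>, in which the terms on the left do not interfere, bounds
 its unknowns \<open>Q\<close> and \<open>r\<close> by \<open>F\<close>, if multiplication by \<open>N\<close> contracts.\<close>

lemma contraction:
 assumes pos: "p > 0" "q > 0" "w > 0" and eq: "fps_X ^ d * Q + r = F + N * Q" "!!i. i \<ge> d ==> r $ i = 0"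
  and N: "weight_ge w d N" "!!K. nrm w p q K N <= p ^ d / 2" and F: "!!K. nrm w p q K F <= C"
 shows "conv2 Q" "conv2 r"
proof -
 have main: "p ^ d / 2 * nrm w p q K Q + nrm w p q (K + d) r <= C" for K
 proof -
  have "p ^ d * nrm w p q K Q + nrm w p q (K + d) r = nrm w p q (K + d) (fps_X ^ d * Q + r)"
   using nrm_split[OF pos(3) eq(2)] by simp
  also have "\<dots> <= nrm w p q (K + d) F + nrm w p q (K + d) (N * Q)"
   unfolding eq(1) by (rule nrm_add) (use pos in auto)
  also have "\<dots> <= C + nrm w p q (K + d) N * nrm w p q K Q"
   using nrm_mult[of p q w d N 0 Q K] N(1) F pos by (intro add_mono) (auto simp: weight_ge_def)
  also have "\<dots> <= C + p ^ d / 2 * nrm w p q K Q"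
   using N(2) pos by (intro add_left_mono mult_right_mono nrm_nonneg) auto
  finally show ?thesis by simp
 qed
 have "nrm w p q K Q <= 2 * C / p ^ d" for K
 proof -
  have "p ^ d / 2 * nrm w p q K Q <= C" using main[of K] nrm_nonneg[of p q w "K + d" r] pos by linarith
  thus ?thesis using pos by (simp add: pos_le_divide_eq mult.commute)
 qed
 thus "conv2 Q" by (rule convergent2_if_nrm[OF pos])
 have "nrm w p q K r <= C" for K
 proof -
  have "0 <= p ^ d / 2 * nrm w p q K Q" using pos nrm_nonneg by simp
  moreover have "nrm w p q K r <= nrm w p q (K + d) r" using pos by (intro nrm_mono) auto
  ultimately show ?thesis using main[of K] by linarith
 qed
 thus "conv2 r" by (rule convergent2_if_nrm[OF pos])
qed

lemma convergent2_const: "conv2 (fps_const (fps_const c))"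
 by (rule convergent2_finite_support) auto

lemma convergent2_X: "conv2 fps_X"
 by (rule convergent2_finite_support) (auto simp: fps_X_def)

lemma convergent2_1: "conv2 1" and convergent2_0: "conv2 0"
 by (rule convergent2_finite_support; auto)+

lemma convergent2_power: "conv2 F ==> conv2 (F ^ n)"
 by (induction n) (auto intro: convergent2_times convergent2_1)

text \<open>After normalising \<open>A(0) = 1\<close>, the quotient solves \<open>G = A G + (1 - A) G\<close>, where \<open>A G\<close> is
 given and \<open>1 - A\<close> is small.\<close>

lemma convergent2_divide_unit:
 assumes A: "conv2 A" "A $ 0 $ 0 ~= 0" and F: "conv2 (A * G)"
 shows "conv2 G"
proof -
 define a where "a = A $ 0 $ 0"
 define c where "c = fps_const (fps_const (1 / a))"
 define N where "N = 1 - c * A"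
 have cc: "conv2 c" unfolding c_def by (rule convergent2_const)
 have N: "conv2 N" "N $ 0 $ 0 = 0"
  using A by (auto simp: N_def c_def a_def intro!: convergent2_minus convergent2_times convergent2_1 convergent2_const)
 have G: "fps_X ^ 0 * G + 0 = c * (A * G) + N * G" by (simp add: N_def algebra_simps)
 obtain d1 C where d1: "d1 > 0" "nrm_le 1 (c * (A * G)) d1 C"
  using nrm_bound[OF convergent2_times[OF cc F], of 1] by auto
 obtain d2 where d2: "d2 > 0" "nrm_le 1 N d2 (1 / 2)" using nrm_small[OF N, of "1 / 2" 1] by auto
 define p where "p = min d1 d2"
 have p: "p > 0" "p <= d1" "p <= d2" using d1 d2 by (auto simp: p_def)
 show ?thesis
  by (rule contraction(1)[where C = C, OF p(1) p(1) zero_less_one G])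
   (use p nrm_leD[OF d1(2)] nrm_leD[OF d2(2)] in \<open>auto simp: weight_ge_def\<close>)
qed

text \<open>Here \<open>G\<close> and \<open>v\<close> are the quotient and the remainder of the division by \<open>x - xi\<close>, and
 multiplication by \<open>xi\<close> contracts for small \<open>y\<close>, as \<open>xi(0) = 0\<close>.\<close>

lemma convergent2_divide_linear:
 assumes xi: "conv2 (fps_const xi)" "xi $ 0 = 0"
  and F: "conv2 (fps_const v + (fps_X - fps_const xi) * G)"
 shows "conv2 G" "conv2 (fps_const v)"
proof -
 define F where "F = fps_const v + (fps_X - fps_const xi) * G"
 have eq: "fps_X ^ 1 * G + fps_const v = F + fps_const xi * G" by (simp add: F_def algebra_simps)
 obtain p C where p: "p > 0" "nrm_le 1 F p C" using nrm_bound[OF F[folded F_def], of 1] by auto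
 have "((fps_const xi) $ 0) $ 0 = 0" using xi(2) by simp
 then obtain d where d: "d > 0" "nrm_le 1 (fps_const xi) d (p / 2)"
  using nrm_small[OF xi(1), of "p / 2" 1] p(1) by auto
 define q where "q = min p d"
 have q: "q > 0" "q <= p" "q <= d" using p d by (auto simp: q_def)
 have small: "nrm 1 p q K (fps_const xi) <= p ^ 1 / 2" for K
  unfolding nrm_const_x[of 1 p q K xi 0] using nrm_leD[OF d(2), of 0 q K] d(1) q by simp
 have "conv2 G \<and> conv2 (fps_const v)"
  using contraction[OF p(1) q(1) zero_less_one eq _ _ small, of C] nrm_leD[OF p(2)] p q xi(2)
  by (auto simp: weight_ge_def)
 thus "conv2 G" "conv2 (fps_const v)" by auto
qed

section \<open>Weierstrass preparation\<close>

text \<open>The coefficient of \<open>y\<^sup>j\<close>, as a series in \<open>x\<close>.\<close>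

definition slice :: "nat => complex fps fps => complex fps" where
 "slice j F = Abs_fps (%i. F $ i $ j)"

lemma slice_nth [simp]: "(slice j F) $ i = F $ i $ j"
 by (simp add: slice_def)

lemma slice_mult: "slice j (F * G) = (\<Sum>k\<le>j. slice (j - k) F * slice k G)"
proof (rule fps_ext)
 fix i
 have "(slice j (F * G)) $ i = (\<Sum>a=0..i. \<Sum>b=0..j. F $ a $ b * (G $ (i - a)) $ (j - b))"
  by (simp add: fps_mult_nth fps_sum_nth)
 also have "\<dots> = (\<Sum>b=0..j. \<Sum>a=0..i. F $ a $ b * (G $ (i - a)) $ (j - b))"
  by (rule sum.swap)
 also have "\<dots> = (\<Sum>k\<le>j. \<Sum>a=0..i. F $ a $ (j - k) * (G $ (i - a)) $ k)"
  by (rule sum.reindex_bij_witness[of _ "%k. j - k" "%k. j - k"]) auto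
 finally show "(slice j (F * G)) $ i = (\<Sum>k\<le>j. slice (j - k) F * slice k G) $ i"
  by (simp add: fps_sum_nth fps_mult_nth)
qed

text \<open>The quotient for a series \<open>x\<^sup>d - N\<close>, where \<open>y\<close> divides \<open>N\<close>, is found by recursion on the power
 of \<open>y\<close>.\<close>

fun weierstrass_slices :: "complex fps fps => nat => nat => complex fps" where
 "weierstrass_slices N d j = (if j = 0 then 1 else 0) +
  fps_shift d (\<Sum>k<j. slice (j - k) N * weierstrass_slices N d k)"

declare weierstrass_slices.simps [simp del]

lemma weierstrass_monic_quotient:
 assumes "slice 0 N = 0"
 obtains Q r where "fps_X ^ d * Q + r = fps_X ^ d + N * Q" "!!i. i \<ge> d ==> r $ i = 0"
  "!!i. r $ i $ 0 = 0" "Q $ 0 $ 0 = 1"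
proof -
 define Q where "Q = Abs_fps (%i. Abs_fps (%j. (weierstrass_slices N d j) $ i))"
 have sQ: "slice j Q = weierstrass_slices N d j" for j
  by (rule fps_ext) (simp add: Q_def)
 have s: "slice j (N * Q) = (\<Sum>k<j. slice (j - k) N * weierstrass_slices N d k)" for j
  using assms by (simp add: slice_mult sQ lessThan_Suc_atMost[symmetric])
 have Q: "slice j Q = (if j = 0 then 1 else 0) + fps_shift d (slice j (N * Q))" for j
  unfolding sQ s by (rule weierstrass_slices.simps)
 have Qn: "Q $ i $ j = (if j = 0 \<and> i = 0 then 1 else 0) + ((N * Q) $ (i + d)) $ j" for i j
  using arg_cong[OF Q[of j], of "%F. F $ i"] by simp
 define r where "r = fps_X ^ d + N * Q - fps_X ^ d * Q"
 have N0: "((N * Q) $ i) $ 0 = 0" for i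
  using arg_cong[OF s[of 0], of "%F. F $ i"] by simp
 show ?thesis
 proof
  show "fps_X ^ d * Q + r = fps_X ^ d + N * Q" by (simp add: r_def)
  show "r $ i = 0" if "i \<ge> d" for i
  proof (rule fps_ext)
   fix j
   show "r $ i $ j = 0 $ j"
    using that Qn[of "i - d" j] by (auto simp: r_def fps_X_power_mult_nth)
  qed
  show "Q $ 0 $ 0 = 1" using Qn[of 0 0] N0 by simp
  show "r $ i $ 0 = 0" for i
   using Qn[of "i - d" 0] N0 by (auto simp: r_def fps_X_power_mult_nth)
 qed
qed

definition x_regular :: "nat => complex fps fps => bool" where
 "x_regular d F \<longleftrightarrow> (\<forall>i<d. F $ i $ 0 = 0) \<and> F $ d $ 0 ~= 0"

text \<open>The series \<open>F(x, 0)\<close> is \<open>x\<^sup>d\<close> times a unit, whose inverse, read as a series in \<open>x\<close> and \<open>y\<close>,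
 is the multiplier.\<close>

lemma regular_normalise:
 assumes "x_regular d F"
 obtains V where "slice 0 (F * V) = fps_X ^ d" "V $ 0 $ 0 ~= 0"
  "conv2 F ==> conv2 V"
proof -
 define v where "v = fps_shift d (slice 0 F)"
 have v0: "v $ 0 ~= 0" using assms by (simp add: v_def x_regular_def)
 have Fv: "slice 0 F = fps_X ^ d * v"
  by (rule fps_ext) (use assms in \<open>auto simp: v_def x_regular_def fps_X_power_mult_nth\<close>)
 define lift :: "complex fps => complex fps fps" where "lift = (%a. coeff_map fps_const a)"
 have rl: "ring_map lift"
  unfolding lift_def by (rule ring_map_coeff_map) (simp add: ring_map_def)
 have sl: "slice 0 (lift a) = a" for a by (rule fps_ext) (simp add: lift_def)
 have "lift v * lift (inverse v) = 1"
  using v0 by (simp only: ring_mapD(2)[OF rl, symmetric] inverse_mult_eq_1' ring_mapD(3)[OF rl] not_False_eq_True)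
 show ?thesis
 proof
  show "slice 0 (F * lift (inverse v)) = fps_X ^ d"
   using v0 by (simp add: slice_mult sl Fv mult.assoc inverse_mult_eq_1')
  show "fps_nth ((lift (inverse v)) $ 0) 0 ~= 0" using v0 by (simp add: lift_def)
  assume "conv2 F"
  then obtain C R where CR: "R > 0" "C \<ge> 0" "!!i j. norm (F $ i $ j) <= C * R ^ (i + j)"
   using convergent2_common_bound by metis
  have "norm (((lift v) $ i) $ j) <= (C * R ^ d) * R ^ (i + j)" for i j
   using CR(3)[of "i + d" 0] CR(1,2) by (cases j) (simp_all add: lift_def v_def power_add mult_ac)
  hence lv: "conv2 (lift v)" using CR(1) by (rule convergent2I[rotated])
  show "conv2 (lift (inverse v))"
  proof (rule convergent2_divide_unit[OF lv])
   show "((lift v) $ 0) $ 0 ~= 0" using v0 by (simp add: lift_def)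
   show "conv2 (lift v * lift (inverse v))"
    unfolding \<open>lift v * lift (inverse v) = 1\<close> by (rule convergent2_1)
  qed
 qed
qed

text \<open>After the normalisation by \<open>regular_normalise\<close> the series is \<open>x\<^sup>d - N\<close>, where \<open>N\<close> is divisible by
 \<open>y\<close>, and the formal solution is \<open>weierstrass_monic_quotient\<close>.  On polydiscs whose radius in
 \<open>y\<close> is small compared with the \<open>d\<close>-th power of the radius \<open>p\<close> in \<open>x\<close>, multiplication by \<open>N\<close>
 contracts by \<open>p\<^sup>d / 2\<close>, and \<open>N\<close> has weight at least \<open>d\<close> if \<open>y\<close> gets the weight \<open>d\<close>.\<close>

lemma weierstrass_preparation:
 assumes "x_regular d F"
 obtains Q r where "F * Q = fps_X ^ d - r" "!!i. i \<ge> d ==> r $ i = 0"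
  "!!i. r $ i $ 0 = 0" "Q $ 0 $ 0 ~= 0"
  "conv2 F ==> conv2 Q \<and> conv2 r"
proof -
 obtain V where V: "slice 0 (F * V) = fps_X ^ d" "V $ 0 $ 0 ~= 0"
  "conv2 F ==> conv2 V" using regular_normalise[OF assms] by blast
 define N where "N = fps_X ^ d - F * V"
 have sX: "slice 0 (fps_X ^ d) = fps_X ^ d" by (rule fps_ext) auto
 have N0: "slice 0 N = 0"
 proof (rule fps_ext)
  fix i show "(slice 0 N) $ i = 0 $ i"
   using arg_cong[OF V(1), of "%F. F $ i"] arg_cong[OF sX, of "%F. F $ i"]
   by (simp add: N_def)
 qed
 obtain Q r where Q: "fps_X ^ d * Q + r = fps_X ^ d + N * Q" "!!i. i \<ge> d ==> r $ i = 0"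
  "!!i. r $ i $ 0 = 0" "Q $ 0 $ 0 = 1"
  using weierstrass_monic_quotient[OF N0, of d] by metis
 show ?thesis
 proof
  have "F * (V * Q) = (fps_X ^ d - N) * Q" by (simp add: N_def mult.assoc)
  also have "\<dots> = fps_X ^ d - r" using Q(1) by (simp add: algebra_simps)
  finally show "F * (V * Q) = fps_X ^ d - r" .
  show "((V * Q) $ 0) $ 0 ~= 0" using V Q by simp
  show "r $ i = 0" if "i \<ge> d" for i using that by (rule Q)
  show "r $ i $ 0 = 0" for i by (rule Q)
  assume F: "conv2 F"
  show "conv2 (V * Q) \<and> conv2 r"
  proof (cases "d = 0")
   case True
   hence "F * (V * Q) = 1" using \<open>F * (V * Q) = fps_X ^ d - r\<close> Q(2) by (auto intro!: fps_ext)
   moreover have "r = 0" using True Q(2) by (intro fps_ext[of r]) auto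
   moreover have "F $ 0 $ 0 ~= 0" using assms True by (simp add: x_regular_def)
   ultimately show ?thesis using F convergent2_1 convergent2_0
    by (auto intro: convergent2_divide_unit[of F])
  next
   case False
   hence d: "d > 0" by simp
   have cN: "conv2 N" unfolding N_def
    using F V(3) by (intro convergent2_minus convergent2_times convergent2_power convergent2_X)
   define N' where "N' = Abs_fps (%i. fps_shift 1 (N $ i))"
   define Y :: "complex fps fps" where "Y = fps_const fps_X"
   have NY: "N = Y * N'"
   proof (rule fps_ext, rule fps_ext)
    fix i j
    have "N $ i $ 0 = 0" using arg_cong[OF N0, of "%F. F $ i"] by simp
    thus "N $ i $ j = ((Y * N') $ i) $ j"
     by (simp add: Y_def N'_def)
   qed
   have "conv2 N'"
   proof -
    obtain C R where CR: "R > 0" "C \<ge> 0" "!!i j. norm (N $ i $ j) <= C * R ^ (i + j)"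
     using convergent2_common_bound[OF cN cN] by metis
    show ?thesis
    proof (rule convergent2I[OF CR(1)])
     fix i j show "norm (N' $ i $ j) <= (C * R) * R ^ (i + j)"
      using CR(3)[of i "Suc j"] by (simp add: N'_def mult_ac)
    qed
   qed
   then obtain p1 C1 where p1: "p1 > 0" "nrm_le d N' p1 C1" using nrm_bound[OF _ d] by blast
   obtain p2 C2 where p2: "p2 > 0" "nrm_le d (fps_X ^ d) p2 C2"
    using nrm_bound[OF convergent2_power[OF convergent2_X] d] by blast
   define p where "p = min p1 p2"
   have p: "p > 0" "p <= p1" "p <= p2" using p1 p2 by (auto simp: p_def)
   have C1: "C1 \<ge> 0" using nrm_leD[OF p1(2), of p p 0] p nrm_nonneg[of p p d 0 N'] by linarith
   (* then q C1, which bounds the norm of N, is at most p^d / 2 *)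
   define q where "q = min p (p ^ d / (2 * (C1 + 1)))"
   have q: "q > 0" "q <= p" "q * C1 <= p ^ d / 2"
   proof -
    show "q > 0" "q <= p" using p C1 by (auto simp: q_def)
    have "q * C1 <= (p ^ d / (2 * (C1 + 1))) * (C1 + 1)"
     using C1 p by (intro mult_mono) (auto simp: q_def)
    also have "\<dots> = p ^ d / 2" using C1 by (simp add: field_simps)
    finally show "q * C1 <= p ^ d / 2" .
   qed
   have nY: "nrm d p q K Y <= q" for K
   proof -
    have "nrm d p q K Y <= (\<Sum>(i, j)\<in>{(0, 1)}. norm (Y $ i $ j) * p ^ i * q ^ j)"
    proof -
     have "nrm d p q K Y = (\<Sum>(i, j)\<in>idx d K \<inter> {(0, 1)}. norm (Y $ i $ j) * p ^ i * q ^ j)"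
      unfolding nrm_def
      by (rule sum.mono_neutral_right) (use finite_idx[OF d] in \<open>auto simp: Y_def fps_X_def split: if_splits\<close>)
     also have "\<dots> <= (\<Sum>(i, j)\<in>{(0, 1)}. norm (Y $ i $ j) * p ^ i * q ^ j)"
      by (rule sum_mono2) (use p q in auto)
     finally show ?thesis .
    qed
    thus ?thesis by (simp add: Y_def)
   qed
   have nN: "nrm d p q K N <= p ^ d / 2" for K
   proof -
    have "nrm d p q K N <= nrm d p q K Y * nrm d p q K N'"
     unfolding NY by (rule nrm_mult0) (use p q d in auto)
    also have "\<dots> <= q * C1" using nY nrm_leD[OF p1(2)] p q nrm_nonneg by (intro mult_mono) auto
    finally show ?thesis using q(3) by linarith
   qed
   have w: "weight_ge d d N"
    unfolding weight_ge_def
   proof (intro allI impI)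
    fix i j assume "i + d * j < d"
    hence "j = 0" by (cases j) auto
    thus "N $ i $ j = 0" using arg_cong[OF N0, of "%F. F $ i"] by simp
   qed
   have "nrm d p q K (fps_X ^ d) <= C2" for K using nrm_leD[OF p2(2)] p q by simp
   from contraction[OF p(1) q(1) d Q(1,2) w nN this] show ?thesis using convergent2_times[OF V(3)[OF F]] by blast
  qed
 qed
qed

section \<open>Ramification\<close>

text \<open>Replacing \<open>y\<close> by \<open>t\<^sup>n\<close> turns fractional power series into power series in \<open>t\<close>.\<close>

definition ramify_series :: "nat => complex fps => complex fps" where
 "ramify_series n a = Abs_fps (%k. if n dvd k then a $ (k div n) else 0)"

lemma puiseux_of_ramify_series:
 assumes "n > 0" shows "of_fps (ramify_series n a) = ysub n (of_fps a)"
proof (rule puiseux_eqI)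
 fix r
 show "pcoeff (of_fps (ramify_series n a)) r = pcoeff (ysub n (of_fps a)) r"
 proof (cases "r / of_nat n \<in> \<nat>")
  case True
  then obtain k where k: "r / of_nat n = of_nat k" by (elim Nats_cases)
  hence "r = of_nat (k * n)" using assms by (simp add: field_simps)
  thus ?thesis using assms k
   by (simp add: ysub.rep_eq pcoeff_puiseux_of_fps ramify_series_def del: of_nat_mult)
 next
  case False
  have "pcoeff (of_fps (ramify_series n a)) r = 0"
  proof (cases "r \<in> \<nat>")
   case True
   then obtain k where k: "r = of_nat k" by (elim Nats_cases)
   have "\<not> n dvd k" using False assms k by (auto simp: dvd_def)
   thus ?thesis by (simp add: k pcoeff_puiseux_of_fps ramify_series_def)
  qed (simp add: pcoeff_puiseux_of_fps_not)
  thus ?thesis using assms False by (simp add: ysub.rep_eq pcoeff_puiseux_of_fps_not)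
 qed
qed

lemma convergent2_ramify:
 assumes "conv2 F" "n > 0" shows "conv2 (coeff_map (ramify_series n) F)"
proof -
 obtain C R where CR: "R > 0" "C \<ge> 0" "!!i j. norm (F $ i $ j) <= C * R ^ (i + j)"
  using convergent2_common_bound[OF assms(1,1)] by metis
 have "norm (fps_nth ((coeff_map (ramify_series n) F) $ i) j) <= C * (max 1 R) ^ (i + j)" for i j
 proof -
  have "norm (fps_nth ((coeff_map (ramify_series n) F) $ i) j) <= C * R ^ (i + j div n)"
   using CR by (auto simp: ramify_series_def)
  also have "\<dots> <= C * (max 1 R) ^ (i + j div n)" using CR by (intro mult_left_mono power_mono) auto
  also have "\<dots> <= C * (max 1 R) ^ (i + j)" using CR by (intro mult_left_mono power_increasing) auto
  finally show ?thesis .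
 qed
 thus ?thesis by (intro convergent2I[of "max 1 R"]) auto
qed

definition ramify :: "nat => germ => germ" where
 "ramify n F = Abs_germ (coeff_map (ramify_series n) (series F))"

lemma series_ramify: "n > 0 ==> series (ramify n F) = coeff_map (ramify_series n) (series F)"
 unfolding ramify_def using convergent2_ramify[OF series[of F, simplified]]
 by (simp add: Abs_germ_inverse)

lemma germ_embed_ramify: "n > 0 ==> emb (ramify n F) = coeff_map (ysub n) (emb F)"
 by (rule fps_ext) (simp add: germ_embed_alt series_ramify puiseux_of_ramify_series)

lemma range_germ_embed: "F \<in> range emb \<longleftrightarrow> (\<exists>S. conv2 S \<and> F = coeff_map of_fps S)"
proof
 assume "\<exists>S. conv2 S \<and> F = coeff_map of_fps S"
 then obtain S where S: "conv2 S" "F = coeff_map of_fps S" by blast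
 hence "F = emb (Abs_germ S)" by (simp add: germ_embed_alt Abs_germ_inverse)
 thus "F \<in> range emb" by blast
qed (use series in \<open>auto simp: germ_embed_alt\<close>)

text \<open>Convergence of a series in \<open>x\<close> whose coefficients are fractional power series with a common
 denominator: it becomes a germ after the substitution \<open>y \<mapsto> y\<^sup>n\<close>.\<close>

definition conv :: "puiseux fps => bool" where
 "conv F \<longleftrightarrow> (\<exists>n>0. coeff_map (ysub n) F \<in> range emb)"

lemma ysub_ysub: "n > 0 ==> m > 0 ==> ysub m (ysub n a) = ysub (n * m) a"
 by (rule puiseux_eqI) (simp add: ysub.rep_eq field_simps)

lemma conv_multiple:
 assumes "n > 0" "m > 0" "coeff_map (ysub n) F \<in> range emb"
 shows "coeff_map (ysub (n * m)) F \<in> range emb"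
proof -
 obtain G where "coeff_map (ysub n) F = emb G" using assms(3) by blast
 hence "coeff_map (ysub m) (coeff_map (ysub n) F) = emb (ramify m G)"
  by (simp add: germ_embed_ramify assms)
 moreover have "coeff_map (ysub m) (coeff_map (ysub n) F) = coeff_map (ysub (n * m)) F"
  by (rule fps_ext) (simp add: ysub_ysub assms)
 ultimately show ?thesis by (metis rangeI)
qed

lemma conv_closed:
 assumes "conv F" "conv G" shows "conv (F + G)" "conv (F - G)" "conv (F * G)"
proof -
 obtain n m where nm: "n > 0" "coeff_map (ysub n) F \<in> range emb"
  "m > 0" "coeff_map (ysub m) G \<in> range emb" using assms by (auto simp: conv_def)
 have "coeff_map (ysub (n * m)) F \<in> range emb" "coeff_map (ysub (n * m)) G \<in> range emb"
  using conv_multiple[of n m F] conv_multiple[of m n G] nm by (auto simp: mult.commute)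
 then obtain A B where AB: "coeff_map (ysub (n * m)) F = emb A" "coeff_map (ysub (n * m)) G = emb B"
  by blast
 have p: "n * m > 0" using nm by simp
 note r = ring_mapD[OF ring_map_coeff_map[OF ring_map_ysub[OF p]]] and e = ring_mapD[OF ring_map_germ_embed]
 have "coeff_map (ysub (n * m)) (F + G) = emb (A + B)" "coeff_map (ysub (n * m)) (F - G) = emb (A - B)"
  "coeff_map (ysub (n * m)) (F * G) = emb (A * B)" using AB by (simp_all add: r(1,2,6) e(1,2,6))
 thus "conv (F + G)" "conv (F - G)" "conv (F * G)" unfolding conv_def using p by (metis rangeI)+
qed

lemma ysub_1: "ysub 1 a = a" by (rule puiseux_eqI) (simp add: ysub.rep_eq)

lemma conv_range: assumes "F \<in> range emb" shows "conv F"
proof -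
 have "coeff_map (ysub 1) F = F" by (rule fps_ext) (simp add: ysub_1[unfolded One_nat_def])
 thus ?thesis using assms unfolding conv_def by (metis zero_less_one)
qed

lemma conv_1: "conv 1" and conv_0: "conv 0" and conv_X: "conv fps_X"
proof -
 note e = ring_mapD[OF ring_map_germ_embed]
 show "conv 1" "conv 0" by (rule conv_range, metis e(3,4) rangeI)+
 have "coeff_map of_fps fps_X = fps_X" by (rule fps_ext) (simp add: fps_X_def ring_mapD[OF ring_map_puiseux_of_fps])
 thus "conv fps_X" using range_germ_embed convergent2_X by (metis conv_range)
qed

lemma conv_prod: "(!!x. x \<in> A ==> conv (F x)) ==> conv (prod F A)"
 by (induction A rule: infinite_finite_induct) (auto intro: conv_closed conv_1)

lemma conv_power: "conv F ==> conv (F ^ n)"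
 by (induction n) (auto intro: conv_closed conv_1)

lemma surj_ysub: assumes "n > 0" shows "\<exists>a. ysub n a = b"
proof -
 obtain m where m: "has_denom m (pcoeff b)" using denom_puiseux by blast
 have "has_denom (m * n) (%r. pcoeff b (r * of_nat n))"
  unfolding has_denom_def
 proof (intro conjI allI impI)
  show "m * n > 0" using m assms by (simp add: has_denom_def)
  fix r assume "pcoeff b (r * of_nat n) ~= 0"
  then obtain k :: nat where "r * of_nat n = of_nat k / of_nat m" using m by (auto simp: has_denom_def)
  moreover have "m > 0" using m by (simp add: has_denom_def)
  ultimately have "r = of_nat k / of_nat (m * n)" using assms by (simp add: field_simps)
  thus "\<exists>k::nat. r = of_nat k / of_nat (m * n)" by blast
 qed
 hence p: "pcoeff (Abs_puiseux (%r. pcoeff b (r * of_nat n))) = (%r. pcoeff b (r * of_nat n))"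
  by (intro Abs_puiseux_inverse) auto
 have "ysub n (Abs_puiseux (%r. pcoeff b (r * of_nat n))) = b"
  by (rule puiseux_eqI) (use assms in \<open>simp add: ysub.rep_eq p\<close>)
 thus ?thesis by blast
qed

lemma ysub_denom: "has_denom n (pcoeff a) ==> ysub n a = of_fps (root_fps n a)"
proof (rule puiseux_eqI)
 fix r assume n: "has_denom n (pcoeff a)"
 hence n0: "n > 0" by (simp add: has_denom_def)
 show "pcoeff (ysub n a) r = pcoeff (of_fps (root_fps n a)) r"
 proof (cases "r \<in> \<nat>")
  case True
  then obtain k where r: "r = of_nat k" by (elim Nats_cases)
  show ?thesis unfolding r pcoeff_puiseux_of_fps using n0 by (simp add: ysub.rep_eq root_fps_def)
 next
  case False
  have "pcoeff a (r / of_nat n) = 0"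
  proof (rule ccontr)
   assume "pcoeff a (r / of_nat n) ~= 0"
   then obtain k :: nat where "r / of_nat n = of_nat k / of_nat n" using n by (auto simp: has_denom_def)
   hence "r = of_nat k" using n0 by simp
   with False show False by simp
  qed
  thus ?thesis using False n0 by (simp add: ysub.rep_eq pcoeff_puiseux_of_fps_not)
 qed
qed

lemma convergent2_coeff: assumes "conv2 F" shows "conv2 (fps_const (F $ k))"
proof -
 obtain C R where CR: "R > 0" "C \<ge> 0" "!!i j. norm (F $ i $ j) <= C * R ^ (i + j)"
  using convergent2_common_bound[OF assms assms] by metis
 show ?thesis
 proof (rule convergent2I[OF CR(1)])
  fix i j show "norm (fps_nth ((fps_const (F $ k)) $ i) j) <= (C * R ^ k) * R ^ (i + j)"
   using CR(1,2) CR(3)[of k j] by (auto simp: power_add mult_ac)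
 qed
qed

abbreviation conv_series :: "complex fps => bool" where
 "conv_series a \<equiv> conv2 (fps_const a)"

abbreviation conv_arc :: "puiseux => bool" where "conv_arc a \<equiv> conv (fps_const a)"

lemma conv_series_shift: assumes "conv_series a" shows "conv_series (fps_shift n a)"
proof -
 obtain C R where CR: "R > 0" "C \<ge> 0" "!!i j. norm (((fps_const a) $ i) $ j) <= C * R ^ (i + j)"
  using convergent2_common_bound[OF assms assms] by metis
 show ?thesis
 proof (rule convergent2I[OF CR(1)])
  fix i j
  show "norm (fps_nth ((fps_const (fps_shift n a)) $ i) j) <= (C * R ^ n) * R ^ (i + j)"
   using CR(1,2) CR(3)[of 0 "j + n"] by (auto simp: power_add mult_ac)
 qed
qed

lemma conv_arcI: assumes "n > 0" "ysub n a = of_fps A" "conv_series A" shows "conv_arc a"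
proof -
 have "coeff_map (ysub n) (fps_const a) = coeff_map of_fps (fps_const A)"
  using assms coeff_map_const ring_map_ysub ring_map_puiseux_of_fps by metis
 thus ?thesis unfolding conv_def range_germ_embed using assms by blast
qed

lemma conv_arc_closed:
 assumes "conv_arc a" "conv_arc b" shows "conv_arc (a + b)" "conv_arc (a - b)" "conv_arc (a * b)"
 using conv_closed[OF assms] by simp_all

lemma conv_arc_1: "conv_arc 1" using conv_1 by simp

lemma conv_arc_of_nat: "conv_arc (of_nat n)"
 by (induction n) (auto intro: conv_arc_closed conv_0 conv_arc_1 simp del: fps_const_add)

lemma conv_arc_ymonom: assumes "e \<ge> 0" shows "conv_arc (ymonom e c)"
proof -
 obtain n where n: "has_denom n (pcoeff (ymonom e 1))" using denom_puiseux by blast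
 then obtain l :: nat where l: "e = of_nat l / of_nat n" using assms by (metis has_denom_def pcoeff_ymonom zero_neq_one)
 have n0: "n > 0" using n by (simp add: has_denom_def)
 have "of_fps (fps_const c * fps_X ^ l) = ysub n (ymonom e c)"
 proof (rule puiseux_eqI)
  fix r show "pcoeff (of_fps (fps_const c * fps_X ^ l)) r = pcoeff (ysub n (ymonom e c)) r"
  proof (cases "r \<in> \<nat>")
   case True
   then obtain k where "r = of_nat k" by (elim Nats_cases)
   hence "r / of_nat n = e \<longleftrightarrow> k = l" using n0 l by (simp add: field_simps)
   thus ?thesis using n0 assms \<open>r = of_nat k\<close> pcoeff_puiseux_of_fps[of _ k]
    by (simp add: ysub.rep_eq pcoeff_ymonom fps_X_power_nth)
  next
   case False
   hence "r / of_nat n ~= e" using n0 l by auto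
   thus ?thesis using False n0 assms by (simp add: pcoeff_puiseux_of_fps_not ysub.rep_eq pcoeff_ymonom)
  qed
 qed
 moreover have "conv_series (fps_const c * fps_X ^ l)"
  by (rule convergent2I[where R = 1 and C = "norm c"]) (auto simp: fps_X_power_nth)
 ultimately show ?thesis using conv_arcI[OF n0] by metis
qed

text \<open>After a ramification the division by a monomial is a shift of the coefficients.\<close>

lemma conv_arc_divide:
 assumes e: "e \<ge> 0" and "conv_arc (ymonom e 1 * b)" shows "conv_arc b"
proof -
 let ?a = "ymonom e 1 * b"
 obtain n0 where n0: "n0 > 0" "coeff_map (ysub n0) (fps_const ?a) \<in> range emb" using assms(2) by (auto simp: conv_def)
 obtain m where m: "has_denom m (pcoeff b)" "has_denom m (pcoeff (ymonom e 1))" using denom_two by blast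
 then obtain l :: nat where l: "e = of_nat l / of_nat m" using e by (metis has_denom_def pcoeff_ymonom zero_neq_one)
 have m0: "m > 0" using m by (simp add: has_denom_def)
 define n where "n = n0 * m"
 have n: "n > 0" "has_denom n (pcoeff b)" using n0 m0 has_denom_mult[OF m(1) n0(1)] by (auto simp: n_def mult.commute)
 obtain S where S: "conv2 S" "coeff_map (ysub n) (fps_const ?a) = coeff_map of_fps S"
  using conv_multiple[OF n0(1) m0 n0(2)] unfolding range_germ_embed n_def by blast
 have A: "ysub n ?a = of_fps (S $ 0)" using arg_cong[OF S(2), of "%F. F $ 0"] by simp
 have "root_fps n b = fps_shift (n0 * l) (S $ 0)"
 proof (rule fps_ext)
  fix i
  have "S $ 0 $ (i + n0 * l) = pcoeff (ysub n ?a) (of_nat (i + n0 * l))"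
   unfolding A pcoeff_puiseux_of_fps ..
  also have "\<dots> = pcoeff b (of_nat (i + n0 * l) / of_nat n - e)"
   using n(1) e by (simp add: ysub.rep_eq pcoeff_ymonom_times)
  also have "of_nat (i + n0 * l) / of_nat n - e = of_nat i / of_nat n"
   using n0(1) m0 by (simp add: l n_def field_simps)
  finally show "(root_fps n b) $ i = (fps_shift (n0 * l) (S $ 0)) $ i" by (simp add: root_fps_def)
 qed
 moreover have "conv_series (S $ 0)" by (rule convergent2_coeff[OF S(1)])
 ultimately show ?thesis using conv_arcI[OF n(1) ysub_denom[OF n(2)]] conv_series_shift by metis
qed


section \<open>The Newton--Puiseux theorem\<close>

lemma has_value_poly:
 fixes P :: "puiseux poly"
 shows "has_value (fps_of_poly P) xi (poly P xi)"
proof (induction P)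
 case 0
 thus ?case by (simp add: has_value_def)
next
 case (pCons a P)
 have "has_value fps_X xi xi" by (simp add: has_value_def)
 with pCons show ?case
  using has_value_add[OF has_value_const[of a xi] has_value_mult[OF \<open>has_value fps_X xi xi\<close> pCons(2)]]
  by (simp add: fps_of_poly_pCons algebra_simps)
qed

lemma pcoeff0_mult: "pcoeff (a * b) 0 = pcoeff a 0 * pcoeff b 0"
proof -
 have "lead_term 0 (pcoeff c 0) c" for c by (simp add: lead_term_def pcoeff_neg)
 from lead_term_pcoeff[OF lead_term_mult[OF this this, of a b]] show ?thesis by simp
qed

lemma ring_map_pcoeff0: "ring_map (%a. pcoeff a 0)"
 by (simp add: ring_map_def pcoeff0_mult pcoeff_one)

lemma pos_arc_iff: "pos_arc a \<longleftrightarrow> pcoeff a 0 = 0"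
 by (simp add: yord_gt_iff lead_term_def pcoeff_neg)

lemma has_value_at_0:
 assumes "pos_arc xi" "has_value F xi w" shows "pcoeff w 0 = pcoeff (F $ 0) 0"
proof -
 obtain G where "F - fps_const w = lin xi * G" using assms(2) by (auto simp: has_value_def)
 from arg_cong[OF this, of "%F. pcoeff (F $ 0) 0"] assms(1) show ?thesis
  by (simp add: left_diff_distrib pos_arc_iff pcoeff0_mult)
qed

text \<open>For \<open>d = 1\<close>, Weierstrass preparation writes the series as a unit times \<open>x - r(y)\<close>, and \<open>r\<close>
 is the root.\<close>

lemma hensel_root:
 fixes P :: "puiseux poly"
 assumes "pcoeff (coeff P 0) 0 = 0" "pcoeff (coeff P 1) 0 ~= 0" "!!i. conv_arc (coeff P i)"
 obtains xi where "pos_arc xi" "poly P xi = 0" "conv_arc xi"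
proof -
 have "conv (fps_of_poly P)" using assms(3)
 proof (induction P)
  case (pCons a P)
  have "conv_arc a" "conv_arc (coeff P i)" for i using pCons.prems[of 0] pCons.prems[of "Suc i"] by simp_all
  thus ?case unfolding fps_of_poly_pCons by (intro conv_closed conv_X pCons.IH)
 qed (simp add: conv_0)
 then obtain n F where n: "n > 0" and cF: "conv2 F"
  and F: "coeff_map (ysub n) (fps_of_poly P) = coeff_map of_fps F" unfolding conv_def range_germ_embed by blast
 have "F $ i $ 0 = pcoeff (coeff P i) 0" for i
  using arg_cong[OF F, of "%F. pcoeff (F $ i) 0"] pcoeff_puiseux_of_fps[of _ 0] n by (simp add: ysub.rep_eq)
 hence "x_regular 1 F" using assms by (simp add: x_regular_def)
 then obtain Q r where Q: "F * Q = fps_X ^ 1 - r" "!!i. i \<ge> 1 ==> r $ i = 0"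
  "!!i. r $ i $ 0 = 0" "Q $ 0 $ 0 ~= 0" "conv2 r"
  using weierstrass_preparation[of 1 F] cF by metis
 have r: "r = fps_const (r $ 0)" by (rule fps_ext) (use Q(2) in auto)
 let ?e = "coeff_map of_fps"
 note re = ring_mapD[OF ring_map_coeff_map[OF ring_map_puiseux_of_fps]]
 obtain xi where xi: "ysub n xi = of_fps (r $ 0)" using surj_ysub[OF n] by blast
 have pe: "pos_arc (ysub n xi)"
  using Q(3)[of 0] pcoeff_puiseux_of_fps[of "r $ 0" 0] by (simp add: pos_arc_iff xi)
 have "?e F * ?e Q = lin (ysub n xi)"
  unfolding re(2)[symmetric] Q(1) xi using coeff_map_linear[OF ring_map_puiseux_of_fps, of "r $ 0"]
  by (subst r) simp
 hence "has_value (?e F * ?e Q) (ysub n xi) 0" by (simp add: has_value_zero_iff)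
 moreover have "tame (?e Q)" using denom_puiseux_of_fps by (auto simp: tame_def)
 hence vQ: "has_value (?e Q) (ysub n xi) (peval (?e Q) (ysub n xi))" by (rule has_value_peval[OF _ pe])
 have vF: "has_value (?e F) (ysub n xi) (ysub n (poly P xi))"
  unfolding F[symmetric] by (rule has_value_map[OF ring_map_ysub[OF n] has_value_poly])
 ultimately have "ysub n (poly P xi) * peval (?e Q) (ysub n xi) = 0"
  using has_value_unique[OF pe has_value_mult[OF vF vQ]] by blast
 moreover have "peval (?e Q) (ysub n xi) ~= 0"
  using has_value_at_0[OF pe vQ] Q(4) pcoeff_puiseux_of_fps[of "Q $ 0" 0] by auto
 ultimately have "ysub n (poly P xi) = ysub n 0" using ring_mapD(4)[OF ring_map_ysub[OF n]] by simp
 hence "poly P xi = 0" using ysub_inject n by blast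
 moreover have "pos_arc xi" using pe n by (simp add: pos_arc_iff ysub.rep_eq)
 moreover have "conv_arc xi" using conv_arcI[OF n xi] Q(5) r by metis
 ultimately show ?thesis using that by blast
qed

lemma conv_coeff_pcompose:
 assumes "!!i. conv_arc (coeff P i)" "conv_arc s" shows "conv_arc (coeff (pcompose P [:s, 1:]) i)"
proof -
 have "coeff (pcompose P [:s, 1:]) i \<in> {c. conv_arc c}"
  by (rule coeff_pcompose_semiring_closed)
   (use assms in \<open>auto simp: coeff_pCons conv_0 conv_1 intro: conv_arc_closed split: nat.splits simp del: fps_const_add fps_const_mult\<close>)
 thus ?thesis by simp
qed

lemma ymonom_divides:
 assumes "e \<ge> 0" "Fin e <= yord a" obtains b where "a = ymonom e 1 * b"
proof -
 obtain n where n: "has_denom n (pcoeff a)" "has_denom n (pcoeff (ymonom e 1))" using denom_two by blast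
 hence n0: "n > 0" by (simp add: has_denom_def)
 obtain l :: nat where l: "e = of_nat l / of_nat n" using n(2) assms(1)
  by (metis has_denom_def pcoeff_ymonom zero_neq_one)
 have "has_denom n (%r. pcoeff a (r + e))"
  unfolding has_denom_def
 proof (intro conjI allI impI n0)
  fix r assume r: "pcoeff a (r + e) ~= 0"
  then obtain k :: nat where k: "r + e = of_nat k / of_nat n" using n by (auto simp: has_denom_def)
  have "\<not> r + e < e" using r assms(2) by (auto simp: yord_ge_iff)
  hence "of_nat l / of_nat n <= (of_nat k / of_nat n :: rat)" using k l by simp
  hence "l <= k" using n0 by (simp add: divide_le_cancel)
  hence "r = of_nat (k - l) / of_nat n" using k l by (simp add: of_nat_diff diff_divide_distrib)
  thus "\<exists>k::nat. r = of_nat k / of_nat n" by blast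
 qed
 hence p: "pcoeff (Abs_puiseux (%r. pcoeff a (r + e))) = (%r. pcoeff a (r + e))"
  by (intro Abs_puiseux_inverse) auto
 have "a = ymonom e 1 * Abs_puiseux (%r. pcoeff a (r + e))"
  by (rule puiseux_eqI) (simp add: pcoeff_ymonom_times assms(1) p)
 thus ?thesis using that by blast
qed

lemma ymonom_power: "h \<ge> 0 ==> ymonom h 1 ^ k = ymonom (of_nat k * h) 1"
proof (induction k)
 case 0
 thus ?case by (intro puiseux_eqI) (auto simp: pcoeff_one pcoeff_ymonom)
next
 case (Suc k)
 thus ?case
  by (intro puiseux_eqI) (auto simp: pcoeff_ymonom_times pcoeff_ymonom algebra_simps)
qed

lemma ymonom_add: "h \<ge> 0 ==> k \<ge> 0 ==> ymonom h 1 * ymonom k 1 = ymonom (h + k) 1"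
 by (intro puiseux_eqI) (auto simp: pcoeff_ymonom_times pcoeff_ymonom)

lemma ymonom_neq_0: "h \<ge> 0 ==> ymonom h 1 ~= 0"
 using pcoeff_ymonom[of h 1 h] by auto

definition reduction :: "puiseux poly => complex poly" where
 "reduction P = map_poly (%a. pcoeff a 0) P"

lemma coeff_reduction [simp]: "coeff (reduction P) i = pcoeff (coeff P i) 0"
 by (simp add: reduction_def coeff_map_poly)

lemma reduction_pcompose: "reduction (pcompose P Q) = pcompose (reduction P) (reduction Q)"
proof -
 have m: "reduction (A * B) = reduction A * reduction B" for A B
  by (rule poly_eqI) (simp add: coeff_mult pcoeff_sum pcoeff0_mult)
 have a: "reduction (A + B) = reduction A + reduction B" for A B by (rule poly_eqI) simp
 have c: "reduction [:a:] = [:pcoeff a 0:]" for a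
  by (rule poly_eqI) (simp add: coeff_pCons split: nat.splits)
 have p: "reduction (pCons b P) = pCons (pcoeff b 0) (reduction P)" for b P
  by (rule poly_eqI) (simp add: coeff_pCons split: nat.splits)
 have z: "reduction 0 = 0" by (rule poly_eqI) simp
 show ?thesis
 proof (induction P)
  case (pCons b P)
  thus ?case by (simp add: pcompose_pCons a m c p z)
 qed (simp add: z)
qed

text \<open>If a root \<open>c\<close> had the multiplicity \<open>d\<close>, the polynomial would be a constant times \<open>(x -
 c)\<^sup>d\<close>; its coefficient of degree \<open>d - 1\<close> is zero only for \<open>c = 0\<close>, and then the coefficient of
 degree \<open>i\<close> is zero as well.\<close>

lemma complex_poly_small_root:
 fixes h :: "complex poly"
 assumes "degree h = d" "coeff h (d - 1) = 0" "i < d" "coeff h i ~= 0"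
 obtains c where "poly h c = 0" "order c h < d" "order c h > 0" "h ~= 0"
proof -
 have h0: "h ~= 0" using assms by auto
 have "\<not> (\<exists>a l. a ~= 0 \<and> l = 0 \<and> h = pCons a l)" using assms(1,3) by auto
 then obtain c where c: "poly h c = 0" using fundamental_theorem_of_algebra_alt by blast
 hence pos: "order c h > 0" using h0 by (simp add: order_gt_0_iff)
 have "order c h < d"
 proof (rule ccontr)
  assume "\<not> order c h < d"
  hence "[:-c, 1:] ^ d dvd h" by (simp add: order_divides)
  then obtain q where q: "h = [:-c, 1:] ^ d * q" by (auto simp: dvd_def)
  hence "q ~= 0" using h0 by auto
  hence "degree h = d + degree q" unfolding q by (subst degree_mult_eq) (auto simp: degree_power_eq)
  then obtain b where b: "q = [:b:]" using assms(1) degree_eq_zeroE[of q] by auto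
  hence hb: "h = smult b ([:-c, 1:] ^ d)" using q by simp
  have "coeff h (d - 1) = b * (of_nat (d choose (d - 1)) * 1 * (- c) ^ (d - (d - 1)))"
   unfolding hb coeff_smult by (subst coeff_linear_poly_power) auto
  moreover have "b ~= 0" using b \<open>q ~= 0\<close> by auto
  moreover have "d choose (d - 1) > 0" by (rule zero_less_binomial) simp
  ultimately have "c = 0" using assms(2,3) by auto
  hence "h = smult b (monom 1 d)" using hb by (simp add: monom_altdef)
  hence "coeff h i = 0" using assms(3) by simp
  with assms(4) show False by simp
 qed
 with c pos h0 show ?thesis using that by blast
qed

lemma pderiv_shift:
 fixes P :: "puiseux poly"
 shows "(pderiv ^^ k) (pcompose P [:s, 1:]) = pcompose ((pderiv ^^ k) P) [:s, 1:]"
 by (induction k) (auto simp: pderiv_pcompose pderiv_pCons)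

lemma of_nat_puiseux_neq_0: "n > 0 ==> (of_nat n :: puiseux) ~= 0"
proof
 assume "n > 0" "(of_nat n :: puiseux) = 0"
 hence "pcoeff (of_nat n) 0 = 0" by simp
 thus False using \<open>n > 0\<close> ring_mapD(10)[OF ring_map_pcoeff0, of n] by simp
qed

text \<open>The induction step: a translation removes the term of degree \<open>d - 1\<close>, so that after the
 rescaling given by the Newton polygon the reduction is not a \<open>d\<close>-th power and the multiplicity
 drops.  The translation is by a root of the \<open>(d - 1)\<close>-th derivative, for which this root is
 simple.  Convergence is inherited by each of these finitely many steps.\<close>

theorem newton_puiseux_root:
 fixes P :: "puiseux poly"
 assumes "d > 0" "!!i. i < d ==> pcoeff (coeff P i) 0 = 0" "pcoeff (coeff P d) 0 ~= 0"
  "!!i. conv_arc (coeff P i)"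
 obtains xi where "pos_arc xi" "poly P xi = 0" "conv_arc xi"
proof -
 have "\<exists>xi. pos_arc xi \<and> poly P xi = 0 \<and> conv_arc xi" using assms
 proof (induction d arbitrary: P rule: less_induct)
  case (less d P)
  define R where "R = (pderiv ^^ (d - 1)) P"
  have R: "coeff R k = of_nat (pochhammer (Suc k) (d - 1)) * coeff P (k + (d - 1))" for k
   unfolding R_def coeff_higher_pderiv by (metis of_nat_Suc pochhammer_of_nat of_nat_eq_iff)
  have poch: "pochhammer (Suc k) (d - 1) > 0" for k by (rule pochhammer_pos) simp
  have d: "1 + (d - 1) = d" using less.prems(1) by simp
  note p0 = ring_mapD[OF ring_map_pcoeff0]
  have R01: "pcoeff (coeff R 0) 0 = 0" "pcoeff (coeff R 1) 0 ~= 0"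
   using less.prems poch[of 0] poch[of 1] by (simp_all add: R d p0(2,10) del: One_nat_def)
  have "conv_arc (coeff R k)" for k unfolding R by (intro conv_arc_closed conv_arc_of_nat less.prems)
  then obtain s where s: "pos_arc s" "poly R s = 0" "conv_arc s" using hensel_root[OF R01] by blast
  define G where "G = pcompose P [:s, 1:]"
  have redG: "reduction G = reduction P"
  proof -
   have "reduction [:s, 1:] = [:0, 1:]"
    using s(1) by (intro poly_eqI) (auto simp: coeff_pCons pos_arc_iff pcoeff_one split: nat.splits)
   thus ?thesis by (simp add: G_def reduction_pcompose)
  qed
  have G: "pcoeff (coeff G i) 0 = pcoeff (coeff P i) 0" for i
   using arg_cong[OF redG, of "%p. coeff p i"] by simp
  have Gd1: "coeff G (d - 1) = 0"
  proof -
   have "coeff ((pderiv ^^ (d - 1)) G) 0 = poly R s"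
    unfolding G_def pderiv_shift R_def[symmetric] by simp
   hence "of_nat (pochhammer (Suc 0) (d - 1)) * coeff G (d - 1) = 0"
    using s(2) by (simp add: coeff_higher_pderiv flip: pochhammer_of_nat)
   thus ?thesis using of_nat_puiseux_neq_0[OF poch[of 0]] by simp
  qed
  have PG: "poly P (s + z) = poly G z" for z by (simp add: G_def poly_pcompose)
  show ?case
  proof (cases "coeff G 0 = 0")
   case True
   hence "poly P s = 0" using PG[of 0] by (simp add: poly_0_coeff_0)
   thus ?thesis using s by blast
  next
   case False
   define I where "I = {i. i < d \<and> coeff G i ~= 0}"
   define v where "v = (%i. SOME r. yord (coeff G i) = Fin r)"
   have v: "yord (coeff G i) = Fin (v i)" if "coeff G i ~= 0" for i
   proof -
    have "\<exists>r. yord (coeff G i) = Fin r" using that by (cases "coeff G i" rule: yord_cases) auto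
    thus ?thesis unfolding v_def by (rule someI_ex)
   qed
   have vpos: "v i > 0" if "i \<in> I" for i
   proof -
    have "pos_arc (coeff G i)" using that less.prems(2)[of i] G by (simp add: pos_arc_iff I_def)
    thus ?thesis using v[of i] that by (simp add: I_def)
   qed
   have I: "finite I" "I ~= {}" using False less.prems(1) by (auto simp: I_def)
   (* the slope of the Newton polygon next to the vertex of degree d *)
   define r where "r = Min ((%i. v i / of_nat (d - i)) ` I)"
   have "r \<in> (%i. v i / of_nat (d - i)) ` I" unfolding r_def using I by (intro Min_in) auto
   then obtain i0 where i0: "i0 \<in> I" "r = v i0 / of_nat (d - i0)" by auto
   have rpos: "r > 0" using i0 vpos[OF i0(1)] by (auto simp: I_def)
   have rle: "of_nat (d - i) * r <= v i" if "i \<in> I" for i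
   proof -
    have "r <= v i / of_nat (d - i)" unfolding r_def using I that by (intro Min_le) auto
    thus ?thesis using that by (auto simp: I_def field_simps)
   qed
   have low: "Fin (of_nat (d - i) * r) <= yord (coeff G i)" for i
   proof (cases "i \<in> I")
    case True
    thus ?thesis using rle[of i] v[of i] by (simp add: I_def)
   next
    case False
    hence "coeff G i = 0 \<or> d - i = 0" by (auto simp: I_def)
    thus ?thesis using yord_nonneg by auto
   qed
   have "\<exists>b. coeff G i = ymonom (of_nat (d - i) * r) 1 * b" for i
    using ymonom_divides[OF _ low[of i]] rpos by (metis less_eq_rat_def of_nat_0_le_iff split_mult_pos_le)
   then obtain b where b: "!!i. coeff G i = ymonom (of_nat (d - i) * r) 1 * b i" by metis
   have cG: "conv_arc (coeff G i)" for i unfolding G_def by (rule conv_coeff_pcompose[OF less.prems(4) s(3)])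
   have cb: "conv_arc (b i)" for i
    by (rule conv_arc_divide[of "of_nat (d - i) * r"]) (use cG[of i, unfolded b[of i]] rpos in auto)
   define H where "H = (\<Sum>i\<le>degree G. monom (b i * ymonom (of_nat (i - d) * r) 1) i)"
   have b0: "b i = 0" if "coeff G i = 0" for i
    using b[of i] that ymonom_neq_0[of "of_nat (d - i) * r"] rpos by auto
   have H: "coeff H i = b i * ymonom (of_nat (i - d) * r) 1" for i
   proof -
    have "coeff H i = (\<Sum>k\<le>degree G. if k = i then b i * ymonom (of_nat (i - d) * r) 1 else 0)"
     unfolding H_def coeff_sum by (intro sum.cong) auto
    also have "\<dots> = b i * ymonom (of_nat (i - d) * r) 1"
     using b0[of i] coeff_eq_0[of G i] by (auto simp: not_le)
    finally show ?thesis .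
   qed
   have scale: "coeff G i * ymonom r 1 ^ i = ymonom (of_nat d * r) 1 * coeff H i" for i
   proof -
    have "coeff G i * ymonom r 1 ^ i = b i * ymonom (of_nat (d - i) * r + of_nat i * r) 1"
     using rpos by (simp add: b[of i] ymonom_power ymonom_add[symmetric])
    also have "of_nat (d - i) * r + of_nat i * r = of_nat d * r + of_nat (i - d) * r"
     by (cases "i <= d") (auto simp: of_nat_diff algebra_simps)
    also have "b i * ymonom (of_nat d * r + of_nat (i - d) * r) 1 = ymonom (of_nat d * r) 1 * coeff H i"
     using rpos by (simp add: H ymonom_add[symmetric] mult_ac)
    finally show ?thesis .
   qed
   have GH: "poly G (ymonom r 1 * z) = ymonom (of_nat d * r) 1 * poly H z" for z
   proof -
    have "pcompose G [:0, ymonom r 1:] = smult (ymonom (of_nat d * r) 1) H"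
     by (rule poly_eqI) (use scale in \<open>simp add: coeff_pcompose_linear mult.commute\<close>)
    from arg_cong[OF this, of "%p. poly p z"] show ?thesis by (simp add: poly_pcompose mult.commute)
   qed
   define h where "h = reduction H"
   have hd: "coeff h d ~= 0"
   proof -
    have "ymonom 0 1 = 1" using ymonom_power[of 0 0] by simp
    hence "coeff H d = coeff G d" using b[of d] by (simp add: H)
    thus ?thesis using less.prems(3) G by (simp add: h_def)
   qed
   have h_high: "coeff h i = 0" if "i > d" for i
   proof -
    have "of_nat (i - d) * r > 0" using that rpos by simp
    hence "pcoeff (ymonom (of_nat (i - d) * r) 1) 0 = 0"
     using pcoeff_ymonom[of "of_nat (i - d) * r" 1 0] by (simp only: less_imp_le less_imp_neq if_False)
    thus ?thesis by (simp only: h_def H pcoeff0_mult coeff_reduction mult_zero_right)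
   qed
   have deg: "degree h = d"
    using hd h_high by (metis le_degree degree_le le_antisym)
   have hd1: "coeff h (d - 1) = 0" using b0[OF Gd1] by (simp add: h_def H)
   have hi0: "coeff h i0 ~= 0"
   proof -
    have "d > i0" using i0(1) by (simp add: I_def)
    hence e: "v i0 = of_nat (d - i0) * r" using i0(2) by simp
    have "b i0 ~= 0" using b[of i0] i0(1) by (auto simp: I_def)
    then obtain e c where ec: "e \<ge> 0" "c ~= 0" "lead_term e c (b i0)" by (elim lead_term_exists)
    have "lead_term (of_nat (d - i0) * r + e) (1 * c) (coeff G i0)"
     unfolding b[of i0] using rpos by (intro lead_term_mult lead_term_ymonom ec) auto
    hence "yord (coeff G i0) = Fin (of_nat (d - i0) * r + e)" using ec yord_lead_term by fastforce
    hence "e = 0" using v[of i0] i0(1) e by (simp add: I_def)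
    moreover have "ymonom 0 1 = 1" using ymonom_power[of 0 0] by simp
    ultimately have "coeff h i0 = c" using ec \<open>d > i0\<close> by (simp add: h_def H lead_term_def)
    thus ?thesis using ec by simp
   qed
   obtain c where c: "poly h c = 0" "order c h < d" "order c h > 0" "h ~= 0"
    using complex_poly_small_root[OF deg hd1 _ hi0] i0(1) by (auto simp: I_def)
   define k where "k = order c h"
   define c' where "c' = ymonom 0 c"
   define H2 where "H2 = pcompose H [:c', 1:]"
   have red2: "reduction H2 = pcompose h [:c, 1:]"
   proof -
    have "reduction [:c', 1:] = [:c, 1:]"
     by (intro poly_eqI) (auto simp: coeff_pCons c'_def pcoeff_ymonom pcoeff_one split: nat.splits)
    thus ?thesis by (simp add: H2_def reduction_pcompose h_def)
   qed
   obtain g where g: "h = [:-c, 1:] ^ k * g" "\<not> [:-c, 1:] dvd g"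
    using order_decomp[OF c(4)] unfolding k_def by blast
   have red2': "reduction H2 = monom 1 k * pcompose g [:c, 1:]"
   proof -
    have "pcompose ([:-c, 1:] ^ k) [:c, 1:] = (pcompose [:-c, 1:] [:c, 1:]) ^ k"
     by (induction k) (simp_all only: power_0 power_Suc pcompose_mult pcompose_1)
    also have "pcompose [:-c, 1:] [:c, 1:] = [:0, 1:]" by (simp add: pcompose_pCons)
    finally show ?thesis unfolding red2 g(1) pcompose_mult by (simp add: monom_altdef)
   qed
   have H2: "pcoeff (coeff H2 i) 0 = (if i < k then 0 else coeff (pcompose g [:c, 1:]) (i - k))" for i
    using arg_cong[OF red2', of "%p. coeff p i"] by (simp add: coeff_monom_mult)
   have cH2: "conv_arc (coeff H2 i)" for i
    unfolding H2_def c'_def by (rule conv_coeff_pcompose) (use cb rpos in \<open>auto simp: H intro!: conv_arc_closed conv_arc_ymonom simp del: fps_const_mult fps_const_add\<close>)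
   have "poly g c ~= 0" using g(2) by (simp add: poly_eq_0_iff_dvd)
   hence "pcoeff (coeff H2 k) 0 ~= 0" by (simp add: H2)
   then obtain et where eta: "pos_arc et" "poly H2 et = 0"
    and ce: "conv_arc et" using less.IH[of k H2] c H2 cH2 by (auto simp: k_def)
   have "poly P (s + ymonom r 1 * (c' + et)) = 0"
    unfolding PG GH using eta(2) by (simp add: H2_def poly_pcompose)
   moreover have "conv_arc (s + ymonom r 1 * (c' + et))"
    unfolding c'_def using rpos by (intro conv_arc_closed s ce conv_arc_ymonom) auto
   moreover have "pos_arc (s + ymonom r 1 * (c' + et))"
    using s(1) rpos by (simp add: pos_arc_iff pcoeff0_mult pcoeff_ymonom)
   ultimately show ?thesis by blast
  qed
 qed
 thus ?thesis using that by blast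
qed

section \<open>Factorisation of germs\<close>

lemma galois_fixed_arc: assumes "galois b = b" shows "of_fps (root_fps 1 b) = b"
proof (rule puiseux_eqI)
 fix r show "pcoeff (of_fps (root_fps 1 b)) r = pcoeff b r"
 proof (cases "r \<in> \<nat>")
  case True
  then obtain k where "r = of_nat k" by (elim Nats_cases)
  thus ?thesis by (simp add: pcoeff_puiseux_of_fps root_fps_def)
 next
  case False
  thus ?thesis using assms by (auto simp: galois_fixed_iff pcoeff_puiseux_of_fps_not)
 qed
qed

lemma galois_fixed_series:
 assumes "coeff_map galois F = F" shows "coeff_map of_fps (Abs_fps (%i. root_fps 1 (F $ i))) = F"
proof (rule fps_ext)
 fix i
 have "galois (F $ i) = F $ i" using arg_cong[OF assms, of "%F. F $ i"] by simp
 from galois_fixed_arc[OF this]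
 show "fps_nth (coeff_map of_fps (Abs_fps (%i. root_fps 1 (F $ i)))) i = F $ i" by simp
qed

text \<open>A series fixed by the conjugation has integer exponents only, and its coefficients are found
 among those of the germ that it becomes after \<open>y \<mapsto> y\<^sup>n\<close>.\<close>

lemma conv_descent:
 assumes "conv F" "coeff_map galois F = F" shows "F \<in> range emb"
proof -
 obtain n G where n: "n > 0" "coeff_map (ysub n) F = emb G" using assms(1) by (auto simp: conv_def)
 define S where "S = Abs_fps (%i. root_fps 1 (F $ i))"
 have F: "F = coeff_map of_fps S" using galois_fixed_series[OF assms(2)] by (simp add: S_def)
 obtain C R where CR: "R > 0" "C \<ge> 0" "!!i j. norm (((series G) $ i) $ j) <= C * R ^ (i + j)"
  using convergent2_common_bound series[of G] by (metis mem_Collect_eq)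
 have "norm (S $ i $ j) <= C * ((max 1 R) ^ n) ^ (i + j)" for i j
 proof -
  have "S $ i $ j = pcoeff (ysub n (F $ i)) (of_nat (n * j))"
   using n(1) by (simp add: S_def root_fps_def ysub.rep_eq)
  also have "\<dots> = ((series G) $ i) $ (n * j)"
   using arg_cong[OF n(2), of "%F. pcoeff (F $ i) (of_nat (n * j))"]
   by (simp only: coeff_map_nth germ_embed_alt pcoeff_puiseux_of_fps)
  finally have "norm (S $ i $ j) <= C * R ^ (i + n * j)" using CR(3) by simp
  also have "\<dots> <= C * (max 1 R) ^ (i + n * j)" using CR by (intro mult_left_mono power_mono) auto
  also have "\<dots> <= C * (max 1 R) ^ (n * (i + j))"
   using CR n(1) by (intro mult_left_mono power_increasing) (auto simp: distrib_left)
  finally show ?thesis by (simp add: power_mult)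
 qed
 hence "conv2 S" using CR by (intro convergent2I[of "(max 1 R) ^ n"]) auto
 thus ?thesis using F range_germ_embed by blast
qed

lemma germ_unit: assumes "germ_at_origin Q ~= 0" shows "Q dvd 1"
proof -
 have "x_regular 0 (series Q)" using assms by (simp add: x_regular_def germ_at_origin_def)
 then obtain S r where S: "series Q * S = fps_X ^ 0 - r" "!!i. i \<ge> 0 ==> r $ i = 0"
  "conv2 (series Q) ==> conv2 S \<and> conv2 r" using weierstrass_preparation by metis
 have "r = 0" using S(2) by (intro fps_ext[of r]) auto
 moreover have "conv2 S" using S(3) series[of Q] by simp
 ultimately have "Q * Abs_germ S = 1"
  using S(1) by (simp add: series_inject[symmetric] times_germ.rep_eq one_germ.rep_eq Abs_germ_inverse)
 thus ?thesis by (metis dvd_triv_left)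
qed

lemma germ_at_origin_mult: "germ_at_origin (F * G) = germ_at_origin F * germ_at_origin G"
 by (simp add: germ_at_origin_def times_germ.rep_eq)

lemma germ_unit_iff: "Q dvd 1 \<longleftrightarrow> germ_at_origin Q ~= 0"
proof
 assume "Q dvd 1"
 then obtain S where "1 = Q * S" by (auto simp: dvd_def)
 hence "germ_at_origin Q * germ_at_origin S = 1"
  by (metis germ_at_origin_mult germ_at_origin_def one_germ.rep_eq fps_one_nth)
 thus "germ_at_origin Q ~= 0" by auto
qed (rule germ_unit)

lemma germ_eval_at_0:
 assumes "pos_arc xi" shows "pcoeff (germ_eval F xi) 0 = germ_at_origin F"
 using has_value_at_0[OF assms has_value_germ[OF assms, of F]] pcoeff_puiseux_of_fps[of _ 0]
 by (simp add: germ_embed_alt germ_at_origin_def)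

lemma germ_eval_y: "pos_arc xi ==> germ_eval germ_y xi = ymonom 1 1"
 by (intro germ_evalI) (auto simp: germ_embed_y has_value_const)

lemma germ_eval_unit_y_lead:
 assumes "pos_arc xi" "u dvd 1"
 shows "lead_term (of_nat E) (germ_at_origin u) (germ_eval (u * germ_y ^ E) xi)"
proof -
 have "lead_term 0 (germ_at_origin u) (germ_eval u xi)"
  using germ_eval_at_0[OF assms(1), of u] by (simp add: lead_term_def pcoeff_neg)
 moreover have "lead_term (of_nat E * 1) (1 ^ E) (ymonom 1 1 ^ E)"
  by (rule lead_term_power) (simp add: lead_term_ymonom)
 ultimately have "lead_term (0 + of_nat E * 1) (germ_at_origin u * 1 ^ E) (germ_eval u xi * ymonom 1 1 ^ E)"
  by (rule lead_term_mult)
 thus ?thesis using assms(1) by (simp add: germ_eval_simps germ_eval_y)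
qed

lemma germ_eval_unit_y_neq_0:
 "pos_arc xi ==> u dvd 1 ==> germ_eval (u * germ_y ^ E) xi ~= 0"
 using germ_eval_unit_y_lead[of xi u E] germ_unit_iff[of u] by (auto simp: lead_term_def)

lemma weierstrass_poly_splits:
 fixes P :: "puiseux poly"
 assumes "reduction P = monom 1 (degree P)" "lead_coeff P = 1" "!!i. conv_arc (coeff P i)"
 shows "\<exists>A m. finite A \<and> (\<forall>ga\<in>A. pos_arc ga \<and> conv_arc ga) \<and> P = (\<Prod>ga\<in>A. [:-ga, 1:] ^ m ga)"
 using assms
proof (induction "degree P" arbitrary: P rule: less_induct)
 case less
 show ?case
 proof (cases "degree P = 0")
  case True
  then obtain c where "P = [:c:]" using degree_eq_zeroE[of P] by auto
  hence "P = 1" using less.prems(2) by (simp add: one_pCons)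
  thus ?thesis by (intro exI[of _ "{}"]) auto
 next
  case False
  have cP: "pcoeff (coeff P i) 0 = (if i = degree P then 1 else 0)" for i
   using arg_cong[OF less.prems(1), of "%p. coeff p i"] by simp
  obtain xi where xi: "pos_arc xi" "poly P xi = 0" "conv_arc xi"
   using newton_puiseux_root[of "degree P" P] False cP less.prems(3) by auto
  obtain Q where Q: "P = [:-xi, 1:] * Q" using xi(2) by (auto simp: poly_eq_0_iff_dvd dvd_def)
  hence Q0: "Q ~= 0" using less.prems(2) by auto
  have dQ: "degree P = Suc (degree Q)" unfolding Q by (subst degree_mult_eq) (use Q0 in auto)
  have lQ: "lead_coeff Q = 1" using less.prems(2) unfolding Q lead_coeff_mult by simp
  have "reduction Q = monom 1 (degree Q)"
  proof (rule poly_eqI)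
   fix i
   have "pcoeff (coeff P (Suc i)) 0 = pcoeff (coeff Q i) 0"
    using xi(1) by (simp add: Q pcoeff0_mult pos_arc_iff)
   thus "coeff (reduction Q) i = coeff (monom 1 (degree Q)) i"
    using cP[of "Suc i"] dQ by (auto split: if_splits)
  qed
  moreover have "conv_arc (coeff Q i)" for i
  proof (induction "degree Q - i" arbitrary: i)
   case 0
   then consider "i = degree Q" | "coeff Q i = 0" using coeff_eq_0[of Q i] by linarith
   thus ?case by cases (use lQ conv_0 conv_1 in auto)
  next
   case (Suc k)
   have "coeff Q i = coeff P (Suc i) + xi * coeff Q (Suc i)" by (simp add: Q)
   thus ?case using less.prems(3) xi(3) Suc by (auto intro!: conv_arc_closed simp del: fps_const_add)
  qed
  ultimately obtain A m where A: "finite A" "\<forall>ga\<in>A. pos_arc ga \<and> conv_arc ga" "Q = (\<Prod>ga\<in>A. [:-ga, 1:] ^ m ga)"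
   using less.hyps[of Q] dQ lQ by auto
  show ?thesis
  proof (cases "xi \<in> A")
   case True
   have "P = (\<Prod>ga\<in>A. [:-ga, 1:] ^ (m(xi := Suc (m xi))) ga)"
    unfolding Q A(3) prod.remove[OF A(1) True]
    by (simp add: mult.assoc del: mult_pCons_left mult_pCons_right)
   thus ?thesis using A by blast
  next
   case False
   have "(\<Prod>ga\<in>A. [:-ga, 1:] ^ (m(xi := 1)) ga) = (\<Prod>ga\<in>A. [:-ga, 1:] ^ m ga)"
    using False by (intro prod.cong) auto
   hence "P = (\<Prod>ga\<in>insert xi A. [:-ga, 1:] ^ (m(xi := 1)) ga)"
    unfolding prod.insert[OF A(1) False] by (simp only: Q A(3) fun_upd_same power_one_right)
   thus ?thesis using A xi(1,3) by (intro exI[of _ "insert xi A"] exI[of _ "m(xi := 1)"]) auto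
  qed
 qed
qed

lemma fps_of_poly_linear_factor: "fps_of_poly [:-ga, 1:] = lin ga"
 by (rule fps_ext) (auto simp: coeff_pCons fps_X_def split: nat.splits)

lemma linear_factor_neq_0: "lin ga ~= 0"
 using arg_cong[of "lin ga" 0 "%F. F $ 1"] by auto

lemma root_mult_factor:
 assumes "pos_arc ga" "emb F = lin ga ^ m * R" "has_value R ga w" "w ~= 0"
 shows "root_mult F ga = m"
proof -
 have "{k. lin ga ^ k dvd emb F} = {..m}"
 proof (rule set_eqI, simp, rule iffI)
  fix k assume k: "lin ga ^ k dvd emb F"
  show "k <= m"
  proof (rule ccontr)
   assume "\<not> k <= m"
   hence "lin ga ^ Suc m dvd lin ga ^ k" by (intro le_imp_power_dvd) auto
   from dvd_trans[OF this k] have "lin ga ^ m * lin ga dvd lin ga ^ m * R"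
    unfolding assms(2) power_Suc2 .
   hence "lin ga dvd R"
    by (simp add: dvd_mult_cancel_left linear_factor_neq_0)
   thus False using has_value_unique[OF assms(1,3)] assms(4) has_value_zero_iff by blast
  qed
 qed (auto simp: assms(2) intro: dvd_mult2 le_imp_power_dvd)
 thus ?thesis unfolding root_mult_def by (simp add: Max_eq_iff)
qed

lemma germ_split_y:
 assumes "F ~= 0"
 obtains G E d where "F = germ_y ^ E * G" "x_regular d (series G)"
proof -
 define S where "S = series F"
 have "S ~= 0" using assms by (metis S_def series_inject zero_germ.rep_eq)
 then obtain i j where ij: "S $ i $ j ~= 0" by (metis fps_ext fps_zero_nth)
 define E where "E = (LEAST j. \<exists>i. S $ i $ j ~= 0)"
 have "\<exists>i. S $ i $ E ~= 0"
  unfolding E_def by (rule LeastI[of "%j. \<exists>i. S $ i $ j ~= 0" j]) (use ij in blast)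
 then obtain i where i: "S $ i $ E ~= 0" by blast
 define d where "d = (LEAST i. S $ i $ E ~= 0)"
 have d: "S $ d $ E ~= 0" "!!i. i < d ==> S $ i $ E = 0"
  unfolding d_def by (rule LeastI[of "%i. S $ i $ E ~= 0", OF i]) (blast dest: not_less_Least)
 have low: "S $ i $ k = 0" if "k < E" for i k
  using that not_less_Least[of k "%j. \<exists>i. S $ i $ j ~= 0"] unfolding E_def by blast
 define T where "T = coeff_map (fps_shift E) S"
 obtain C R where CR: "R > 0" "C \<ge> 0" "!!i j. norm (S $ i $ j) <= C * R ^ (i + j)"
  using convergent2_common_bound series[of F] unfolding S_def by (metis mem_Collect_eq)
 have "norm (T $ i $ j) <= (C * R ^ E) * R ^ (i + j)" for i j
  using CR(3)[of i "j + E"] by (simp add: T_def power_add mult_ac)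
 hence T: "conv2 T" using CR(1) by (rule convergent2I[rotated])
 hence Tinv: "series (Abs_germ T) = T" by (simp add: Abs_germ_inverse)
 have yE: "series (germ_y ^ E) = fps_const (fps_X ^ E)"
  by (induction E) (simp_all add: one_germ.rep_eq times_germ.rep_eq germ_y.rep_eq)
 show ?thesis
 proof
  have "series F = series (germ_y ^ E * Abs_germ T)"
   unfolding times_germ.rep_eq yE S_def[symmetric]
   by (intro fps_ext) (auto simp: Tinv[unfolded T_def] T_def fps_X_power_mult_nth low not_less)
  thus "F = germ_y ^ E * Abs_germ T" by (simp add: series_inject)
  show "x_regular d (series (Abs_germ T))"
   using d by (simp add: Abs_germ_inverse T x_regular_def) (simp add: T_def)
 qed
qed

lemma regular_germ_factorisation:
 assumes "x_regular d (series F)"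
 obtains Q A m where "Q dvd 1" "finite A" "\<forall>ga\<in>A. pos_arc ga \<and> conv_arc ga"
  "emb F * emb Q = (\<Prod>ga\<in>A. lin ga ^ m ga)"
proof -
 obtain S r where S: "series F * S = fps_X ^ d - r" "!!i. i \<ge> d ==> r $ i = 0"
  "!!i. r $ i $ 0 = 0" "S $ 0 $ 0 ~= 0"
  "conv2 S" "conv2 r"
  using weierstrass_preparation[OF assms] series[of F] by (metis mem_Collect_eq)
 define p where "p = monom 1 d - (\<Sum>i<d. monom (r $ i) i)"
 have cp: "coeff p i = (if i = d then 1 else 0) - r $ i" for i
  by (cases "i < d") (auto simp: p_def coeff_sum S(2))
 have pF: "fps_of_poly p = series F * S" unfolding S(1) by (rule fps_ext) (auto simp: cp)
 define P where "P = map_poly of_fps p"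
 have P: "coeff P i = of_fps (coeff p i)" for i
  by (simp add: P_def coeff_map_poly ring_mapD[OF ring_map_puiseux_of_fps])
 have dp: "degree P = d"
 proof (rule antisym)
  show "degree P <= d" by (rule degree_le) (auto simp: P cp S(2) ring_mapD[OF ring_map_puiseux_of_fps])
  show "d <= degree P" by (rule le_degree) (simp add: P cp S(2) ring_mapD[OF ring_map_puiseux_of_fps])
 qed
 have lP: "lead_coeff P = 1" by (simp add: dp P cp S(2) ring_mapD[OF ring_map_puiseux_of_fps])
 have rP: "reduction P = monom 1 (degree P)"
  using pcoeff_puiseux_of_fps[of _ 0] by (intro poly_eqI) (auto simp: dp P cp S(2,3))
 have cP: "conv_arc (coeff P i)" for i
 proof (cases "i < d")
  case True
  hence "coeff P i = 0 - of_fps (r $ i)"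
   by (simp add: P cp ring_mapD[OF ring_map_puiseux_of_fps])
  moreover have "conv_arc (of_fps (r $ i))"
   using conv_arcI[OF zero_less_one ysub_1 convergent2_coeff[OF S(6)]] .
  ultimately show ?thesis using conv_arc_closed(2)[of 0] conv_0 by simp
 qed (use conv_0 conv_1 in \<open>auto simp: P cp S(2) ring_mapD[OF ring_map_puiseux_of_fps]\<close>)
 obtain A m where A: "finite A" "\<forall>ga\<in>A. pos_arc ga \<and> conv_arc ga" "P = (\<Prod>ga\<in>A. [:-ga, 1:] ^ m ga)"
  using weierstrass_poly_splits[OF rP lP cP] by blast
 have PA: "fps_of_poly P = (\<Prod>ga\<in>A. lin ga ^ m ga)"
  unfolding A(3) fps_of_poly_prod fps_of_poly_power fps_of_poly_linear_factor ..
 show ?thesis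
 proof (rule that[OF _ A(1,2)])
  show "Abs_germ S dvd 1" using S(4,5) by (simp add: germ_unit_iff germ_at_origin_def Abs_germ_inverse)
  have "emb F * emb (Abs_germ S) = coeff_map of_fps (fps_of_poly p)"
   unfolding germ_embed_simps(2)[symmetric] by (simp add: germ_embed_alt times_germ.rep_eq Abs_germ_inverse S(5) pF)
  also have "\<dots> = fps_of_poly P" by (rule fps_ext) (simp add: P)
  finally show "emb F * emb (Abs_germ S) = (\<Prod>ga\<in>A. lin ga ^ m ga)" using PA by simp
 qed
qed

text \<open>Division by a power of \<open>y\<close> makes the germ regular in \<open>x\<close>; a unit times a regular germ is a
 polynomial in \<open>x\<close> that splits by the Newton--Puiseux theorem; and the exponents are the
 multiplicities, as a product of other factors has a nonzero value at a root.\<close>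

theorem germ_factorisation:
 assumes "F ~= 0"
 obtains u E where "u dvd 1" "finite (np_roots F)"
  "emb F = emb (u * germ_y ^ E) * (\<Prod>ga\<in>np_roots F. lin ga ^ root_mult F ga)"
  "!!ga. ga \<in> np_roots F ==> root_mult F ga > 0 \<and> conv (lin ga)"
proof -
 obtain G E d where G: "F = germ_y ^ E * G" "x_regular d (series G)" using germ_split_y[OF assms] by blast
 obtain Q A m where Q: "Q dvd 1" and A: "finite A" "\<forall>ga\<in>A. pos_arc ga \<and> conv_arc ga"
  and GQ: "emb G * emb Q = (\<Prod>ga\<in>A. lin ga ^ m ga)"
  by (rule regular_germ_factorisation[OF G(2)]) (rule that)
 obtain u where u: "Q * u = 1" using Q by (auto simp: dvd_def)
 hence u1: "u dvd 1" by (metis dvd_triv_right)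
 have F: "emb F = emb (u * germ_y ^ E) * (\<Prod>ga\<in>A. lin ga ^ m ga)"
 proof -
  have "F = (u * germ_y ^ E) * (G * Q)" using u G(1) by (simp add: mult_ac)
  thus ?thesis by (simp only: germ_embed_simps(2) GQ)
 qed
 have mult: "root_mult F ga = (if ga \<in> A then m ga else 0)" if g: "pos_arc ga" for ga
 proof -
  define R where "R = emb (u * germ_y ^ E) * (\<Prod>de\<in>A - {ga}. lin de ^ m de)"
  have "emb F = lin ga ^ (if ga \<in> A then m ga else 0) * R"
   unfolding F R_def using A(1) by (auto simp: prod.remove[of A ga] mult_ac)
  moreover have "has_value R ga (germ_eval (u * germ_y ^ E) ga * (\<Prod>de\<in>A - {ga}. (ga - de) ^ m de))"
   unfolding R_def by (intro has_value_mult has_value_germ g has_value_prod has_value_power has_value_linear)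
  moreover have "germ_eval (u * germ_y ^ E) ga * (\<Prod>de\<in>A - {ga}. (ga - de) ^ m de) ~= 0"
   using germ_eval_unit_y_neq_0[OF g u1] A(1) by auto
  ultimately show ?thesis using root_mult_factor[OF g] by blast
 qed
 have roots: "np_roots F = {ga \<in> A. m ga > 0}"
 proof (rule set_eqI)
  fix ga
  show "ga \<in> np_roots F \<longleftrightarrow> ga \<in> {ga \<in> A. m ga > 0}"
  proof (cases "pos_arc ga")
   case True
   have "has_value (emb F) ga (germ_eval (u * germ_y ^ E) ga * (\<Prod>de\<in>A. (ga - de) ^ m de))"
    unfolding F by (intro has_value_mult has_value_germ True has_value_prod has_value_power has_value_linear)
   hence "germ_eval F ga = germ_eval (u * germ_y ^ E) ga * (\<Prod>de\<in>A. (ga - de) ^ m de)"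
    by (rule germ_evalI[OF True])
   thus ?thesis using True germ_eval_unit_y_neq_0[OF True u1, of E] A(1) by (auto simp: np_roots_def)
  qed (use A(2) in \<open>auto simp: np_roots_def\<close>)
 qed
 have prod: "(\<Prod>ga\<in>A. lin ga ^ m ga) = (\<Prod>ga\<in>np_roots F. lin ga ^ root_mult F ga)"
  by (rule prod.mono_neutral_cong_right) (use A mult in \<open>auto simp: roots\<close>)
 show ?thesis
 proof (rule that[OF u1])
  show "finite (np_roots F)" using roots A(1) by simp
  show "emb F = emb (u * germ_y ^ E) * (\<Prod>ga\<in>np_roots F. lin ga ^ root_mult F ga)"
   using F prod by simp
  show "root_mult F ga > 0 \<and> conv (lin ga)" if "ga \<in> np_roots F" for ga
   using that roots mult[of ga] A(2) by (auto intro: conv_closed conv_X)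
 qed
qed


section \<open>Conjugate roots and irreducible germs\<close>

lemma coeff_map_galois_linear_power:
 "coeff_map galois (lin ga ^ m) = lin (galois ga) ^ m"
 using ring_mapD(9)[OF ring_map_coeff_map[OF ring_map_galois]] coeff_map_linear[OF ring_map_galois] by simp

lemma galois_back: obtains n where "(galois ^^ n) (galois ga) = ga"
proof -
 obtain n where n: "has_denom n (pcoeff ga)" using denom_puiseux by blast
 then obtain k where "n = Suc k" by (cases n) (auto simp: has_denom_def)
 thus ?thesis using galois_period[OF n] that[of k] by (simp add: funpow_swap1)
qed

lemma root_mult_galois [simp]: "root_mult F (galois ga) = root_mult F ga"
proof -
 have step: "lin (galois ga) ^ m dvd emb F" if "lin ga ^ m dvd emb F" for m ga
  using ring_map_dvd[OF ring_map_coeff_map[OF ring_map_galois] that]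
  by (simp add: galois_germ_embed coeff_map_galois_linear_power)
 have steps: "lin ((galois ^^ n) ga) ^ m dvd emb F" if "lin ga ^ m dvd emb F" for n m ga
  by (induction n) (use that step in auto)
 obtain n where "(galois ^^ n) (galois ga) = ga" using galois_back by blast
 hence "lin (galois ga) ^ m dvd emb F \<longleftrightarrow> lin ga ^ m dvd emb F" for m
  using step steps[of "galois ga" m n] by auto
 thus ?thesis by (simp add: root_mult_def)
qed

text \<open>The product is fixed by the conjugation, so that \<open>conv_descent\<close> applies.\<close>

lemma stable_product_is_germ:
 assumes "!!ga. ga \<in> S ==> conv (lin ga)" "finite S" "galois ` S = S"
  "!!ga. ga \<in> S ==> m (galois ga) = m ga"
 shows "(\<Prod>ga\<in>S. lin ga ^ m ga) \<in> range emb"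
proof (rule conv_descent)
 show "conv (\<Prod>ga\<in>S. lin ga ^ m ga)" using assms(1) by (intro conv_prod conv_power)
 have "coeff_map galois (\<Prod>ga\<in>S. lin ga ^ m ga) = (\<Prod>ga\<in>S. lin (galois ga) ^ m (galois ga))"
  using assms(4)
  by (simp add: ring_mapD(8)[OF ring_map_coeff_map[OF ring_map_galois]] coeff_map_galois_linear_power)
 also have "\<dots> = (\<Prod>ga\<in>galois ` S. lin ga ^ m ga)"
  by (subst prod.reindex) (auto intro: inj_on_subset[OF inj_galois])
 finally show "coeff_map galois (\<Prod>ga\<in>S. lin ga ^ m ga) = (\<Prod>ga\<in>S. lin ga ^ m ga)"
  using assms(3) by simp
qed

definition galois_orbit :: "puiseux => puiseux set" where
 "galois_orbit xi = range (%i. (galois ^^ i) xi)"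

lemma funpow_mod_period: "(f ^^ n) x = x ==> (f ^^ (i mod n)) x = (f ^^ i) x"
 by (metis funpow_mod_eq)

lemma galois_orbit_finite: "finite (galois_orbit xi)"
proof -
 obtain n where n: "has_denom n (pcoeff xi)" using denom_puiseux by blast
 hence "n > 0" by (simp add: has_denom_def)
 have "(galois ^^ i) xi \<in> (%i. (galois ^^ i) xi) ` {..<n}" for i
  using funpow_mod_period[OF galois_period[OF n], of i] \<open>n > 0\<close>
  by (intro image_eqI[of _ _ "i mod n"]) auto
 hence "galois_orbit xi \<subseteq> (%i. (galois ^^ i) xi) ` {..<n}" by (auto simp: galois_orbit_def)
 thus ?thesis by (rule finite_subset) simp
qed

lemma galois_orbit_self: "xi \<in> galois_orbit xi"
 unfolding galois_orbit_def by (rule range_eqI[of _ _ 0]) simp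

lemma galois_image_eq:
 assumes "finite S" "galois ` S \<subseteq> S" shows "galois ` S = S"
 using assms inj_galois by (meson endo_inj_surj inj_on_subset subset_UNIV)

lemma galois_orbit_stable: "galois ` galois_orbit xi = galois_orbit xi"
proof (rule galois_image_eq[OF galois_orbit_finite])
 show "galois ` galois_orbit xi \<subseteq> galois_orbit xi"
 proof clarify
  fix ga assume "ga \<in> galois_orbit xi"
  then obtain i where "ga = (galois ^^ i) xi" by (auto simp: galois_orbit_def)
  hence "galois ga = (galois ^^ Suc i) xi" by simp
  thus "galois ga \<in> galois_orbit xi" unfolding galois_orbit_def by (rule range_eqI)
 qed
qed

lemma funpow_np_roots: "xi \<in> np_roots F ==> (galois ^^ i) xi \<in> np_roots F"
 by (induction i) (auto simp: galois_np_roots_iff)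

lemma galois_orbit_np_roots: "xi \<in> np_roots F ==> galois_orbit xi \<subseteq> np_roots F"
 by (auto simp: galois_orbit_def funpow_np_roots)

lemma np_roots_stable: "finite (np_roots F) ==> galois ` np_roots F = np_roots F"
 by (rule galois_image_eq) (auto simp: galois_np_roots_iff)

lemma not_unit_if_root: "xi \<in> np_roots F ==> \<not> F dvd 1"
 using germ_eval_at_0[of xi F] by (auto simp: np_roots_def germ_unit_iff)

text \<open>The minimal germ of a root: a germ with this root has all its conjugates as roots, hence is
 divisible by the product over them.\<close>

lemma orbit_germ:
 assumes F: "F ~= 0" "xi \<in> np_roots F"
 obtains p where "p ~= 0" "np_roots p = galois_orbit xi" "!!a. a ~= 0 ==> xi \<in> np_roots a ==> p dvd a"
proof -
 let ?O = "galois_orbit xi"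
 have cO: "conv (lin ga) \<and> pos_arc ga" if "ga \<in> ?O" for ga
 proof -
  have "ga \<in> np_roots F" using galois_orbit_np_roots[OF F(2)] that by blast
  thus ?thesis using germ_factorisation[OF F(1)] by (auto simp: np_roots_def)
 qed
 have germ: "(\<Prod>ga\<in>?O. lin ga ^ m ga) \<in> range emb" if "!!ga. m (galois ga) = m ga" for m
  by (rule stable_product_is_germ[OF _ galois_orbit_finite galois_orbit_stable]) (use cO that in simp_all)
 obtain p where p: "(\<Prod>ga\<in>?O. lin ga ^ 1) = emb p" using germ[of "%_. 1"] by auto
 have p0: "p ~= 0"
 proof
  assume "p = 0"
  hence "(\<Prod>ga\<in>?O. lin ga ^ 1) = 0" using p germ_embed_simps(4) by simp
  thus False using galois_orbit_finite linear_factor_neq_0 by (auto simp: prod_zero_iff)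
 qed
 have "germ_eval p et = (\<Prod>ga\<in>?O. (et - ga) ^ 1)" if "pos_arc et" for et
  unfolding p[symmetric] by (intro germ_evalI[OF that, of p]) (auto simp: p[symmetric] intro!: has_value_prod has_value_linear)
 hence "np_roots p = ?O" using galois_orbit_finite cO by (auto simp: np_roots_def prod_zero_iff)
 moreover have "p dvd a" if a: "a ~= 0" "xi \<in> np_roots a" for a
 proof -
  have sub: "?O \<subseteq> np_roots a" using a(2) by (rule galois_orbit_np_roots)
  obtain u E where fac: "finite (np_roots a)"
   "emb a = emb (u * germ_y ^ E) * (\<Prod>ga\<in>np_roots a. lin ga ^ root_mult a ga)"
   "!!ga. ga \<in> np_roots a ==> root_mult a ga > 0 \<and> conv (lin ga)"
   using germ_factorisation[OF a(1)] by metis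
  obtain c where c: "(\<Prod>ga\<in>?O. lin ga ^ (root_mult a ga - 1)) = emb c"
   using germ[of "%ga. root_mult a ga - 1"] by auto
  have "galois ` (np_roots a - ?O) = np_roots a - ?O"
   unfolding image_set_diff[OF inj_galois] np_roots_stable[OF fac(1)] galois_orbit_stable ..
  hence "(\<Prod>ga\<in>np_roots a - ?O. lin ga ^ root_mult a ga) \<in> range emb"
   using fac by (intro stable_product_is_germ) auto
  then obtain d where d: "(\<Prod>ga\<in>np_roots a - ?O. lin ga ^ root_mult a ga) = emb d" by (rule imageE)
  have "(\<Prod>ga\<in>?O. lin ga ^ root_mult a ga) = (\<Prod>ga\<in>?O. lin ga ^ 1 * lin ga ^ (root_mult a ga - 1))"
  proof (rule prod.cong)
   fix ga assume "ga \<in> ?O"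
   hence "root_mult a ga = 1 + (root_mult a ga - 1)" using fac(3)[of ga] sub by auto
   thus "lin ga ^ root_mult a ga = lin ga ^ 1 * lin ga ^ (root_mult a ga - 1)"
    by (metis power_add)
  qed simp
  hence "emb a = emb (p * (u * germ_y ^ E * d * c))"
   unfolding fac(2) prod.subset_diff[OF sub fac(1)] d prod.distrib p c germ_embed_simps(2) by (simp only: mult_ac)
  thus ?thesis by (simp add: germ_embed_inject)
 qed
 ultimately show ?thesis using that p0 by blast
qed

lemma irreducible_germ_roots_conjugate:
 assumes p: "irreducible p" and roots: "xi \<in> np_roots p" "et \<in> np_roots p"
 shows "\<exists>i. et = (galois ^^ i) xi"
proof -
 have "p ~= 0" using p by auto
 then obtain q where q: "np_roots q = galois_orbit xi" "q dvd p" using orbit_germ[OF _ roots(1)] roots(1) by metis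
 then obtain c where c: "p = q * c" by (auto simp: dvd_def)
 have "\<not> q dvd 1" using not_unit_if_root q(1) galois_orbit_self by blast
 hence "c dvd 1" using irreducibleD[OF p c] by blast
 hence "et \<notin> np_roots c" using not_unit_if_root by blast
 hence "et \<in> np_roots q" using roots(2) unfolding c by (auto simp: np_roots_def germ_eval_simps)
 thus ?thesis using q(1) by (auto simp: galois_orbit_def)
qed

lemma minimal_germ_irreducible:
 assumes "F ~= 0" "xi \<in> np_roots F"
 obtains p where "irreducible p" "!!i. (galois ^^ i) xi \<in> np_roots p"
proof -
 obtain p where p: "p ~= 0" "np_roots p = galois_orbit xi" "!!a. a ~= 0 ==> xi \<in> np_roots a ==> p dvd a"
  using orbit_germ[OF assms] by metis
 have r: "xi \<in> np_roots p" using p(2) galois_orbit_self by simp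
 have key: "b dvd 1" if ab: "p = a * b" "xi \<in> np_roots a" for a b
 proof -
  obtain c where c: "a = p * c" using p(1,3) ab by (metis dvdE mult_zero_left)
  have "p * 1 = a * b" using ab(1) by simp
  also have "\<dots> = p * (c * b)" unfolding c by (rule mult.assoc)
  finally have "1 = c * b" unfolding mult_left_cancel[OF p(1)] .
  thus "b dvd 1" by (metis dvd_triv_right)
 qed
 have "irreducible p"
 proof (rule irreducibleI[OF p(1)])
  show "\<not> p dvd 1" using not_unit_if_root r by blast
  fix a b assume ab: "p = a * b"
  hence "xi \<in> np_roots a \<or> xi \<in> np_roots b" using r by (auto simp: np_roots_def germ_eval_simps)
  thus "a dvd 1 \<or> b dvd 1" using key[of a b] key[of b a] ab by (auto simp: mult.commute)
 qed
 thus ?thesis using that p(2) by (auto simp: galois_orbit_def)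
qed

section \<open>Codimension of ideals of germs\<close>

definition ideal2 :: "germ => germ => germ set" where
 "ideal2 F G = {A * F + B * G | A B. True}"

abbreviation comb :: "'a set => ('a => complex) => ('a => germ) => germ" where
 "comb J c h \<equiv> \<Sum>j\<in>J. germ_const (c j) * h j"

text \<open>The classes of the \<open>h j\<close> form a basis of the quotient of the ring of germs by \<open>I\<close>.\<close>

definition basis_mod :: "germ set => 'a set => ('a => germ) => bool" where
 "basis_mod I J h \<longleftrightarrow> finite J \<and> (\<forall>F. \<exists>c. F - comb J c h \<in> I) \<and> (\<forall>c. comb J c h \<in> I --> (\<forall>j\<in>J. c j = 0))"

definition has_codim :: "germ set => nat => bool" where
 "has_codim I n \<longleftrightarrow> (\<exists>h. basis_mod I {..<n} h)"

lemma ideal2_iff: "H \<in> ideal2 F G \<longleftrightarrow> (\<exists>A B. H = A * F + B * G)"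
 by (auto simp: ideal2_def)

lemma ideal2_closed:
 "0 \<in> ideal2 F G" "a \<in> ideal2 F G ==> b \<in> ideal2 F G ==> a + b \<in> ideal2 F G"
 "a \<in> ideal2 F G ==> b \<in> ideal2 F G ==> a - b \<in> ideal2 F G" "a \<in> ideal2 F G ==> c * a \<in> ideal2 F G"
proof -
 show "0 \<in> ideal2 F G" unfolding ideal2_iff by (intro exI[of _ 0]) simp
 assume "a \<in> ideal2 F G"
 then obtain A B where a: "a = A * F + B * G" by (auto simp: ideal2_iff)
 have "c * a = (c * A) * F + (c * B) * G" by (simp add: a algebra_simps)
 thus "c * a \<in> ideal2 F G" unfolding ideal2_iff by blast
 assume "b \<in> ideal2 F G"
 then obtain C D where b: "b = C * F + D * G" by (auto simp: ideal2_iff)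
 have "a + b = (A + C) * F + (B + D) * G" "a - b = (A - C) * F + (B - D) * G" by (simp_all add: a b algebra_simps)
 thus "a + b \<in> ideal2 F G" "a - b \<in> ideal2 F G" unfolding ideal2_iff by blast+
qed

lemma ideal2_sum: "(!!x. x \<in> A ==> h x \<in> ideal2 F G) ==> sum h A \<in> ideal2 F G"
 by (induction A rule: infinite_finite_induct) (auto intro: ideal2_closed)

lemma ring_map_germ_const: "ring_map germ_const"
 unfolding ring_map_def by (intro conjI allI; transfer; simp)

lemmas gc = ring_mapD[OF ring_map_germ_const]

lemma linear_dependence:
 fixes x :: "'s => 'j => complex"
 assumes "finite J" "finite S" "card S > card J"
 shows "\<exists>c. (\<exists>s\<in>S. c s ~= 0) \<and> (\<forall>j\<in>J. (\<Sum>s\<in>S. c s * x s j) = 0)"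
 using assms
proof (induction J arbitrary: S x rule: finite_induct)
 case empty
 then obtain s where "s \<in> S" by fastforce
 thus ?case by (intro exI[of _ "%_. 1"]) auto
next
 case (insert n J)
 show ?case
 proof (cases "\<forall>s\<in>S. x s n = 0")
  case True
  obtain c where "\<exists>s\<in>S. c s ~= 0" "\<forall>j\<in>J. (\<Sum>s\<in>S. c s * x s j) = 0"
   using insert.IH[of S x] insert.prems insert.hyps by auto
  with True show ?thesis by (intro exI[of _ c]) auto
 next
  case False
  then obtain t where t: "t \<in> S" "x t n ~= 0" by blast
  define y where "y = (%s j. x s j - x s n / x t n * x t j)"
  have "card (S - {t}) > card J" using insert t by simp
  then obtain c where c: "\<exists>s\<in>S - {t}. c s ~= 0" "\<forall>j\<in>J. (\<Sum>s\<in>S - {t}. c s * y s j) = 0"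
   using insert.IH[of "S - {t}" y] insert.prems by auto
  define c' where "c' = c(t := - (\<Sum>s\<in>S - {t}. c s * (x s n / x t n)))"
  have "(\<Sum>s\<in>S. c' s * x s j) = (\<Sum>s\<in>S - {t}. c s * y s j)" for j
  proof -
   have "(\<Sum>s\<in>S. c' s * x s j) = c' t * x t j + (\<Sum>s\<in>S - {t}. c s * x s j)"
    using insert.prems t by (subst sum.remove[of S t]) (auto simp: c'_def intro!: sum.cong)
   thus ?thesis
    by (simp add: c'_def y_def right_diff_distrib sum_subtractf sum_distrib_right mult.assoc)
  qed
  moreover have "(\<Sum>s\<in>S - {t}. c s * y s n) = 0" using t(2) by (intro sum.neutral) (simp add: y_def)
  ultimately have "\<forall>j\<in>insert n J. (\<Sum>s\<in>S. c' s * x s j) = 0" using c(2) by auto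
  moreover have "\<exists>s\<in>S. c' s ~= 0" using c(1) by (auto simp: c'_def)
  ultimately show ?thesis by blast
 qed
qed

lemma basis_mod_dependence:
 assumes b: "basis_mod (ideal2 f P) J h" and S: "finite S" "card S > card J"
 shows "\<exists>c. (\<exists>s\<in>S. c s ~= 0) \<and> comb S c k \<in> ideal2 f P"
proof -
 have "\<forall>s. \<exists>c. k s - comb J c h \<in> ideal2 f P" using b by (simp add: basis_mod_def)
 from choice[OF this] obtain C where C: "!!s. k s - comb J (C s) h \<in> ideal2 f P" by blast
 obtain c where c: "\<exists>s\<in>S. c s ~= 0" "\<forall>j\<in>J. (\<Sum>s\<in>S. c s * C s j) = 0"
  using linear_dependence[of J S C] b S by (auto simp: basis_mod_def)
 have "(\<Sum>s\<in>S. germ_const (c s) * comb J (C s) h) = (\<Sum>j\<in>J. germ_const (\<Sum>s\<in>S. c s * C s j) * h j)"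
  by (simp add: gc sum_distrib_left sum_distrib_right mult.assoc) (rule sum.swap)
 also have "\<dots> = 0" using c(2) by (intro sum.neutral) (simp add: gc)
 finally have "comb S c k = (\<Sum>s\<in>S. germ_const (c s) * (k s - comb J (C s) h))"
  by (simp add: right_diff_distrib sum_subtractf)
 also have "\<dots> \<in> ideal2 f P" by (intro ideal2_sum ideal2_closed(4) C)
 finally show ?thesis using c(1) by blast
qed

lemma basis_mod_has_codim:
 assumes "basis_mod I J h" shows "has_codim I (card J)"
proof -
 have J: "finite J" "!!F. \<exists>c. F - comb J c h \<in> I" "!!c j. comb J c h \<in> I ==> j \<in> J ==> c j = 0"
  using assms by (auto simp: basis_mod_def)
 obtain e where e: "bij_betw e {..<card J} J" using ex_bij_betw_nat_finite[OF J(1)] by (auto simp: atLeast0LessThan)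
 have re: "comb {..<card J} (c \<circ> e) (h \<circ> e) = comb J c h" for c
  using sum.reindex_bij_betw[OF e, of "%j. germ_const (c j) * h j"] by simp
 have "basis_mod I {..<card J} (h \<circ> e)"
  unfolding basis_mod_def
 proof (intro conjI allI impI ballI)
  show "\<exists>c. F - comb {..<card J} c (h \<circ> e) \<in> I" for F using J(2)[of F] re by metis
  fix c j assume c: "comb {..<card J} c (h \<circ> e) \<in> I" and j: "j \<in> {..<card J}"
  let ?c = "c \<circ> the_inv_into {..<card J} e"
  have inv: "the_inv_into {..<card J} e (e i) = i" if "i < card J" for i
   using e that by (auto simp: bij_betw_def intro: the_inv_into_f_f)
  have "comb J ?c h = comb {..<card J} c (h \<circ> e)" unfolding re[symmetric] by (intro sum.cong) (simp_all add: inv)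
  hence "?c (e j) = 0" using J(3)[of ?c "e j"] c j bij_betwE[OF e] by simp
  thus "c j = 0" using inv j by simp
 qed simp
 thus ?thesis by (auto simp: has_codim_def)
qed

text \<open>The intersection multiplicity is the supremum of the sizes of independent families modulo
 the ideal; a basis bounds them by \<open>basis_mod_dependence\<close> and attains the bound.\<close>

lemma intersection_mult_codim:
 assumes "has_codim (ideal2 F G) n" shows "intersection_mult F G = enat n"
proof -
 let ?I = "ideal2 F G"
 obtain h where h: "basis_mod ?I {..<n} h" using assms by (auto simp: has_codim_def)
 hence ind: "comb {..<n} c h \<in> ?I ==> j < n ==> c j = 0" for c j by (simp add: basis_mod_def)
 have inj: "inj_on h {..<n}"
 proof (rule inj_onI, rule ccontr)
  fix i j assume ij: "i \<in> {..<n}" "j \<in> {..<n}" "h i = h j" "i ~= j"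
  define c where "c = (%k. if k = i then 1 else if k = j then -1 else 0 :: complex)"
  have "comb {..<n} c h = (\<Sum>k\<in>{i, j}. germ_const (c k) * h k)"
   using ij by (intro sum.mono_neutral_right) (auto simp: c_def gc)
  also have "\<dots> = 0" using ij by (simp add: c_def gc)
  finally have "c i = 0" using ind[of c i] ij(1) ideal2_closed(1) by simp
  thus False by (simp add: c_def)
 qed
 have mult: "intersection_mult F G = Sup {enat (card S) | S. finite S \<and> (\<forall>c. comb S c id \<in> ?I --> (\<forall>s\<in>S. c s = 0))}"
  by (simp add: intersection_mult_def ideal2_iff)
 have bound: "card S <= n" if "finite S" "\<forall>c. comb S c id \<in> ?I --> (\<forall>s\<in>S. c s = 0)" for S
  using basis_mod_dependence[OF h that(1), of id] that(2) by (force simp: not_le[symmetric])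
 have "c s = 0" if "comb (h ` {..<n}) c id \<in> ?I" "s \<in> h ` {..<n}" for c s
  using ind[of "c \<circ> h"] that by (auto simp: sum.reindex[OF inj])
 thus ?thesis unfolding mult
  by (intro antisym Sup_least Sup_upper) (use bound card_image[OF inj] in \<open>auto intro!: exI[of _ "h ` {..<n}"]\<close>)
qed

lemma has_codim_0: "has_codim (ideal2 F 1) 0"
proof -
 have "H \<in> ideal2 F 1" for H unfolding ideal2_iff by (intro exI[of _ 0] exI[of _ H]) simp
 thus ?thesis by (simp add: has_codim_def basis_mod_def)
qed

text \<open>Additivity: multiplication by \<open>P\<close> induces an isomorphism from \<open>\<complex>{x, y} / (f, Q)\<close> to
 \<open>(f, P) / (f, P Q)\<close>.\<close>

lemma has_codim_mult:
 assumes P: "has_codim (ideal2 f P) m" and Q: "has_codim (ideal2 f Q) n"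
  and coprime: "!!a. P dvd a * f ==> P dvd a" and P0: "P ~= 0"
 shows "has_codim (ideal2 f (P * Q)) (m + n)"
proof -
 obtain h k where h: "basis_mod (ideal2 f P) {..<m} h" and k: "basis_mod (ideal2 f Q) {..<n} k"
  using P Q by (auto simp: has_codim_def)
 let ?J = "{..<m} <+> {..<n}" and ?h = "case_sum h (%j. P * k j)"
 have split: "comb ?J c ?h = comb {..<m} (c \<circ> Inl) h + P * comb {..<n} (c \<circ> Inr) k" for c
  by (simp add: sum.Plus sum_distrib_left mult_ac)
 have "basis_mod (ideal2 f (P * Q)) ?J ?h"
  unfolding basis_mod_def split
 proof (intro conjI allI impI)
  fix F
  obtain c a b where c: "F - comb {..<m} c h = a * f + b * P" using h unfolding basis_mod_def ideal2_iff by meson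
  obtain d a' b' where d: "b - comb {..<n} d k = a' * f + b' * Q" using k unfolding basis_mod_def ideal2_iff by meson
  have "F - (comb {..<m} c h + P * comb {..<n} d k) = a * f + P * (b - comb {..<n} d k)"
   using c by (simp add: algebra_simps)
  also have "\<dots> = (a + P * a') * f + b' * (P * Q)" unfolding d by (simp add: algebra_simps)
  finally have "F - (comb {..<m} c h + P * comb {..<n} d k) \<in> ideal2 f (P * Q)" unfolding ideal2_iff by blast
  thus "\<exists>c. F - (comb {..<m} (c \<circ> Inl) h + P * comb {..<n} (c \<circ> Inr) k) \<in> ideal2 f (P * Q)"
   by (intro exI[of _ "case_sum c d"]) simp
 next
  fix c assume "comb {..<m} (c \<circ> Inl) h + P * comb {..<n} (c \<circ> Inr) k \<in> ideal2 f (P * Q)"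
  then obtain a b where ab: "comb {..<m} (c \<circ> Inl) h + P * comb {..<n} (c \<circ> Inr) k = a * f + b * (P * Q)"
   by (auto simp: ideal2_iff)
  hence "comb {..<m} (c \<circ> Inl) h = a * f + (b * Q - comb {..<n} (c \<circ> Inr) k) * P" by (simp add: algebra_simps)
  hence "comb {..<m} (c \<circ> Inl) h \<in> ideal2 f P" unfolding ideal2_iff by blast
  hence c1: "c (Inl i) = 0" if "i < m" for i using h that by (fastforce simp: basis_mod_def)
  hence e: "a * f = P * (comb {..<n} (c \<circ> Inr) k - b * Q)" using ab by (simp add: gc algebra_simps)
  hence "P dvd a * f" by simp
  then obtain a' where a': "a = P * a'" using coprime by (auto simp: dvd_def)
  have "P * (a' * f) = P * (comb {..<n} (c \<circ> Inr) k - b * Q)" using e unfolding a' by (simp add: mult.assoc)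
  hence "a' * f = comb {..<n} (c \<circ> Inr) k - b * Q" unfolding mult_left_cancel[OF P0] .
  hence "comb {..<n} (c \<circ> Inr) k = a' * f + b * Q" by (simp add: algebra_simps)
  hence "comb {..<n} (c \<circ> Inr) k \<in> ideal2 f Q" unfolding ideal2_iff by blast
  hence "c (Inr i) = 0" if "i < n" for i using k that by (fastforce simp: basis_mod_def)
  thus "\<forall>j\<in>?J. c j = 0" using c1 by auto
 qed simp
 thus ?thesis using basis_mod_has_codim by (fastforce simp: card_Plus)
qed

text \<open>An independent set of the largest size is a basis.\<close>

lemma has_codim_exists:
 assumes bound: "!!(n::nat) h. (!!c j. comb {..<n} c h \<in> ideal2 f P ==> j < n ==> c j = 0) ==> n <= N"
 obtains k where "has_codim (ideal2 f P) k"
proof -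
 let ?ind = "%n::nat. \<exists>h. \<forall>c. comb {..<n} c h \<in> ideal2 f P --> (\<forall>j<n. c j = 0)"
 have "?ind 0" by (intro exI[of _ "%_. 0"]) auto
 moreover have "\<forall>n. ?ind n --> n <= N" using bound by blast
 ultimately obtain n where n: "?ind n" "!!m. ?ind m ==> m <= n"
  using GreatestI_nat[of ?ind 0 N] Greatest_le_nat[of ?ind _ N] by blast
 then obtain h where h: "!!c j. comb {..<n} c h \<in> ideal2 f P ==> j < n ==> c j = 0" by blast
 have "\<exists>c. F - comb {..<n} c h \<in> ideal2 f P" for F
 proof -
  have same: "comb {..<n} c (h(n := F)) = comb {..<n} c h" for c by (intro sum.cong) auto
  have "\<not> (\<forall>c. comb {..<Suc n} c (h(n := F)) \<in> ideal2 f P --> (\<forall>j<Suc n. c j = 0))"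
   using n(2)[of "Suc n"] not_less_eq_eq[of n n] by blast
  then obtain c j where c: "comb {..<n} c h + germ_const (c n) * F \<in> ideal2 f P" "j < Suc n" "c j ~= 0"
   using same by auto
  have cn: "c n ~= 0"
  proof
   assume z: "c n = 0"
   hence "comb {..<n} c h \<in> ideal2 f P" using c(1) by (simp add: gc)
   thus False using h[of c j] c(2,3) z by (auto simp: less_Suc_eq)
  qed
  have "germ_const (1 / c n) * (comb {..<n} c h + germ_const (c n) * F) = F - comb {..<n} (%j. - c j / c n) h"
   using cn by (simp add: distrib_left sum_distrib_left mult.assoc[symmetric] gc(2)[symmetric] gc(3) gc(5) sum_negf)
  thus ?thesis using ideal2_closed(4)[OF c(1), of "germ_const (1 / c n)"] by (intro exI[of _ "%j. - c j / c n"]) simp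
 qed
 hence "basis_mod (ideal2 f P) {..<n} h" using h by (auto simp: basis_mod_def)
 thus ?thesis using that by (auto simp: has_codim_def)
qed

section \<open>Intersection multiplicity with a product of smooth branches\<close>

lemma germ_const_embed: "emb (germ_const c) = fps_const (ymonom 0 c)"
proof (rule fps_ext)
 fix i
 have "of_fps (fps_const c) = ymonom 0 c"
  by (rule puiseux_eqI) (auto simp: puiseux_of_fps.rep_eq pcoeff_ymonom elim!: Nats_cases)
 thus "(emb (germ_const c)) $ i = (fps_const (ymonom 0 c)) $ i"
  by (simp add: germ_embed_alt germ_const.rep_eq ring_mapD[OF ring_map_puiseux_of_fps])
qed

lemma germ_eval_const: "pos_arc xi ==> germ_eval (germ_const c) xi = ymonom 0 c"
 by (intro germ_evalI) (auto simp: germ_const_embed has_value_const)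

text \<open>For an arc with integer exponents, division with remainder by \<open>x - ga\<close> stays in \<open>\<complex>{x, y}\<close>.\<close>

lemma germ_divide_linear:
 assumes l: "emb l = lin ga" and pos: "pos_arc ga"
 obtains a g where "conv_series a" "F = Abs_germ (fps_const a) + l * g" "germ_eval F ga = of_fps a"
proof -
 let ?e = "coeff_map of_fps"
 note rg = ring_mapD[OF ring_map_coeff_map[OF ring_map_galois]]
 note re = ring_mapD[OF ring_map_coeff_map[OF ring_map_puiseux_of_fps]]
 have inj: "S = T" if e: "?e S = ?e T" for S T
 proof (intro fps_ext[of S] injD[OF inj_puiseux_of_fps])
  show "of_fps (S $ i) = of_fps (T $ i)" for i
   using arg_cong[OF e, of "%F. F $ i"] by simp
 qed
 have lin: "lin (galois ga) = lin ga"
  using galois_germ_embed[of l] unfolding l coeff_map_linear[OF ring_map_galois] .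
 hence gg: "galois ga = ga" using arg_cong[OF lin, of "%F. F $ 0"] by simp
 hence gv: "galois (germ_eval F ga) = germ_eval F ga" using germ_eval_galois[OF pos, of F] by simp
 define c where "c = root_fps 1 ga"
 define a where "a = root_fps 1 (germ_eval F ga)"
 have c: "of_fps c = ga" and a: "of_fps a = germ_eval F ga"
  unfolding c_def a_def by (rule galois_fixed_arc[OF gg] galois_fixed_arc[OF gv])+
 have sl: "series l = fps_X - fps_const c"
  using l by (intro inj) (simp add: germ_embed_alt coeff_map_linear[OF ring_map_puiseux_of_fps] c)
 have cc: "conv_series c" using convergent2_minus[OF convergent2_X] series[of l] by (force simp: sl)
 have c0: "c $ 0 = 0" using pos by (simp add: c_def root_fps_def pos_arc_iff)
 obtain G where G: "emb F - fps_const (germ_eval F ga) = lin ga * G"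
  using has_value_germ[OF pos, of F] by (auto simp: has_value_def)
 have "lin ga * coeff_map galois G = coeff_map galois (emb F - fps_const (germ_eval F ga))"
  unfolding G rg(2) coeff_map_linear[OF ring_map_galois] gg ..
 also have "\<dots> = lin ga * G"
  unfolding rg(6) galois_germ_embed coeff_map_const[OF ring_map_galois] gv by (rule G)
 finally have "coeff_map galois G = G" unfolding mult_left_cancel[OF linear_factor_neq_0] .
 then obtain g where g: "G = ?e g" using galois_fixed_series[of G] by metis
 have eq: "series F = fps_const a + (fps_X - fps_const c) * g"
 proof (rule inj)
  have "?e (series F) = fps_const (germ_eval F ga) + lin ga * G"
   using G by (simp add: germ_embed_alt algebra_simps)
  thus "?e (series F) = ?e (fps_const a + (fps_X - fps_const c) * g)"
   unfolding re(1) re(2) coeff_map_linear[OF ring_map_puiseux_of_fps] coeff_map_const[OF ring_map_puiseux_of_fps] a c g .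
 qed
 have "conv2 (fps_const a + (fps_X - fps_const c) * g)" using series[of F] eq by simp
 from convergent2_divide_linear[OF cc c0 this] have conv: "conv2 g" "conv_series a" by auto
 hence "F = Abs_germ (fps_const a) + l * Abs_germ g"
  using eq by (simp add: series_inject[symmetric] plus_germ.rep_eq times_germ.rep_eq Abs_germ_inverse sl)
 thus ?thesis using that conv(2) a by metis
qed

lemma linear_dvd_iff:
 assumes l: "emb l = lin ga" and pos: "pos_arc ga"
 shows "l dvd F \<longleftrightarrow> germ_eval F ga = 0"
proof
 assume "germ_eval F ga = 0"
 moreover obtain a g where a: "F = Abs_germ (fps_const a) + l * g" "germ_eval F ga = of_fps a"
  using germ_divide_linear[OF l pos] by metis
 ultimately have "of_fps a = of_fps 0" using ring_mapD(4)[OF ring_map_puiseux_of_fps] by simp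
 hence "a = 0" by (rule injD[OF inj_puiseux_of_fps])
 moreover have "Abs_germ (fps_const 0) = 0" by (simp add: zero_germ_def)
 ultimately show "l dvd F" using a by simp
next
 assume "l dvd F"
 then obtain g where "F = l * g" by (auto simp: dvd_def)
 moreover have "germ_eval l ga = 0" using germ_eval_zero_iff[OF pos, of l] l by simp
 ultimately show "germ_eval F ga = 0" using pos by (simp add: germ_eval_simps)
qed

lemma series_y_power: "series (germ_y ^ v) = fps_const (fps_X ^ v)"
 by (induction v) (simp_all add: one_germ.rep_eq times_germ.rep_eq germ_y.rep_eq)

text \<open>Substituting \<open>ga\<close> identifies the quotient by \<open>l\<close> with \<open>\<complex>{y}\<close>, where \<open>f\<close> becomes a unit times
 \<open>y\<^sup>v\<close>; hence the powers \<open>y\<^sup>i\<close>, \<open>i < v\<close>, form a basis.\<close>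

lemma codim_linear:
 assumes l: "emb l = lin ga" and pos: "pos_arc ga"
  and v: "yord (germ_eval f ga) = Fin (of_nat v)"
 shows "has_codim (ideal2 f l) v"
proof -
 have l0: "germ_eval l ga = 0" using germ_eval_zero_iff[OF pos, of l] l by simp
 have "germ_eval (sum h A) ga = (\<Sum>i\<in>A. germ_eval (h i) ga)" for h :: "nat => germ" and A
  by (induction A rule: infinite_finite_induct) (auto simp: germ_eval_simps[OF pos])
 hence ev: "pcoeff (germ_eval (comb {..<v} c (%i. germ_y ^ i)) ga) (of_nat j) = (if j < v then c j else 0)" for c j
  by (simp add: germ_eval_simps[OF pos] germ_eval_const[OF pos] germ_eval_y[OF pos] pcoeff_sum pcoeff_ymonom_times
    ymonom_power pcoeff_ymonom if_distrib[of "%x. _ * x"] cong: if_cong)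
 have factor: "\<exists>e g. F = germ_y ^ v * e + l * g \<and> germ_at_origin e = pcoeff (germ_eval F ga) (of_nat v)"
  if z: "\<forall>i<v. pcoeff (germ_eval F ga) (of_nat i) = 0" for F
 proof -
  obtain a g where a: "conv_series a" "F = Abs_germ (fps_const a) + l * g" "germ_eval F ga = of_fps a"
   using germ_divide_linear[OF l pos] by blast
  have "a = fps_X ^ v * fps_shift v a"
   using z by (intro fps_ext) (auto simp: fps_X_power_mult_nth a(3) pcoeff_puiseux_of_fps)
  hence "fps_const a = fps_const (fps_X ^ v) * fps_const (fps_shift v a)" by simp
  hence "Abs_germ (fps_const a) = germ_y ^ v * Abs_germ (fps_const (fps_shift v a))"
   using conv_series_shift[OF a(1), of v] a(1)
   by (simp add: series_inject[symmetric] times_germ.rep_eq Abs_germ_inverse series_y_power del: fps_const_mult)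
  moreover have "germ_at_origin (Abs_germ (fps_const (fps_shift v a))) = pcoeff (germ_eval F ga) (of_nat v)"
   using conv_series_shift[OF a(1), of v] by (simp add: germ_at_origin_def Abs_germ_inverse a(3) pcoeff_puiseux_of_fps)
  ultimately show ?thesis using a(2) by metis
 qed
 obtain c where c: "c ~= 0" "lead_term (of_nat v) c (germ_eval f ga)" using v yord_eq_Fin by blast
 obtain ef gf where ef: "f = germ_y ^ v * ef + l * gf" "germ_at_origin ef ~= 0"
  using factor[of f] c by (auto simp: lead_term_def)
 obtain uf where uf: "ef * uf = 1" using germ_unit[OF ef(2)] by (auto simp: dvd_def)
 have "basis_mod (ideal2 f l) {..<v} (%i. germ_y ^ i)"
  unfolding basis_mod_def
 proof (intro conjI allI impI ballI)
  fix F
  let ?G = "F - comb {..<v} (%i. pcoeff (germ_eval F ga) (of_nat i)) (%i. germ_y ^ i)"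
  obtain e g where e: "?G = germ_y ^ v * e + l * g"
   using factor[of ?G] ev by (auto simp: germ_eval_simps[OF pos] pcoeff_simps)
  have "(e * uf) * f + (g - e * uf * gf) * l = e * (ef * uf) * germ_y ^ v + l * g"
   unfolding ef(1) by (simp add: algebra_simps)
  hence "?G = (e * uf) * f + (g - e * uf * gf) * l" unfolding e uf by (simp add: mult_ac)
  hence "?G \<in> ideal2 f l" unfolding ideal2_iff by blast
  thus "\<exists>c. F - comb {..<v} c (%i. germ_y ^ i) \<in> ideal2 f l"
   by (rule exI[of _ "%i. pcoeff (germ_eval F ga) (of_nat i)"])
 next
  fix c j assume "comb {..<v} c (%i. germ_y ^ i) \<in> ideal2 f l" and j: "j \<in> {..<v}"
  then obtain a b where "comb {..<v} c (%i. germ_y ^ i) = a * f + b * l" by (auto simp: ideal2_iff)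
  hence s: "germ_eval (comb {..<v} c (%i. germ_y ^ i)) ga = germ_eval a ga * germ_eval f ga"
   using l0 by (simp add: germ_eval_simps[OF pos])
  have "Fin (0 + of_nat v) <= yord (germ_eval a ga * germ_eval f ga)"
   using yord_mult_ge[OF yord_nonneg[of "germ_eval a ga"], of "of_nat v" "germ_eval f ga"] v by simp
  hence "pcoeff (germ_eval (comb {..<v} c (%i. germ_y ^ i)) ga) (of_nat j) = 0"
   using j unfolding s yord_ge_iff by simp
  thus "c j = 0" using j by (simp add: ev)
 qed simp
 thus ?thesis by (auto simp: has_codim_def)
qed

lemma codim_product:
 assumes "finite S" "!!ga. ga \<in> S ==> pos_arc ga \<and> emb (l ga) = lin ga \<and> yord (germ_eval f ga) = Fin (of_nat (v ga))"
 shows "has_codim (ideal2 f (\<Prod>ga\<in>S. l ga ^ m ga)) (\<Sum>ga\<in>S. m ga * v ga)"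
 using assms
proof (induction S rule: finite_induct)
 case empty
 thus ?case by (simp add: has_codim_0)
next
 case (insert ga S)
 have g: "pos_arc ga" "emb (l ga) = lin ga" "yord (germ_eval f ga) = Fin (of_nat (v ga))"
  using insert.prems by auto
 have l0: "l ga ~= 0" using g(2) linear_factor_neq_0[of ga] germ_embed_simps(4) by metis
 have f0: "germ_eval f ga ~= 0" using g(3) by auto
 have "has_codim (ideal2 f (l ga ^ k * (\<Prod>ga\<in>S. l ga ^ m ga))) (k * v ga + (\<Sum>ga\<in>S. m ga * v ga))" for k
 proof (induction k)
  case 0
  thus ?case using insert.IH insert.prems by simp
 next
  case (Suc k)
  have "has_codim (ideal2 f (l ga * (l ga ^ k * (\<Prod>ga\<in>S. l ga ^ m ga)))) (v ga + (k * v ga + (\<Sum>ga\<in>S. m ga * v ga)))"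
  proof (rule has_codim_mult[OF codim_linear[OF g(2,1,3)] Suc _ l0])
   fix a assume "l ga dvd a * f"
   thus "l ga dvd a" using f0 by (simp add: linear_dvd_iff[OF g(2,1)] germ_eval_simps[OF g(1)])
  qed
  thus ?case by (simp add: mult.assoc add.assoc)
 qed
 from this[of "m ga"] show ?case using insert.hyps by simp
qed


section \<open>Descent along a ramification\<close>

text \<open>The components of \<open>F\<close> with respect to the basis \<open>1, t, \<dots>, t\<^sup>n\<^sup>-\<^sup>1\<close> of the series in \<open>t\<close> over
 those in \<open>y = t\<^sup>n\<close>.\<close>

definition comp :: "nat => nat => germ => germ" where
 "comp n i F = Abs_germ (coeff_map (%a. Abs_fps (%k. a $ (n * k + i))) (series F))"

lemma series_comp: "series (comp n i F) = coeff_map (%a. Abs_fps (%k. a $ (n * k + i))) (series F)"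
proof -
 obtain C R where CR: "R > 0" "C \<ge> 0" "!!i j. norm (((series F) $ i) $ j) <= C * R ^ (i + j)"
  using convergent2_common_bound series[of F] by (metis mem_Collect_eq)
 have "norm (((series F) $ x) $ (n * k + i)) <= (C * max 1 R ^ i) * (max 1 R ^ (n + 1)) ^ (x + k)" for x k
 proof -
  have "norm (((series F) $ x) $ (n * k + i)) <= C * max 1 R ^ (x + (n * k + i))"
   using CR by (intro order_trans[OF CR(3)] mult_left_mono power_mono) auto
  also have "\<dots> <= C * max 1 R ^ (i + (n + 1) * (x + k))"
   using CR by (intro mult_left_mono power_increasing) (auto simp: algebra_simps)
  also have "\<dots> = (C * max 1 R ^ i) * (max 1 R ^ (n + 1)) ^ (x + k)"
   by (simp only: power_add power_mult mult.assoc)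
  finally show ?thesis .
 qed
 hence "conv2 (coeff_map (%a. Abs_fps (%k. a $ (n * k + i))) (series F))"
  by (intro convergent2I[of "max 1 R ^ (n + 1)" _ "C * max 1 R ^ i"]) auto
 thus ?thesis by (simp add: comp_def Abs_germ_inverse)
qed

lemma comp_nth: "fps_nth ((series (comp n i F)) $ x) k = ((series F) $ x) $ (n * k + i)"
 by (simp add: series_comp)

lemma germ_eqI: "(!!x k. ((series F) $ x) $ k = ((series G) $ x) $ k) ==> F = G"
 by (simp add: series_inject[symmetric] fps_eq_iff)

lemma comp_add: "comp n i (F + G) = comp n i F + comp n i G"
 by (rule germ_eqI) (simp add: comp_nth plus_germ.rep_eq)

lemma ramify_simps:
 assumes "n > 0"
 shows "ramify n (F + G) = ramify n F + ramify n G" "ramify n (F * G) = ramify n F * ramify n G"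
  "ramify n (germ_const c) = germ_const c" "ramify n 1 = 1" "ramify n (prod h A) = (\<Prod>x\<in>A. ramify n (h x))"
  "ramify n (F ^ k) = ramify n F ^ k"
proof -
 note r = ring_mapD[OF ring_map_coeff_map[OF ring_map_ysub[OF assms]]]
 have rm: "ring_map (ramify n)"
  unfolding ring_map_def
  by (intro conjI allI; subst germ_embed_inject[symmetric])
   (simp_all only: germ_embed_ramify[OF assms] germ_embed_simps r)
 show "ramify n (F + G) = ramify n F + ramify n G" "ramify n (F * G) = ramify n F * ramify n G"
  "ramify n 1 = 1" "ramify n (prod h A) = (\<Prod>x\<in>A. ramify n (h x))" "ramify n (F ^ k) = ramify n F ^ k"
  by (rule ring_mapD[OF rm])+
 show "ramify n (germ_const c) = germ_const c"
  by (rule germ_eqI) (use assms in \<open>auto simp: series_ramify germ_const.rep_eq ramify_series_def\<close>)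
qed

lemma comp_decomposition:
 assumes "n > 0" shows "F = (\<Sum>i<n. germ_y ^ i * ramify n (comp n i F))"
proof (rule germ_eqI)
 fix x k
 have ssum: "series (sum h A) = (\<Sum>i\<in>A. series (h i))" for h and A :: "nat set"
  by (induction A rule: infinite_finite_induct) (auto simp: zero_germ.rep_eq plus_germ.rep_eq)
 have "fps_nth (fps_nth (series (\<Sum>i<n. germ_y ^ i * ramify n (comp n i F))) x) k =
  (\<Sum>i<n. if i <= k \<and> n dvd k - i then fps_nth ((series F) $ x) (n * ((k - i) div n) + i) else 0)"
  unfolding ssum fps_sum_nth times_germ.rep_eq series_y_power series_ramify[OF assms]
  by (intro sum.cong) (auto simp: fps_X_power_mult_nth ramify_series_def comp_nth)
 also have "\<dots> = (\<Sum>i<n. if i = k mod n then ((series F) $ x) $ k else 0)"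
 proof (intro sum.cong refl)
  fix i assume i: "i \<in> {..<n}"
  have "(i <= k \<and> n dvd k - i) \<longleftrightarrow> i = k mod n"
   using i by (metis assms lessThan_iff mod_eq_dvd_iff_nat mod_less mod_less_eq_dividend)
  thus "(if i <= k \<and> n dvd k - i then fps_nth ((series F) $ x) (n * ((k - i) div n) + i) else 0) =
    (if i = k mod n then ((series F) $ x) $ k else 0)" by auto
 qed
 also have "\<dots> = ((series F) $ x) $ k" using assms by simp
 finally show "((series F) $ x) $ k =
   fps_nth (fps_nth (series (\<Sum>i<n. germ_y ^ i * ramify n (comp n i F))) x) k" ..
qed

lemma comp_sum: "comp n i (sum h A) = (\<Sum>j\<in>A. comp n i (h j))"
proof -
 have "comp n i 0 = 0" by (rule germ_eqI) (simp add: comp_nth zero_germ.rep_eq)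
 thus ?thesis by (induction A rule: infinite_finite_induct) (auto simp: comp_add)
qed

lemma comp_y_ramify:
 assumes "i < n" "j < n" shows "comp n i (germ_y ^ j * ramify n F) = (if i = j then F else 0)"
proof (rule germ_eqI)
 fix x k
 have "j <= n * k + i \<and> n dvd n * k + i - j \<longleftrightarrow> i = j"
 proof
  assume a: "j <= n * k + i \<and> n dvd n * k + i - j"
  hence "(n * k + i) mod n = j mod n" using mod_eq_dvd_iff_nat[of j "n * k + i" n] by blast
  thus "i = j" using assms by simp
 qed auto
 thus "fps_nth (fps_nth (series (comp n i (germ_y ^ j * ramify n F))) x) k =
   fps_nth ((series (if i = j then F else 0)) $ x) k"
  using assms by (auto simp: comp_nth times_germ.rep_eq series_y_power series_ramify fps_X_power_mult_nth
    ramify_series_def zero_germ.rep_eq)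
qed

lemma comp_ramify_mult:
 assumes "i < n" shows "comp n i (ramify n F * G) = F * comp n i G"
proof -
 have n: "n > 0" using assms by simp
 have "ramify n F * G = (\<Sum>j<n. germ_y ^ j * ramify n (F * comp n j G))"
  by (subst comp_decomposition[OF n, of G]) (simp add: sum_distrib_left ramify_simps[OF n] mult_ac)
 hence "comp n i (ramify n F * G) = (\<Sum>j<n. if i = j then F * comp n j G else 0)"
  using assms by (simp add: comp_sum comp_y_ramify)
 thus ?thesis using assms by simp
qed

text \<open>The ring of series in \<open>x\<close> and \<open>t\<close>, \<open>t\<^sup>n = y\<close>, is free over \<open>\<complex>{x, y}\<close> with basis
 \<open>1, t, \<dots>, t\<^sup>n\<^sup>-\<^sup>1\<close>; hence codimensions are multiplied by \<open>n\<close>.\<close>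

lemma codim_ramify:
 assumes n: "n > 0" and N: "has_codim (ideal2 (ramify n f) (ramify n P)) N"
 obtains k where "has_codim (ideal2 f P) k" "N = n * k"
proof -
 let ?J = "ideal2 (ramify n f) (ramify n P)" and ?I = "ideal2 f P"
 have J_comp: "H \<in> ?J \<longleftrightarrow> (\<forall>i<n. comp n i H \<in> ideal2 f P)" for H
 proof
  assume "H \<in> ?J"
  then obtain A B where H: "H = ramify n f * A + ramify n P * B" by (auto simp: ideal2_iff mult.commute)
  have "comp n i H = comp n i A * f + comp n i B * P" if "i < n" for i
   unfolding H comp_add comp_ramify_mult[OF that] by (simp add: mult.commute)
  thus "\<forall>i<n. comp n i H \<in> ideal2 f P" unfolding ideal2_iff by blast
 next
  assume "\<forall>i<n. comp n i H \<in> ideal2 f P"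
  then obtain A B where AB: "!!i. i < n ==> comp n i H = A i * f + B i * P" unfolding ideal2_iff by metis
  have "H = (\<Sum>i<n. germ_y ^ i * ramify n (comp n i H))" by (rule comp_decomposition[OF n])
  also have "\<dots> = (\<Sum>i<n. germ_y ^ i * ramify n (A i) * ramify n f + germ_y ^ i * ramify n (B i) * ramify n P)"
   using AB by (intro sum.cong) (auto simp: ramify_simps[OF n] algebra_simps)
  also have "\<dots> = (\<Sum>i<n. germ_y ^ i * ramify n (A i)) * ramify n f + (\<Sum>i<n. germ_y ^ i * ramify n (B i)) * ramify n P"
   by (simp add: sum.distrib sum_distrib_right)
  finally show "H \<in> ?J" unfolding ideal2_iff by blast
 qed
 have cc: "comp n i (comb S c h) = comb S c (%s. comp n i (h s))" if "i < n" for i c S and h :: "'s => germ"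
  unfolding comp_sum using comp_ramify_mult[OF that, of "germ_const _"] by (simp add: ramify_simps[OF n])
 have c0: "comp n i (ramify n F) = (if i = 0 then F else 0)" if "i < n" for i F
  using comp_y_ramify[OF that n, of F] by simp
 obtain h where h: "basis_mod ?J {..<N} h" using N by (auto simp: has_codim_def)
 obtain k where k: "has_codim ?I k"
 proof (rule has_codim_exists)
  fix m and e :: "nat => germ" assume ind: "!!c j. comb {..<m} c e \<in> ?I ==> j < m ==> c j = 0"
  show "m <= N"
  proof (rule ccontr)
   assume "\<not> m <= N"
   then obtain c where c: "\<exists>j<m. c j ~= 0" "comb {..<m} c (%j. ramify n (e j)) \<in> ?J"
    using basis_mod_dependence[OF h, of "{..<m}" "%j. ramify n (e j)"] by fastforce
   hence "comp n 0 (comb {..<m} c (%j. ramify n (e j))) \<in> ?I" using J_comp n by blast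
   hence "comb {..<m} c e \<in> ?I" by (simp add: cc[OF n] c0[OF n])
   thus False using ind c(1) by blast
  qed
 qed (rule that)
 obtain e where e: "basis_mod ?I {..<k} e" using k by (auto simp: has_codim_def)
 let ?K = "{..<n} \<times> {..<k}" and ?h = "%(i, j). germ_y ^ i * ramify n (e j)"
 have ck: "comp n i (comb ?K c ?h) = comb {..<k} (%j. c (i, j)) e" if i: "i < n" for i c
 proof -
  have "comp n i (comb ?K c ?h) = (\<Sum>i'<n. \<Sum>j<k. if i = i' then germ_const (c (i', j)) * e j else 0)"
   unfolding cc[OF i] sum.cartesian_product by (intro sum.cong) (auto simp: comp_y_ramify i)
  also have "\<dots> = (\<Sum>i'<n. if i = i' then comb {..<k} (%j. c (i', j)) e else 0)" by (intro sum.cong) auto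
  finally show ?thesis using i by simp
 qed
 have "basis_mod ?J ?K ?h"
  unfolding basis_mod_def
 proof (intro conjI allI impI)
  fix H
  have "\<exists>c. comp n i H - comb {..<k} c e \<in> ?I" for i using e by (simp add: basis_mod_def)
  then obtain c where c: "!!i. comp n i H - comb {..<k} (c i) e \<in> ?I" by metis
  have sub: "comp n i (F - G) = comp n i F - comp n i G" for i F G
   using comp_add[of n i "F - G" G] by simp
  have "comp n i (H - comb ?K (%(i, j). c i j) ?h) \<in> ?I" if "i < n" for i
   using c[of i] by (simp only: sub ck[OF that] prod.case)
  hence "H - comb ?K (%(i, j). c i j) ?h \<in> ?J" using J_comp by blast
  thus "\<exists>c. H - comb ?K c ?h \<in> ?J" by (rule exI[of _ "%(i, j). c i j"])
 next
  fix c assume H: "comb ?K c ?h \<in> ?J"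
  have "comb {..<k} (%j. c (i, j)) e \<in> ?I" if "i < n" for i
   using H that unfolding J_comp ck[OF that, symmetric] by blast
  moreover have "c' j = 0" if "comb {..<k} c' e \<in> ?I" "j < k" for c' j using e that by (simp add: basis_mod_def)
  ultimately have "c (i, j) = 0" if "i < n" "j < k" for i j using that by metis
  thus "\<forall>j\<in>?K. c j = 0" by auto
 qed simp
 hence "has_codim ?J (n * k)" using basis_mod_has_codim by (fastforce simp: card_cartesian_product)
 hence "enat N = enat (n * k)" using intersection_mult_codim N by metis
 thus ?thesis using that k by simp
qed

text \<open>After the substitution \<open>y \<mapsto> y\<^sup>n\<close> all roots have integer exponents and \<open>codim_product\<close>
 applies; the codimension and the orders are both multiplied by \<open>n\<close>.\<close>

theorem intersection_mult_by_roots: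
 assumes P: "emb P = (\<Prod>ga\<in>S. lin ga ^ m ga)" and S: "finite S"
  and roots: "!!ga. ga \<in> S ==> pos_arc ga \<and> conv (lin ga) \<and> yord (germ_eval f ga) = Fin (v ga)"
 shows "has_intersection_mult f P (\<Sum>ga\<in>S. of_nat (m ga) * v ga)"
proof -
 have "\<exists>n>0. \<forall>ga\<in>S. coeff_map (ysub n) (lin ga) \<in> range emb"
  using S roots
 proof (induction S rule: finite_induct)
  case (insert ga S)
  then obtain n where n: "n > 0" "\<forall>ga\<in>S. coeff_map (ysub n) (lin ga) \<in> range emb" by auto
  obtain k where k: "k > 0" "coeff_map (ysub k) (lin ga) \<in> range emb"
   using insert.prems[of ga] by (auto simp: conv_def)
  have "coeff_map (ysub (n * k)) (lin de) \<in> range emb" if d: "de \<in> insert ga S" for de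
  proof (cases "de = ga")
   case True
   thus ?thesis using conv_multiple[OF k(1) n(1) k(2)] by (simp add: mult.commute)
  next
   case False
   thus ?thesis using conv_multiple[OF n(1) k(1)] n(2) d by blast
  qed
  thus ?case using n k by (intro exI[of _ "n * k"]) auto
 qed auto
 then obtain n where n: "n > 0" "!!ga. ga \<in> S ==> coeff_map (ysub n) (lin ga) \<in> range emb" by blast
 define T where "T = ysub n ` S"
 have inj: "inj_on (ysub n) S" using ysub_inject[OF n(1)] by (auto simp: inj_on_def)
 define bk where "bk = the_inv_into S (ysub n)"
 have bk: "bk (ysub n ga) = ga" if "ga \<in> S" for ga using the_inv_into_f_f[OF inj that] by (simp add: bk_def)
 define l where "l = (%de. inv emb (lin de))"
 have l: "emb (l de) = lin de" if d: "de \<in> T" for de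
 proof -
  obtain ga where "ga \<in> S" "de = ysub n ga" using d by (auto simp: T_def)
  hence "lin de \<in> range emb"
   using n(2)[of ga] coeff_map_linear[OF ring_map_ysub[OF n(1)]] by simp
  thus ?thesis unfolding l_def by (rule f_inv_into_f)
 qed
 have pos: "pos_arc (ysub n ga)" if "pos_arc ga" for ga
  using that n(1) by (simp add: pos_arc_iff ysub.rep_eq)
 have ev: "germ_eval (ramify n f) (ysub n ga) = ysub n (germ_eval f ga)" if "pos_arc ga" for ga
  using has_value_map[OF ring_map_ysub[OF n(1)] has_value_germ[OF that, of f]]
  by (intro germ_evalI pos that) (simp add: germ_embed_ramify[OF n(1)])
 have vn: "\<exists>k::nat. of_nat n * v ga = of_nat k" if g: "ga \<in> S" for ga
 proof -
  have yo: "yord (germ_eval (ramify n f) (ysub n ga)) = Fin (of_nat n * v ga)"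
   using roots[OF g] ev yord_ysub[OF n(1)] by simp
  have "ysub n ga \<in> T" using g by (simp add: T_def)
  then obtain a where "germ_eval (ramify n f) (ysub n ga) = of_fps a"
   using germ_divide_linear[OF l] pos roots[OF g] by metis
  with yo have "pcoeff (of_fps a) (of_nat n * v ga) ~= 0"
   by (auto simp: yord_eq_Fin lead_term_def)
  thus ?thesis using pcoeff_puiseux_of_fps_not by (metis Nats_cases)
 qed
 then obtain w where w: "!!ga. ga \<in> S ==> of_nat n * v ga = of_nat (w ga)" by metis
 have "has_codim (ideal2 (ramify n f) (\<Prod>de\<in>T. l de ^ m (bk de))) (\<Sum>de\<in>T. m (bk de) * w (bk de))"
 proof (rule codim_product)
  show "finite T" using S by (simp add: T_def)
  fix de assume "de \<in> T"
  then obtain ga where g: "ga \<in> S" "de = ysub n ga" by (auto simp: T_def)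
  have "yord (germ_eval (ramify n f) de) = Fin (of_nat n * v ga)"
   using roots[OF g(1)] ev yord_ysub[OF n(1)] g(2) by simp
  thus "pos_arc de \<and> emb (l de) = lin de \<and> yord (germ_eval (ramify n f) de) = Fin (of_nat (w (bk de)))"
   using g bk w pos roots l[OF \<open>de \<in> T\<close>] by simp
 qed
 moreover have "(\<Prod>de\<in>T. l de ^ m (bk de)) = ramify n P"
 proof -
  have "emb (\<Prod>de\<in>T. l de ^ m (bk de)) = (\<Prod>de\<in>T. lin de ^ m (bk de))"
   using l by (simp add: germ_embed_simps)
  also have "\<dots> = (\<Prod>ga\<in>S. lin (ysub n ga) ^ m ga)"
   unfolding T_def by (subst prod.reindex[OF inj]) (simp add: bk)
  also have "\<dots> = coeff_map (ysub n) (emb P)"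
   unfolding P ring_mapD(8,9)[OF ring_map_coeff_map[OF ring_map_ysub[OF n(1)]]]
    coeff_map_linear[OF ring_map_ysub[OF n(1)]] ..
  finally show ?thesis by (simp add: germ_embed_ramify[OF n(1), symmetric] germ_embed_inject)
 qed
 moreover have "(\<Sum>de\<in>T. m (bk de) * w (bk de)) = (\<Sum>ga\<in>S. m ga * w ga)"
  unfolding T_def by (subst sum.reindex[OF inj]) (simp add: bk)
 ultimately obtain k where k: "has_codim (ideal2 f P) k" "(\<Sum>ga\<in>S. m ga * w ga) = n * k"
  using codim_ramify[OF n(1), of f P] by metis
 have "of_nat n * of_nat k = (\<Sum>ga\<in>S. of_nat (m ga) * (of_nat n * v ga))"
  using arg_cong[OF k(2), of "of_nat :: nat => rat"] w by simp
 also have "\<dots> = of_nat n * (\<Sum>ga\<in>S. of_nat (m ga) * v ga)" by (simp add: sum_distrib_left mult_ac)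
 finally have "of_nat k = (\<Sum>ga\<in>S. of_nat (m ga) * v ga)" using n(1) by simp
 thus ?thesis unfolding has_intersection_mult_def using intersection_mult_codim[OF k(1)] by blast
qed

section \<open>Leading terms along a family of arcs\<close>

text \<open>For a root \<open>ga\<close> and the arcs \<open>si + z y\<^sup>h\<close>, the difference \<open>si + z y\<^sup>h - ga\<close> has the order
 \<open>cap h O(ga, si)\<close>, and its leading coefficient is a polynomial in \<open>z\<close>, which is linear if
 \<open>O(ga, si) \<ge> h\<close> and a nonzero constant otherwise.\<close>

definition cap :: "rat => rat extended => rat" where
 "cap h e = (case e of Fin r => min r h | _ => h)"

definition reaches :: "puiseux => rat => puiseux => bool" where
 "reaches si h ga \<longleftrightarrow> Fin h <= contact ga si"

definition lead_poly :: "puiseux => rat => puiseux => complex poly" where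
 "lead_poly si h ga = (if reaches si h ga then [:- pcoeff (ga - si) h, 1:]
  else [:pcoeff (si - ga) (cap h (contact ga si)):])"

definition arrives :: "puiseux => rat => complex => puiseux => bool" where
 "arrives si h a ga \<longleftrightarrow> Fin h < yord (ga - (si + ymonom h a))"

lemma arrives_iff:
 assumes "h \<ge> 0" shows "arrives si h a ga \<longleftrightarrow> reaches si h ga \<and> pcoeff (ga - si) h = a"
 using assms unfolding arrives_def reaches_def yord_gt_iff yord_ge_iff lead_term_def
 by (auto simp: pcoeff_ymonom algebra_simps)

lemma cap_reaches: "reaches si h ga ==> cap h (contact ga si) = h"
 by (cases "contact ga si") (auto simp: reaches_def cap_def)

lemma not_reaches_cases:
 assumes "\<not> reaches si h ga"
 obtains r where "contact ga si = Fin r" "r < h" "cap h (contact ga si) = r"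
  "lead_term r (pcoeff (si - ga) r) (si - ga)" "pcoeff (si - ga) r ~= 0"
proof (cases "ga - si" rule: yord_cases)
 case 1
 thus ?thesis using assms by (simp add: reaches_def)
next
 case (2 r c)
 hence "r < h" using assms by (simp add: reaches_def)
 moreover have s: "pcoeff (si - ga) t = - pcoeff (ga - si) t" for t by simp
 have "lead_term r (pcoeff (si - ga) r) (si - ga)" "pcoeff (si - ga) r ~= 0"
  using 2(2,3) unfolding lead_term_def by (simp_all only: s neg_equal_0_iff_equal simp_thms) blast+
 ultimately show ?thesis using that[of r] 2(4) by (simp add: cap_def)
qed

lemma lead_poly_neq_0: "lead_poly si h ga ~= 0"
proof (cases "reaches si h ga")
 case False
 then obtain r where "cap h (contact ga si) = r" "pcoeff (si - ga) r ~= 0" by (rule not_reaches_cases)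
 thus ?thesis using False by (simp add: lead_poly_def)
qed (simp add: lead_poly_def)

lemma lead_term_difference:
 assumes "h \<ge> 0"
 shows "lead_term (cap h (contact ga si)) (poly (lead_poly si h ga) z) (si + ymonom h z - ga)"
proof (cases "reaches si h ga")
 case True
 hence "\<forall>s<h. pcoeff (ga - si) s = 0" by (simp add: reaches_def yord_ge_iff)
 thus ?thesis using True assms
  by (auto simp: cap_reaches lead_poly_def lead_term_def pcoeff_ymonom)
next
 case False
 then obtain r where r: "r < h" "cap h (contact ga si) = r" "lead_term r (pcoeff (si - ga) r) (si - ga)"
  by (rule not_reaches_cases)
 have "lead_term r (pcoeff (si - ga) r + 0) ((si - ga) + ymonom h z)"
  by (rule lead_term_add[OF r(3) lead_term_less[OF lead_term_ymonom[OF assms] r(1)]])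
 thus ?thesis using False r(2) by (simp add: lead_poly_def algebra_simps)
qed

lemma lead_term_difference_deriv:
 assumes "h \<ge> 0"
 shows "lead_term (cap h (contact ga si)) (poly (pderiv (lead_poly si h ga)) z) (ymonom h 1)"
proof (cases "reaches si h ga")
 case True
 thus ?thesis using lead_term_ymonom[OF assms, of 1] by (simp add: cap_reaches lead_poly_def pderiv_pCons)
next
 case False
 then obtain r where "r < h" "cap h (contact ga si) = r" by (rule not_reaches_cases)
 thus ?thesis using False lead_term_less[OF lead_term_ymonom[OF assms, of 1]]
  by (simp add: lead_poly_def pderiv_pCons)
qed

definition lead_prod :: "complex => puiseux => rat => (puiseux => nat) => puiseux set => complex poly" where
 "lead_prod c si h m A = smult c (\<Prod>ga\<in>A. lead_poly si h ga ^ m ga)"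

definition arc_order :: "nat => puiseux => rat => (puiseux => nat) => puiseux set => rat" where
 "arc_order E si h m A = of_nat E + (\<Sum>ga\<in>A. of_nat (m ga) * cap h (contact ga si))"

definition roots_form :: "germ => germ => nat => (puiseux => nat) => puiseux set => bool" where
 "roots_form F u E m A \<longleftrightarrow> u dvd 1 \<and> finite A \<and>
  emb F = emb (u * germ_y ^ E) * (\<Prod>ga\<in>A. lin ga ^ m ga)"

text \<open>The leading terms of \<open>F\<close> and of \<open>y\<^sup>h F\<^sub>x\<close> at an arc are given by a polynomial and its derivative.
 This property is multiplicative.\<close>

definition expands :: "rat => puiseux => complex => puiseux fps => rat => complex poly => bool" where
 "expands h xi z F r P \<longleftrightarrow> (\<exists>w d. has_value F xi w \<and> has_value (fps_deriv F) xi d \<and>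
  lead_term r (poly P z) w \<and> lead_term r (poly (pderiv P) z) (ymonom h 1 * d))"

lemma expands_mult:
 assumes "expands h xi z F r P" "expands h xi z G s Q" shows "expands h xi z (F * G) (r + s) (P * Q)"
proof -
 obtain w d where 1: "has_value F xi w" "has_value (fps_deriv F) xi d" "lead_term r (poly P z) w"
  "lead_term r (poly (pderiv P) z) (ymonom h 1 * d)" using assms(1) by (auto simp: expands_def)
 obtain v e where 2: "has_value G xi v" "has_value (fps_deriv G) xi e" "lead_term s (poly Q z) v"
  "lead_term s (poly (pderiv Q) z) (ymonom h 1 * e)" using assms(2) by (auto simp: expands_def)
 have "has_value (fps_deriv (F * G)) xi (w * e + d * v)"
  unfolding fps_deriv_mult by (intro has_value_add has_value_mult 1 2)
 moreover have "lead_term (r + s) (poly P z * poly (pderiv Q) z + poly (pderiv P) z * poly Q z)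
   (w * (ymonom h 1 * e) + (ymonom h 1 * d) * v)"
  by (intro lead_term_add lead_term_mult 1 2)
 ultimately show ?thesis unfolding expands_def
  using has_value_mult[OF 1(1) 2(1)] lead_term_mult[OF 1(3) 2(3)]
  by (intro exI[of _ "w * v"] exI[of _ "w * e + d * v"]) (simp add: pderiv_mult algebra_simps)
qed

lemma expands_1: "expands h xi z 1 0 1"
 unfolding expands_def by (intro exI[of _ 1] exI[of _ 0]) (auto simp: has_value_def pderiv_1)

lemma expands_prod: "(!!x. x \<in> A ==> expands h xi z (F x) (r x) (P x)) ==> expands h xi z (prod F A) (sum r A) (prod P A)"
 by (induction A rule: infinite_finite_induct) (auto simp: expands_1 intro: expands_mult)

lemma expands_power: "expands h xi z F r P ==> expands h xi z (F ^ n) (of_nat n * r) (P ^ n)"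
 using expands_prod[of "{..<n}" h xi z "%_. F" "%_. r" "%_. P"] by simp

lemma expands_linear: "h > 0 ==> expands h (si + ymonom h z) z (lin ga) (cap h (contact ga si)) (lead_poly si h ga)"
 unfolding expands_def using has_value_linear has_value_const[of 1] lead_term_difference[of h ga si z]
  lead_term_difference_deriv[of h ga si z]
 by (intro exI[of _ "si + ymonom h z - ga"] exI[of _ 1]) simp

lemma expands_germ:
 assumes F: "roots_form F u E m A" and pos: "pos_arc (si + ymonom h z)" and h: "h > 0"
 shows "expands h (si + ymonom h z) z (emb F) (arc_order E si h m A) (lead_prod (germ_at_origin u) si h m A)"
proof -
 let ?xi = "si + ymonom h z"
 have l0: "lead_term 0 (germ_at_origin G) (germ_eval G ?xi)" for G
  using germ_eval_at_0[OF pos, of G] by (simp add: lead_term_def pcoeff_neg)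
 have "lead_term (h + 0) (1 * germ_at_origin (germ_dx u)) (ymonom h 1 * germ_eval (germ_dx u) ?xi)"
  using h by (intro lead_term_mult l0 lead_term_ymonom) simp
 hence "expands h ?xi z (emb u) 0 [:germ_at_origin u:]"
  unfolding expands_def germ_embed_dx[symmetric] using has_value_germ[OF pos] l0 lead_term_less[of "h + 0"] h
  by (intro exI[of _ "germ_eval u ?xi"] exI[of _ "germ_eval (germ_dx u) ?xi"]) simp
 moreover have "expands h ?xi z (emb germ_y) 1 1"
  unfolding expands_def germ_embed_y using has_value_const[of "ymonom 1 1"] has_value_const[of 0] lead_term_ymonom[of 1 1]
  by (intro exI[of _ "ymonom 1 1"] exI[of _ 0]) (simp add: pderiv_1 lead_term_def)
 ultimately have "expands h ?xi z (emb u * emb germ_y ^ E * (\<Prod>ga\<in>A. lin ga ^ m ga))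
   (0 + of_nat E * 1 + (\<Sum>ga\<in>A. of_nat (m ga) * cap h (contact ga si)))
   ([:germ_at_origin u:] * 1 ^ E * (\<Prod>ga\<in>A. lead_poly si h ga ^ m ga))"
  by (intro expands_mult expands_power expands_prod expands_linear h)
 thus ?thesis using F by (simp add: roots_form_def arc_order_def lead_prod_def germ_embed_simps)
qed

lemma lead_term_on_arc:
 assumes F: "roots_form F u E m A" and pos: "pos_arc (si + ymonom h z)" and h: "h > 0"
 shows "lead_term (arc_order E si h m A) (poly (lead_prod (germ_at_origin u) si h m A) z) (germ_eval F (si + ymonom h z))"
  and "lead_term (arc_order E si h m A) (poly (pderiv (lead_prod (germ_at_origin u) si h m A)) z)
   (ymonom h 1 * germ_eval (germ_dx F) (si + ymonom h z))"
 using expands_germ[OF assms] germ_evalI[OF pos, of F] germ_evalI[OF pos, of "germ_dx F"]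
 unfolding expands_def germ_embed_dx by auto

lemma order_prod_power:
 fixes p :: "'b => complex poly"
 assumes "!!x. x \<in> A ==> p x ~= 0"
 shows "order a (\<Prod>x\<in>A. p x ^ m x) = (\<Sum>x\<in>A. m x * order a (p x))"
 using assms
proof (induction A rule: infinite_finite_induct)
 case (insert x A)
 have pw: "order a (q ^ k) = k * order a q" if "q ~= 0" for q :: "complex poly" and k
  using that by (induction k) (auto simp: order_mult)
 have "(\<Prod>x\<in>insert x A. p x ^ m x) ~= 0" using insert by (auto simp: prod_zero_iff)
 thus ?case using insert pw[of "p x" "m x"] by (simp add: order_mult)
qed auto

lemma order_lead_poly: "h \<ge> 0 ==> order a (lead_poly si h ga) = (if arrives si h a ga then 1 else 0)"
proof -
 assume h: "h \<ge> 0"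
 show ?thesis
 proof (cases "arrives si h a ga")
  case True
  hence "lead_poly si h ga = [:-a, 1:]" using h by (simp add: arrives_iff lead_poly_def)
  thus ?thesis using True order_power_n_n[of a 1] by simp
 next
  case False
  have "poly (lead_poly si h ga) a ~= 0"
   using False h lead_poly_neq_0[of si h ga]
   by (auto simp: arrives_iff lead_poly_def split: if_splits simp del: pcoeff_simps(3))
  thus ?thesis using False by (simp add: order_0I)
 qed
qed

lemma lead_prod_neq_0: "c ~= 0 ==> finite A ==> lead_prod c si h m A ~= 0"
 by (simp add: lead_prod_def lead_poly_neq_0)

lemma order_lead_prod:
 assumes "c ~= 0" "finite A" "h \<ge> 0"
 shows "order a (lead_prod c si h m A) = (\<Sum>ga\<in>{ga\<in>A. arrives si h a ga}. m ga)"
proof -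
 have "order a (lead_prod c si h m A) = (\<Sum>ga\<in>A. m ga * (if arrives si h a ga then 1 else 0))"
  using assms by (simp add: lead_prod_def order_smult order_prod_power lead_poly_neq_0 order_lead_poly del: mult_cancel_left)
 also have "\<dots> = (\<Sum>ga\<in>{ga\<in>A. arrives si h a ga}. m ga)"
  using assms(2) by (intro sum.mono_neutral_cong_right) auto
 finally show ?thesis .
qed

lemma degree_lead_prod:
 assumes "c ~= 0" "finite A"
 shows "degree (lead_prod c si h m A) = (\<Sum>ga\<in>{ga\<in>A. reaches si h ga}. m ga)"
proof -
 have "degree (\<Prod>ga\<in>A. lead_poly si h ga ^ m ga) = (\<Sum>ga\<in>A. degree (lead_poly si h ga ^ m ga))"
  by (rule degree_prod_eq_sum_degree) (simp add: lead_poly_neq_0)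
 also have "\<dots> = (\<Sum>ga\<in>A. m ga * (if reaches si h ga then 1 else 0))"
 proof (intro sum.cong refl)
  fix ga
  have "degree (lead_poly si h ga) = (if reaches si h ga then 1 else 0)" by (simp add: lead_poly_def)
  thus "degree (lead_poly si h ga ^ m ga) = m ga * (if reaches si h ga then 1 else 0)"
   by (simp add: degree_power_eq lead_poly_neq_0)
 qed
 also have "\<dots> = (\<Sum>ga\<in>{ga\<in>A. reaches si h ga}. m ga)"
  using assms(2) by (intro sum.mono_neutral_cong_right) auto
 finally show ?thesis using assms(1) by (simp add: lead_prod_def)
qed


section \<open>The leading coefficient of the Jacobian\<close>

definition wronskian :: "rat => rat => complex poly => complex poly => complex poly" where
 "wronskian \<nu> mu \<phi> \<psi> = smult (of_rat \<nu>) (\<phi> * pderiv \<psi>) - smult (of_rat mu) (pderiv \<phi> * \<psi>)"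

text \<open>With \<open>x = z - a\<close>, the operator \<open>x d/dz\<close> multiplies the lowest term of a polynomial by its
 order.  So the coefficient of the lowest possible power of \<open>x\<close> in \<open>x\<close> times the Wronskian is a
 nonzero multiple of \<open>\<nu> q - mu p\<close>.\<close>

lemma wronskian_local:
 assumes "\<phi> ~= 0" "\<psi> ~= 0" and p: "order a \<phi> = p" and q: "order a \<psi> = q"
 obtains V where "[:-a, 1:] * wronskian \<nu> mu \<phi> \<psi> = [:-a, 1:] ^ (p + q) * V"
  "poly V a = 0 \<longleftrightarrow> \<nu> * of_nat q - mu * of_nat p = 0"
proof -
 have dec: "\<exists>r s. P = [:-a, 1:] ^ k * r \<and> [:-a, 1:] * pderiv P = [:-a, 1:] ^ k * s \<and> poly r a ~= 0 \<and>
   poly s a = of_nat k * poly r a" if P: "P ~= 0" and k: "order a P = k" for P :: "complex poly" and k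
 proof -
  obtain r where r: "P = [:-a, 1:] ^ k * r" "\<not> [:-a, 1:] dvd r" using order_decomp[OF P, of a] k by auto
  define X where "X = [:-a, 1:]"
  have dX: "pderiv X = 1" by (simp add: X_def pderiv_pCons)
  have xd: "X * pderiv (X ^ k) = of_nat k * X ^ k"
  proof (induction k)
   case (Suc k)
   have "X * pderiv (X ^ Suc k) = X * (X * pderiv (X ^ k)) + X * X ^ k"
    by (simp add: pderiv_mult dX algebra_simps)
   thus ?case unfolding Suc by (simp add: algebra_simps)
  qed (simp add: pderiv_1)
  have "X * pderiv P = X ^ k * (X * pderiv r) + r * (X * pderiv (X ^ k))"
   unfolding r(1) X_def[symmetric] by (simp add: pderiv_mult algebra_simps)
  also have "\<dots> = X ^ k * (X * pderiv r + of_nat k * r)" unfolding xd by (simp add: algebra_simps)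
  finally have "X * pderiv P = X ^ k * (X * pderiv r + of_nat k * r)" .
  moreover have "poly (X * pderiv r + of_nat k * r) a = of_nat k * poly r a" by (simp add: X_def)
  moreover have "poly r a ~= 0" using r(2) by (simp add: poly_eq_0_iff_dvd)
  ultimately show ?thesis using r(1) unfolding X_def by blast
 qed
 obtain r s where 1: "\<phi> = [:-a, 1:] ^ p * r" "[:-a, 1:] * pderiv \<phi> = [:-a, 1:] ^ p * s" "poly r a ~= 0"
  "poly s a = of_nat p * poly r a" using dec[OF assms(1) p] by blast
 obtain t w where 2: "\<psi> = [:-a, 1:] ^ q * t" "[:-a, 1:] * pderiv \<psi> = [:-a, 1:] ^ q * w" "poly t a ~= 0"
  "poly w a = of_nat q * poly t a" using dec[OF assms(2) q] by blast
 define V where "V = smult (of_rat \<nu>) (r * w) - smult (of_rat mu) (s * t)"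
 have "[:-a, 1:] * wronskian \<nu> mu \<phi> \<psi> =
   smult (of_rat \<nu>) (\<phi> * ([:-a, 1:] * pderiv \<psi>)) - smult (of_rat mu) (([:-a, 1:] * pderiv \<phi>) * \<psi>)"
  unfolding wronskian_def by (simp only: right_diff_distrib mult_smult_right) (simp only: mult_ac)
 also have "\<dots> = [:-a, 1:] ^ (p + q) * V"
  unfolding 1(2) 2(2) unfolding 1(1) 2(1) V_def power_add right_diff_distrib mult_smult_right
  by (simp only: mult_ac)
 finally have eq: "[:-a, 1:] * wronskian \<nu> mu \<phi> \<psi> = [:-a, 1:] ^ (p + q) * V" .
 have "poly V a = of_rat (\<nu> * of_nat q - mu * of_nat p) * (poly r a * poly t a)"
  by (simp add: V_def 1(4) 2(4) of_rat_diff of_rat_mult algebra_simps)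
 hence "poly V a = 0 \<longleftrightarrow> \<nu> * of_nat q - mu * of_nat p = 0" using 1(3) 2(3) by simp
 with eq show ?thesis using that by blast
qed

lemma wronskian_order:
 assumes "\<phi> ~= 0" "\<psi> ~= 0" "order a \<phi> = p" "order a \<psi> = q"
 shows "\<nu> * of_nat q - mu * of_nat p ~= 0 ==>
   wronskian \<nu> mu \<phi> \<psi> ~= 0 \<and> Suc (order a (wronskian \<nu> mu \<phi> \<psi>)) = p + q"
  and "\<nu> * of_nat q - mu * of_nat p = 0 ==> wronskian \<nu> mu \<phi> \<psi> ~= 0 ==>
   order a (wronskian \<nu> mu \<phi> \<psi>) \<ge> p + q"
proof -
 obtain V where V: "[:-a, 1:] * wronskian \<nu> mu \<phi> \<psi> = [:-a, 1:] ^ (p + q) * V"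
  "poly V a = 0 \<longleftrightarrow> \<nu> * of_nat q - mu * of_nat p = 0" using wronskian_local[OF assms] by metis
 have ord: "Suc (order a (wronskian \<nu> mu \<phi> \<psi>)) = p + q + order a V" if W: "wronskian \<nu> mu \<phi> \<psi> ~= 0"
 proof -
  have "[:-a, 1:] * wronskian \<nu> mu \<phi> \<psi> ~= 0" using W by (simp del: mult_pCons_left)
  moreover have "order a [:-a, 1:] = 1" using order_power_n_n[of a 1] by simp
  ultimately have "order a ([:-a, 1:] * wronskian \<nu> mu \<phi> \<psi>) = Suc (order a (wronskian \<nu> mu \<phi> \<psi>))"
   by (simp add: order_mult del: mult_pCons_left)
  moreover have "order a ([:-a, 1:] ^ (p + q) * V) = p + q + order a V"
   using order_mult[OF \<open>[:-a, 1:] * wronskian \<nu> mu \<phi> \<psi> ~= 0\<close>[unfolded V(1)]] by (simp only: order_power_n_n)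
  ultimately show ?thesis using V(1) by simp
 qed
 show "wronskian \<nu> mu \<phi> \<psi> ~= 0 \<and> Suc (order a (wronskian \<nu> mu \<phi> \<psi>)) = p + q"
  if d: "\<nu> * of_nat q - mu * of_nat p ~= 0"
 proof -
  have Va: "poly V a ~= 0" using V(2) d by simp
  hence "V ~= 0" by auto
  hence "[:-a, 1:] ^ (p + q) * V ~= 0" by simp
  hence "wronskian \<nu> mu \<phi> \<psi> ~= 0" using V(1) by auto
  thus ?thesis using ord Va by (simp add: order_0I)
 qed
 show "order a (wronskian \<nu> mu \<phi> \<psi>) \<ge> p + q"
  if d: "\<nu> * of_nat q - mu * of_nat p = 0" and W: "wronskian \<nu> mu \<phi> \<psi> ~= 0"
 proof -
  have "V ~= 0" using V(1) W by (auto simp del: mult_pCons_left)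
  hence "order a V > 0" using V(2) d by (simp add: order_gt_0_iff)
  thus ?thesis using ord[OF W] by simp
 qed
qed

text \<open>The coefficient of the highest possible degree is a multiple of the difference that is
 assumed to be nonzero.\<close>

lemma wronskian_degree:
 assumes "\<nu> * of_nat (degree \<psi>) - mu * of_nat (degree \<phi>) ~= 0" "\<phi> ~= 0" "\<psi> ~= 0"
 shows "wronskian \<nu> mu \<phi> \<psi> ~= 0 \<and> Suc (degree (wronskian \<nu> mu \<phi> \<psi>)) = degree \<phi> + degree \<psi>"
proof -
 define W where "W = wronskian \<nu> mu \<phi> \<psi>"
 let ?P = "degree \<phi>" and ?Q = "degree \<psi>"
 have XW: "pCons 0 W = smult (of_rat \<nu>) (\<phi> * pCons 0 (pderiv \<psi>)) - smult (of_rat mu) (pCons 0 (pderiv \<phi>) * \<psi>)"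
  by (simp add: W_def wronskian_def)
 have c: "coeff (pCons 0 (pderiv P)) i = of_nat i * coeff P i" for P :: "complex poly" and i
  by (cases i) (auto simp: coeff_pderiv)
 have dle: "degree (pCons 0 (pderiv P)) <= degree P" for P :: "complex poly"
  by (rule degree_le) (auto simp: c coeff_eq_0)
 have top: "coeff (A * B) (m + n) = coeff A m * coeff B n" if "degree A <= m" "degree B <= n" for A B :: "complex poly" and m n
 proof -
  have "coeff (A * B) (m + n) = (\<Sum>i\<le>m + n. coeff A i * coeff B (m + n - i))" by (rule coeff_mult)
  also have "\<dots> = (\<Sum>i\<le>m + n. if i = m then coeff A m * coeff B n else 0)"
  proof (intro sum.cong refl)
   fix i assume "i \<in> {..m + n}"
   show "coeff A i * coeff B (m + n - i) = (if i = m then coeff A m * coeff B n else 0)"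
   proof (cases "i = m")
    case False
    hence "i > m \<or> m + n - i > n" by auto
    thus ?thesis using that False by (auto simp: coeff_eq_0)
   qed simp
  qed
  finally show ?thesis by simp
 qed
 have "coeff (pCons 0 W) (?P + ?Q) = of_rat (\<nu> * of_nat ?Q - mu * of_nat ?P) * (lead_coeff \<phi> * lead_coeff \<psi>)"
  unfolding XW coeff_diff coeff_smult top[OF order_refl dle] top[OF dle order_refl] c
  by (simp add: of_rat_diff of_rat_mult algebra_simps)
 moreover have "lead_coeff \<phi> * lead_coeff \<psi> ~= 0" using assms by simp
 ultimately have nz: "coeff (pCons 0 W) (?P + ?Q) ~= 0" using assms(1) by simp
 hence W0: "W ~= 0" by auto
 have "degree (pCons 0 W) <= ?P + ?Q"
  unfolding XW by (intro degree_diff_le order_trans[OF degree_smult_le] order_trans[OF degree_mult_le] add_mono dle order_refl)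
 moreover have "?P + ?Q <= degree (pCons 0 W)" by (rule le_degree[OF nz])
 ultimately show ?thesis using W0 by (simp add: W_def[symmetric])
qed

definition lead_jacobian :: "germ => germ => nat => nat => puiseux set => puiseux set => puiseux => rat => complex poly" where
 "lead_jacobian u v E E' A B si h =
  wronskian (arc_order E si h (%_. 1) A) (arc_order E' si h (%_. 1) B)
   (lead_prod (germ_at_origin u) si h (%_. 1) A) (lead_prod (germ_at_origin v) si h (%_. 1) B)"

text \<open>The chain rule gives the leading coefficient of the Jacobian along the arcs \<open>si + z y\<^sup>h\<close> in
 terms of the two germs, the Newton--Puiseux factorisation of the Jacobian gives it in terms of
 the polar roots; both are polynomials in \<open>z\<close>, so that their orders and degrees agree.\<close>

theorem polar_roots_on_arcs:
 assumes f: "roots_form f u E (%_. 1) A" and g: "roots_form g v E' (%_. 1) B"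
  and pos: "pos_arc si" and h: "h > 0" and W: "lead_jacobian u v E E' A B si h ~= 0"
 shows "jacobian_germ f g ~= 0"
  and "(\<Sum>ga\<in>{ga\<in>np_roots (jacobian_germ f g). arrives si h a ga}. root_mult (jacobian_germ f g) ga) =
   order a (lead_jacobian u v E E' A B si h)"
  and "(\<Sum>ga\<in>{ga\<in>np_roots (jacobian_germ f g). reaches si h ga}. root_mult (jacobian_germ f g) ga) =
   degree (lead_jacobian u v E E' A B si h)"
proof -
 let ?J = "jacobian_germ f g" and ?W = "lead_jacobian u v E E' A B si h"
 let ?\<nu> = "arc_order E si h (%_. 1) A" and ?mu = "arc_order E' si h (%_. 1) B"
 let ?\<phi> = "lead_prod (germ_at_origin u) si h (%_. 1) A" and ?\<psi> = "lead_prod (germ_at_origin v) si h (%_. 1) B"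
 have posz: "pos_arc (si + ymonom h z)" for z using pos h by (simp add: pos_arc_iff pcoeff_ymonom)
 have T: "lead_term (?\<nu> + ?mu) (poly ?W z) (ymonom h 1 * (ymonom 1 1 * germ_eval ?J (si + ymonom h z)))" for z
 proof -
  note lf = lead_term_on_arc[OF f posz h, of z] and lg = lead_term_on_arc[OF g posz h, of z]
  let ?xi = "si + ymonom h z"
  have "ymonom h 1 * (ymonom 1 1 * germ_eval ?J ?xi) =
   ytheta (germ_eval f ?xi) * (ymonom h 1 * germ_eval (germ_dx g) ?xi) - (ymonom h 1 * germ_eval (germ_dx f) ?xi) * ytheta (germ_eval g ?xi)"
   unfolding y_jacobian_on_arc[OF posz] by (simp add: algebra_simps)
  moreover have "lead_term (?\<nu> + ?mu) (of_rat ?\<nu> * poly ?\<phi> z * poly (pderiv ?\<psi>) z - poly (pderiv ?\<phi>) z * (of_rat ?mu * poly ?\<psi> z))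
   (ytheta (germ_eval f ?xi) * (ymonom h 1 * germ_eval (germ_dx g) ?xi) - (ymonom h 1 * germ_eval (germ_dx f) ?xi) * ytheta (germ_eval g ?xi))"
   by (intro lead_term_diff lead_term_mult lead_term_ytheta lf lg)
  moreover have "of_rat ?\<nu> * poly ?\<phi> z * poly (pderiv ?\<psi>) z - poly (pderiv ?\<phi>) z * (of_rat ?mu * poly ?\<psi> z) = poly ?W z"
   by (simp add: lead_jacobian_def wronskian_def algebra_simps)
  ultimately show ?thesis by (simp only:)
 qed
 show J0: "?J ~= 0"
 proof
  assume J: "?J = 0"
  have "poly ?W z = 0" for z
   using lead_term_pcoeff[OF T[of z]] by (simp add: J germ_eval_simps[OF posz])
  thus False using W poly_all_0_iff_0 by blast
 qed
 obtain w e where we: "w dvd 1" "finite (np_roots ?J)"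
  "emb ?J = emb (w * germ_y ^ e) * (\<Prod>ga\<in>np_roots ?J. lin ga ^ root_mult ?J ga)"
  using germ_factorisation[OF J0] by metis
 hence Jf: "roots_form ?J w e (root_mult ?J) (np_roots ?J)" by (simp add: roots_form_def)
 let ?ka = "lead_prod (germ_at_origin w) si h (root_mult ?J) (np_roots ?J)"
 let ?n = "h + (1 + arc_order e si h (root_mult ?J) (np_roots ?J))"
 have K: "lead_term ?n (poly ?ka z) (ymonom h 1 * (ymonom 1 1 * germ_eval ?J (si + ymonom h z)))" for z
 proof -
  have "lead_term ?n (1 * (1 * poly ?ka z)) (ymonom h 1 * (ymonom 1 1 * germ_eval ?J (si + ymonom h z)))"
   using h by (intro lead_term_mult lead_term_ymonom lead_term_on_arc(1)[OF Jf posz]) auto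
  thus ?thesis by simp
 qed
 have w0: "germ_at_origin w ~= 0" using we(1) germ_unit_iff by blast
 have k0: "?ka ~= 0" by (rule lead_prod_neq_0[OF w0 we(2)])
 have "?W * ?ka ~= 0" using W k0 by simp
 then obtain z0 where "poly (?W * ?ka) z0 ~= 0" using poly_all_0_iff_0 by blast
 hence z0: "poly ?W z0 ~= 0" "poly ?ka z0 ~= 0" by auto
 have n: "?\<nu> + ?mu = ?n" by (rule lead_term_unique(1)[OF T K z0])
 have "poly ?W z = poly ?ka z" for z
  using lead_term_pcoeff[OF T[of z]] lead_term_pcoeff[OF K[of z]] unfolding n by simp
 hence Wk: "?W = ?ka" by (intro poly_eq_poly_eq_iff[THEN iffD1]) auto
 show "(\<Sum>ga\<in>{ga\<in>np_roots ?J. arrives si h a ga}. root_mult ?J ga) = order a ?W"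
  unfolding Wk using order_lead_prod[OF w0 we(2)] h by simp
 show "(\<Sum>ga\<in>{ga\<in>np_roots ?J. reaches si h ga}. root_mult ?J ga) = degree ?W"
  unfolding Wk using degree_lead_prod[OF w0 we(2)] by simp
qed

lemma zorder_poly_quotient:
 fixes W D :: "complex poly"
 assumes "W ~= 0" "D ~= 0" "!!z. poly D z ~= 0 ==> F z = poly W z / poly D z"
 shows "zorder F a = int (order a W) - int (order a D)"
proof -
 obtain W1 where W1: "W = [:-a, 1:] ^ order a W * W1" "\<not> [:-a, 1:] dvd W1" using order_decomp[OF assms(1)] by blast
 obtain D1 where D1: "D = [:-a, 1:] ^ order a D * D1" "\<not> [:-a, 1:] dvd D1" using order_decomp[OF assms(2)] by blast
 have a: "poly W1 a ~= 0" "poly D1 a ~= 0" using W1(2) D1(2) by (auto simp: poly_eq_0_iff_dvd)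
 have D10: "D1 ~= 0" using a(2) by auto
 show ?thesis
 proof (rule zorder_eqI)
  have "finite {z. poly D1 z = 0}" by (rule poly_roots_finite[OF D10])
  hence "open (- {z. poly D1 z = 0})" by (simp add: finite_imp_closed open_Compl)
  thus "open {z. poly D1 z ~= 0}" by (simp add: Collect_neg_eq)
  show "a \<in> {z. poly D1 z ~= 0}" using a by simp
  show "(%z. poly W1 z / poly D1 z) holomorphic_on {z. poly D1 z ~= 0}" by (intro holomorphic_intros) auto
  show "poly W1 a / poly D1 a ~= 0" using a by simp
  fix z assume z: "z \<in> {z. poly D1 z ~= 0}" "z ~= a"
  have pW: "poly W z = (z - a) ^ order a W * poly W1 z" by (subst W1(1)) (simp add: poly_power)
  have pD: "poly D z = (z - a) ^ order a D * poly D1 z" by (subst D1(1)) (simp add: poly_power)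
  have "F z = poly W z / poly D z" using z assms(3) pD by simp
  also have "\<dots> = poly W1 z / poly D1 z * ((z - a) ^ order a W / (z - a) ^ order a D)"
   unfolding pW pD by (simp add: mult_ac)
  also have "(z - a) ^ order a W / (z - a) ^ order a D = (z - a) powi (int (order a W) - int (order a D))"
   using z(2) by (simp add: power_int_diff)
  finally show "F z = poly W1 z / poly D1 z * (z - a) powi (int (order a W) - int (order a D))" .
 qed
qed

section \<open>Bars of the tree of a pair\<close>

lemma contact_pos: "pos_arc a ==> pos_arc b ==> Fin 0 < contact a b"
 by (simp add: pos_arc_iff)

lemma eventually_avoid_finite:
 fixes a :: complex
 assumes "finite S" shows "\<forall>\<^sub>F z in at a. z \<notin> S"
proof -
 have "\<forall>\<^sub>F z in at a. \<forall>y\<in>S. z ~= y"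
  using assms by (rule eventually_ball_finite) (simp add: eventually_neq_at_within)
 thus ?thesis by eventually_elim auto
qed

lemma nu_unique:
 assumes "\<forall>\<^sub>F z in at 0. yord (germ_eval F (stem B + ymonom (ht B) z)) = Fin v"
 shows "nu F B = v"
 unfolding nu_def
proof (rule the_equality[where P = "%v. \<forall>\<^sub>F z in at 0. yord (germ_eval F (stem B + ymonom (ht B) z)) = Fin v", OF assms])
 fix w assume "\<forall>\<^sub>F z in at 0. yord (germ_eval F (stem B + ymonom (ht B) z)) = Fin w"
 with assms have "\<forall>\<^sub>F z in at (0::complex). w = v" by eventually_elim simp
 thus "w = v" by simp
qed

lemma nu_positive_height:
 assumes F: "roots_form F u E m A" and pos: "pos_arc (stem B)" and h: "ht B > 0"
 shows "nu F B = arc_order E (stem B) (ht B) m A"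
proof (rule nu_unique)
 let ?P = "lead_prod (germ_at_origin u) (stem B) (ht B) m A"
 have "?P ~= 0" using F by (intro lead_prod_neq_0) (auto simp: roots_form_def germ_unit_iff)
 hence "\<forall>\<^sub>F z in at 0. z \<notin> {z. poly ?P z = 0}" by (intro eventually_avoid_finite poly_roots_finite)
 thus "\<forall>\<^sub>F z in at 0. yord (germ_eval F (stem B + ymonom (ht B) z)) = Fin (arc_order E (stem B) (ht B) m A)"
 proof eventually_elim
  case (elim z)
  have "pos_arc (stem B + ymonom (ht B) z)" using pos h by (simp add: pos_arc_iff pcoeff_ymonom)
  from lead_term_on_arc(1)[OF F this] h elim show ?case by (intro yord_lead_term) auto
 qed
qed

text \<open>Setting \<open>y = 0\<close> turns each factor \<open>x - ga(y)\<close> into \<open>x\<close>.\<close>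

lemma pcoeff0_product:
 assumes "!!ga. ga \<in> S ==> pos_arc ga"
 shows "coeff_map (%c. pcoeff c 0) (\<Prod>ga\<in>S. lin ga ^ m ga) = (\<Prod>ga\<in>S. fps_X ^ m ga)"
proof -
 note r0 = ring_mapD[OF ring_map_coeff_map[OF ring_map_pcoeff0]]
 have "coeff_map (%c. pcoeff c 0) (lin ga) = fps_X" if "ga \<in> S" for ga
  using assms[OF that] coeff_map_linear[OF ring_map_pcoeff0, of ga] by (simp add: pos_arc_iff)
 thus ?thesis unfolding r0(8) r0(9) by simp
qed

lemma stem_height_0: "stem (0, S) = 0"
 by (rule puiseux_eqI) (simp add: stem_def pcoeff_ytrunc pcoeff_neg)

text \<open>At height \<open>0\<close> the arcs \<open>x = z\<close> are not positive.  The coefficient of \<open>y\<^sup>E\<close> in \<open>F\<close> is a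
 nonzero convergent series in \<open>x\<close>, and it does not vanish at small \<open>z ~= 0\<close>.\<close>

lemma nu_ground:
 assumes F: "roots_form F u E m A" and pos: "!!ga. ga \<in> A ==> pos_arc ga"
 shows "nu F (0, S) = of_nat E"
proof (rule nu_unique)
 define R where "R = emb u * (\<Prod>ga\<in>A. lin ga ^ m ga)"
 have yE: "emb (germ_y ^ E) = fps_const (ymonom (of_nat E) 1)"
  by (simp add: germ_embed_simps germ_embed_y fps_const_power ymonom_power)
 have FR: "emb F = fps_const (ymonom (of_nat E) 1) * R"
  using F by (simp add: roots_form_def R_def germ_embed_simps(2) yE mult_ac)
 define a where "a = coeff_map (%c. pcoeff c 0) R"
 note r0 = ring_mapD[OF ring_map_coeff_map[OF ring_map_pcoeff0]]
 have "a = coeff_map (%c. pcoeff c 0) (emb u) * (\<Prod>ga\<in>A. fps_X ^ m ga)"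
  unfolding a_def R_def r0(2) using pcoeff0_product pos by metis
 moreover have "coeff_map (%c. pcoeff c 0) (emb u) ~= 0"
 proof
  assume "coeff_map (%c. pcoeff c 0) (emb u) = 0"
  from arg_cong[OF this, of "%F. F $ 0"] have "germ_at_origin u = 0"
   using pcoeff_puiseux_of_fps[of _ 0] by (simp add: germ_embed_alt germ_at_origin_def)
  thus False using F by (simp add: roots_form_def germ_unit_iff)
 qed
 ultimately have a0: "a ~= 0" using F by (auto simp: roots_form_def prod_zero_iff)
 have cF: "pcoeff ((emb F) $ k) r = pcoeff (R $ k) (r - of_nat E)" for k r
  by (simp add: FR pcoeff_ymonom_times)
 have ak: "a $ k = ((series F) $ k) $ E" for k
  using cF[of k "of_nat E"] by (simp add: a_def germ_embed_alt pcoeff_puiseux_of_fps)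
 have rad: "fps_conv_radius a > 0"
 proof -
  obtain C Q where CQ: "Q > 0" "C \<ge> 0" "!!i j. norm (((series F) $ i) $ j) <= C * Q ^ (i + j)"
   using convergent2_common_bound series[of F] by (metis mem_Collect_eq)
  define z where "z = complex_of_real (1 / (2 * Q))"
  have nz: "norm z = 1 / (2 * Q)" using CQ by (simp add: z_def norm_divide norm_mult)
  have "summable (%k. a $ k * z ^ k)"
  proof (rule summable_comparison_test'[where g = "%k. C * Q ^ E * (1 / 2) ^ k" and N = 0])
   show "summable (%k. C * Q ^ E * (1 / 2 :: real) ^ k)" by (intro summable_mult summable_geometric) simp
   fix k :: nat
   have "norm (a $ k * z ^ k) <= (C * Q ^ (k + E)) * (1 / (2 * Q)) ^ k"
    unfolding norm_mult norm_power nz ak using CQ by (intro mult_right_mono) auto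
   also have "\<dots> = C * Q ^ E * (1 / 2) ^ k"
    using CQ(1) by (simp add: power_add power_divide power_mult_distrib field_simps)
   finally show "norm (a $ k * z ^ k) <= C * Q ^ E * (1 / 2) ^ k" .
  qed
  hence "norm z <= fps_conv_radius a" unfolding fps_conv_radius_def by (rule conv_radius_geI)
  moreover have "norm z > 0" using nz CQ by simp
  ultimately show ?thesis by (metis ereal_less(2) less_le_trans)
 qed
 hence "eval_fps a has_fps_expansion a" by (simp add: has_fps_expansion_def)
 hence "\<forall>\<^sub>F z in at 0. eval_fps a z ~= 0"
  using a0 has_laurent_expansion_nonzero_imp_eventually_nonzero[OF has_laurent_expansion_fps] by auto
 thus "\<forall>\<^sub>F z in at 0. yord (germ_eval F (stem (0, S) + ymonom (ht (0, S)) z)) = Fin (of_nat E)"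
 proof eventually_elim
  case (elim z)
  have ym: "ymonom 0 z ^ k = ymonom 0 (z ^ k)" for k
   by (induction k) (auto intro!: puiseux_eqI simp: pcoeff_one pcoeff_ymonom pcoeff_ymonom_times)
  have ev: "pcoeff (germ_eval F (ymonom 0 z)) r = (\<Sum>k. pcoeff ((emb F) $ k) r * z ^ k)" for r
  proof -
   have "pcoeff ((emb F) $ k * ymonom 0 z ^ k) r = pcoeff ((emb F) $ k) r * z ^ k" for k
    using pcoeff_ymonom_times[of 0 "z ^ k" "(emb F) $ k" r] by (simp add: ym mult.commute)
   thus ?thesis by (simp add: pcoeff_germ_eval germ_embed_alt)
  qed
  have "lead_term (of_nat E) (eval_fps a z) (germ_eval F (ymonom 0 z))"
   unfolding lead_term_def
  proof (intro conjI allI impI)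
   fix s :: rat assume "s < of_nat E"
   thus "pcoeff (germ_eval F (ymonom 0 z)) s = 0" by (simp add: ev cF pcoeff_neg)
  next
   show "pcoeff (germ_eval F (ymonom 0 z)) (of_nat E) = eval_fps a z"
    by (simp add: ev cF eval_fps_def a_def)
  qed
  thus ?case using elim yord_lead_term by (simp add: stem_height_0)
 qed
qed

locale curve_pair =
 fixes f g :: germ
 assumes np: "np_pair f g"
begin

abbreviation Lam :: "puiseux set" where "Lam \<equiv> np_roots f \<union> np_roots g"

abbreviation Jac :: germ where "Jac \<equiv> jacobian_germ f g"

abbreviation (input) "col == collinear_bar f g"
abbreviation (input) "cpoints == collinear_points f g"
abbreviation (input) "mmult == mero_mult f g"
abbreviation (input) "ground == ground_bar f g"
abbreviation (input) "min_bars == minimal_noncollinear_bars f g"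
abbreviation (input) "cov == cover f g"

lemma Lam_pos: "ka \<in> Lam ==> pos_arc ka"
 by (auto simp: np_roots_def)

lemma Lam_nonempty: "Lam ~= {}" and Lam_disjoint: "np_roots f \<inter> np_roots g = {}"
 using np by (auto simp: np_pair_def)

lemma roots_form_exists:
 "\<exists>E u. roots_form f u E (%_. 1) (np_roots f)" "\<exists>E u. roots_form g u E (%_. 1) (np_roots g)"
 using np by (auto simp: np_pair_def np_factorisation_def roots_form_def)

definition Ef :: nat where "Ef = (SOME E. \<exists>u. roots_form f u E (%_. 1) (np_roots f))"
definition uf :: germ where "uf = (SOME u. roots_form f u Ef (%_. 1) (np_roots f))"
definition Eg :: nat where "Eg = (SOME E. \<exists>u. roots_form g u E (%_. 1) (np_roots g))"
definition ug :: germ where "ug = (SOME u. roots_form g u Eg (%_. 1) (np_roots g))"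

lemma f_form: "roots_form f uf Ef (%_. 1) (np_roots f)"
 unfolding uf_def using someI_ex[OF roots_form_exists(1), folded Ef_def] by (rule someI_ex)

lemma g_form: "roots_form g ug Eg (%_. 1) (np_roots g)"
 unfolding ug_def using someI_ex[OF roots_form_exists(2), folded Eg_def] by (rule someI_ex)

lemma finite_f: "finite (np_roots f)" and finite_g: "finite (np_roots g)"
 using f_form g_form by (simp_all add: roots_form_def)

lemma finite_Lam: "finite Lam" using finite_f finite_g by simp

lemma uf_unit: "germ_at_origin uf ~= 0" and ug_unit: "germ_at_origin ug ~= 0"
 using f_form g_form by (simp_all add: roots_form_def germ_unit_iff)

lemma roots_form_nonzero: assumes "roots_form F u E m A" shows "F ~= 0"
proof
 assume "F = 0"
 moreover have "emb (u * germ_y ^ E) ~= 0"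
 proof
  assume "emb (u * germ_y ^ E) = 0"
  hence "germ_eval (u * germ_y ^ E) 0 = 0" by (simp add: germ_eval_zero_iff)
  thus False using germ_eval_unit_y_neq_0[of 0 u E] assms by (simp add: roots_form_def)
 qed
 ultimately show False
  using assms linear_factor_neq_0 by (auto simp: roots_form_def germ_embed_simps(4) prod_zero_iff)
qed

lemma f_neq_0: "f ~= 0" and g_neq_0: "g ~= 0"
 using roots_form_nonzero f_form g_form by auto

definition nuf :: "puiseux => rat => rat" where "nuf si h = arc_order Ef si h (%_. 1) (np_roots f)"
definition nug :: "puiseux => rat => rat" where "nug si h = arc_order Eg si h (%_. 1) (np_roots g)"

lemma nonunit: assumes "roots_form F u E (%_. 1) A" "germ_at_origin F = 0" "A = {}" shows "E > 0"
proof (rule ccontr)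
 assume "\<not> E > 0"
 hence "emb F = emb u" using assms by (simp add: roots_form_def)
 hence "F = u" by (simp add: germ_embed_inject)
 thus False using assms by (simp add: roots_form_def germ_unit_iff)
qed

lemma arc_order_pos:
 assumes F: "roots_form F u E (%_. 1) A" "germ_at_origin F = 0" "!!ga. ga \<in> A ==> pos_arc ga"
  and "pos_arc si" "h > 0"
 shows "arc_order E si h (%_. 1) A > 0"
proof -
 have cap: "cap h (contact ga si) > 0" if "ga \<in> A" for ga
  using contact_pos[OF F(3)[OF that] assms(4)] assms(5) by (cases "contact ga si") (auto simp: cap_def)
 have fin: "finite A" using F(1) by (simp add: roots_form_def)
 show ?thesis
 proof (cases "A = {}")
  case True
  thus ?thesis using nonunit[OF F(1,2)] by (simp add: arc_order_def)
 next
  case False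
  hence "(\<Sum>ga\<in>A. cap h (contact ga si)) > 0" using cap fin by (intro sum_pos) auto
  thus ?thesis by (simp add: arc_order_def add_nonneg_pos)
 qed
qed

lemma nuf_pos: "pos_arc si ==> h > 0 ==> nuf si h > 0"
 unfolding nuf_def using np by (intro arc_order_pos[OF f_form]) (auto simp: np_pair_def np_roots_def)

lemma nug_pos: "pos_arc si ==> h > 0 ==> nug si h > 0"
 unfolding nug_def using np by (intro arc_order_pos[OF g_form]) (auto simp: np_pair_def np_roots_def)

definition phi :: "puiseux => rat => complex poly" where
 "phi si h = lead_prod (germ_at_origin uf) si h (%_. 1) (np_roots f)"
definition psi :: "puiseux => rat => complex poly" where
 "psi si h = lead_prod (germ_at_origin ug) si h (%_. 1) (np_roots g)"
definition LJ :: "puiseux => rat => complex poly" where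
 "LJ si h = wronskian (nuf si h) (nug si h) (phi si h) (psi si h)"

lemma phi_neq_0: "phi si h ~= 0" and psi_neq_0: "psi si h ~= 0"
 unfolding phi_def psi_def by (intro lead_prod_neq_0 uf_unit ug_unit finite_f finite_g)+

lemma order_phi: "h \<ge> 0 ==> order a (phi si h) = card {ga\<in>np_roots f. arrives si h a ga}"
 and order_psi: "h \<ge> 0 ==> order a (psi si h) = card {ga\<in>np_roots g. arrives si h a ga}"
 unfolding phi_def psi_def
 by (simp_all add: order_lead_prod[OF uf_unit finite_f] order_lead_prod[OF ug_unit finite_g])

lemma degree_phi: "degree (phi si h) = card {ga\<in>np_roots f. reaches si h ga}"
 and degree_psi: "degree (psi si h) = card {ga\<in>np_roots g. reaches si h ga}"
 unfolding phi_def psi_def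
 by (simp_all add: degree_lead_prod[OF uf_unit finite_f] degree_lead_prod[OF ug_unit finite_g])

lemma LJ_eq: "lead_jacobian uf ug Ef Eg (np_roots f) (np_roots g) si h = LJ si h"
 by (simp add: lead_jacobian_def LJ_def nuf_def nug_def phi_def psi_def)

definition pcount :: "(puiseux => bool) => nat" where
 "pcount P = (\<Sum>ga\<in>{ga\<in>np_roots Jac. P ga}. root_mult Jac ga)"

lemma polar_counts:
 assumes "pos_arc si" "h > 0" "LJ si h ~= 0"
 shows "Jac ~= 0" "pcount (arrives si h a) = order a (LJ si h)" "pcount (reaches si h) = degree (LJ si h)"
 using polar_roots_on_arcs[OF f_form g_form assms(1,2), unfolded LJ_eq, OF assms(3)]
 by (simp_all add: pcount_def)

subsection \<open>Bars as ultrametric balls\<close>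

definition ball :: "puiseux => rat => puiseux set" where
 "ball ka h = {mu \<in> Lam. Fin h <= contact ka mu}"

text \<open>By the ultrametric inequality the roots below a bar form a ball around each of them.  This
 describes the bars without the recursion along the tree; the two descriptions agree by
 \<open>bars_eq\<close>.\<close>

definition is_bar :: "bar => bool" where
 "is_bar B \<longleftrightarrow> (\<exists>ka\<in>Lam. bar_roots B = ball ka (ht B) \<and> ht B \<ge> 0 \<and>
  (ht B = 0 \<or> (\<exists>mu\<in>Lam. contact ka mu = Fin (ht B))))"

lemma contact_self [simp]: "contact ka ka = Pinf" by simp

lemma ball_self: "ka \<in> Lam ==> ka \<in> ball ka h" by (simp add: ball_def)

lemma ball_eq: "mu \<in> ball ka h ==> ball mu h = ball ka h"
 unfolding ball_def using contact_ge_trans contact_commute by (smt (verit) Collect_cong mem_Collect_eq)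

lemma is_bar_roots: "is_bar B ==> bar_roots B \<subseteq> Lam"
 by (auto simp: is_bar_def ball_def)

lemma is_bar_ball: "is_bar B ==> ka \<in> bar_roots B ==> bar_roots B = ball ka (ht B)"
 unfolding is_bar_def using ball_eq by metis

lemma is_bar_nonneg: "is_bar B ==> ht B \<ge> 0" by (auto simp: is_bar_def)

lemma is_bar_nonempty: "is_bar B ==> bar_roots B ~= {}"
 unfolding is_bar_def using ball_self by fastforce

lemma is_bar_pair:
 assumes "is_bar B" "ht B > 0"
 obtains ka mu where "ka \<in> bar_roots B" "mu \<in> bar_roots B" "contact ka mu = Fin (ht B)"
proof -
 obtain ka mu where k: "ka \<in> Lam" "bar_roots B = ball ka (ht B)" "mu \<in> Lam" "contact ka mu = Fin (ht B)"
  using assms by (auto simp: is_bar_def)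
 hence "ka \<in> bar_roots B" "mu \<in> bar_roots B" by (auto simp: ball_def)
 with k show ?thesis using that by blast
qed

lemma is_bar_contact: "is_bar B ==> ka \<in> bar_roots B ==> mu \<in> bar_roots B ==> Fin (ht B) <= contact ka mu"
 using is_bar_ball[of B ka] by (simp add: ball_def)

lemma is_bar_eqI: "is_bar B ==> is_bar B' ==> ht B = ht B' ==> ka \<in> bar_roots B ==> ka \<in> bar_roots B' ==> B = B'"
 using is_bar_ball by (metis prod.expand)

lemma is_bar_ground: "is_bar (ground)"
proof -
 obtain ka where k: "ka \<in> Lam" using Lam_nonempty by blast
 have "Fin 0 <= contact ka mu" for mu by (rule yord_nonneg)
 hence "Lam = ball ka 0" by (auto simp: ball_def)
 thus ?thesis unfolding is_bar_def ground_bar_def using k by auto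
qed

lemma is_bar_height_0: assumes "is_bar B" "ht B = 0" shows "B = ground"
proof -
 obtain ka where "ka \<in> bar_roots B" using is_bar_nonempty[OF assms(1)] by blast
 thus ?thesis
  using assms is_bar_ground is_bar_roots[OF assms(1)]
  by (intro is_bar_eqI[of B "ground" ka]) (auto simp: ground_bar_def)
qed

lemma some_root: "is_bar B ==> (SOME ka. ka \<in> bar_roots B) \<in> bar_roots B"
 using is_bar_nonempty by (simp add: some_in_eq)

lemma stem_pos: assumes "is_bar B" shows "pos_arc (stem B)"
proof -
 have "pos_arc (SOME ka. ka \<in> bar_roots B)" using some_root[OF assms] is_bar_roots[OF assms] Lam_pos by blast
 thus ?thesis by (simp add: stem_def pos_arc_iff pcoeff_ytrunc)
qed

lemma pcoeff_stem [simp]: "pcoeff (stem B) (ht B) = 0"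
 by (simp add: stem_def pcoeff_ytrunc)

lemma stem_contact: assumes "is_bar B" "ka \<in> bar_roots B" shows "Fin (ht B) <= contact ka (stem B)"
proof -
 let ?s = "SOME ka. ka \<in> bar_roots B"
 have "Fin (ht B) <= contact ?s (stem B)" by (simp add: stem_def yord_ge_iff pcoeff_ytrunc)
 moreover have "Fin (ht B) <= contact ka ?s"
  using is_bar_contact[OF assms(1,2) some_root[OF assms(1)]] .
 ultimately show ?thesis using contact_ge_trans by blast
qed

lemma reaches_stem_iff:
 assumes "is_bar B" "ka \<in> bar_roots B"
 shows "reaches (stem B) (ht B) ga \<longleftrightarrow> Fin (ht B) <= contact ga ka"
 unfolding reaches_def using stem_contact[OF assms] contact_ge_trans contact_commute by metis

lemma reaches_root_iff:
 assumes "is_bar B" "mu \<in> Lam" shows "reaches (stem B) (ht B) mu \<longleftrightarrow> mu \<in> bar_roots B"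
proof -
 obtain ka where k: "ka \<in> bar_roots B" using is_bar_nonempty[OF assms(1)] by blast
 show ?thesis using reaches_stem_iff[OF assms(1) k] is_bar_ball[OF assms(1) k] assms(2)
  by (auto simp: ball_def contact_commute)
qed

lemma climbs_at_arrives: "climbs_at ga B a \<longleftrightarrow> arrives (stem B) (ht B) a ga"
 by (simp add: climbs_at_def arrives_def)

lemma climbs_at_iff:
 "is_bar B ==> climbs_at ga B a \<longleftrightarrow> reaches (stem B) (ht B) ga \<and> pcoeff ga (ht B) = a"
 by (simp add: climbs_at_arrives arrives_iff is_bar_nonneg)

lemma climbs_iff: "is_bar B ==> climbs ga B \<longleftrightarrow> reaches (stem B) (ht B) ga"
 by (simp add: climbs_def climbs_at_iff)

lemma bounded_by_iff: "is_bar B ==> bounded_by ga B \<longleftrightarrow> \<not> climbs ga B"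
 by (auto simp: bounded_by_def climbs_iff reaches_def not_le)

lemma climbs_root_iff: "is_bar B ==> mu \<in> Lam ==> climbs mu B \<longleftrightarrow> mu \<in> bar_roots B"
 by (simp add: climbs_iff reaches_root_iff)

subsection \<open>Trunks\<close>

definition trunk_at :: "bar => complex => puiseux set" where
 "trunk_at B a = {mu \<in> bar_roots B. pcoeff mu (ht B) = a}"

definition points :: "bar => complex set" where
 "points B = (%mu. pcoeff mu (ht B)) ` bar_roots B"

lemma trunk_at_arrives: "is_bar B ==> trunk_at B a = {mu \<in> Lam. arrives (stem B) (ht B) a mu}"
 using is_bar_roots[of B] by (auto simp: trunk_at_def climbs_at_arrives[symmetric] climbs_at_iff reaches_root_iff)

lemma trunk_at_eq:
 assumes "is_bar B" "ka \<in> bar_roots B"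
 shows "{mu \<in> bar_roots B. Fin (ht B) < contact ka mu} = trunk_at B (pcoeff ka (ht B))"
proof -
 have "Fin (ht B) < contact ka mu \<longleftrightarrow> pcoeff mu (ht B) = pcoeff ka (ht B)"
  if "mu \<in> bar_roots B" for mu
  using is_bar_contact[OF assms that] by (auto simp: yord_gt_iff yord_ge_iff lead_term_def)
 thus ?thesis by (auto simp: trunk_at_def)
qed

lemma trunks_eq: "is_bar B ==> trunks B = trunk_at B ` points B"
 unfolding trunks_def points_def using trunk_at_eq by (auto simp: image_iff) (metis trunk_at_eq)

lemma finite_bar_roots: "is_bar B ==> finite (bar_roots B)"
 using is_bar_roots finite_Lam finite_subset by blast

lemma finite_points: "is_bar B ==> finite (points B)"
 by (simp add: points_def finite_bar_roots)

lemma trunk_at_nonempty: "a \<in> points B \<longleftrightarrow> trunk_at B a ~= {}"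
 by (auto simp: points_def trunk_at_def)

lemma finite_trunk_at: "is_bar B ==> finite (trunk_at B a)"
 by (simp add: trunk_at_def finite_bar_roots)

lemma card_trunk_at: "is_bar B ==> a \<in> points B ==> card (trunk_at B a) > 0"
 by (simp add: card_gt_0_iff finite_trunk_at trunk_at_nonempty[symmetric])

lemma trunk_point_at: assumes "a \<in> points B" shows "trunk_point B (trunk_at B a) = a"
proof -
 have "(SOME ka. ka \<in> trunk_at B a) \<in> trunk_at B a"
  using assms trunk_at_nonempty by (simp add: some_in_eq)
 thus ?thesis by (simp add: trunk_point_def trunk_at_def)
qed

lemma trunk_points: "is_bar B ==> trunk_point B ` trunks B = points B"
 by (force simp: trunks_eq image_image trunk_point_at)

lemma inj_trunk_at: "inj_on (trunk_at B) (points B)"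
 by (rule inj_on_inverseI[of _ "trunk_point B"]) (simp add: trunk_point_at)

definition nc_points :: "bar => complex set" where
 "nc_points B = {a \<in> points B. Delta f g B (trunk_at B a) ~= 0}"

lemma collinear_points_eq:
 "is_bar B ==> cpoints B = {a \<in> points B. Delta f g B (trunk_at B a) = 0}"
 by (force simp: collinear_points_def trunks_eq trunk_point_at)

lemma collinear_bar_iff: "is_bar B ==> col B \<longleftrightarrow> nc_points B = {}"
 by (auto simp: collinear_bar_def trunks_eq nc_points_def)

lemma nu_upper:
 assumes "is_bar B" "ht B > 0"
 shows "nu f B = nuf (stem B) (ht B)" "nu g B = nug (stem B) (ht B)"
 using nu_positive_height[OF f_form stem_pos[OF assms(1)] assms(2)]
  nu_positive_height[OF g_form stem_pos[OF assms(1)] assms(2)] by (simp_all add: nuf_def nug_def)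

lemma nu_ground_bar: "nu f (ground) = of_nat Ef" "nu g (ground) = of_nat Eg"
 unfolding ground_bar_def using nu_ground[OF f_form] nu_ground[OF g_form] by (auto simp: np_roots_def)

lemma trunk_at_f: "is_bar B ==> trunk_at B a \<inter> np_roots f = {ga \<in> np_roots f. arrives (stem B) (ht B) a ga}"
 and trunk_at_g: "is_bar B ==> trunk_at B a \<inter> np_roots g = {ga \<in> np_roots g. arrives (stem B) (ht B) a ga}"
 by (auto simp: trunk_at_arrives)

lemma card_split: "T \<subseteq> Lam ==> card T = card (T \<inter> np_roots f) + card (T \<inter> np_roots g)"
proof -
 assume T: "T \<subseteq> Lam"
 have "card ((T \<inter> np_roots f) \<union> (T \<inter> np_roots g)) = card (T \<inter> np_roots f) + card (T \<inter> np_roots g)"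
  using Lam_disjoint finite_f finite_g by (intro card_Un_disjoint) auto
 moreover have "(T \<inter> np_roots f) \<union> (T \<inter> np_roots g) = T" using T by auto
 ultimately show ?thesis by simp
qed

subsection \<open>The rational function and the number of polar roots\<close>

lemma Delta_upper:
 assumes "is_bar B" "ht B > 0"
 shows "Delta f g B (trunk_at B a) =
  nuf (stem B) (ht B) * of_nat (order a (psi (stem B) (ht B))) -
  nug (stem B) (ht B) * of_nat (order a (phi (stem B) (ht B)))"
 using assms by (simp add: Delta_def nu_upper order_phi order_psi trunk_at_f trunk_at_g)

lemma orders_card:
 assumes "is_bar B"
 shows "order a (phi (stem B) (ht B)) + order a (psi (stem B) (ht B)) = card (trunk_at B a)"
proof -
 have "trunk_at B a \<subseteq> Lam" using is_bar_roots[OF assms] by (auto simp: trunk_at_def)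
 from card_split[OF this] assms show ?thesis
  by (simp add: order_phi order_psi trunk_at_f trunk_at_g is_bar_nonneg)
qed

lemma LJ_neq_0:
 assumes "is_bar B" "ht B > 0" "\<not> col B"
 shows "LJ (stem B) (ht B) ~= 0"
proof -
 obtain a where "Delta f g B (trunk_at B a) ~= 0"
  using assms by (auto simp: collinear_bar_iff nc_points_def)
 thus ?thesis unfolding LJ_def Delta_upper[OF assms(1,2)]
  using wronskian_order(1)[OF phi_neq_0 psi_neq_0 refl refl] by blast
qed

lemma log_deriv:
 assumes "finite A" "c ~= 0" "poly (lead_prod c si h (%_. 1) A) z ~= 0"
 shows "poly (pderiv (lead_prod c si h (%_. 1) A)) z / poly (lead_prod c si h (%_. 1) A) z =
  (\<Sum>ga\<in>{ga\<in>A. reaches si h ga}. 1 / (z - pcoeff (ga - si) h))"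
 using assms(1,3)
proof (induction A rule: finite_induct)
 case empty
 thus ?case by (simp add: lead_prod_def)
next
 case (insert al A)
 have eq: "lead_prod c si h (%_. 1) (insert al A) = lead_poly si h al * lead_prod c si h (%_. 1) A"
  using insert.hyps by (simp add: lead_prod_def)
 have nz: "poly (lead_poly si h al) z ~= 0" "poly (lead_prod c si h (%_. 1) A) z ~= 0"
  using insert.prems unfolding eq by auto
 have "poly (pderiv (lead_prod c si h (%_. 1) (insert al A))) z / poly (lead_prod c si h (%_. 1) (insert al A)) z =
   poly (pderiv (lead_poly si h al)) z / poly (lead_poly si h al) z +
   poly (pderiv (lead_prod c si h (%_. 1) A)) z / poly (lead_prod c si h (%_. 1) A) z"
  unfolding eq pderiv_mult using nz by (simp add: field_simps)
 also have "\<dots> = (if reaches si h al then 1 / (z - pcoeff (al - si) h) else 0) +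
  (\<Sum>ga\<in>{ga\<in>A. reaches si h ga}. 1 / (z - pcoeff (ga - si) h))"
  unfolding insert.IH[OF nz(2)] by (simp add: lead_poly_def pderiv_pCons)
 also have "\<dots> = (\<Sum>ga\<in>{ga\<in>insert al A. reaches si h ga}. 1 / (z - pcoeff (ga - si) h))"
 proof (cases "reaches si h al")
  case True
  hence "{ga'\<in>insert al A. reaches si h ga'} = insert al {ga\<in>A. reaches si h ga}" by auto
  thus ?thesis using True insert.hyps by simp
 next
  case False
  hence "{ga'\<in>insert al A. reaches si h ga'} = {ga\<in>A. reaches si h ga}" by auto
  thus ?thesis using False by simp
 qed
 finally show ?case .
qed

text \<open>The logarithmic derivatives of \<open>phi\<close> and \<open>psi\<close> are the sums of \<open>1 / (z - a)\<close> over the roots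
 of \<open>f\<close> and \<open>g\<close> on the bar.\<close>

lemma mero_quotient:
 assumes B: "is_bar B" "ht B > 0"
  and z: "poly (phi (stem B) (ht B) * psi (stem B) (ht B)) z ~= 0"
 shows "mero f g B z = poly (LJ (stem B) (ht B)) z /
  poly (phi (stem B) (ht B) * psi (stem B) (ht B)) z"
proof -
 let ?si = "stem B" and ?h = "ht B"
 have z': "poly (phi ?si ?h) z ~= 0" "poly (psi ?si ?h) z ~= 0" using z by auto
 have group: "(\<Sum>ga\<in>{ga\<in>A. reaches ?si ?h ga}. 1 / (z - pcoeff (ga - ?si) ?h)) =
   (\<Sum>a\<in>points B. of_nat (card (trunk_at B a \<inter> A)) / (z - a))" if A: "finite A" "A \<subseteq> Lam" for A
 proof -
  have "(\<Sum>ga\<in>{ga\<in>A. reaches ?si ?h ga}. 1 / (z - pcoeff (ga - ?si) ?h)) = (\<Sum>ga\<in>A \<inter> bar_roots B. 1 / (z - pcoeff ga ?h))"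
   using A reaches_root_iff[OF B(1)] by (intro sum.cong) auto
  also have "\<dots> = (\<Sum>a\<in>points B. \<Sum>ga\<in>{ga\<in>A \<inter> bar_roots B. pcoeff ga ?h = a}. 1 / (z - pcoeff ga ?h))"
   using A finite_points[OF B(1)] by (intro sum.group[symmetric]) (auto simp: points_def)
  also have "\<dots> = (\<Sum>a\<in>points B. of_nat (card (trunk_at B a \<inter> A)) / (z - a))"
  proof (intro sum.cong refl)
   fix a
   have "{ga\<in>A \<inter> bar_roots B. pcoeff ga ?h = a} = trunk_at B a \<inter> A" by (auto simp: trunk_at_def)
   moreover have "(\<Sum>ga\<in>trunk_at B a \<inter> A. 1 / (z - pcoeff ga ?h)) = (\<Sum>ga\<in>trunk_at B a \<inter> A. 1 / (z - a))"
    by (intro sum.cong) (auto simp: trunk_at_def)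
   ultimately show "(\<Sum>ga\<in>{ga\<in>A \<inter> bar_roots B. pcoeff ga ?h = a}. 1 / (z - pcoeff ga ?h)) =
     of_nat (card (trunk_at B a \<inter> A)) / (z - a)" by simp
  qed
  finally show ?thesis .
 qed
 have "poly (LJ ?si ?h) z / poly (phi ?si ?h * psi ?si ?h) z =
   of_rat (nuf ?si ?h) * (poly (pderiv (psi ?si ?h)) z / poly (psi ?si ?h) z) -
   of_rat (nug ?si ?h) * (poly (pderiv (phi ?si ?h)) z / poly (phi ?si ?h) z)"
  unfolding LJ_def wronskian_def using z' by (simp add: field_simps)
 also have "\<dots> = of_rat (nuf ?si ?h) * (\<Sum>a\<in>points B. of_nat (card (trunk_at B a \<inter> np_roots g)) / (z - a)) -
   of_rat (nug ?si ?h) * (\<Sum>a\<in>points B. of_nat (card (trunk_at B a \<inter> np_roots f)) / (z - a))"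
  using z' log_deriv[OF finite_f uf_unit, of ?si ?h z] log_deriv[OF finite_g ug_unit, of ?si ?h z]
   group[OF finite_f] group[OF finite_g] by (simp add: phi_def psi_def)
 also have "\<dots> = (\<Sum>a\<in>points B. of_rat (Delta f g B (trunk_at B a)) / (z - a))"
  by (simp add: Delta_def nu_upper[OF B] sum_distrib_left sum_subtractf[symmetric] of_rat_diff of_rat_mult
    diff_divide_distrib)
 also have "\<dots> = mero f g B z"
  unfolding mero_def trunks_eq[OF B(1)] by (subst sum.reindex[OF inj_trunk_at]) (simp add: trunk_point_at)
 finally show ?thesis ..
qed

text \<open>The number of polar roots climbing at \<open>a\<close> is the order of the numerator \<open>LJ\<close> in
 \<open>mero_quotient\<close>, and the order of the denominator is the number of roots in the trunk at
 \<open>a\<close>.  At a non-collinear point the numerator has an order one less than the denominator, which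
 is a simple pole.\<close>

theorem polar_count_at:
 assumes B: "is_bar B" "ht B > 0" "\<not> col B"
 shows "pcount (%ga. climbs_at ga B a) + (if a \<in> nc_points B then 1 else 0) =
   mmult B a + card (trunk_at B a)"
  and "a \<in> nc_points B ==> mmult B a = 0"
proof -
 let ?W = "LJ (stem B) (ht B)" and ?p = "phi (stem B) (ht B)" and ?q = "psi (stem B) (ht B)"
 have W: "?W ~= 0" by (rule LJ_neq_0[OF B])
 have pq0: "?p * ?q ~= 0" using phi_neq_0 psi_neq_0 by simp
 have zo: "zorder (mero f g B) a = int (order a ?W) - int (order a (?p * ?q))"
  by (rule zorder_poly_quotient[OF W pq0 mero_quotient[OF B(1,2)]])
 have opq: "order a (?p * ?q) = card (trunk_at B a)"
  by (rule trans[OF order_mult[OF pq0] orders_card[OF B(1)]])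
 have cnt: "pcount (%ga. climbs_at ga B a) = order a ?W"
  using polar_counts(2)[OF stem_pos[OF B(1)] B(2) W] by (simp add: climbs_at_arrives[abs_def])
 have mm: "mmult B a = order a ?W - card (trunk_at B a)"
  by (simp add: mero_mult_def zo opq)
 have D0: "Delta f g B (trunk_at B a) = 0" if "a \<notin> points B"
  using that trunk_at_nonempty[of a B] by (simp add: Delta_def)
 have "Suc (order a ?W) = card (trunk_at B a)" if "a \<in> nc_points B"
 proof -
  have "Delta f g B (trunk_at B a) ~= 0" using that by (simp add: nc_points_def)
  hence "Suc (order a ?W) = order a ?p + order a ?q"
   unfolding Delta_upper[OF B(1,2)] LJ_def using wronskian_order(1)[OF phi_neq_0 psi_neq_0 refl refl] by blast
  thus ?thesis using orders_card[OF B(1), of a] by simp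
 qed
 moreover have "order a ?W \<ge> card (trunk_at B a)" if "a \<notin> nc_points B"
 proof -
  have "Delta f g B (trunk_at B a) = 0" using that D0 by (auto simp: nc_points_def)
  hence "order a ?W \<ge> order a ?p + order a ?q"
   using W unfolding Delta_upper[OF B(1,2)] LJ_def by (rule wronskian_order(2)[OF phi_neq_0 psi_neq_0 refl refl])
  thus ?thesis using orders_card[OF B(1), of a] by simp
 qed
 ultimately show "pcount (%ga. climbs_at ga B a) + (if a \<in> nc_points B then 1 else 0) =
   mmult B a + card (trunk_at B a)"
  and "a \<in> nc_points B ==> mmult B a = 0"
  unfolding cnt mm by auto
qed

end

lemma contact_Fin: "ka ~= mu ==> \<exists>r. contact ka mu = Fin r" by (cases "ka - mu" rule: yord_cases) auto

lemma finite_contacts: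
 assumes "finite A" "finite B" shows "finite {r. \<exists>ka\<in>A. \<exists>mu\<in>B. contact ka mu = Fin r}"
proof -
 have "finite {r. e = Fin r}" for e :: "rat extended" by (cases e) auto
 hence "finite (\<Union>ka\<in>A. \<Union>mu\<in>B. {r. contact ka mu = Fin r})" using assms by blast
 thus ?thesis by (rule rev_finite_subset) blast
qed

context curve_pair
begin

subsection \<open>All roots of the Jacobian are polar roots\<close>

text \<open>Near a root \<open>ka\<close> of \<open>f g\<close>, along arcs that separate it from all others, one of \<open>phi\<close>, \<open>psi\<close>
 has a simple zero at \<open>0\<close> and the other none, so that the leading coefficient of the Jacobian
 does not vanish there.\<close>

lemma isolated_root:
 assumes k: "ka \<in> Lam"
 obtains h where "h > 0" "LJ ka h ~= 0" "pcount (arrives ka h 0) = 0"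
proof -
 define H where "H = insert 1 {r. \<exists>mu\<in>Lam. \<exists>\<nu>\<in>{ka}. contact mu \<nu> = Fin r}"
 have fH: "finite H" using finite_contacts[of Lam "{ka}"] finite_Lam by (simp add: H_def)
 (* higher than every finite contact order with ka *)
 define h where "h = Max H + 1"
 have le: "r < h" if "r \<in> H" for r using Max_ge[OF fH that] by (simp add: h_def)
 have h: "h > 0" using le[of 1] by (simp add: H_def)
 have sep: "mu = ka" if "mu \<in> Lam" "arrives ka h 0 mu" for mu
 proof (rule ccontr)
  assume "mu ~= ka"
  then obtain r where "contact mu ka = Fin r" using contact_Fin by blast
  hence "r < h" "Fin h < Fin r" using le[of r] that by (auto simp: H_def arrives_def)
  thus False by simp
 qed
 have arr: "arrives ka h 0 ka" by (simp add: arrives_def)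
 have pos: "pos_arc ka" using Lam_pos k by blast
 obtain i j :: nat where o: "order 0 (phi ka h) = i" "order 0 (psi ka h) = j"
  "nuf ka h * of_nat j - nug ka h * of_nat i ~= 0" "i + j = 1"
 proof (cases "ka \<in> np_roots f")
  case True
  hence e: "{ga\<in>np_roots f. arrives ka h 0 ga} = {ka}" "{ga\<in>np_roots g. arrives ka h 0 ga} = {}"
   using sep arr Lam_disjoint by auto
  thus thesis using that[of 1 0] h nug_pos[OF pos h] by (simp add: order_phi order_psi e)
 next
  case False
  hence e: "{ga\<in>np_roots g. arrives ka h 0 ga} = {ka}" "{ga\<in>np_roots f. arrives ka h 0 ga} = {}"
   using sep arr k by auto
  thus thesis using that[of 0 1] h nuf_pos[OF pos h] by (simp add: order_phi order_psi e)
 qed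
 from wronskian_order(1)[OF phi_neq_0 psi_neq_0 o(1-3)] o(4)
 have "LJ ka h ~= 0 \<and> Suc (order 0 (LJ ka h)) = 1" by (simp add: LJ_def)
 thus ?thesis using that[OF h] polar_counts(2)[OF pos h] by simp
qed

lemma Jac_neq_0: "Jac ~= 0"
proof -
 obtain ka where "ka \<in> Lam" using Lam_nonempty by blast
 then obtain h where "h > 0" "LJ ka h ~= 0" using isolated_root by metis
 thus ?thesis using polar_counts(1) Lam_pos \<open>ka \<in> Lam\<close> by blast
qed

abbreviation Gam :: "puiseux set" where "Gam \<equiv> np_roots Jac"

lemma finite_Gam: "finite Gam" and Gam_mult: "ga \<in> Gam ==> root_mult Jac ga > 0"
 and Gam_conv: "ga \<in> Gam ==> conv (lin ga)"
 using germ_factorisation[OF Jac_neq_0] by metis+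

lemma Gam_pos: "ga \<in> Gam ==> pos_arc ga" by (simp add: np_roots_def)

lemma pcount_eq_0: "pcount P = 0 \<longleftrightarrow> (\<forall>ga\<in>Gam. \<not> P ga)"
proof -
 have "pcount P = 0 \<longleftrightarrow> (\<forall>ga\<in>{ga\<in>Gam. P ga}. root_mult Jac ga = 0)"
  unfolding pcount_def using finite_Gam by (subst sum_eq_0_iff) auto
 thus ?thesis using Gam_mult by fastforce
qed

lemma pcount_cong: "(!!ga. ga \<in> Gam ==> P ga \<longleftrightarrow> Q ga) ==> pcount P = pcount Q"
 unfolding pcount_def by (intro sum.cong) auto

lemma pcount_eq_imp:
 assumes "pcount P = pcount Q" "!!ga. ga \<in> Gam ==> P ga ==> Q ga" "ga \<in> Gam" "Q ga"
 shows "P ga"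
proof (rule ccontr)
 assume n: "\<not> P ga"
 have "pcount Q \<ge> (\<Sum>ga\<in>insert ga {ga\<in>Gam. P ga}. root_mult Jac ga)"
  unfolding pcount_def using finite_Gam assms(2-4) by (intro sum_mono2) auto
 also have "(\<Sum>ga\<in>insert ga {ga\<in>Gam. P ga}. root_mult Jac ga) = root_mult Jac ga + pcount P"
  unfolding pcount_def using finite_Gam n by (subst sum.insert) auto
 finally show False using assms(1) Gam_mult[OF assms(3)] by simp
qed

lemma pcount_partition:
 assumes "finite I" "!!ga. ga \<in> Gam ==> Q ga \<longleftrightarrow> (\<exists>i\<in>I. P i ga)"
  "!!ga i j. ga \<in> Gam ==> i \<in> I ==> j \<in> I ==> P i ga ==> P j ga ==> i = j"
 shows "pcount Q = (\<Sum>i\<in>I. pcount (P i))"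
proof -
 have "{ga\<in>Gam. Q ga} = (\<Union>i\<in>I. {ga\<in>Gam. P i ga})" using assms(2) by auto
 thus ?thesis unfolding pcount_def
  using finite_Gam assms(1,3) by (auto intro!: sum.UNION_disjoint)
qed

lemma pcount_disj:
 assumes "!!ga. ga \<in> Gam ==> Q ga \<longleftrightarrow> P ga \<or> R ga" "!!ga. ga \<in> Gam ==> \<not> (P ga \<and> R ga)"
 shows "pcount Q = pcount P + pcount R"
proof -
 have "{ga\<in>Gam. Q ga} = {ga\<in>Gam. P ga} \<union> {ga\<in>Gam. R ga}" using assms(1) by auto
 thus ?thesis unfolding pcount_def using finite_Gam assms(2) by (auto intro!: sum.union_disjoint)
qed

lemma Gam_disjoint: "Gam \<inter> Lam = {}"
proof -
 have False if "ka \<in> Lam" "ka \<in> Gam" for ka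
 proof -
  obtain h where "h > 0" "pcount (arrives ka h 0) = 0" using isolated_root[OF \<open>ka \<in> Lam\<close>] by metis
  hence "\<not> arrives ka h 0 ka" using that(2) by (simp add: pcount_eq_0)
  thus False by (simp add: arrives_def)
 qed
 thus ?thesis by blast
qed

lemma polar_roots_eq: "polar_roots f g = Gam"
 using Gam_disjoint by (auto simp: polar_roots_def np_roots_def)

subsection \<open>Polar roots climbing over a non-collinear bar\<close>

lemma leaves_iff:
 "is_bar B ==> leaves_tree_on ga B \<longleftrightarrow> (climbs ga B \<and> pcoeff ga (ht B) \<notin> points B)"
 by (auto simp: leaves_tree_on_def trunk_points climbs_at_iff climbs_iff)

lemma mero_mult_support:
 assumes B: "is_bar B" "ht B > 0" "\<not> col B" and m: "mmult B a > 0"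
 shows "a \<in> (%ga. pcoeff ga (ht B)) ` {ga\<in>Gam. climbs ga B}"
proof -
 have "a \<notin> nc_points B" using polar_count_at(2)[OF B] m by force
 hence "pcount (%ga. climbs_at ga B a) ~= 0" using polar_count_at(1)[OF B, of a] m by simp
 then obtain ga where "ga \<in> Gam" "climbs_at ga B a" by (auto simp: pcount_eq_0)
 thus ?thesis using B(1) by (auto simp: climbs_at_iff climbs_iff)
qed

text \<open>Summation of \<open>polar_count_at\<close> over the points at which a trunk grows or a polar root climbs.\<close>

lemma total_counts:
 assumes B: "is_bar B" "ht B > 0" "\<not> col B"
 shows "pcount (%ga. climbs ga B) + card (nc_points B) = card (bar_roots B) + total_mero_mult f g B"
  and "pcount (%ga. leaves_tree_on ga B) = pure_mero_mult f g B"
  and "total_mero_mult f g B = pure_mero_mult f g B + (\<Sum>c\<in>cpoints B. mmult B c)"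
proof -
 define G where "G = (%ga. pcoeff ga (ht B)) ` {ga\<in>Gam. climbs ga B}"
 define F where "F = G \<union> points B"
 have fF: "finite F" using finite_Gam finite_points[OF B(1)] by (simp add: F_def G_def)
 have supp: "a \<in> G" if "mmult B a > 0" for a using mero_mult_support[OF B that] by (simp add: G_def)
 have tot: "total_mero_mult f g B = (\<Sum>a\<in>F. mmult B a)"
  unfolding total_mero_mult_def using fF supp by (intro sum.mono_neutral_left) (auto simp: F_def)
 have colP: "cpoints B \<subseteq> points B" using collinear_points_eq[OF B(1)] by auto
 have pure: "pure_mero_mult f g B = (\<Sum>a\<in>F - cpoints B. mmult B a)"
  unfolding pure_mero_mult_def using fF supp by (intro sum.mono_neutral_left) (auto simp: F_def)
 have NP: "nc_points B \<subseteq> F" by (auto simp: nc_points_def F_def)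
 have "pcount (%ga. climbs ga B) = (\<Sum>a\<in>F. pcount (%ga. climbs_at ga B a))"
  by (rule pcount_partition[OF fF]) (auto simp: F_def G_def climbs_iff[OF B(1)] climbs_at_iff[OF B(1)])
 moreover have "card (nc_points B) = (\<Sum>a\<in>F. if a \<in> nc_points B then 1 else 0)"
 proof -
  have "(\<Sum>a\<in>F. if a \<in> nc_points B then 1 else 0) = (\<Sum>a\<in>nc_points B. 1::nat)"
   using fF NP by (intro sum.mono_neutral_cong_right) auto
  thus ?thesis by (simp only: card_eq_sum)
 qed
 ultimately have "pcount (%ga. climbs ga B) + card (nc_points B) =
   (\<Sum>a\<in>F. mmult B a + card (trunk_at B a))"
  using polar_count_at(1)[OF B] by (simp only: sum.distrib[symmetric])
 also have "\<dots> = total_mero_mult f g B + (\<Sum>a\<in>F. card (trunk_at B a))" by (simp add: tot sum.distrib)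
 also have "(\<Sum>a\<in>F. card (trunk_at B a)) = card (bar_roots B)"
 proof -
  have "bar_roots B = (\<Union>a\<in>F. trunk_at B a)" by (auto simp: trunk_at_def F_def points_def)
  moreover have "card (\<Union>a\<in>F. trunk_at B a) = (\<Sum>a\<in>F. card (trunk_at B a))"
   by (rule card_UN_disjoint[OF fF]) (use finite_trunk_at[OF B(1)] in \<open>auto simp: trunk_at_def\<close>)
  ultimately show ?thesis by simp
 qed
 finally show "pcount (%ga. climbs ga B) + card (nc_points B) = card (bar_roots B) + total_mero_mult f g B"
  by simp
 show "total_mero_mult f g B = pure_mero_mult f g B + (\<Sum>c\<in>cpoints B. mmult B c)"
  unfolding tot pure using fF colP by (subst sum.subset_diff[of "cpoints B" F]) (auto simp: F_def)
 have "pcount (%ga. leaves_tree_on ga B) = (\<Sum>a\<in>F - points B. pcount (%ga. climbs_at ga B a))"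
  using fF by (intro pcount_partition)
   (auto simp: F_def G_def leaves_iff[OF B(1)] climbs_iff[OF B(1)] climbs_at_iff[OF B(1)])
 also have "\<dots> = (\<Sum>a\<in>F - points B. mmult B a)"
 proof (intro sum.cong refl)
  fix a assume "a \<in> F - points B"
  hence "a \<notin> nc_points B" "trunk_at B a = {}"
   by (auto simp: nc_points_def trunk_at_nonempty)
  thus "pcount (%ga. climbs_at ga B a) = mmult B a" using polar_count_at(1)[OF B, of a] by simp
 qed
 also have "\<dots> = pure_mero_mult f g B"
  unfolding pure
 proof (rule sum.mono_neutral_left)
  show "\<forall>a\<in>(F - cpoints B) - (F - points B). mmult B a = 0"
  proof
   fix a assume "a \<in> (F - cpoints B) - (F - points B)"
   hence "a \<in> nc_points B" using collinear_points_eq[OF B(1)] by (auto simp: nc_points_def)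
   thus "mmult B a = 0" by (rule polar_count_at(2)[OF B])
  qed
 qed (use fF colP in auto)
 finally show "pcount (%ga. leaves_tree_on ga B) = pure_mero_mult f g B" .
qed

subsection \<open>Postbars\<close>

definition bar_over :: "bar => complex => bar" where
 "bar_over B a = (trunk_height (trunk_at B a), trunk_at B a)"

lemma postbar_at_iff:
 assumes "is_bar B"
 shows "postbar_at B c B' \<longleftrightarrow> c \<in> points B \<and> card (trunk_at B c) \<ge> 2 \<and> B' = bar_over B c"
 unfolding postbar_at_def trunks_eq[OF assms] bar_over_def using trunk_point_at by auto

lemma bar_over_pair:
 assumes B: "is_bar B" and T: "card (trunk_at B a) \<ge> 2"
 shows "ht B < ht (bar_over B a)"
  "\<exists>ka\<in>trunk_at B a. \<exists>mu\<in>trunk_at B a. contact ka mu = Fin (ht (bar_over B a))"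
  "!!ka mu. ka \<in> trunk_at B a ==> mu \<in> trunk_at B a ==> Fin (ht (bar_over B a)) <= contact ka mu"
proof -
 let ?T = "trunk_at B a"
 define H where "H = {h. \<exists>ka\<in>?T. \<exists>mu\<in>?T. ka ~= mu \<and> contact ka mu = Fin h}"
 have fH: "finite H"
  by (rule finite_subset[OF _ finite_contacts[of ?T ?T]]) (use finite_trunk_at[OF B] in \<open>auto simp: H_def\<close>)
 obtain ka0 mu0 where "ka0 \<in> ?T" "mu0 \<in> ?T" "ka0 ~= mu0"
  using T card_le_Suc0_iff_eq[OF finite_trunk_at[OF B, of a]] by (auto simp: numeral_2_eq_2 not_less_eq_eq[symmetric])
 hence neH: "H ~= {}" using contact_Fin[of ka0 mu0] by (auto simp: H_def)
 have hb: "ht (bar_over B a) = Min H" by (simp add: bar_over_def trunk_height_def H_def)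
 have "Min H \<in> H" by (rule Min_in[OF fH neH])
 then obtain ka mu where k: "ka \<in> ?T" "mu \<in> ?T" "contact ka mu = Fin (Min H)" by (auto simp: H_def)
 thus "\<exists>ka\<in>?T. \<exists>mu\<in>?T. contact ka mu = Fin (ht (bar_over B a))" unfolding hb by blast
 have "mu \<in> {mu \<in> bar_roots B. Fin (ht B) < contact ka mu}"
  using trunk_at_eq[OF B, of ka] k by (auto simp: trunk_at_def)
 thus "ht B < ht (bar_over B a)" using k(3) hb by simp
 show "Fin (ht (bar_over B a)) <= contact ka mu" if "ka \<in> ?T" "mu \<in> ?T" for ka mu
 proof (cases "ka = mu")
  case False
  then obtain r where r: "contact ka mu = Fin r" using contact_Fin by blast
  hence "r \<in> H" using that False by (auto simp: H_def)
  thus ?thesis using Min_le[OF fH] r hb by simp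
 qed simp
qed

lemma is_bar_over:
 assumes B: "is_bar B" and T: "card (trunk_at B a) \<ge> 2"
 shows "is_bar (bar_over B a)"
proof -
 let ?T = "trunk_at B a" and ?h = "ht (bar_over B a)"
 obtain ka mu where k: "ka \<in> ?T" "mu \<in> ?T" "contact ka mu = Fin ?h" using bar_over_pair(2)[OF B T] by blast
 have kB: "ka \<in> bar_roots B" using k by (simp add: trunk_at_def)
 have sub: "?T \<subseteq> Lam" using is_bar_roots[OF B] by (auto simp: trunk_at_def)
 have "?T = ball ka ?h"
 proof
  show "?T \<subseteq> ball ka ?h" using bar_over_pair(3)[OF B T k(1)] sub by (auto simp: ball_def)
  show "ball ka ?h \<subseteq> ?T"
  proof
   fix \<nu> assume n: "\<nu> \<in> ball ka ?h"
   hence c: "Fin (ht B) < contact ka \<nu>"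
    using bar_over_pair(1)[OF B T] by (auto simp: ball_def intro: less_le_trans[rotated])
   hence "\<nu> \<in> bar_roots B" using is_bar_ball[OF B kB] n by (auto simp: ball_def)
   hence "\<nu> \<in> trunk_at B (pcoeff ka (ht B))" using trunk_at_eq[OF B kB] c by auto
   thus "\<nu> \<in> ?T" using k(1) by (simp add: trunk_at_def)
  qed
 qed
 thus ?thesis unfolding is_bar_def
  using k sub bar_over_pair(1)[OF B T] is_bar_nonneg[OF B]
  by (intro bexI[of _ ka]) (auto simp: bar_over_def)
qed

lemma bar_roots_over [simp]: "bar_roots (bar_over B a) = trunk_at B a" by (simp add: bar_over_def)

lemma finite_is_bar: "finite {B. is_bar B}"
proof -
 define H where "H = insert 0 {h. \<exists>ka\<in>Lam. \<exists>mu\<in>Lam. contact ka mu = Fin h}"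
 have "finite H" unfolding H_def using finite_contacts[of Lam Lam] finite_Lam by simp
 moreover have "{B. is_bar B} \<subseteq> (%(ka, h). (h, ball ka h)) ` (Lam \<times> H)"
 proof
  fix B assume "B \<in> {B. is_bar B}"
  then obtain ka where k: "ka \<in> Lam" "bar_roots B = ball ka (ht B)" "ht B \<in> H"
   by (auto simp: is_bar_def H_def)
  thus "B \<in> (%(ka, h). (h, ball ka h)) ` (Lam \<times> H)"
   by (intro image_eqI[of _ _ "(ka, ht B)"]) (auto simp: prod_eq_iff)
 qed
 ultimately show ?thesis using finite_Lam by (meson finite_SigmaI finite_imageI finite_subset)
qed

lemma height_induct [consumes 1, case_names step]:
 assumes "is_bar X" "!!X. is_bar X ==> (!!Y. is_bar Y ==> ht X < ht Y ==> P Y) ==> P X"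
 shows "P X"
 using assms(1)
proof (induction "card {C. is_bar C \<and> ht X < ht C}" arbitrary: X rule: less_induct)
 case less
 show ?case
 proof (rule assms(2)[OF less.prems])
  fix Y assume Y: "is_bar Y" "ht X < ht Y"
  have "{C. is_bar C \<and> ht Y < ht C} \<subset> {C. is_bar C \<and> ht X < ht C}"
   using Y by (intro psubsetI subsetI) (auto dest: less_trans)
  hence "card {C. is_bar C \<and> ht Y < ht C} < card {C. is_bar C \<and> ht X < ht C}"
   using finite_subset[OF _ finite_is_bar] by (intro psubset_card_mono) auto
  thus "P Y" using less.hyps Y(1) by blast
 qed
qed

text \<open>A bar above \<open>X\<close> that contains \<open>ka\<close> lies over the point of \<open>X\<close> at which \<open>ka\<close> climbs, and no bar
 lies strictly between \<open>X\<close> and the bar on top of the trunk at this point.\<close>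

lemma next_bar:
 assumes X: "is_bar X" and Z: "is_bar Z" and k: "ka \<in> bar_roots X" "ka \<in> bar_roots Z" and lt: "ht X < ht Z"
 defines "a \<equiv> pcoeff ka (ht X)"
 shows "bar_roots Z \<subseteq> trunk_at X a" "card (trunk_at X a) \<ge> 2" "ht (bar_over X a) <= ht Z"
proof -
 show sub: "bar_roots Z \<subseteq> trunk_at X a"
 proof
  fix mu assume m: "mu \<in> bar_roots Z"
  have c: "Fin (ht X) < contact ka mu"
   using is_bar_contact[OF Z k(2) m] lt by (auto intro: less_le_trans[rotated])
  hence "mu \<in> bar_roots X" using is_bar_ball[OF X k(1)] is_bar_roots[OF Z] m by (auto simp: ball_def)
  thus "mu \<in> trunk_at X a" using trunk_at_eq[OF X k(1)] c by (auto simp: a_def)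
 qed
 have "ht Z > 0" using lt is_bar_nonneg[OF X] by simp
 then obtain mu \<nu> where mn: "mu \<in> bar_roots Z" "\<nu> \<in> bar_roots Z" "contact mu \<nu> = Fin (ht Z)"
  using is_bar_pair[OF Z] by blast
 hence "mu ~= \<nu>" by auto
 hence "card {mu, \<nu>} = 2" by simp
 moreover have "{mu, \<nu>} \<subseteq> trunk_at X a" using mn sub by auto
 ultimately show T: "card (trunk_at X a) \<ge> 2" by (metis card_mono finite_trunk_at[OF X])
 show "ht (bar_over X a) <= ht Z"
  using bar_over_pair(3)[OF X T, of mu \<nu>] mn sub by auto
qed

lemma postbar_iff: "is_bar X ==> postbar X Y \<longleftrightarrow> (\<exists>c\<in>points X. card (trunk_at X c) \<ge> 2 \<and> Y = bar_over X c)"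
 by (auto simp: postbar_def postbar_at_iff)

lemma bars_eq: "bars f g = {B. is_bar B}"
proof
 show "bars f g \<subseteq> {B. is_bar B}"
 proof
  fix B assume "B \<in> bars f g"
  hence "postbar\<^sup>*\<^sup>* (ground) B" by (simp add: bars_def)
  thus "B \<in> {B. is_bar B}"
   by (induction rule: rtranclp_induct) (auto simp: is_bar_ground postbar_iff is_bar_over)
 qed
 show "{B. is_bar B} \<subseteq> bars f g"
 proof clarify
  fix h S assume B: "is_bar (h, S)"
  let ?B = "(h, S)"
  have "bar_roots ?B \<subseteq> bar_roots X ==> ht X <= ht ?B ==> postbar\<^sup>*\<^sup>* X ?B" if "is_bar X" for X
   using that
  proof (induction X rule: height_induct)
   case (step X)
   obtain ka where k: "ka \<in> bar_roots ?B" using is_bar_nonempty[OF B] by blast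
   show ?case
   proof (cases "ht X = ht ?B")
    case True
    hence "X = ?B" using is_bar_eqI[OF step(1) B True _ k] k step(3) by blast
    thus ?thesis by simp
   next
    case False
    hence lt: "ht X < ht ?B" using step(4) by simp
    define a where "a = pcoeff ka (ht X)"
    have kX: "ka \<in> bar_roots X" using k step(3) by blast
    note nb = next_bar[OF step(1) B kX k lt, folded a_def]
    have aX: "a \<in> points X" using kX by (auto simp: a_def points_def)
    have "postbar X (bar_over X a)" using postbar_iff[OF step(1)] aX nb(2) by blast
    moreover have "postbar\<^sup>*\<^sup>* (bar_over X a) ?B"
     using step(2)[OF is_bar_over[OF step(1) nb(2)] bar_over_pair(1)[OF step(1) nb(2)]] nb(1,3) by simp
    ultimately show ?thesis by (rule converse_rtranclp_into_rtranclp)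
   qed
  qed
  from this[OF is_bar_ground] show "?B \<in> bars f g"
   using is_bar_roots[OF B] is_bar_nonneg[OF B] by (auto simp: bars_def ground_bar_def)
 qed
qed

subsection \<open>Conservation at non-collinear points\<close>

lemma ground_barI:
 assumes "is_bar B" "\<not> ht B > 0" shows "B = ground" "ht B = 0"
 using is_bar_nonneg[OF assms(1)] is_bar_height_0[OF assms(1)] assms(2) by (auto simp: not_less)

lemma nu_bar:
 assumes "is_bar B"
 shows "nu f B = nuf (stem B) (ht B)" "nu g B = nug (stem B) (ht B)"
proof -
 have "nu f B = nuf (stem B) (ht B) \<and> nu g B = nug (stem B) (ht B)"
 proof (cases "ht B > 0")
  case False
  note B = ground_barI[OF assms False]
  have st: "stem B = 0" unfolding B(1) ground_bar_def by (rule stem_height_0)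
  have "cap 0 (yord a) = 0" for a
   using yord_nonneg[of a] by (cases "yord a") (auto simp: cap_def)
  thus ?thesis unfolding st B(2) using nu_ground_bar B(1) by (simp add: nuf_def nug_def arc_order_def)
 qed (use nu_upper assms in auto)
 thus "nu f B = nuf (stem B) (ht B)" "nu g B = nug (stem B) (ht B)" by auto
qed

lemma contact_isosceles: "contact a b < contact b c ==> contact a c = contact a b"
 using contact_ultra[of a b c] contact_ultra[of a c b] contact_commute[of c b]
 by (auto simp: min_def split: if_splits)

text \<open>On the way from \<open>B\<close> to the bar on top of a trunk, only the roots in this trunk gain contact with
 the stem.\<close>

lemma cap_shift:
 assumes B: "is_bar B" and T: "card (trunk_at B a) \<ge> 2" and al: "al \<in> Lam"
 defines "B' \<equiv> bar_over B a"
 shows "cap (ht B') (contact al (stem B')) =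
  cap (ht B) (contact al (stem B)) + (if al \<in> trunk_at B a then ht B' - ht B else 0)"
proof -
 let ?h = "ht B" and ?h' = "ht B'"
 have B': "is_bar B'" unfolding B'_def by (rule is_bar_over[OF B T])
 have lt: "?h < ?h'" unfolding B'_def by (rule bar_over_pair(1)[OF B T])
 show ?thesis
 proof (cases "al \<in> trunk_at B a")
  case True
  hence "reaches (stem B') ?h' al" "reaches (stem B) ?h al"
   using reaches_root_iff[OF B' al] reaches_root_iff[OF B al] by (auto simp: B'_def trunk_at_def)
  thus ?thesis using True by (simp add: cap_reaches)
 next
  case False
  obtain ka where k: "ka \<in> trunk_at B a" using T by (metis card.empty equals0I not_numeral_le_zero)
  hence kB: "ka \<in> bar_roots B" "pcoeff ka ?h = a" by (auto simp: trunk_at_def)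
  have kB': "ka \<in> bar_roots B'" using k by (simp add: B'_def)
  have le: "contact al ka <= Fin ?h"
  proof (rule ccontr)
   assume "\<not> ?thesis"
   hence c: "Fin ?h < contact ka al" by (simp add: contact_commute)
   hence "al \<in> bar_roots B" using is_bar_ball[OF B kB(1)] al by (auto simp: ball_def)
   thus False using False trunk_at_eq[OF B kB(1)] c kB(2) by auto
  qed
  then obtain e where e: "contact al ka = Fin e" "e <= ?h"
   using yord_nonneg[of "al - ka"] by (cases "contact al ka") auto
  have "contact al (stem B') = contact al ka"
   using less_le_trans[OF _ stem_contact[OF B' kB'], of "Fin e"] e lt by (intro contact_isosceles) simp
  moreover have "cap ?h (contact al (stem B)) = e"
  proof (cases "e < ?h")
   case True
   hence "contact al (stem B) = contact al ka"
    using less_le_trans[OF _ stem_contact[OF B kB(1)], of "Fin e"] e True by (intro contact_isosceles) simp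
   thus ?thesis using e by (simp add: cap_def)
  next
   case F: False
   hence "e = ?h" using e by simp
   hence "reaches (stem B) ?h al" using reaches_stem_iff[OF B kB(1)] e by simp
   thus ?thesis using \<open>e = ?h\<close> by (simp add: cap_reaches)
  qed
  ultimately show ?thesis using False e lt by (simp add: cap_def)
 qed
qed

lemma nu_over:
 assumes B: "is_bar B" and T: "card (trunk_at B a) \<ge> 2"
 defines "B' \<equiv> bar_over B a"
 shows "nuf (stem B') (ht B') = nu f B + of_nat (card (trunk_at B a \<inter> np_roots f)) * (ht B' - ht B)"
  "nug (stem B') (ht B') = nu g B + of_nat (card (trunk_at B a \<inter> np_roots g)) * (ht B' - ht B)"
proof -
 have sum: "(\<Sum>al\<in>A. cap (ht B') (contact al (stem B'))) =
   (\<Sum>al\<in>A. cap (ht B) (contact al (stem B))) +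
   of_nat (card (trunk_at B a \<inter> A)) * (ht B' - ht B)" if "A \<subseteq> Lam" for A
 proof -
  have fA: "finite A" using that finite_Lam finite_subset by blast
  have "(\<Sum>al\<in>A. if al \<in> trunk_at B a then ht B' - ht B else 0) =
   (\<Sum>al\<in>trunk_at B a \<inter> A. ht B' - ht B)"
   using fA by (intro sum.mono_neutral_cong_right) auto
  moreover have "(\<Sum>al\<in>A. cap (ht B') (contact al (stem B'))) =
   (\<Sum>al\<in>A. cap (ht B) (contact al (stem B)) + (if al \<in> trunk_at B a then ht B' - ht B else 0))"
   unfolding B'_def using that cap_shift[OF B T] by (intro sum.cong) auto
  ultimately show ?thesis by (simp add: sum.distrib)
 qed
 from sum[of "np_roots f"] sum[of "np_roots g"] show
  "nuf (stem B') (ht B') = nu f B + of_nat (card (trunk_at B a \<inter> np_roots f)) * (ht B' - ht B)"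
  "nug (stem B') (ht B') = nu g B + of_nat (card (trunk_at B a \<inter> np_roots g)) * (ht B' - ht B)"
  unfolding nu_bar[OF B] nuf_def nug_def arc_order_def by simp_all
qed

text \<open>Climbing along the trunk changes \<open>\<nu>\<^sub>f\<close> and \<open>\<nu>\<^sub>g\<close> in proportion to the numbers of roots of
 \<open>f\<close> and \<open>g\<close> in it, and these changes cancel in \<open>\<Delta>\<close>.  So the sum of \<open>\<Delta>\<close> over the points of the
 upper bar is \<open>\<Delta>\<close> of the trunk, hence nonzero, and the Wronskian has the maximal degree.\<close>

lemma noncollinear_over:
 assumes B: "is_bar B" and T: "card (trunk_at B a) \<ge> 2" and D: "Delta f g B (trunk_at B a) ~= 0"
 shows "\<not> col (bar_over B a)"
  and "Suc (pcount (%ga. climbs ga (bar_over B a))) = card (trunk_at B a)"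
proof -
 let ?B = "bar_over B a" and ?T = "trunk_at B a"
 let ?s = "stem ?B" and ?h = "ht ?B"
 have B': "is_bar ?B" by (rule is_bar_over[OF B T])
 have h: "?h > 0" using bar_over_pair(1)[OF B T] is_bar_nonneg[OF B] by simp
 have deg: "degree (phi ?s ?h) = card (?T \<inter> np_roots f)" "degree (psi ?s ?h) = card (?T \<inter> np_roots g)"
 proof -
  have "{ga\<in>np_roots f. reaches ?s ?h ga} = ?T \<inter> np_roots f" "{ga\<in>np_roots g. reaches ?s ?h ga} = ?T \<inter> np_roots g"
   using reaches_root_iff[OF B'] by auto
  thus "degree (phi ?s ?h) = card (?T \<inter> np_roots f)" "degree (psi ?s ?h) = card (?T \<inter> np_roots g)"
   by (simp_all add: degree_phi degree_psi)
 qed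
 have tot: "nuf ?s ?h * of_nat (card (?T \<inter> np_roots g)) - nug ?s ?h * of_nat (card (?T \<inter> np_roots f)) = Delta f g B ?T"
  unfolding nu_over[OF B T] Delta_def by (simp add: algebra_simps)
 have ne: "nuf ?s ?h * of_nat (degree (psi ?s ?h)) - nug ?s ?h * of_nat (degree (phi ?s ?h)) ~= 0"
  unfolding deg tot by (rule D)
 from wronskian_degree[OF ne phi_neq_0 psi_neq_0] have W: "LJ ?s ?h ~= 0"
  "Suc (degree (LJ ?s ?h)) = degree (phi ?s ?h) + degree (psi ?s ?h)" by (simp_all add: LJ_def)
 have "?T \<subseteq> Lam" using is_bar_roots[OF B] by (auto simp: trunk_at_def)
 hence "Suc (degree (LJ ?s ?h)) = card ?T" using W(2) deg card_split by simp
 thus "Suc (pcount (%ga. climbs ga ?B)) = card ?T"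
  using polar_counts(3)[OF stem_pos[OF B'] h W(1)] by (simp add: climbs_iff[OF B'])
 show "\<not> col ?B"
 proof
  assume "col ?B"
  hence z: "Delta f g ?B (trunk_at ?B c) = 0" if "c \<in> points ?B" for c
   using that collinear_bar_iff[OF B'] by (auto simp: nc_points_def)
  have card: "card (?T \<inter> A) = (\<Sum>c\<in>points ?B. card (trunk_at ?B c \<inter> A))" for A
  proof -
   have "?T \<inter> A = (\<Union>c\<in>points ?B. trunk_at ?B c \<inter> A)" by (auto simp: trunk_at_def[of ?B] points_def)
   moreover have "card (\<Union>c\<in>points ?B. trunk_at ?B c \<inter> A) = (\<Sum>c\<in>points ?B. card (trunk_at ?B c \<inter> A))"
    by (rule card_UN_disjoint[OF finite_points[OF B']])
     (use finite_trunk_at[OF B'] in \<open>auto simp: trunk_at_def[of ?B]\<close>)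
   ultimately show ?thesis by simp
  qed
  have "nu f ?B * of_nat (card (?T \<inter> np_roots g)) - nu g ?B * of_nat (card (?T \<inter> np_roots f)) =
    (\<Sum>c\<in>points ?B. Delta f g ?B (trunk_at ?B c))"
   unfolding card Delta_def by (simp add: sum_subtractf sum_distrib_left)
  also have "\<dots> = 0" using z by (intro sum.neutral) auto
  finally show False using tot D nu_bar[OF B'] by simp
 qed
qed

text \<open>Only one of the two terms of \<open>\<Delta>\<close> is present, and its coefficient is positive: \<open>f\<close> and \<open>g\<close>
 are not units.\<close>

lemma Delta_single:
 assumes B: "is_bar B" and T: "card (trunk_at B a) = 1"
 shows "Delta f g B (trunk_at B a) ~= 0"
proof -
 obtain ka where k: "trunk_at B a = {ka}" using T card_1_singletonE by blast
 have kL: "ka \<in> Lam" using k is_bar_roots[OF B] by (auto simp: trunk_at_def)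
 have nu: "(ka \<in> np_roots f --> nu g B > 0) \<and> (ka \<in> np_roots g --> nu f B > 0)"
 proof (cases "ht B > 0")
  case True
  thus ?thesis using nu_upper[OF B] nuf_pos[OF stem_pos[OF B]] nug_pos[OF stem_pos[OF B]] by simp
 next
  case False
  note Bg = ground_barI(1)[OF B False]
  have "trunk_at B a = Lam \<or> trunk_at B a = {}"
   using Lam_pos by (auto simp: Bg ground_bar_def trunk_at_def pos_arc_iff)
  hence "Lam = {ka}" using k by auto
  hence "ka \<in> np_roots f ==> np_roots g = {}" "ka \<in> np_roots g ==> np_roots f = {}"
   using Lam_disjoint by auto
  thus ?thesis using nonunit[OF f_form] nonunit[OF g_form] np by (auto simp: np_pair_def Bg nu_ground_bar)
 qed
 show ?thesis
 proof (cases "ka \<in> np_roots f")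
  case True
  hence "{ka} \<inter> np_roots f = {ka}" "{ka} \<inter> np_roots g = {}" using Lam_disjoint by auto
  thus ?thesis using nu True by (simp add: Delta_def k)
 next
  case False
  hence "{ka} \<inter> np_roots g = {ka}" "{ka} \<inter> np_roots f = {}" using kL by auto
  thus ?thesis using nu False kL by (simp add: Delta_def k)
 qed
qed

lemma card_collinear_trunk:
 assumes "is_bar B" "c \<in> points B" "Delta f g B (trunk_at B c) = 0" shows "card (trunk_at B c) \<ge> 2"
 using Delta_single[OF assms(1), of c] card_trunk_at[OF assms(1,2)] assms(3) by (cases "card (trunk_at B c) = 1") auto

lemma climbs_ground: "pos_arc ga ==> climbs_at ga (ground) 0"
 unfolding climbs_at_iff[OF is_bar_ground] using stem_height_0[of Lam]
 by (simp add: ground_bar_def reaches_def yord_nonneg pos_arc_iff)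

lemma ground_points: "points (ground) = {0}" "trunk_at (ground) 0 = Lam"
proof -
 have "pcoeff ka 0 = 0" if "ka \<in> Lam" for ka using Lam_pos[OF that] by (simp add: pos_arc_iff)
 thus "points (ground) = {0}" "trunk_at (ground) 0 = Lam"
  using Lam_nonempty by (auto simp: points_def trunk_at_def ground_bar_def)
qed

text \<open>On the ground bar, where the arcs \<open>x = z\<close> are not positive, the count is made on the arcs \<open>z
 y\<^sup>h\<close> for a small height \<open>h > 0\<close>.\<close>

lemma count_at_noncollinear_point:
 assumes B: "is_bar B" and a: "a \<in> nc_points B"
 shows "Suc (pcount (%ga. climbs_at ga B a)) = card (trunk_at B a)"
proof (cases "ht B > 0")
 case True
 have nc: "\<not> col B" using a collinear_bar_iff[OF B] by auto
 show ?thesis using polar_count_at[OF B True nc, of a] a by simp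
next
 case False
 note Bg = ground_barI(1)[OF B False]
 have a0: "a = 0" using a ground_points by (auto simp: nc_points_def Bg)
 define H where "H = insert 1 {r. \<exists>ga\<in>Gam \<union> Lam. \<exists>\<nu>\<in>{0}. contact ga \<nu> = Fin r}"
 have fH: "finite H" unfolding H_def using finite_contacts[of "Gam \<union> Lam" "{0}"] finite_Gam finite_Lam by simp
 have posH: "r > 0" if "r \<in> H" for r using that Gam_pos Lam_pos by (auto simp: H_def) (metis less_extended_simps(1) Un_iff)+
 (* not above the order of any root of f, g or the Jacobian *)
 define h where "h = Min H"
 have h: "h > 0" using posH Min_in[OF fH] by (auto simp: h_def H_def)
 have reach: "reaches 0 h ga" if "ga \<in> Gam \<union> Lam" for ga
 proof (cases ga rule: yord_cases)
  case (2 r c)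
  hence "r \<in> H" using that by (auto simp: H_def)
  thus ?thesis using Min_le[OF fH] 2 by (simp add: reaches_def h_def)
 qed (simp add: reaches_def)
 have capL: "cap h (contact ga 0) = h" if "ga \<in> Lam" for ga using cap_reaches reach that by blast
 have nus: "nuf 0 h = of_nat Ef + of_nat (card (np_roots f)) * h" "nug 0 h = of_nat Eg + of_nat (card (np_roots g)) * h"
  using capL by (simp_all add: nuf_def nug_def arc_order_def)
 have deg: "degree (phi 0 h) = card (np_roots f)" "degree (psi 0 h) = card (np_roots g)"
  using reach by (auto simp: degree_phi degree_psi intro!: arg_cong[of _ _ card])
 have D: "Delta f g B Lam = of_nat Ef * of_nat (card (np_roots g)) - of_nat Eg * of_nat (card (np_roots f))"
  by (simp add: Delta_def Bg nu_ground_bar Int_Un_distrib2 Int_absorb1)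
 have "nuf 0 h * of_nat (degree (psi 0 h)) - nug 0 h * of_nat (degree (phi 0 h)) = Delta f g B Lam"
  unfolding nus deg D by (simp add: algebra_simps)
 hence ne: "nuf 0 h * of_nat (degree (psi 0 h)) - nug 0 h * of_nat (degree (phi 0 h)) ~= 0"
  using a ground_points by (simp add: nc_points_def Bg a0)
 from wronskian_degree[OF ne phi_neq_0 psi_neq_0] have W: "LJ 0 h ~= 0"
  "Suc (degree (LJ 0 h)) = card Lam"
  using card_split[of Lam] by (simp_all add: LJ_def deg Int_Un_distrib2 Int_absorb1)
 have "Suc (pcount (reaches 0 h)) = card Lam" using polar_counts(3)[OF _ h W(1)] W(2) by simp
 moreover have "pcount (reaches 0 h) = pcount (%ga. climbs_at ga B a)"
  by (rule pcount_cong) (use reach climbs_ground Gam_pos in \<open>auto simp: Bg a0\<close>)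
 ultimately show ?thesis by (simp add: Bg a0 ground_points)
qed

text \<open>The polar roots climbing at the point are as many as those climbing over the bar above it,
 and they include the latter.\<close>

lemma climbs_noncollinear_point:
 assumes B: "is_bar B" and a: "a \<in> nc_points B" and g: "ga \<in> Gam" "climbs_at ga B a"
 shows "card (trunk_at B a) \<ge> 2" "climbs ga (bar_over B a)" "\<not> col (bar_over B a)"
proof -
 note cnt = count_at_noncollinear_point[OF B a]
 have "pcount (%ga. climbs_at ga B a) ~= 0" using g by (auto simp: pcount_eq_0)
 thus T: "card (trunk_at B a) \<ge> 2" using cnt by simp
 have D: "Delta f g B (trunk_at B a) ~= 0" using a by (simp add: nc_points_def)
 note over = noncollinear_over[OF B T D] and B' = is_bar_over[OF B T]
 show "\<not> col (bar_over B a)" by (rule over(1))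
 have up: "climbs_at de B a" if "climbs de (bar_over B a)" for de
 proof -
  obtain ka where k: "ka \<in> trunk_at B a" using T by (metis card.empty equals0I not_numeral_le_zero)
  have "Fin (ht (bar_over B a)) <= contact de ka"
   using that climbs_iff[OF B'] reaches_stem_iff[OF B', of ka] k by simp
  hence c: "Fin (ht B) < contact de ka"
   using bar_over_pair(1)[OF B T] by (auto intro: less_le_trans[rotated])
  have "pcoeff (de - ka) (ht B) = 0" using c by (simp add: yord_gt_iff lead_term_def)
  thus ?thesis using k reaches_stem_iff[OF B, of ka de] c unfolding climbs_at_iff[OF B]
   by (auto simp: trunk_at_def pcoeff_simps)
 qed
 show "climbs ga (bar_over B a)"
  by (rule pcount_eq_imp[OF _ up g(1)]) (use cnt over(2) g(2) in auto)
qed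

subsection \<open>Covers\<close>

lemma collinear_path_step:
 "col X ==> postbar X Y ==> collinear_path f g Y Z ==> collinear_path f g X Z"
 unfolding collinear_path_def by (rule converse_rtranclp_into_rtranclp[of _ X Y]) auto

lemma path_props:
 assumes "collinear_path f g X Y" "is_bar X"
 shows "is_bar Y" "ht X <= ht Y" "bar_roots Y \<subseteq> bar_roots X"
proof -
 have "is_bar Y \<and> ht X <= ht Y \<and> bar_roots Y \<subseteq> bar_roots X"
  using assms(1) unfolding collinear_path_def
 proof (induction rule: rtranclp_induct)
  case base
  thus ?case using assms(2) by simp
 next
  case (step Y Z)
  then obtain c where c: "card (trunk_at Y c) \<ge> 2" "Z = bar_over Y c" using postbar_iff by blast
  thus ?case using step bar_over_pair(1)[of Y c] is_bar_over[of Y c]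
   by (auto simp: trunk_at_def[of Y])
 qed
 thus "is_bar Y" "ht X <= ht Y" "bar_roots Y \<subseteq> bar_roots X" by auto
qed

text \<open>In this form minimality compares with all other non-collinear bars, not only with those on
 the same path.\<close>

definition lowest_over :: "(bar => bool) => puiseux => bar => bool" where
 "lowest_over P ka Y \<longleftrightarrow> \<not> col Y \<and> ka \<in> bar_roots Y \<and>
  (\<forall>Z. is_bar Z \<and> \<not> col Z \<and> ka \<in> bar_roots Z \<and> P Z --> ht Y <= ht Z)"

lemma lowest_overD:
 "lowest_over P ka Y ==> is_bar Z ==> \<not> col Z ==> ka \<in> bar_roots Z ==> P Z ==>
  ht Y <= ht Z"
 "lowest_over P ka Y ==> ka \<in> bar_roots Y" "lowest_over P ka Y ==> \<not> col Y"
 unfolding lowest_over_def by blast+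

text \<open>Follow the trunk of \<open>ka\<close> upwards as long as the bars are collinear.  By \<open>Delta_single\<close> a
 trunk on a collinear bar has at least two roots, so that the path can only end at a
 non-collinear bar.\<close>

lemma path_exists:
 assumes "is_bar X" "ka \<in> bar_roots X"
 shows "\<exists>Y. collinear_path f g X Y \<and> lowest_over (%Z. ht X <= ht Z) ka Y"
 using assms
proof (induction X rule: height_induct)
 case (step X)
 show ?case
 proof (cases "col X")
  case False
  thus ?thesis using step(3) by (intro exI[of _ X]) (auto simp: collinear_path_def lowest_over_def)
 next
  case True
  define a where "a = pcoeff ka (ht X)"
  have aX: "a \<in> points X" using step(3) by (auto simp: a_def points_def)
  have D0: "Delta f g X (trunk_at X a) = 0"
   using True collinear_bar_iff[OF step(1)] aX by (auto simp: nc_points_def)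
  have T: "card (trunk_at X a) \<ge> 2" by (rule card_collinear_trunk[OF step(1) aX D0])
  have kT: "ka \<in> trunk_at X a" using step(3) by (simp add: trunk_at_def a_def)
  obtain Y where Y: "collinear_path f g (bar_over X a) Y" "lowest_over (%Z. ht (bar_over X a) <= ht Z) ka Y"
   using step(2)[OF is_bar_over[OF step(1) T] bar_over_pair(1)[OF step(1) T], unfolded bar_roots_over, OF kT] by blast
  have "postbar X (bar_over X a)" using postbar_iff[OF step(1)] aX T by blast
  hence "collinear_path f g X Y" using collinear_path_step[OF True _ Y(1)] by blast
  moreover have "ht (bar_over X a) <= ht Z"
   if Z: "is_bar Z" "\<not> col Z" "ka \<in> bar_roots Z" "ht X <= ht Z" for Z
  proof -
   have "ht X ~= ht Z" using is_bar_eqI[OF step(1) Z(1) _ step(3) Z(3)] True Z(2) by auto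
   thus ?thesis unfolding a_def using next_bar(3)[OF step(1) Z(1) step(3) Z(3)] Z(4) by simp
  qed
  ultimately show ?thesis using Y(2) unfolding lowest_over_def by blast
 qed
qed

lemma path_unique:
 assumes "collinear_path f g X Y" "is_bar X" "collinear_path f g X Z" "\<not> col Y" "\<not> col Z"
  "ka \<in> bar_roots Y" "ka \<in> bar_roots Z"
 shows "Y = Z"
 using assms(1,2,3) unfolding collinear_path_def
proof (induction rule: converse_rtranclp_induct)
 case base
 from base(2) assms(4) show ?case by (auto elim: converse_rtranclpE)
next
 case (step X X')
 from step(1) step.prems(1) obtain c where c: "c \<in> points X" "card (trunk_at X c) \<ge> 2" "X' = bar_over X c"
  using postbar_iff by blast
 have X': "is_bar X'" unfolding c(3) by (rule is_bar_over[OF step.prems(1) c(2)])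
 have "X ~= Z" using step(1) assms(5) by auto
 with step.prems(2) obtain X'' where x: "postbar X X''" "collinear_path f g X'' Z"
  unfolding collinear_path_def by (auto elim: converse_rtranclpE)
 then obtain d where d: "card (trunk_at X d) \<ge> 2" "X'' = bar_over X d" using postbar_iff step.prems(1) by blast
 have "ka \<in> bar_roots X'" using path_props(3)[OF _ X'] step(2) assms(6) unfolding collinear_path_def by blast
 moreover have "ka \<in> bar_roots X''"
  using path_props(3)[OF x(2)] is_bar_over[OF step.prems(1) d(1)] assms(7) d(2) by auto
 ultimately have "c = d" using c(3) d(2) by (simp add: trunk_at_def)
 hence "X'' = X'" using c d by simp
 thus ?case using step.IH X' x(2) unfolding collinear_path_def by blast
qed

lemma collinear_pointD:
 assumes "is_bar B" "c \<in> cpoints B"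
 shows "c \<in> points B" "Delta f g B (trunk_at B c) = 0" "card (trunk_at B c) \<ge> 2"
 using assms collinear_points_eq card_collinear_trunk by auto

lemma cover_eq:
 assumes B: "is_bar B" and c: "c \<in> cpoints B"
 shows "cov B c = {B'. \<not> col B' \<and> collinear_path f g (bar_over B c) B'}"
proof -
 note cp = collinear_pointD[OF B c]
 let ?S = "{B'. \<not> col B' \<and> collinear_path f g (bar_over B c) B'}"
 have B1: "is_bar (bar_over B c)" by (rule is_bar_over[OF B cp(3)])
 have pb: "postbar_at B c B' \<longleftrightarrow> B' = bar_over B c" for B' using postbar_at_iff[OF B] cp by auto
 have S_bar: "is_bar B'" "bar_roots B' \<subseteq> trunk_at B c" if "B' \<in> ?S" for B'
  using path_props[OF _ B1, of B'] that by auto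
 have climb: "climbs_at ka B c \<longleftrightarrow> ka \<in> trunk_at B c" if "ka \<in> Lam" for ka
  using trunk_at_arrives[OF B] that by (auto simp: climbs_at_arrives)
 have S: "is_cover f g B c ?S"
  unfolding is_cover_def pb
 proof (intro conjI ballI impI)
  fix ka assume k: "ka \<in> Lam" "climbs_at ka B c"
  hence kT: "ka \<in> bar_roots (bar_over B c)" using climb by simp
  obtain Y where Y: "collinear_path f g (bar_over B c) Y" "\<not> col Y" "ka \<in> bar_roots Y"
   using path_exists[OF B1 kT] unfolding lowest_over_def by blast
  have YS: "Y \<in> ?S" using Y by simp
  show "\<exists>!B'. B' \<in> ?S \<and> climbs ka B'"
  proof (rule ex1I[of _ Y])
   show "Y \<in> ?S \<and> climbs ka Y" using YS Y(3) climbs_root_iff[OF S_bar(1)[OF YS] k(1)] by simp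
   fix Z assume Z: "Z \<in> ?S \<and> climbs ka Z"
   hence "ka \<in> bar_roots Z" using climbs_root_iff[OF S_bar(1) k(1)] by blast
   thus "Z = Y" using path_unique[OF _ B1 Y(1) _ Y(2) _ Y(3), of Z] Z by blast
  qed
 qed auto
 have uniq: "S = ?S" if cov: "is_cover f g B c S" for S
 proof
  show sub: "S \<subseteq> ?S" using that unfolding is_cover_def pb by auto
  show "?S \<subseteq> S"
  proof
   fix B' assume B': "B' \<in> ?S"
   obtain ka where k: "ka \<in> bar_roots B'" using is_bar_nonempty[OF S_bar(1)[OF B']] by blast
   have kL: "ka \<in> Lam" using k is_bar_roots[OF S_bar(1)[OF B']] by blast
   have "climbs_at ka B c" using climb[OF kL] S_bar(2)[OF B'] k by blast
   then obtain B'' where B'': "B'' \<in> S" "climbs ka B''" using cov kL unfolding is_cover_def by blast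
   hence S'': "B'' \<in> ?S" using sub by blast
   hence "ka \<in> bar_roots B''" using climbs_root_iff[OF S_bar(1)[OF S''] kL] B''(2) by simp
   hence "B'' = B'" using path_unique[of "bar_over B c" B'' B' ka] B1 S'' B' k by blast
   thus "B' \<in> S" using B'' by simp
  qed
 qed
 show ?thesis unfolding cover_def by (rule the_equality[where P = "is_cover f g B c", OF S uniq])
qed

lemma coverD:
 assumes B: "is_bar B" and c: "c \<in> cpoints B" and B': "B' \<in> cov B c"
 shows "is_bar B'" "\<not> col B'" "ht B < ht B'" "bar_roots B' \<subseteq> trunk_at B c"
proof -
 note T = collinear_pointD(3)[OF B c]
 note B1 = is_bar_over[OF B T]
 from B' have p: "\<not> col B'" "collinear_path f g (bar_over B c) B'" by (auto simp: cover_eq[OF B c])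
 show "is_bar B'" "\<not> col B'" "bar_roots B' \<subseteq> trunk_at B c" using path_props[OF p(2) B1] p by auto
 show "ht B < ht B'" using path_props(2)[OF p(2) B1] bar_over_pair(1)[OF B T] by simp
qed

lemma cover_exists:
 assumes B: "is_bar B" and c: "c \<in> cpoints B" and k: "ka \<in> trunk_at B c"
 obtains Y where "Y \<in> cov B c" "lowest_over (%Z. ht B < ht Z) ka Y"
proof -
 note B1 = is_bar_over[OF B collinear_pointD(3)[OF B c]]
 have kT: "ka \<in> bar_roots (bar_over B c)" using k by simp
 have kB: "ka \<in> bar_roots B" "c = pcoeff ka (ht B)" using k by (auto simp: trunk_at_def)
 obtain Y where Y: "collinear_path f g (bar_over B c) Y" "lowest_over (%Z. ht (bar_over B c) <= ht Z) ka Y"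
  using path_exists[OF B1 kT] by blast
 have "lowest_over (%Z. ht B < ht Z) ka Y"
  using Y(2) next_bar(3)[OF B _ kB(1), folded kB(2)] unfolding lowest_over_def by blast
 moreover have "Y \<in> cov B c" using Y by (simp add: cover_eq[OF B c] lowest_over_def)
 ultimately show ?thesis by (rule that[rotated])
qed

lemma cover_unique:
 assumes B: "is_bar B" and c: "c \<in> cpoints B"
  and "Y \<in> cov B c" "Z \<in> cov B c" "ka \<in> bar_roots Y" "ka \<in> bar_roots Z"
 shows "Y = Z"
 using path_unique[of "bar_over B c" Y Z ka] assms is_bar_over[OF B collinear_pointD(3)[OF B c]]
 by (auto simp: cover_eq[OF B c])

end

context curve_pair
begin

subsection \<open>The highest non-collinear bar below a polar root\<close>

text \<open>The bars are balls that meet, so that the higher one is contained in the lower one.\<close>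

lemma climbs_both:
 assumes B: "is_bar B" and B': "is_bar B'" and c: "climbs ga B" "climbs ga B'" and le: "ht B <= ht B'"
  and k: "ka \<in> bar_roots B'"
 shows "ka \<in> bar_roots B" "Fin (ht B') <= contact ga ka"
  "ht B < ht B' ==> ka \<in> trunk_at B (pcoeff ga (ht B))"
proof -
 show g: "Fin (ht B') <= contact ga ka"
  using c(2) climbs_iff[OF B'] reaches_stem_iff[OF B' k] by simp
 obtain mu where m: "mu \<in> bar_roots B" using is_bar_nonempty[OF B] by blast
 have "Fin (ht B) <= contact ga mu" using c(1) climbs_iff[OF B] reaches_stem_iff[OF B m] by simp
 moreover have "Fin (ht B) <= contact ga ka" using g le by (auto intro: order_trans[rotated])
 ultimately have "Fin (ht B) <= contact mu ka" using contact_ge_trans contact_commute by metis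
 thus kB: "ka \<in> bar_roots B" using is_bar_ball[OF B m] is_bar_roots[OF B'] k by (auto simp: ball_def)
 assume "ht B < ht B'"
 hence "Fin (ht B) < contact ga ka" using g by (auto intro: less_le_trans[rotated])
 hence "pcoeff (ga - ka) (ht B) = 0" by (simp add: yord_gt_iff lead_term_def)
 thus "ka \<in> trunk_at B (pcoeff ga (ht B))" using kB by (simp add: trunk_at_def pcoeff_simps)
qed

lemma climbs_lower:
 assumes "is_bar B" "ka \<in> bar_roots B" "Fin h <= contact ga ka" "ht B <= h"
 shows "climbs ga B"
proof -
 have "Fin (ht B) <= contact ga ka" using assms(3,4) by (auto intro: order_trans[rotated])
 thus ?thesis using climbs_iff[OF assms(1)] reaches_stem_iff[OF assms(1,2)] by simp
qed

definition upper_nc :: "bar set" where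
 "upper_nc = {B. is_bar B \<and> ht B > 0 \<and> \<not> col B}"

lemma upperD: "B \<in> upper_nc ==> is_bar B" "B \<in> upper_nc ==> ht B > 0"
  "B \<in> upper_nc ==> \<not> col B"
 by (auto simp: upper_nc_def)

lemma finite_upper: "finite upper_nc"
 using finite_subset[OF _ finite_is_bar] by (auto simp: upper_nc_def)

text \<open>The highest non-collinear bar of positive height over which the arc climbs decides on the
 factor of the Jacobian that the arc belongs to.\<close>

definition top_bar :: "bar => puiseux => bool" where
 "top_bar B ga \<longleftrightarrow> climbs ga B \<and> (\<forall>B'\<in>upper_nc. climbs ga B' --> ht B' <= ht B)"

definition Q_root :: "bar => puiseux => bool" where
 "Q_root B ga \<longleftrightarrow> (\<exists>c\<in>cpoints B. climbs_at ga B c \<and> (\<forall>B'\<in>cov B c. bounded_by ga B'))"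

definition ground_root :: "puiseux => bool" where
 "ground_root ga \<longleftrightarrow> (\<forall>B\<in>min_bars. bounded_by ga B)"

lemma top_bar_exists:
 assumes "B \<in> upper_nc" "climbs ga B" obtains Y where "Y \<in> upper_nc" "top_bar Y ga"
proof -
 let ?S = "{B\<in>upper_nc. climbs ga B}"
 have "B \<in> ?S" using assms by simp
 hence "finite (ht ` ?S)" "ht ` ?S ~= {}" using finite_upper by (simp, blast)
 note M = Max_in[OF this] Max_ge[OF this(1)]
 from M(1) obtain Y where Y: "Y \<in> ?S" "Max (ht ` ?S) = ht Y" by auto
 have "ht B' <= ht Y" if "B' \<in> ?S" for B' using M(2)[of "ht B'"] that Y(2) by simp
 thus ?thesis using Y(1) by (intro that[of Y]) (auto simp: top_bar_def)
qed

lemma top_bar_unique: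
 assumes "B \<in> upper_nc" "B' \<in> upper_nc" "top_bar B ga" "top_bar B' ga" shows "B = B'"
proof -
 have h: "ht B = ht B'" using assms by (auto simp: top_bar_def intro!: order_antisym)
 obtain ka where k: "ka \<in> bar_roots B'" using is_bar_nonempty upperD(1) assms(2) by blast
 thus ?thesis
  using climbs_both(1)[of B B' ga ka] is_bar_eqI[of B B' ka] assms h upperD(1) by (auto simp: top_bar_def)
qed

lemma leaves_top_iff:
 assumes B: "B \<in> upper_nc"
 shows "leaves_tree_on ga B \<longleftrightarrow> top_bar B ga \<and> pcoeff ga (ht B) \<notin> points B"
proof -
 have "ht B' <= ht B"
  if l: "leaves_tree_on ga B" and B': "B' \<in> upper_nc" "climbs ga B'" for B'
 proof (rule ccontr)
  assume "\<not> ?thesis"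
  hence lt: "ht B < ht B'" by simp
  obtain ka where k: "ka \<in> bar_roots B'" using is_bar_nonempty upperD(1)[OF B'(1)] by blast
  have "ka \<in> trunk_at B (pcoeff ga (ht B))"
   using climbs_both(3)[OF upperD(1)[OF B] upperD(1)[OF B'(1)] _ B'(2) _ k lt] lt l leaves_iff[OF upperD(1)[OF B]] by simp
  thus False using l leaves_iff[OF upperD(1)[OF B]] trunk_at_nonempty by auto
 qed
 thus ?thesis by (auto simp: leaves_iff[OF upperD(1)[OF B]] top_bar_def)
qed

lemma cover_upper: "B \<in> upper_nc ==> c \<in> cpoints B ==> B' \<in> cov B c ==> B' \<in> upper_nc"
 using coverD[OF upperD(1), of B c B'] less_trans[OF upperD(2)[of B], of "ht B'"]
 by (simp add: upper_nc_def)

text \<open>At a non-collinear point the polar root would climb over the next bar, which is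
 non-collinear; at a collinear point the next non-collinear bars are those of the cover.\<close>

lemma Q_root_top_iff:
 assumes B: "B \<in> upper_nc" and g: "ga \<in> Gam"
 shows "Q_root B ga \<longleftrightarrow> top_bar B ga \<and> pcoeff ga (ht B) \<in> points B"
proof
 note Bb = upperD(1)[OF B]
 let ?a = "pcoeff ga (ht B)"
 assume "Q_root B ga"
 hence a: "?a \<in> cpoints B" and cl: "climbs ga B" and bd: "\<forall>B'\<in>cov B ?a. bounded_by ga B'"
  by (auto simp: Q_root_def climbs_at_iff[OF Bb] climbs_iff[OF Bb])
 have "ht B' <= ht B" if B': "B' \<in> upper_nc" "climbs ga B'" for B'
 proof (rule ccontr)
  assume "\<not> ?thesis"
  hence lt: "ht B < ht B'" by simp
  note Bb' = upperD(1)[OF B'(1)]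
  obtain ka where k: "ka \<in> bar_roots B'" using is_bar_nonempty[OF Bb'] by blast
  note cb = climbs_both[OF Bb Bb' cl B'(2) less_imp_le[OF lt] k]
  obtain Y where Y: "Y \<in> cov B ?a" "lowest_over (%Z. ht B < ht Z) ka Y"
   using cover_exists[OF Bb a cb(3)[OF lt]] by metis
  have Yb: "is_bar Y" by (rule coverD[OF Bb a Y(1)])
  have "climbs ga Y" using climbs_lower[OF Yb lowest_overD(2)[OF Y(2)] cb(2)] lowest_overD(1)[OF Y(2) Bb' upperD(3)[OF B'(1)] k] lt by simp
  thus False using bd Y(1) bounded_by_iff[OF Yb] by blast
 qed
 thus "top_bar B ga \<and> ?a \<in> points B" using cl collinear_pointD(1)[OF Bb a] by (auto simp: top_bar_def)
next
 note Bb = upperD(1)[OF B]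
 let ?a = "pcoeff ga (ht B)"
 assume t: "top_bar B ga \<and> ?a \<in> points B"
 hence at: "climbs_at ga B ?a" by (simp add: top_bar_def climbs_at_iff[OF Bb] climbs_iff[OF Bb])
 have "?a \<notin> nc_points B"
 proof
  assume "?a \<in> nc_points B"
  note up = climbs_noncollinear_point[OF Bb this g at]
  have "bar_over B ?a \<in> upper_nc"
   using is_bar_over[OF Bb up(1)] up(3) bar_over_pair(1)[OF Bb up(1)] upperD(2)[OF B] by (simp add: upper_nc_def)
  thus False using t up(2) bar_over_pair(1)[OF Bb up(1)] by (auto simp: top_bar_def not_le[symmetric])
 qed
 hence a: "?a \<in> cpoints B" using t collinear_points_eq[OF Bb] by (simp add: nc_points_def)
 have "bounded_by ga B'" if "B' \<in> cov B ?a" for B'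
 proof -
  have "B' \<in> upper_nc" "ht B < ht B'"
   using cover_upper[OF B a that] coverD(3)[OF Bb a that] by auto
  thus ?thesis using t bounded_by_iff[OF upperD(1)] by (auto simp: top_bar_def not_le[symmetric])
 qed
 thus "Q_root B ga" using a at by (auto simp: Q_root_def)
qed

lemma minimal_noncollinear:
 assumes "B \<in> min_bars"
 shows "is_bar B" "\<not> col B" "collinear_path f g (ground) B"
 using assms path_props(1)[OF _ is_bar_ground] by (auto simp: minimal_noncollinear_bars_def)

lemma minimal_ground:
 assumes "\<not> col (ground)" shows "min_bars = {ground}"
 using assms by (auto simp: minimal_noncollinear_bars_def collinear_path_def elim: converse_rtranclpE)

lemma minimal_upper:
 assumes "col (ground)" shows "min_bars \<subseteq> upper_nc"
proof
 fix B assume "B \<in> min_bars"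
 note B = minimal_noncollinear[OF this]
 have "ht B > 0" using ground_barI(1)[OF B(1)] B(2) assms by metis
 thus "B \<in> upper_nc" using B by (simp add: upper_nc_def)
qed

lemma climbs_ground_bar: "pos_arc ga ==> climbs ga (ground)"
 using climbs_ground by (auto simp: climbs_def)

lemma ground_root_iff:
 assumes g: "ga \<in> Gam"
 shows "ground_root ga \<longleftrightarrow> (\<forall>B\<in>upper_nc. \<not> climbs ga B)"
proof
 assume gr: "ground_root ga"
 show "\<forall>B\<in>upper_nc. \<not> climbs ga B"
 proof (intro ballI notI)
  fix B assume B: "B \<in> upper_nc" "climbs ga B"
  note Bb = upperD(1)[OF B(1)]
  obtain ka where k: "ka \<in> bar_roots B" using is_bar_nonempty[OF Bb] by blast
  hence kg: "ka \<in> bar_roots (ground)" using is_bar_roots[OF Bb] by (auto simp: ground_bar_def)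
  obtain Y where Y: "collinear_path f g (ground) Y"
   "lowest_over (%Z. ht (ground) <= ht Z) ka Y" using path_exists[OF is_bar_ground kg] by blast
  hence Y': "ka \<in> bar_roots Y" and m: "Y \<in> min_bars"
   by (auto simp: minimal_noncollinear_bars_def lowest_over_def)
  have "ht Y <= ht B"
   using lowest_overD(1)[OF Y(2) Bb upperD(3)[OF B(1)] k] upperD(2)[OF B(1)] by (simp add: ground_bar_def)
  hence "climbs ga Y"
   using climbs_lower[OF minimal_noncollinear(1)[OF m] Y'] climbs_both(2)[OF Bb Bb B(2,2) _ k] by blast
  thus False using gr m bounded_by_iff[OF minimal_noncollinear(1)[OF m]] by (auto simp: ground_root_def)
 qed
next
 assume n: "\<forall>B\<in>upper_nc. \<not> climbs ga B"
 have col: "col (ground)"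
 proof (rule ccontr)
  assume "\<not> ?thesis"
  hence "0 \<in> nc_points (ground)"
   using collinear_bar_iff[OF is_bar_ground] ground_points(1) by (auto simp: nc_points_def)
  note up = climbs_noncollinear_point[OF is_bar_ground this g climbs_ground[OF Gam_pos[OF g]]]
  have "bar_over (ground) 0 \<in> upper_nc"
   using is_bar_over[OF is_bar_ground up(1)] up(3) bar_over_pair(1)[OF is_bar_ground up(1)]
   by (simp add: upper_nc_def ground_bar_def)
  thus False using n up(2) by blast
 qed
 show "ground_root ga"
  using n minimal_upper[OF col] bounded_by_iff[OF minimal_noncollinear(1)] by (auto simp: ground_root_def)
qed

lemma ground_root_noncollinear:
 assumes "\<not> col (ground)" "ga \<in> Gam" shows "\<not> ground_root ga"
 using assms bounded_by_iff[OF is_bar_ground] climbs_ground_bar[OF Gam_pos]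
 by (auto simp: ground_root_def minimal_ground)

text \<open>By the preceding characterisations the factors partition the polar roots: the ground factor
 takes those without a top bar, and the top bar determines the factor of any other.\<close>

lemma polar_root_factor:
 assumes g: "ga \<in> Gam" and n: "\<not> ground_root ga"
 obtains B where "B \<in> upper_nc" "leaves_tree_on ga B \<or> Q_root B ga"
proof -
 obtain B where "B \<in> upper_nc" "climbs ga B" using n ground_root_iff[OF g] by blast
 then obtain Y where Y: "Y \<in> upper_nc" "top_bar Y ga" using top_bar_exists by blast
 thus ?thesis using that[OF Y(1)] leaves_top_iff[OF Y(1), of ga] Q_root_top_iff[OF Y(1) g] by blast
qed

lemma factor_unique:
 assumes "ga \<in> Gam" "B \<in> upper_nc" "B' \<in> upper_nc"
  "leaves_tree_on ga B \<or> Q_root B ga" "leaves_tree_on ga B' \<or> Q_root B' ga"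
 shows "B = B'" "\<not> (leaves_tree_on ga B \<and> Q_root B ga)" "\<not> ground_root ga"
proof -
 have t: "top_bar B ga" "top_bar B' ga"
  using assms leaves_top_iff[of B ga] leaves_top_iff[of B' ga] Q_root_top_iff[of B ga] Q_root_top_iff[of B' ga] by blast+
 show "B = B'" by (rule top_bar_unique[OF assms(2,3) t])
 show "\<not> (leaves_tree_on ga B \<and> Q_root B ga)"
  using leaves_top_iff[OF assms(2), of ga] Q_root_top_iff[OF assms(2,1)] by blast
 show "\<not> ground_root ga" using ground_root_iff[OF assms(1)] t(1) assms(2) by (auto simp: top_bar_def)
qed

subsection \<open>Numbers of polar roots\<close>

lemma disjoint_climbs:
 assumes "is_bar Y" "is_bar Z" "climbs ga Y" "climbs ga Z"
 obtains ka where "ka \<in> bar_roots Y" "ka \<in> bar_roots Z"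
proof (cases "ht Y <= ht Z")
 case True
 obtain ka where "ka \<in> bar_roots Z" using is_bar_nonempty[OF assms(2)] by blast
 thus ?thesis using that climbs_both(1)[OF assms True] by blast
next
 case False
 obtain ka where "ka \<in> bar_roots Y" using is_bar_nonempty[OF assms(1)] by blast
 thus ?thesis using that climbs_both(1)[OF assms(2,1,4,3)] False by simp
qed

lemma finite_cover: "is_bar B ==> c \<in> cpoints B ==> finite (cov B c)"
 using finite_subset[OF _ finite_is_bar] coverD(1) by blast

text \<open>The polar roots that climb at a collinear point and are not bounded by the cover climb over
 exactly one bar of the cover.\<close>

lemma Q_root_count:
 assumes B: "B \<in> upper_nc"
 shows "pcount (Q_root B) + (\<Sum>c\<in>cpoints B. \<Sum>B'\<in>cov B c. pcount (%ga. climbs ga B')) =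
  (\<Sum>c\<in>cpoints B. mmult B c + card (trunk_at B c))"
proof -
 note Bb = upperD(1)[OF B]
 let ?C = "cpoints B"
 have fC: "finite ?C" using collinear_points_eq[OF Bb] finite_points[OF Bb] by simp
 let ?Q = "%c ga. climbs_at ga B c \<and> (\<forall>B'\<in>cov B c. bounded_by ga B')"
 have at: "pcount (%ga. climbs_at ga B c) = pcount (?Q c) + (\<Sum>B'\<in>cov B c. pcount (%ga. climbs ga B'))" if c: "c \<in> ?C" for c
 proof -
  let ?R = "%ga. \<exists>B'\<in>cov B c. climbs ga B'"
  have R: "pcount ?R = (\<Sum>B'\<in>cov B c. pcount (%ga. climbs ga B'))"
  proof (rule pcount_partition[OF finite_cover[OF Bb c]])
   show "Y = Z" if "Y \<in> cov B c" "Z \<in> cov B c" "climbs ga Y" "climbs ga Z" for ga Y Z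
    using disjoint_climbs[OF _ _ that(3,4)] coverD(1)[OF Bb c] cover_unique[OF Bb c that(1,2)] that(1,2) by metis
  qed simp
  have "climbs_at ga B c" if R: "?R ga" for ga
  proof -
   from R obtain B' where B': "B' \<in> cov B c" "climbs ga B'" by blast
   note cv = coverD[OF Bb c B'(1)]
   obtain ka where k: "ka \<in> bar_roots B'" using is_bar_nonempty[OF cv(1)] by blast
   hence kT: "ka \<in> trunk_at B c" using cv(4) by blast
   have "climbs ga B" using climbs_lower[OF Bb _ climbs_both(2)[OF cv(1,1) B'(2,2) _ k]] cv(3) kT by (simp add: trunk_at_def)
   thus ?thesis using climbs_both(3)[OF Bb cv(1) _ B'(2) _ k cv(3)] cv(3) kT
    by (simp add: climbs_at_iff[OF Bb] climbs_iff[OF Bb] trunk_at_def)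
  qed
  hence "pcount (%ga. climbs_at ga B c) = pcount (?Q c) + pcount ?R"
   using bounded_by_iff[OF coverD(1)[OF Bb c]] by (intro pcount_disj) auto
  thus ?thesis using R by simp
 qed
 have "pcount (Q_root B) = (\<Sum>c\<in>?C. pcount (?Q c))"
  by (rule pcount_partition[OF fC]) (auto simp: Q_root_def climbs_at_iff[OF Bb])
 hence "pcount (Q_root B) + (\<Sum>c\<in>?C. \<Sum>B'\<in>cov B c. pcount (%ga. climbs ga B')) =
   (\<Sum>c\<in>?C. pcount (%ga. climbs_at ga B c))" using at by (simp add: sum.distrib)
 also have "\<dots> = (\<Sum>c\<in>?C. mmult B c + card (trunk_at B c))"
 proof (intro sum.cong refl)
  fix c assume "c \<in> ?C"
  hence "c \<notin> nc_points B" using collinear_points_eq[OF Bb] by (simp add: nc_points_def)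
  thus "pcount (%ga. climbs_at ga B c) = mmult B c + card (trunk_at B c)"
   using polar_count_at(1)[OF upperD[OF B], of c] by simp
 qed
 finally show ?thesis .
qed

lemma ground_root_count:
 assumes col: "col (ground)"
 shows "pcount ground_root + (\<Sum>B\<in>min_bars. pcount (%ga. climbs ga B)) = polar_count f g"
proof -
 let ?R = "%ga. \<exists>B\<in>min_bars. climbs ga B"
 have R: "pcount ?R = (\<Sum>B\<in>min_bars. pcount (%ga. climbs ga B))"
 proof (rule pcount_partition)
  show "finite (min_bars)"
   using finite_subset[OF _ finite_is_bar] minimal_noncollinear(1) by blast
  show "Y = Z" if YZ: "Y \<in> min_bars" "Z \<in> min_bars" "climbs ga Y" "climbs ga Z" for ga Y Z
  proof -
   note Y = minimal_noncollinear[OF YZ(1)] and Z = minimal_noncollinear[OF YZ(2)]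
   obtain ka where "ka \<in> bar_roots Y" "ka \<in> bar_roots Z" using disjoint_climbs[OF Y(1) Z(1) YZ(3,4)] by blast
   thus ?thesis by (rule path_unique[OF Y(3) is_bar_ground Z(3) Y(2) Z(2)])
  qed
 qed simp
 have "pcount (%_. True) = pcount ground_root + pcount ?R"
  using bounded_by_iff[OF minimal_noncollinear(1)] by (intro pcount_disj) (auto simp: ground_root_def)
 moreover have "pcount (%_. True) = polar_count f g" by (simp add: pcount_def polar_count_def polar_roots_eq)
 ultimately show ?thesis using R by simp
qed

subsection \<open>Values of the two curves along polar roots\<close>

text \<open>The order of the germ on a bar is that along the arcs with generic \<open>z\<close>, that is with \<open>z\<close> not
 a zero of the leading polynomial; where no trunk grows, \<open>z\<close> is generic.\<close>

lemma order_along_leaving: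
 assumes B: "is_bar B" "ht B > 0" and l: "leaves_tree_on ga B" and g: "pos_arc ga"
  and F: "roots_form F u E (%_. 1) A" "A \<subseteq> Lam"
 shows "yord (germ_eval F ga) = Fin (nu F B)"
proof -
 let ?h = "ht B"
 have l: "reaches (stem B) ?h ga" "pcoeff ga ?h \<notin> points B" using l by (auto simp: leaves_iff[OF B(1)] climbs_iff[OF B(1)])
 have zero: "ymonom ?h 0 = 0" by (rule puiseux_eqI) (simp add: pcoeff_ymonom zero_puiseux.rep_eq)
 have cap: "cap ?h (contact al ga) = cap ?h (contact al (stem B))" for al
 proof (cases "reaches ga ?h al")
  case True
  hence "reaches (stem B) ?h al" using l(1) unfolding reaches_def by (rule contact_ge_trans)
  thus ?thesis using True by (simp add: cap_reaches)
 next
  case False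
  hence "contact al ga < contact ga (stem B)"
   using l(1) less_le_trans[of "contact al ga" "Fin ?h"] by (simp add: reaches_def not_le)
  thus ?thesis using contact_isosceles[of al ga "stem B"] by simp
 qed
 have fA: "finite A" and u0: "germ_at_origin u ~= 0" using F(1) by (auto simp: roots_form_def germ_unit_iff)
 have "\<not> arrives ga ?h 0 al" if "al \<in> A" for al
 proof
  assume "arrives ga ?h 0 al"
  hence r: "reaches ga ?h al" "pcoeff al ?h = pcoeff ga ?h" using B(2) by (auto simp: arrives_iff pcoeff_simps)
  from r(1) l(1) have "reaches (stem B) ?h al" unfolding reaches_def by (rule contact_ge_trans)
  hence "al \<in> bar_roots B" using reaches_root_iff[OF B(1)] F(2) that by blast
  thus False using r(2) l(2) imageI[of al "bar_roots B" "%mu. pcoeff mu ?h"] by (simp add: points_def)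
 qed
 hence none: "{al\<in>A. arrives ga ?h 0 al} = {}" by blast
 have "order 0 (lead_prod (germ_at_origin u) ga ?h (%_. 1) A) = 0"
  using order_lead_prod[OF u0 fA, of ?h 0 ga "%_. 1"] B(2) by (simp add: none)
 hence "poly (lead_prod (germ_at_origin u) ga ?h (%_. 1) A) 0 ~= 0"
  using lead_prod_neq_0[OF u0 fA] by (simp add: order_root)
 with lead_term_on_arc(1)[OF F(1), of ga ?h 0] g B(2)
 have "yord (germ_eval F ga) = Fin (arc_order E ga ?h (%_. 1) A)"
  by (intro yord_lead_term) (auto simp: zero)
 thus ?thesis
  by (simp add: nu_positive_height[OF F(1) stem_pos[OF B(1)] B(2)] arc_order_def cap)
qed

lemma order_along_P_root:
 assumes B: "is_bar B" "ht B > 0" and l: "leaves_tree_on ga B" and g: "ga \<in> Gam"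
 shows "yord (germ_eval f ga) = Fin (nu f B)" "yord (germ_eval g ga) = Fin (nu g B)"
  "yord (germ_eval (f * g) ga) = Fin (nu f B + nu g B)"
proof -
 note o = order_along_leaving[OF B l Gam_pos[OF g]]
 show f: "yord (germ_eval f ga) = Fin (nu f B)" and g': "yord (germ_eval g ga) = Fin (nu g B)"
  by (rule o[OF f_form] o[OF g_form]; simp)+
 show "yord (germ_eval (f * g) ga) = Fin (nu f B + nu g B)"
  using yord_mult_Fin[OF f g'] germ_eval_simps(3)[OF Gam_pos[OF g]] by simp
qed

text \<open>On a non-collinear ground bar the rational function is \<open>\<Delta> / z\<close>, without zeros.\<close>

lemma ground_mero_mult:
 assumes "\<not> col (ground)" shows "mmult (ground) a = 0"
proof -
 let ?G = "ground"
 let ?D = "of_rat (Delta f g ?G Lam) :: complex"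
 have "?D ~= 0" using assms collinear_bar_iff[OF is_bar_ground] ground_points by (auto simp: nc_points_def)
 moreover have "trunk_point ?G Lam = 0" using trunk_point_at[of 0 ?G] ground_points by simp
 hence "mero f g ?G z = poly [:?D:] z / poly [:0, 1:] z" for z
  by (simp add: mero_def trunks_eq[OF is_bar_ground] ground_points)
 ultimately have "zorder (mero f g ?G) a = int (order a [:?D:]) - int (order a [:0, 1:])"
  by (intro zorder_poly_quotient) auto
 moreover have "order a [:?D:] = 0" using \<open>?D ~= 0\<close> by (intro order_0I) simp
 ultimately show ?thesis by (simp add: mero_mult_def)
qed

end

section \<open>Correspondences of trees\<close>

context curve_pair
begin

lemma climbs_contact: "is_bar B ==> ka \<in> bar_roots B ==> climbs ga B \<longleftrightarrow> Fin (ht B) <= contact ga ka"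
 by (simp add: climbs_iff reaches_stem_iff)

lemma climbs_at_contact:
 assumes B: "is_bar B" and k: "ka \<in> bar_roots B"
 shows "climbs_at ga B (pcoeff ka (ht B)) \<longleftrightarrow> Fin (ht B) < contact ga ka"
proof
 assume "climbs_at ga B (pcoeff ka (ht B))"
 moreover have "climbs_at ka B (pcoeff ka (ht B))"
  using climbs_contact[OF B k, of ka] by (simp add: climbs_at_iff[OF B] climbs_iff[OF B])
 ultimately show "Fin (ht B) < contact ga ka"
  unfolding climbs_at_def using contact_gt_trans contact_commute by metis
next
 assume c: "Fin (ht B) < contact ga ka"
 hence "pcoeff (ga - ka) (ht B) = 0" by (simp add: yord_gt_iff lead_term_def)
 thus "climbs_at ga B (pcoeff ka (ht B))"
  using c climbs_contact[OF B k, of ga] by (simp add: climbs_at_iff[OF B] climbs_iff[OF B] pcoeff_simps)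
qed

lemma leaves_contact:
 assumes B: "is_bar B"
 shows "leaves_tree_on ga B \<longleftrightarrow> (\<forall>ka\<in>bar_roots B. contact ga ka = Fin (ht B))"
proof -
 obtain mu where m: "mu \<in> bar_roots B" using is_bar_nonempty[OF B] by blast
 have "pcoeff ga (ht B) \<notin> points B \<longleftrightarrow> (\<forall>ka\<in>bar_roots B. \<not> Fin (ht B) < contact ga ka)" if "climbs ga B"
  using that climbs_at_contact[OF B, of _ ga] by (fastforce simp: climbs_at_iff[OF B] climbs_iff[OF B] points_def)
 thus ?thesis unfolding leaves_iff[OF B] using climbs_contact[OF B, of _ ga] m
  by (metis less_le order.refl)
qed

lemma trunk_at_sub: "is_bar B ==> trunk_at B a \<subseteq> Lam"
 using is_bar_roots[of B] by (auto simp: trunk_at_def)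

lemma trunk_at_contact: "is_bar B ==> ka \<in> bar_roots B ==>
  trunk_at B (pcoeff ka (ht B)) = {mu\<in>bar_roots B. Fin (ht B) < contact ka mu}"
 by (simp add: trunk_at_eq)

end

text \<open>An equivalence without the condition on the rational functions.\<close>

locale tree_map = curve_pair f g + R: curve_pair f' g' for f g f' g' +
 fixes \<phi> :: "puiseux => puiseux"
 assumes bij_f: "bij_betw \<phi> (np_roots f) (np_roots f')" and bij_g: "bij_betw \<phi> (np_roots g) (np_roots g')"
  and contacts: "!!ka mu. ka \<in> Lam ==> mu \<in> Lam ==> contact (\<phi> ka) (\<phi> mu) = contact ka mu"
  and nu_ground_f: "nu f (ground) = nu f' (ground_bar f' g')"
  and nu_ground_g: "nu g (ground) = nu g' (ground_bar f' g')"
begin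

lemma image_f: "\<phi> ` np_roots f = np_roots f'" and image_g: "\<phi> ` np_roots g = np_roots g'"
 using bij_f bij_g by (auto simp: bij_betw_def)

lemma image_Lam: "\<phi> ` Lam = R.Lam" by (simp add: image_Un image_f image_g)

lemma inj_phi: "inj_on \<phi> Lam"
proof (rule inj_onI)
 fix ka mu assume k: "ka \<in> Lam" "mu \<in> Lam" "\<phi> ka = \<phi> mu"
 hence "contact ka mu = Pinf" using contacts[OF k(1,2)] by simp
 thus "ka = mu" using yord_Pinf by simp
qed

lemma image_ball: "ka \<in> Lam ==> \<phi> ` ball ka h = R.ball (\<phi> ka) h"
 unfolding ball_def R.ball_def image_Lam[symmetric] using contacts by auto

lemma fst_bar_map [simp]: "ht (bar_map \<phi> B) = ht B" "bar_roots (bar_map \<phi> B) = \<phi> ` bar_roots B"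
 by (simp_all add: bar_map_def)

lemma is_bar_map: assumes B: "is_bar B" shows "R.is_bar (bar_map \<phi> B)"
proof -
 obtain ka where k: "ka \<in> Lam" "bar_roots B = ball ka (ht B)" "ht B \<ge> 0"
  "ht B = 0 \<or> (\<exists>mu\<in>Lam. contact ka mu = Fin (ht B))" using B by (auto simp: is_bar_def)
 have "ht B = 0 \<or> (\<exists>mu\<in>\<phi> ` Lam. contact (\<phi> ka) mu = Fin (ht B))"
  using k(4) contacts[OF k(1)] by auto
 thus ?thesis unfolding R.is_bar_def image_Lam
  using k(2,3) image_ball[OF k(1)] imageI[OF k(1), of \<phi>] image_Lam by (intro bexI[of _ "\<phi> ka"]) simp_all
qed

lemma is_bar_map_onto: assumes B: "R.is_bar B'" obtains B where "is_bar B" "B' = bar_map \<phi> B"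
proof -
 obtain ka' where "ka' \<in> R.Lam" "bar_roots B' = R.ball ka' (ht B')" and h: "ht B' \<ge> 0"
  and "ht B' = 0 \<or> (\<exists>mu\<in>R.Lam. contact ka' mu = Fin (ht B'))" using B by (auto simp: R.is_bar_def)
 then obtain ka where k: "ka \<in> Lam" "bar_roots B' = R.ball (\<phi> ka) (ht B')"
  "ht B' = 0 \<or> (\<exists>mu\<in>\<phi> ` Lam. contact (\<phi> ka) mu = Fin (ht B'))" unfolding image_Lam[symmetric] by blast
 hence "is_bar (ht B', ball ka (ht B'))"
  unfolding is_bar_def using h contacts[OF k(1)] by (intro bexI[of _ ka]) auto
 moreover have "B' = bar_map \<phi> (ht B', ball ka (ht B'))"
  using k(2) image_ball[OF k(1)] by (simp add: bar_map_def prod_eq_iff)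
 ultimately show ?thesis by (rule that)
qed

lemma inj_bar_map: "inj_on (bar_map \<phi>) {B. is_bar B}"
proof (rule inj_onI)
 fix B C assume "B \<in> {B. is_bar B}" "C \<in> {B. is_bar B}" and e: "bar_map \<phi> B = bar_map \<phi> C"
 hence "bar_roots B \<subseteq> Lam" "bar_roots C \<subseteq> Lam" using is_bar_roots by auto
 thus "B = C" using e inj_on_image_eq_iff[OF inj_phi] by (auto simp: bar_map_def prod_eq_iff)
qed

lemma map_ground: "bar_map \<phi> (ground) = ground_bar f' g'"
 by (simp add: bar_map_def ground_bar_def image_Lam)

text \<open>The point of the image bar that corresponds to \<open>a\<close>.\<close>

definition move :: "bar => complex => complex" where
 "move B a = pcoeff (\<phi> (SOME ka. ka \<in> trunk_at B a)) (ht B)"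

lemma trunk_map:
 assumes B: "is_bar B" and k: "ka \<in> bar_roots B"
 shows "R.trunk_at (bar_map \<phi> B) (pcoeff (\<phi> ka) (ht B)) = \<phi> ` trunk_at B (pcoeff ka (ht B))"
proof -
 have "\<phi> ka \<in> bar_roots (bar_map \<phi> B)" using k by simp
 note t = R.trunk_at_contact[OF is_bar_map[OF B] this] trunk_at_contact[OF B k]
 have "contact (\<phi> ka) (\<phi> mu) = contact ka mu" if "mu \<in> bar_roots B" for mu
  using contacts is_bar_roots[OF B] k that by blast
 thus ?thesis using t by auto
qed

lemma move_eq:
 assumes B: "is_bar B" and k: "ka \<in> bar_roots B"
 shows "move B (pcoeff ka (ht B)) = pcoeff (\<phi> ka) (ht B)"
proof -
 let ?a = "pcoeff ka (ht B)" and ?s = "SOME mu. mu \<in> trunk_at B (pcoeff ka (ht B))"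
 have "ka \<in> trunk_at B ?a" using k by (simp add: trunk_at_def)
 hence "?s \<in> trunk_at B ?a" by (rule someI)
 hence "\<phi> ?s \<in> R.trunk_at (bar_map \<phi> B) (pcoeff (\<phi> ka) (ht B))" using trunk_map[OF B k] by blast
 thus ?thesis by (simp add: move_def R.trunk_at_def)
qed

lemma trunk_at_move:
 assumes B: "is_bar B" and a: "a \<in> points B" shows "R.trunk_at (bar_map \<phi> B) (move B a) = \<phi> ` trunk_at B a"
 using a trunk_map[OF B] move_eq[OF B] by (auto simp: points_def)

lemma bij_move: assumes B: "is_bar B" shows "bij_betw (move B) (points B) (R.points (bar_map \<phi> B))"
 unfolding bij_betw_def
proof
 show "move B ` points B = R.points (bar_map \<phi> B)"
  using move_eq[OF B] by (auto simp: points_def R.points_def image_image)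
 show "inj_on (move B) (points B)"
 proof (rule inj_onI)
  fix a b assume ab: "a \<in> points B" "b \<in> points B" "move B a = move B b"
  have "trunk_at B a \<subseteq> Lam" "trunk_at B b \<subseteq> Lam" using trunk_at_sub[OF B] by auto
  hence "trunk_at B a = trunk_at B b"
   using trunk_at_move[OF B] ab inj_on_image_eq_iff[OF inj_phi] by metis
  thus "a = b" using inj_onD[OF inj_trunk_at _ ab(1,2)] by blast
 qed
qed

lemma card_image: "T \<subseteq> Lam ==> card (\<phi> ` T) = card T"
 using inj_phi by (meson card_image inj_on_subset)

lemma card_image_f: assumes "T \<subseteq> Lam" shows "card (\<phi> ` T \<inter> np_roots f') = card (T \<inter> np_roots f)"
 and "card (\<phi> ` T \<inter> np_roots g') = card (T \<inter> np_roots g)"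
proof -
 have "\<phi> ` T \<inter> np_roots f' = \<phi> ` (T \<inter> np_roots f)" "\<phi> ` T \<inter> np_roots g' = \<phi> ` (T \<inter> np_roots g)"
  unfolding image_f[symmetric] image_g[symmetric]
  using assms by (simp_all add: inj_on_image_Int[OF inj_phi])
 thus "card (\<phi> ` T \<inter> np_roots f') = card (T \<inter> np_roots f)" "card (\<phi> ` T \<inter> np_roots g') = card (T \<inter> np_roots g)"
  using assms by (simp_all add: card_image le_infI1)
qed

lemma bar_over_map:
 assumes B: "is_bar B" and a: "a \<in> points B"
 shows "R.bar_over (bar_map \<phi> B) (move B a) = bar_map \<phi> (bar_over B a)"
proof -
 let ?T = "trunk_at B a"
 note T = trunk_at_sub[OF B, of a]
 have "(\<exists>ka\<in>\<phi> ` ?T. \<exists>mu\<in>\<phi> ` ?T. ka ~= mu \<and> contact ka mu = Fin h) \<longleftrightarrow> (\<exists>ka\<in>?T. \<exists>mu\<in>?T. ka ~= mu \<and> contact ka mu = Fin h)" for h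
 proof -
  have "\<phi> ka ~= \<phi> mu \<and> contact (\<phi> ka) (\<phi> mu) = Fin h \<longleftrightarrow> ka ~= mu \<and> contact ka mu = Fin h" if "ka \<in> ?T" "mu \<in> ?T" for ka mu
   using that T contacts inj_on_eq_iff[OF inj_phi] by (metis subsetD)
  thus ?thesis by simp
 qed
 hence "trunk_height (\<phi> ` ?T) = trunk_height ?T" by (simp add: trunk_height_def)
 thus ?thesis unfolding R.bar_over_def bar_over_def trunk_at_move[OF B a] by (simp add: bar_map_def)
qed

lemma postbar_map: assumes X: "is_bar X" shows "postbar X Y ==> postbar (bar_map \<phi> X) (bar_map \<phi> Y)"
 and "postbar (bar_map \<phi> X) Z ==> \<exists>Y. Z = bar_map \<phi> Y \<and> postbar X Y"
proof -
 have T: "card (R.trunk_at (bar_map \<phi> X) (move X c)) = card (trunk_at X c)" if "c \<in> points X" for c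
  using trunk_at_move[OF X that] card_image[of "trunk_at X c"] trunk_at_sub[OF X] by simp
 have p: "R.points (bar_map \<phi> X) = move X ` points X" using bij_move[OF X] by (simp add: bij_betw_def)
 show "postbar X Y ==> postbar (bar_map \<phi> X) (bar_map \<phi> Y)"
  unfolding postbar_iff[OF X] R.postbar_iff[OF is_bar_map[OF X]] p using T bar_over_map[OF X] by fastforce
 show "postbar (bar_map \<phi> X) Z ==> \<exists>Y. Z = bar_map \<phi> Y \<and> postbar X Y"
  unfolding postbar_iff[OF X] R.postbar_iff[OF is_bar_map[OF X]] p using T bar_over_map[OF X] by fastforce
qed

text \<open>The orders on a bar are determined by those on the bar below and by the bimultiplicity of the
 trunk in between.\<close>

lemma nu_map: assumes "is_bar B" shows "nu f' (bar_map \<phi> B) = nu f B" "nu g' (bar_map \<phi> B) = nu g B"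
proof -
 have "postbar\<^sup>*\<^sup>* (ground) B" using assms bars_eq by (auto simp: bars_def)
 hence "is_bar B \<and> nu f' (bar_map \<phi> B) = nu f B \<and> nu g' (bar_map \<phi> B) = nu g B"
 proof (induction rule: rtranclp_induct)
  case base
  thus ?case by (simp add: map_ground nu_ground_f nu_ground_g is_bar_ground)
 next
  case (step X Y)
  hence X: "is_bar X" by blast
  from step(2) obtain c where c: "c \<in> points X" "card (trunk_at X c) \<ge> 2" "Y = bar_over X c"
   using postbar_iff[OF X] by blast
  note T = trunk_at_sub[OF X, of c]
  have Y: "is_bar Y" using is_bar_over[OF X c(2)] c(3) by simp
  have c': "card (R.trunk_at (bar_map \<phi> X) (move X c)) \<ge> 2" using c(2) T by (simp add: trunk_at_move[OF X c(1)] card_image)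
  have o: "R.bar_over (bar_map \<phi> X) (move X c) = bar_map \<phi> Y" unfolding c(3) by (rule bar_over_map[OF X c(1)])
  show ?case
   using R.nu_over[OF is_bar_map[OF X] c'] nu_over[OF X c(2)] R.nu_bar[OF is_bar_map[OF Y]] nu_bar[OF Y] step.IH Y
   unfolding o c(3)[symmetric] trunk_at_move[OF X c(1)] card_image_f[OF T] by simp
 qed
 thus "nu f' (bar_map \<phi> B) = nu f B" "nu g' (bar_map \<phi> B) = nu g B" by auto
qed

lemma Delta_map: "is_bar B ==> T \<subseteq> Lam ==> Delta f' g' (bar_map \<phi> B) (\<phi> ` T) = Delta f g B T"
 by (simp add: Delta_def nu_map card_image_f)

lemma Delta_move:
 assumes "is_bar B" "a \<in> points B"
 shows "Delta f' g' (bar_map \<phi> B) (R.trunk_at (bar_map \<phi> B) (move B a)) = Delta f g B (trunk_at B a)"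
 using Delta_map[OF assms(1) trunk_at_sub[OF assms(1)]] by (simp add: trunk_at_move[OF assms])

lemma nc_points_map: assumes B: "is_bar B" shows "R.nc_points (bar_map \<phi> B) = move B ` nc_points B"
proof -
 have p: "R.points (bar_map \<phi> B) = move B ` points B" using bij_move[OF B] by (simp add: bij_betw_def)
 show ?thesis unfolding R.nc_points_def nc_points_def p using Delta_move[OF B] by auto
qed

lemma collinear_points_map: assumes B: "is_bar B" shows "collinear_points f' g' (bar_map \<phi> B) = move B ` cpoints B"
proof -
 have p: "R.points (bar_map \<phi> B) = move B ` points B" using bij_move[OF B] by (simp add: bij_betw_def)
 show ?thesis unfolding R.collinear_points_eq[OF is_bar_map[OF B]] collinear_points_eq[OF B] p using Delta_move[OF B] by auto
qed

lemma inj_move: assumes "is_bar B" shows "inj_on (move B) (cpoints B)" "inj_on (move B) (nc_points B)"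
 using bij_betw_imp_inj_on[OF bij_move[OF assms]] collinear_points_eq[OF assms]
 by (auto simp: nc_points_def intro: inj_on_subset)

lemma collinear_map: "is_bar B ==> collinear_bar f' g' (bar_map \<phi> B) \<longleftrightarrow> col B"
 by (simp add: collinear_bar_iff R.collinear_bar_iff[OF is_bar_map] nc_points_map)

lemma upper_map: "R.upper_nc = bar_map \<phi> ` upper_nc"
proof
 show "bar_map \<phi> ` upper_nc \<subseteq> R.upper_nc"
  using is_bar_map collinear_map by (auto simp: upper_nc_def R.upper_nc_def)
 show "R.upper_nc \<subseteq> bar_map \<phi> ` upper_nc"
 proof
  fix C assume C: "C \<in> R.upper_nc"
  obtain B where "is_bar B" "C = bar_map \<phi> B" using is_bar_map_onto[OF R.upperD(1)[OF C]] by blast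
  thus "C \<in> bar_map \<phi> ` upper_nc"
   using C collinear_map[of B] by (auto simp: upper_nc_def R.upper_nc_def)
 qed
qed

lemma path_map:
 assumes X: "is_bar X"
 shows "collinear_path f g X Y ==> collinear_path f' g' (bar_map \<phi> X) (bar_map \<phi> Y)"
  and "collinear_path f' g' (bar_map \<phi> X) Z ==> \<exists>Y. Z = bar_map \<phi> Y \<and> collinear_path f g X Y"
proof -
 show "collinear_path f' g' (bar_map \<phi> X) (bar_map \<phi> Y)" if p: "collinear_path f g X Y"
  using p unfolding collinear_path_def
 proof (induction rule: rtranclp_induct)
  case (step Y Z)
  have Y: "is_bar Y" using path_props(1)[OF _ X, of Y] step(1) by (simp add: collinear_path_def)
  show ?case
   by (rule rtranclp.rtrancl_into_rtrancl[OF step(3)]) (use step(2) collinear_map[OF Y] postbar_map(1)[OF Y] in simp)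
 qed simp
 show "\<exists>Y. Z = bar_map \<phi> Y \<and> collinear_path f g X Y" if p: "collinear_path f' g' (bar_map \<phi> X) Z"
  using p unfolding collinear_path_def
 proof (induction rule: rtranclp_induct)
  case (step Z W)
  then obtain Y where Y: "Z = bar_map \<phi> Y" "collinear_path f g X Y" by (auto simp: collinear_path_def)
  have Yb: "is_bar Y" by (rule path_props(1)[OF Y(2) X])
  obtain V where V: "W = bar_map \<phi> V" "postbar Y V" using postbar_map(2)[OF Yb] step(2) Y(1) by blast
  have st: "col Y \<and> postbar Y V" using step(2) Y(1) collinear_map[OF Yb] V(2) by simp
  from Y(2) st have "(%X Y. col X \<and> postbar X Y)\<^sup>*\<^sup>* X V"
   unfolding collinear_path_def by (rule rtranclp.rtrancl_into_rtrancl)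
  thus ?case using V(1) by blast
 qed (rule exI[of _ X], simp)
qed

lemma path_ends_map:
 assumes X: "is_bar X"
 shows "{Z. \<not> collinear_bar f' g' Z \<and> collinear_path f' g' (bar_map \<phi> X) Z} =
  bar_map \<phi> ` {Y. \<not> col Y \<and> collinear_path f g X Y}" (is "?L = ?R")
proof
 show "?L \<subseteq> ?R"
 proof clarify
  fix h S assume Z: "\<not> collinear_bar f' g' (h, S)" "collinear_path f' g' (bar_map \<phi> X) (h, S)"
  obtain Y where Y: "(h, S) = bar_map \<phi> Y" "collinear_path f g X Y" using path_map(2)[OF X Z(2)] by blast
  have "\<not> col Y" using Z(1) Y(1) collinear_map[OF path_props(1)[OF Y(2) X]] by simp
  thus "(h, S) \<in> ?R" using Y by blast
 qed
 show "?R \<subseteq> ?L"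
  using path_map(1)[OF X] collinear_map[OF path_props(1)[OF _ X]] by (intro image_subsetI) simp
qed

lemma minimal_map: "minimal_noncollinear_bars f' g' = bar_map \<phi> ` min_bars"
 unfolding minimal_noncollinear_bars_def map_ground[symmetric] by (rule path_ends_map[OF is_bar_ground])

lemma cover_map:
 assumes B: "is_bar B" and c: "c \<in> cpoints B"
 shows "cover f' g' (bar_map \<phi> B) (move B c) = bar_map \<phi> ` cov B c"
proof -
 note cp = collinear_pointD[OF B c]
 have "move B c \<in> collinear_points f' g' (bar_map \<phi> B)" using collinear_points_map[OF B] c by blast
 thus ?thesis
  using path_ends_map[OF is_bar_over[OF B cp(3)]]
  by (simp add: R.cover_eq[OF is_bar_map[OF B]] cover_eq[OF B c] bar_over_map[OF B cp(1)])
qed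

end

text \<open>An equivalence of pairs.  The two conditions on the rational functions then determine all
 multiplicities that occur in the counts of polar roots.\<close>

locale tree_equiv = tree_map +
 assumes total_eq: "!!B. is_bar B ==> \<not> col B ==>
   total_mero_mult f' g' (bar_map \<phi> B) = total_mero_mult f g B"
  and zero_eq: "!!B c. is_bar B ==> \<not> col B ==> c \<in> cpoints B ==>
   mero_mult f' g' (bar_map \<phi> B) (move B c) = mmult B c"
begin

lemma zeros_eq:
 assumes "is_bar B" "\<not> col B"
 shows "(\<Sum>c\<in>collinear_points f' g' (bar_map \<phi> B). mero_mult f' g' (bar_map \<phi> B) c) =
  (\<Sum>c\<in>cpoints B. mmult B c)"
 unfolding collinear_points_map[OF assms(1)] sum.reindex[OF inj_move(1)[OF assms(1)]]
 by (intro sum.cong) (simp_all add: zero_eq[OF assms])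

lemma upper_image: "B \<in> upper_nc ==> bar_map \<phi> B \<in> R.upper_nc"
 by (simp add: upper_map)

lemma pure_eq:
 assumes B: "is_bar B" "\<not> col B"
 shows "pure_mero_mult f' g' (bar_map \<phi> B) = pure_mero_mult f g B"
proof (cases "ht B > 0")
 case True
 hence B': "R.is_bar (bar_map \<phi> B)" "ht (bar_map \<phi> B) > 0" "\<not> collinear_bar f' g' (bar_map \<phi> B)"
  using B is_bar_map collinear_map by auto
 show ?thesis using total_counts(3)[OF B(1) True B(2)] R.total_counts(3)[OF B'] total_eq[OF B] zeros_eq[OF B] by simp
next
 case False
 note g = ground_barI(1)[OF B(1) False]
 hence "\<not> collinear_bar f' g' (ground_bar f' g')" using B collinear_map map_ground by metis
 thus ?thesis using B(2) unfolding g map_ground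
  by (simp add: pure_mero_mult_def ground_mero_mult R.ground_mero_mult)
qed

lemma climbs_count_eq:
 assumes B: "B \<in> upper_nc"
 shows "R.pcount (%ga. climbs ga (bar_map \<phi> B)) = pcount (%ga. climbs ga B)"
proof -
 note b = upperD[OF B] and b' = R.upperD[OF upper_image[OF B]]
 have "card (R.nc_points (bar_map \<phi> B)) = card (nc_points B)"
  unfolding nc_points_map[OF b(1)] by (rule Finite_Set.card_image[OF inj_move(2)[OF b(1)]])
 moreover have "card (bar_roots (bar_map \<phi> B)) = card (bar_roots B)" using is_bar_roots[OF b(1)] by (simp add: card_image)
 ultimately show ?thesis using total_counts(1)[OF b] R.total_counts(1)[OF b'] total_eq[OF b(1,3)] by simp
qed

lemma Q_count_eq:
 assumes B: "B \<in> upper_nc"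
 shows "R.pcount (R.Q_root (bar_map \<phi> B)) = pcount (Q_root B)"
proof -
 note b = upperD[OF B]
 let ?C = "cpoints B"
 have inj: "inj_on (move B) ?C" by (rule inj_move(1)[OF b(1)])
 have "(\<Sum>c\<in>?C. \<Sum>B'\<in>cover f' g' (bar_map \<phi> B) (move B c). R.pcount (%ga. climbs ga B')) =
   (\<Sum>c\<in>?C. \<Sum>B'\<in>cov B c. pcount (%ga. climbs ga B'))"
 proof (rule sum.cong[OF refl])
  fix c assume c: "c \<in> ?C"
  have "inj_on (bar_map \<phi>) (cov B c)" by (rule inj_on_subset[OF inj_bar_map]) (use coverD(1)[OF b(1) c] in blast)
  thus "(\<Sum>B'\<in>cover f' g' (bar_map \<phi> B) (move B c). R.pcount (%ga. climbs ga B')) =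
    (\<Sum>B'\<in>cov B c. pcount (%ga. climbs ga B'))"
   unfolding cover_map[OF b(1) c] using cover_upper[OF B c] by (simp add: sum.reindex climbs_count_eq)
 qed
 moreover have "(\<Sum>c\<in>?C. mero_mult f' g' (bar_map \<phi> B) (move B c) + card (R.trunk_at (bar_map \<phi> B) (move B c))) =
   (\<Sum>c\<in>?C. mmult B c + card (trunk_at B c))"
  using collinear_pointD(1)[OF b(1)] trunk_at_sub[OF b(1)]
  by (intro sum.cong refl) (simp add: zero_eq[OF b(1,3)] trunk_at_move[OF b(1)] card_image)
 ultimately show ?thesis
  using Q_root_count[OF B] R.Q_root_count[OF upper_image[OF B]]
  unfolding collinear_points_map[OF b(1)] sum.reindex[OF inj] o_def by simp
qed

lemma ground_count_eq:
 assumes "\<not> col (ground) \<or> polar_count f g = polar_count f' g'"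
 shows "R.pcount R.ground_root = pcount ground_root"
proof (cases "col (ground)")
 case True
 hence col': "collinear_bar f' g' (ground_bar f' g')" using collinear_map[OF is_bar_ground] map_ground by simp
 have "inj_on (bar_map \<phi>) (min_bars)"
  by (rule inj_on_subset[OF inj_bar_map]) (use minimal_noncollinear(1) in blast)
 hence "(\<Sum>B\<in>minimal_noncollinear_bars f' g'. R.pcount (%ga. climbs ga B)) =
   (\<Sum>B\<in>min_bars. pcount (%ga. climbs ga B))"
  unfolding minimal_map using minimal_upper[OF True] by (subst sum.reindex) (auto intro!: sum.cong climbs_count_eq)
 thus ?thesis using ground_root_count[OF True] R.ground_root_count[OF col'] assms True by simp
next
 case False
 hence "\<not> collinear_bar f' g' (ground_bar f' g')" using collinear_map[OF is_bar_ground] map_ground by simp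
 hence "R.pcount R.ground_root = 0" "pcount ground_root = 0"
  using ground_root_noncollinear[OF False] R.ground_root_noncollinear by (auto simp: pcount_eq_0 R.pcount_eq_0)
 thus ?thesis by simp
qed

end

lemma tree_equivI:
 assumes np: "np_pair f g" "np_pair f' g'" and te: "tree_equivalence f g f' g' \<phi>"
 shows "tree_equiv f g f' g' \<phi>"
proof -
 interpret L: curve_pair f g by (rule curve_pair.intro[OF np(1)])
 interpret R: curve_pair f' g' by (rule curve_pair.intro[OF np(2)])
 interpret M: tree_map f g f' g' \<phi> using te by unfold_locales (auto simp: tree_equivalence_def)
 have 1: "total_mero_mult f g B = total_mero_mult f' g' (bar_map \<phi> B)"
  and 2: "!!T. T \<in> trunks B ==> Delta f g B T = 0 ==> mero_mult f g B (trunk_point B T) =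
    mero_mult f' g' (bar_map \<phi> B) (trunk_point (bar_map \<phi> B) (\<phi> ` T))"
  if "L.is_bar B" "\<not> collinear_bar f g B" for B
  using te that L.bars_eq unfolding tree_equivalence_def by blast+
 show ?thesis
 proof unfold_locales
  fix B c assume B: "L.is_bar B" "\<not> collinear_bar f g B" "c \<in> collinear_points f g B"
  note cp = L.collinear_pointD[OF B(1,3)]
  have "M.move B c \<in> R.points (bar_map \<phi> B)" using M.bij_move[OF B(1)] cp(1) by (auto simp: bij_betw_def)
  hence "trunk_point (bar_map \<phi> B) (\<phi> ` L.trunk_at B c) = M.move B c"
   using M.trunk_at_move[OF B(1) cp(1)] R.trunk_point_at by metis
  thus "mero_mult f' g' (bar_map \<phi> B) (M.move B c) = mero_mult f g B c"
   using 2[OF B(1,2), of "L.trunk_at B c"] cp(1,2) L.trunks_eq[OF B(1)] L.trunk_point_at[OF cp(1)] by simp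
 qed (use 1 in simp)
qed

section \<open>Conjugation\<close>

text \<open>The conjugation \<open>y\<^sup>1\<^sup>/\<^sup>n \<mapsto> e\<^sup>2\<^sup>\<pi>\<^sup>i\<^sup>/\<^sup>n y\<^sup>1\<^sup>/\<^sup>n\<close> is an equivalence of the pair with itself.\<close>

context curve_pair
begin

lemma bij_galois: "finite (np_roots F) ==> bij_betw galois (np_roots F) (np_roots F)"
 using np_roots_stable inj_galois by (auto simp: bij_betw_def intro: inj_on_subset)

lemma galois_tree_map: "tree_map f g f g galois"
 by unfold_locales (auto intro: bij_galois finite_f finite_g)

interpretation G: tree_map f g f g galois by (rule galois_tree_map)

abbreviation conj_bar :: "bar => bar" where "conj_bar \<equiv> bar_map galois"

lemma climbs_conj: assumes B: "is_bar B" shows "climbs (galois ga) (conj_bar B) \<longleftrightarrow> climbs ga B"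
proof -
 obtain ka where k: "ka \<in> bar_roots B" using is_bar_nonempty[OF B] by blast
 have "galois ka \<in> bar_roots (conj_bar B)" using k by simp
 thus ?thesis using climbs_contact[OF G.is_bar_map[OF B]] climbs_contact[OF B k] by simp
qed

lemma leaves_conj: "is_bar B ==> leaves_tree_on (galois ga) (conj_bar B) \<longleftrightarrow> leaves_tree_on ga B"
 by (simp add: leaves_contact G.is_bar_map)

lemma pcount_conj:
 assumes "!!ga. ga \<in> Gam ==> P (galois ga) \<longleftrightarrow> Q ga" shows "pcount P = pcount Q"
proof -
 have "galois ` {ga\<in>Gam. Q ga} = {ga\<in>Gam. P ga}"
 proof
  show "galois ` {ga\<in>Gam. Q ga} \<subseteq> {ga\<in>Gam. P ga}" using assms by (auto simp: galois_np_roots_iff)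
  show "{ga\<in>Gam. P ga} \<subseteq> galois ` {ga\<in>Gam. Q ga}"
  proof clarify
   fix ga assume "ga \<in> Gam" "P ga"
   moreover from this obtain de where "de \<in> Gam" "ga = galois de" using np_roots_stable[OF finite_Gam] by blast
   ultimately show "ga \<in> galois ` {ga\<in>Gam. Q ga}" using assms by simp
  qed
 qed
 hence "pcount P = (\<Sum>ga\<in>galois ` {ga\<in>Gam. Q ga}. root_mult Jac ga)" by (simp add: pcount_def)
 also have "\<dots> = pcount Q"
  using inj_galois by (subst sum.reindex) (auto simp: pcount_def intro: inj_on_subset)
 finally show ?thesis .
qed

lemma galois_tree_equiv: "tree_equiv f g f g galois"
proof unfold_locales
 fix B assume B: "is_bar B" "\<not> col B"
 note B' = G.is_bar_map[OF B(1)] and nc' = B(2)[folded G.collinear_map[OF B(1)]]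
 have ground: "conj_bar B = B" "!!a. mmult B a = 0" if "\<not> ht B > 0"
  using ground_barI(1)[OF B(1) that] G.map_ground ground_mero_mult B(2) by auto
 show "total_mero_mult f g (conj_bar B) = total_mero_mult f g B"
 proof (cases "ht B > 0")
  case True
  have "card (nc_points (conj_bar B)) = card (nc_points B)"
   unfolding G.nc_points_map[OF B(1)] by (rule Finite_Set.card_image[OF G.inj_move(2)[OF B(1)]])
  moreover have "card (bar_roots (conj_bar B)) = card (bar_roots B)" using is_bar_roots[OF B(1)] by (simp add: G.card_image)
  moreover have "pcount (%ga. climbs ga (conj_bar B)) = pcount (%ga. climbs ga B)"
   by (rule pcount_conj) (rule climbs_conj[OF B(1)])
  ultimately show ?thesis using total_counts(1)[OF B(1) True B(2)] total_counts(1)[OF B' _ nc'] True by simp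
 qed (use ground in simp)
 fix c assume c: "c \<in> cpoints B"
 note cp = collinear_pointD[OF B(1) c]
 show "mmult (conj_bar B) (G.move B c) = mmult B c"
 proof (cases "ht B > 0")
  case True
  obtain ka where k: "ka \<in> bar_roots B" "c = pcoeff ka (ht B)" using cp(1) by (auto simp: points_def)
  have gk: "galois ka \<in> bar_roots (conj_bar B)" using k(1) by simp
  have "pcount (%ga. climbs_at ga (conj_bar B) (G.move B c)) = pcount (%ga. climbs_at ga B c)"
   using climbs_at_contact[OF B' gk] climbs_at_contact[OF B(1) k(1)] G.move_eq[OF B(1) k(1)]
   by (intro pcount_conj) (simp add: k(2))
  moreover have "card (trunk_at (conj_bar B) (G.move B c)) = card (trunk_at B c)"
   using trunk_at_sub[OF B(1)] by (simp add: G.trunk_at_move[OF B(1) cp(1)] G.card_image)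
  moreover have "c \<notin> nc_points B" "G.move B c \<notin> nc_points (conj_bar B)"
   using G.collinear_points_map[OF B(1)] c collinear_points_eq[OF B(1)] collinear_points_eq[OF B']
   by (auto simp: nc_points_def)
  ultimately show ?thesis
   using polar_count_at(1)[OF B(1) True B(2), of c] polar_count_at(1)[OF B' _ nc', of "G.move B c"] True by simp
 qed (use ground in simp)
qed

lemma top_bar_conj: assumes B: "is_bar B" shows "top_bar (conj_bar B) (galois ga) \<longleftrightarrow> top_bar B ga"
proof -
 have "(\<forall>B'\<in>upper_nc. climbs (galois ga) B' --> ht B' <= ht B) \<longleftrightarrow>
   (\<forall>B'\<in>conj_bar ` upper_nc. climbs (galois ga) B' --> ht B' <= ht B)"
  by (simp only: G.upper_map[symmetric])
 thus ?thesis by (simp add: top_bar_def climbs_conj upperD(1) B)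
qed

lemma Q_root_conj:
 assumes B: "B \<in> upper_nc" and g: "ga \<in> Gam"
 shows "Q_root (conj_bar B) (galois ga) \<longleftrightarrow> Q_root B ga"
proof -
 have B': "conj_bar B \<in> upper_nc" using G.upper_map B by blast
 have *: "Q_root C de \<longleftrightarrow> top_bar C de \<and> \<not> leaves_tree_on de C" if "C \<in> upper_nc" "de \<in> Gam" for C de
  using Q_root_top_iff[OF that] leaves_top_iff[OF that(1)] by blast
 show ?thesis using *[OF B g] *[OF B', of "galois ga"] g upperD(1)[OF B]
  by (simp add: galois_np_roots_iff top_bar_conj leaves_conj)
qed

lemma ground_root_conj: assumes g: "ga \<in> Gam" shows "ground_root (galois ga) \<longleftrightarrow> ground_root ga"
proof -
 have "ground_root (galois ga) \<longleftrightarrow> (\<forall>B\<in>conj_bar ` upper_nc. \<not> climbs (galois ga) B)"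
  using ground_root_iff[of "galois ga"] g G.upper_map by (simp add: galois_np_roots_iff)
 thus ?thesis using ground_root_iff[OF g] by (simp add: climbs_conj upperD(1))
qed

subsection \<open>Classes of conjugate bars\<close>

lemma is_bar_funpow: "is_bar B ==> is_bar ((conj_bar ^^ i) B)"
 by (induction i) (auto intro: G.is_bar_map)

lemma climbs_funpow: "is_bar B ==> climbs ((galois ^^ i) ga) ((conj_bar ^^ i) B) \<longleftrightarrow> climbs ga B"
 by (induction i) (simp_all add: climbs_conj is_bar_funpow)

lemma height_funpow [simp]: "ht ((conj_bar ^^ i) B) = ht B"
 by (induction i) simp_all

text \<open>The roots of an irreducible germ form one orbit of the conjugation.\<close>

lemma conjugate_iff:
 assumes B: "is_bar B" and B': "is_bar B'"
 shows "conjugate_bars B B' \<longleftrightarrow> (\<exists>i. B' = (conj_bar ^^ i) B)"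
proof
 assume "conjugate_bars B B'"
 then obtain p xi et where h: "ht B = ht B'" and p: "irreducible p" "xi \<in> np_roots p" "et \<in> np_roots p"
  and c: "climbs xi B" "climbs et B'" by (auto simp: conjugate_bars_def)
 obtain i where i: "et = (galois ^^ i) xi" using irreducible_germ_roots_conjugate[OF p] by blast
 let ?B = "(conj_bar ^^ i) B"
 have Bi: "is_bar ?B" "climbs et ?B" using is_bar_funpow[OF B] climbs_funpow[OF B] c(1) i by auto
 obtain ka where k: "ka \<in> bar_roots ?B" "ka \<in> bar_roots B'" using disjoint_climbs[OF Bi(1) B' Bi(2) c(2)] by blast
 have "?B = B'" by (rule is_bar_eqI[OF Bi(1) B' _ k]) (simp add: h)
 thus "\<exists>i. B' = (conj_bar ^^ i) B" by blast
next
 assume "\<exists>i. B' = (conj_bar ^^ i) B"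
 then obtain i where i: "B' = (conj_bar ^^ i) B" by blast
 obtain ka where k: "ka \<in> bar_roots B" using is_bar_nonempty[OF B] by blast
 hence kL: "ka \<in> Lam" using is_bar_roots[OF B] by blast
 obtain p where p: "irreducible p" "!!i. (galois ^^ i) ka \<in> np_roots p"
  using minimal_germ_irreducible[OF f_neq_0] minimal_germ_irreducible[OF g_neq_0] kL by blast
 have "climbs ka B" using climbs_root_iff[OF B kL] k by simp
 thus "conjugate_bars B B'"
  unfolding conjugate_bars_def i using p(1) p(2)[of 0] p(2)[of i] climbs_funpow[OF B] by (auto intro!: exI[of _ p])
qed

lemma conjugate_equiv: "equiv (bars f g) {(B, B'). B \<in> bars f g \<and> B' \<in> bars f g \<and> conjugate_bars B B'}"
proof (rule equivI)
 show "{(B, B'). B \<in> bars f g \<and> B' \<in> bars f g \<and> conjugate_bars B B'} \<subseteq> bars f g \<times> bars f g" by auto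
 show "refl_on (bars f g) {(B, B'). B \<in> bars f g \<and> B' \<in> bars f g \<and> conjugate_bars B B'}"
  by (auto simp: refl_on_def bars_eq conjugate_iff intro: exI[of _ 0])
 show "sym {(B, B'). B \<in> bars f g \<and> B' \<in> bars f g \<and> conjugate_bars B B'}"
  by (auto simp: sym_def conjugate_bars_def)
 show "trans {(B, B'). B \<in> bars f g \<and> B' \<in> bars f g \<and> conjugate_bars B B'}"
 proof (rule transI, clarify)
  fix h S k T l U assume b: "(h, S) \<in> bars f g" "(k, T) \<in> bars f g" "(l, U) \<in> bars f g"
   and c: "conjugate_bars (h, S) (k, T)" "conjugate_bars (k, T) (l, U)"
  obtain i j where "(k, T) = (conj_bar ^^ i) (h, S)" "(l, U) = (conj_bar ^^ j) (k, T)"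
   using conjugate_iff[of "(h, S)" "(k, T)"] conjugate_iff[of "(k, T)" "(l, U)"] b c bars_eq by blast
  hence "(l, U) = (conj_bar ^^ (j + i)) (h, S)" by (simp add: funpow_add)
  thus "conjugate_bars (h, S) (l, U)" using b conjugate_iff[of "(h, S)" "(l, U)"] bars_eq by blast
 qed
qed

lemma classD:
 assumes "BB \<in> bar_classes f g"
 shows "BB ~= {}" "B \<in> BB ==> is_bar B" "B \<in> BB ==> conj_bar B \<in> BB"
  "B \<in> BB ==> B' \<in> BB ==> \<exists>i. B' = (conj_bar ^^ i) B"
proof -
 let ?r = "{(B, B'). B \<in> bars f g \<and> B' \<in> bars f g \<and> conjugate_bars B B'}"
 have q: "BB \<in> bars f g // ?r" using assms by (simp add: bar_classes_def)
 show "BB ~= {}" by (rule in_quotient_imp_non_empty[OF conjugate_equiv q])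
 show b: "is_bar B" if "B \<in> BB" for B using in_quotient_imp_subset[OF conjugate_equiv q] that bars_eq by blast
 show "\<exists>i. B' = (conj_bar ^^ i) B" if "B \<in> BB" "B' \<in> BB" for B B'
 proof -
  have "(B, B') \<in> ?r" by (rule in_quotient_imp_in_rel[OF conjugate_equiv q]) (use that in simp)
  thus ?thesis using conjugate_iff[OF b[OF that(1)] b[OF that(2)]] by simp
 qed
 show "conj_bar B \<in> BB" if "B \<in> BB" for B
 proof -
  have "conjugate_bars B (conj_bar B)"
   unfolding conjugate_iff[OF b[OF that] G.is_bar_map[OF b[OF that]]] by (rule exI[of _ 1]) simp
  thus ?thesis
   using in_quotient_imp_closed[OF conjugate_equiv q that] b[OF that] G.is_bar_map[OF b[OF that]] bars_eq by blast
 qed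
qed

lemma classes_disjoint: "BB \<in> bar_classes f g ==> CC \<in> bar_classes f g ==> B \<in> BB ==> B \<in> CC ==> BB = CC"
 using quotient_disj[OF conjugate_equiv] unfolding bar_classes_def by blast

lemma class_exists: assumes "is_bar B" obtains BB where "BB \<in> bar_classes f g" "B \<in> BB"
 using Union_quotient[OF conjugate_equiv] assms unfolding bar_classes_def bars_eq by blast

lemma finite_class: "BB \<in> bar_classes f g ==> finite BB"
 using finite_subset[OF _ finite_is_bar] classD(2) by blast

lemma finite_classes: "finite (bar_classes f g)"
 unfolding bar_classes_def using finite_is_bar bars_eq
 by (intro finite_quotient) auto

lemma class_values:
 assumes c: "BB \<in> bar_classes f g" and B: "B \<in> BB"
 shows "class_height BB = ht B" "class_nu f BB = nu f B" "class_nu g BB = nu g B"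
  "BB \<in> noncollinear_classes f g \<longleftrightarrow> \<not> col B"
proof -
 note b = classD(2)[OF c B]
 have "nu f ((conj_bar ^^ i) B) = nu f B \<and> nu g ((conj_bar ^^ i) B) = nu g B \<and>
   (col ((conj_bar ^^ i) B) \<longleftrightarrow> col B)" for i
  by (induction i) (simp_all add: G.nu_map G.collinear_map is_bar_funpow b)
 hence e: "ht C = ht B \<and> nu f C = nu f B \<and> nu g C = nu g B \<and> (col C \<longleftrightarrow> col B)"
  if "C \<in> BB" for C using classD(4)[OF c B that] height_funpow by metis
 have "v ` BB = {v B}" if "!!C. C \<in> BB ==> v C = v B" for v :: "bar => rat"
  unfolding image_constant[OF B, of "v B", symmetric] by (rule image_cong[OF refl that])
 from this[of ht] this[of "nu f"] this[of "nu g"]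
 show "class_height BB = ht B" "class_nu f BB = nu f B" "class_nu g BB = nu g B"
  using e by (simp_all only: class_height_def class_nu_def the_elem_eq)
 show "BB \<in> noncollinear_classes f g \<longleftrightarrow> \<not> col B"
  unfolding noncollinear_classes_def using c B e by blast
qed

end

section \<open>The factors of the Jacobian\<close>

lemma x_order_product:
 assumes P: "emb P = (\<Prod>ga\<in>S. lin ga ^ m ga)" and pos: "!!ga. ga \<in> S ==> pos_arc ga"
 shows "x_order P = (\<Sum>ga\<in>S. m ga)"
proof -
 have "Abs_fps (%i. ((series P) $ i) $ 0) = coeff_map (%c. pcoeff c 0) (emb P)"
  using pcoeff_puiseux_of_fps[of _ 0] by (intro fps_ext) (simp add: germ_embed_alt)
 also have "\<dots> = (\<Prod>ga\<in>S. fps_X ^ m ga)" unfolding P by (rule pcoeff0_product[OF pos])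
 also have "\<dots> = fps_X ^ (\<Sum>ga\<in>S. m ga)" by (rule power_sum[symmetric])
 finally show ?thesis by (simp add: x_order_def)
qed

context curve_pair
begin

lemma polar_product_germ:
 assumes "!!ga. ga \<in> Gam ==> P ga ==> P (galois ga)"
 shows "polar_product f g {ga\<in>Gam. P ga} \<in> range emb"
  and "emb (inv emb (polar_product f g {ga\<in>Gam. P ga})) = polar_product f g {ga\<in>Gam. P ga}"
  and "x_order (inv emb (polar_product f g {ga\<in>Gam. P ga})) = pcount P"
proof -
 have fin: "finite {ga\<in>Gam. P ga}" using finite_Gam by simp
 show r: "polar_product f g {ga\<in>Gam. P ga} \<in> range emb"
  unfolding polar_product_def
 proof (rule stable_product_is_germ[OF _ fin])
  show "galois ` {ga\<in>Gam. P ga} = {ga\<in>Gam. P ga}"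
   using assms by (intro galois_image_eq[OF fin]) (auto simp: galois_np_roots_iff)
 qed (use Gam_conv in auto)
 thus e: "emb (inv emb (polar_product f g {ga\<in>Gam. P ga})) = polar_product f g {ga\<in>Gam. P ga}"
  by (rule f_inv_into_f)
 show "x_order (inv emb (polar_product f g {ga\<in>Gam. P ga})) = pcount P"
  using x_order_product[OF e[unfolded polar_product_def]] Gam_pos by (simp add: pcount_def polar_product_def)
qed

definition in_P :: "bar set => puiseux => bool" where "in_P BB ga \<longleftrightarrow> (\<exists>B\<in>BB. leaves_tree_on ga B)"
definition in_Q :: "bar set => puiseux => bool" where "in_Q BB ga \<longleftrightarrow> (\<exists>B\<in>BB. Q_root B ga)"

lemma series_eq:
 "P_series f g BB = polar_product f g {ga\<in>Gam. in_P BB ga}"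
 "Q_series f g BB = polar_product f g {ga\<in>Gam. in_Q BB ga}"
 "Q_ground_series f g = polar_product f g {ga\<in>Gam. ground_root ga}"
 by (simp_all add: P_series_def Q_series_def Q_ground_series_def polar_roots_eq in_P_def in_Q_def Q_root_def ground_root_def)

lemma noncollinear_class: "BB \<in> noncollinear_classes f g ==> BB \<in> bar_classes f g"
 by (simp add: noncollinear_classes_def)

lemma class_upper:
 assumes "BB \<in> noncollinear_classes f g" "class_height BB > 0" "B \<in> BB" shows "B \<in> upper_nc"
 using class_values[OF noncollinear_class[OF assms(1)] assms(3)] classD(2)[OF noncollinear_class[OF assms(1)] assms(3)] assms
 by (simp add: upper_nc_def)

lemma in_P_galois: "BB \<in> noncollinear_classes f g ==> in_P BB ga ==> in_P BB (galois ga)"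
 unfolding in_P_def using classD(2,3)[OF noncollinear_class] leaves_conj by blast

lemma in_Q_galois:
 "BB \<in> noncollinear_classes f g ==> class_height BB > 0 ==> ga \<in> Gam ==> in_Q BB ga ==> in_Q BB (galois ga)"
 unfolding in_Q_def using classD(3)[OF noncollinear_class] Q_root_conj class_upper by blast

lemmas P_germ_props = polar_product_germ[of "in_P BB" for BB, folded series_eq P_germ_def, OF in_P_galois]
lemmas Q_germ_props = polar_product_germ[of "in_Q BB" for BB, folded series_eq Q_germ_def, OF in_Q_galois]
lemmas Q_ground_props = polar_product_germ[of ground_root, folded series_eq Q_ground_germ_def]

lemma ground_class:
 assumes "BB \<in> noncollinear_classes f g" "\<not> class_height BB > 0"
 shows "BB = {ground}" "\<not> col (ground)"
proof -
 note c = noncollinear_class[OF assms(1)]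
 have B: "B = ground" if "B \<in> BB" for B
  using ground_barI(1)[OF classD(2)[OF c that]] class_values(1)[OF c that] assms(2) by simp
 thus b: "BB = {ground}" using classD(1)[OF c] by blast
 thus "\<not> col (ground)" using assms(1) by (simp add: noncollinear_classes_def)
qed

lemma P_count: assumes c: "BB \<in> noncollinear_classes f g" shows "pcount (in_P BB) = class_pure_mero_mult f g BB"
proof (cases "class_height BB > 0")
 case True
 note u = class_upper[OF c True]
 have "pcount (in_P BB) = (\<Sum>B\<in>BB. pcount (%ga. leaves_tree_on ga B))"
  by (rule pcount_partition[OF finite_class[OF noncollinear_class[OF c]]])
   (use factor_unique(1) u in \<open>auto simp: in_P_def\<close>)
 also have "\<dots> = (\<Sum>B\<in>BB. pure_mero_mult f g B)" using total_counts(2)[OF upperD] u by (intro sum.cong) auto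
 finally show ?thesis by (simp add: class_pure_mero_mult_def)
next
 case False
 note g = ground_class[OF c False]
 have "\<not> in_P BB ga" if "ga \<in> Gam" for ga
  using Gam_pos[OF that] unfolding g(1) in_P_def leaves_iff[OF is_bar_ground] pos_arc_iff
  by (simp add: leaves_iff[OF is_bar_ground] ground_points) (simp add: ground_bar_def)
 thus ?thesis using g by (simp add: pcount_eq_0 class_pure_mero_mult_def pure_mero_mult_def ground_mero_mult)
qed

lemma Q_count:
 assumes c: "BB \<in> noncollinear_classes f g" "class_height BB > 0"
 shows "pcount (in_Q BB) = (\<Sum>B\<in>BB. pcount (Q_root B))"
 by (rule pcount_partition[OF finite_class[OF noncollinear_class[OF c(1)]]])
  (use factor_unique(1) class_upper[OF c] in \<open>auto simp: in_Q_def\<close>)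

lemma order_along_in_P:
 assumes c: "BB \<in> noncollinear_classes f g" and g: "ga \<in> Gam" "in_P BB ga"
 shows "yord (germ_eval f ga) = Fin (class_nu f BB)" "yord (germ_eval g ga) = Fin (class_nu g BB)"
  "yord (germ_eval (f * g) ga) = Fin (class_nu f BB + class_nu g BB)"
proof -
 obtain B where B: "B \<in> BB" "leaves_tree_on ga B" using g(2) by (auto simp: in_P_def)
 have "class_height BB > 0"
 proof (rule ccontr)
  assume "\<not> ?thesis"
  note gc = ground_class[OF c this]
  have "pcount (in_P BB) = 0"
   using P_count[OF c] gc by (simp add: class_pure_mero_mult_def pure_mero_mult_def ground_mero_mult)
  thus False using g by (simp add: pcount_eq_0)
 qed
 note u = upperD[OF class_upper[OF c this B(1)]]
 note order_along_P_root[OF u(1,2) B(2) g(1), folded class_values(2,3)[OF noncollinear_class[OF c] B(1)]]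
 thus "yord (germ_eval f ga) = Fin (class_nu f BB)" "yord (germ_eval g ga) = Fin (class_nu g BB)"
  "yord (germ_eval (f * g) ga) = Fin (class_nu f BB + class_nu g BB)" by auto
qed

lemma constant_order_intersection:
 assumes c: "BB \<in> noncollinear_classes f g" and v: "!!ga. ga \<in> Gam ==> in_P BB ga ==> yord (germ_eval F ga) = Fin v"
 shows "has_intersection_mult F (P_germ f g BB) (v * of_nat (class_pure_mero_mult f g BB))"
proof -
 have e: "emb (P_germ f g BB) = (\<Prod>ga\<in>{ga\<in>Gam. in_P BB ga}. lin ga ^ root_mult Jac ga)"
  using P_germ_props(2)[OF c] by (simp add: series_eq polar_product_def)
 have "has_intersection_mult F (P_germ f g BB) (\<Sum>ga\<in>{ga\<in>Gam. in_P BB ga}. of_nat (root_mult Jac ga) * v)"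
  by (rule intersection_mult_by_roots[OF e]) (use finite_Gam Gam_pos Gam_conv v in auto)
 thus ?thesis unfolding P_count[OF c, symmetric] pcount_def by (simp add: sum_distrib_left mult.commute)
qed

lemma P_intersection:
 assumes c: "BB \<in> noncollinear_classes f g"
 shows "has_intersection_mult f (P_germ f g BB) (class_nu f BB * of_nat (class_pure_mero_mult f g BB))"
  "has_intersection_mult g (P_germ f g BB) (class_nu g BB * of_nat (class_pure_mero_mult f g BB))"
  "has_intersection_mult (f * g) (P_germ f g BB) ((class_nu f BB + class_nu g BB) * of_nat (class_pure_mero_mult f g BB))"
 by (rule constant_order_intersection[OF c], rule order_along_in_P[OF c]; assumption)+

text \<open>Grouping the roots in the Newton--Puiseux factorisation of the Jacobian according to
 \<open>polar_root_factor\<close>.\<close>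

lemma jacobian_decomposition:
 obtains u E where "u dvd 1" "Jac = u * germ_y ^ E * Q_ground_germ f g *
  (\<Prod>BB\<in>{BB \<in> noncollinear_classes f g. class_height BB > 0}. P_germ f g BB * Q_germ f g BB)"
proof -
 let ?N = "{BB \<in> noncollinear_classes f g. class_height BB > 0}"
 let ?P = "%BB. {ga\<in>Gam. in_P BB ga}" and ?Q = "%BB. {ga\<in>Gam. in_Q BB ga}"
 obtain u E where uE: "u dvd 1"
  "emb Jac = emb (u * germ_y ^ E) * (\<Prod>ga\<in>Gam. lin ga ^ root_mult Jac ga)"
  using germ_factorisation[OF Jac_neq_0] by metis
 have fN: "finite ?N" using finite_subset[OF _ finite_classes] by (auto simp: noncollinear_classes_def)
 have un: "BB = CC \<and> \<not> (in_P BB ga \<and> in_Q BB ga) \<and> \<not> ground_root ga"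
  if g: "ga \<in> Gam" and c: "BB \<in> ?N" "CC \<in> ?N" and i: "in_P BB ga \<or> in_Q BB ga" "in_P CC ga \<or> in_Q CC ga" for ga BB CC
 proof -
  have up: "B \<in> upper_nc" if "B \<in> BB \<or> B \<in> CC" for B using class_upper c that by blast
  obtain B C where B: "B \<in> BB" "leaves_tree_on ga B \<or> Q_root B ga" and C: "C \<in> CC" "leaves_tree_on ga C \<or> Q_root C ga"
   using i by (auto simp: in_P_def in_Q_def)
  have "B = C" "\<not> ground_root ga" using factor_unique[OF g _ _ B(2) C(2)] up B(1) C(1) by blast+
  moreover have "\<not> (in_P BB ga \<and> in_Q BB ga)"
   unfolding in_P_def in_Q_def using factor_unique(1,2)[OF g] up by blast
  moreover have "BB = CC" using classes_disjoint c B(1) C(1) \<open>B = C\<close> noncollinear_class by blast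
  ultimately show ?thesis by blast
 qed
 have cov: "Gam = {ga\<in>Gam. ground_root ga} \<union> (\<Union>BB\<in>?N. ?P BB \<union> ?Q BB)"
 proof -
  have "\<exists>BB\<in>?N. in_P BB ga \<or> in_Q BB ga" if g: "ga \<in> Gam" "\<not> ground_root ga" for ga
  proof -
   obtain B where B: "B \<in> upper_nc" "leaves_tree_on ga B \<or> Q_root B ga" using polar_root_factor[OF g] by blast
   obtain BB where c: "BB \<in> bar_classes f g" "B \<in> BB" using class_exists[OF upperD(1)[OF B(1)]] by blast
   have "BB \<in> ?N" using class_values(1,4)[OF c] upperD(2,3)[OF B(1)] by simp
   thus ?thesis using B(2) c(2) by (auto simp: in_P_def in_Q_def)
  qed
  thus ?thesis by blast
 qed
 have fin: "finite {ga\<in>Gam. S ga}" for S using finite_Gam by simp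
 have "(\<Prod>ga\<in>Gam. lin ga ^ root_mult Jac ga) = polar_product f g ({ga\<in>Gam. ground_root ga} \<union> (\<Union>BB\<in>?N. ?P BB \<union> ?Q BB))"
  using cov by (simp add: polar_product_def)
 also have "\<dots> = Q_ground_series f g * polar_product f g (\<Union>BB\<in>?N. ?P BB \<union> ?Q BB)"
  unfolding series_eq polar_product_def using un fN fin by (intro prod.union_disjoint) blast+
 also have "polar_product f g (\<Union>BB\<in>?N. ?P BB \<union> ?Q BB) = (\<Prod>BB\<in>?N. polar_product f g (?P BB \<union> ?Q BB))"
  unfolding polar_product_def using un fN fin by (intro prod.UNION_disjoint) blast+
 also have "\<dots> = (\<Prod>BB\<in>?N. P_series f g BB * Q_series f g BB)"
 proof (rule prod.cong[OF refl])
  fix BB assume "BB \<in> ?N"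
  thus "polar_product f g (?P BB \<union> ?Q BB) = P_series f g BB * Q_series f g BB"
   unfolding series_eq polar_product_def using un[of _ BB BB] fin by (intro prod.union_disjoint) blast+
 qed
 also have "\<dots> = (\<Prod>BB\<in>?N. emb (P_germ f g BB * Q_germ f g BB))"
  by (intro prod.cong) (simp_all add: germ_embed_simps P_germ_props(2) Q_germ_props(2))
 finally have "emb Jac = emb (u * germ_y ^ E * Q_ground_germ f g * (\<Prod>BB\<in>?N. P_germ f g BB * Q_germ f g BB))"
  using uE(2) by (simp add: germ_embed_simps Q_ground_props(2) ground_root_conj mult.assoc)
 hence "Jac = u * germ_y ^ E * Q_ground_germ f g * (\<Prod>BB\<in>?N. P_germ f g BB * Q_germ f g BB)"
  by (simp add: germ_embed_inject)
 thus ?thesis by (rule that[OF uE(1)])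
qed

end

context tree_equiv
begin

lemma class_map:
 assumes c: "BB \<in> noncollinear_classes f g" and c': "bar_map \<phi> ` BB \<in> bar_classes f' g'"
 shows "bar_map \<phi> ` BB \<in> noncollinear_classes f' g'" "class_height (bar_map \<phi> ` BB) = class_height BB"
  "class_nu f' (bar_map \<phi> ` BB) = class_nu f BB" "class_nu g' (bar_map \<phi> ` BB) = class_nu g BB"
  "class_pure_mero_mult f' g' (bar_map \<phi> ` BB) = class_pure_mero_mult f g BB"
  "inj_on (bar_map \<phi>) BB"
proof -
 note k = noncollinear_class[OF c]
 obtain B where B: "B \<in> BB" using classD(1)[OF k] by blast
 note b = classD(2)[OF k B] and v = class_values[OF k B] and v' = R.class_values[OF c' imageI[OF B]]
 show "bar_map \<phi> ` BB \<in> noncollinear_classes f' g'" using c v(4) v'(4) collinear_map[OF b] by simp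
 show "class_height (bar_map \<phi> ` BB) = class_height BB" using v v' by simp
 show "class_nu f' (bar_map \<phi> ` BB) = class_nu f BB" "class_nu g' (bar_map \<phi> ` BB) = class_nu g BB"
  using v v' nu_map[OF b] by simp_all
 show inj: "inj_on (bar_map \<phi>) BB" by (rule inj_on_subset[OF inj_bar_map]) (use classD(2)[OF k] in blast)
 have "\<not> col C" if "C \<in> BB" for C using c that by (simp add: noncollinear_classes_def)
 thus "class_pure_mero_mult f' g' (bar_map \<phi> ` BB) = class_pure_mero_mult f g BB"
  unfolding class_pure_mero_mult_def sum.reindex[OF inj] o_def
  using pure_eq classD(2)[OF k] by (intro sum.cong) auto
qed

lemma x_orders_eq:
 assumes c: "BB \<in> noncollinear_classes f g" and c': "bar_map \<phi> ` BB \<in> bar_classes f' g'"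
 shows "x_order (P_germ f' g' (bar_map \<phi> ` BB)) = x_order (P_germ f g BB)"
  "class_height BB > 0 ==> x_order (Q_germ f' g' (bar_map \<phi> ` BB)) = x_order (Q_germ f g BB)"
proof -
 note m = class_map[OF c c']
 show "x_order (P_germ f' g' (bar_map \<phi> ` BB)) = x_order (P_germ f g BB)"
  using P_germ_props(3)[OF c] R.P_germ_props(3)[OF m(1)] P_count[OF c] R.P_count[OF m(1)] m(5) by simp
 assume h: "class_height BB > 0"
 hence h': "class_height (bar_map \<phi> ` BB) > 0" using m(2) by simp
 show "x_order (Q_germ f' g' (bar_map \<phi> ` BB)) = x_order (Q_germ f g BB)"
 proof -
  have "(\<Sum>B\<in>bar_map \<phi> ` BB. R.pcount (R.Q_root B)) = (\<Sum>B\<in>BB. pcount (Q_root B))"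
   unfolding sum.reindex[OF m(6)] o_def using Q_count_eq class_upper[OF c h] by (intro sum.cong) auto
  thus ?thesis
   using Q_germ_props(3)[OF c h] R.Q_germ_props(3)[OF m(1) h'] Q_count[OF c h] R.Q_count[OF m(1) h'] by simp
 qed
qed

lemma intersections_eq:
 assumes c: "BB \<in> noncollinear_classes f g" and c': "bar_map \<phi> ` BB \<in> bar_classes f' g'"
 shows "intersection_mult f (P_germ f g BB) = intersection_mult f' (P_germ f' g' (bar_map \<phi> ` BB))"
  "intersection_mult g (P_germ f g BB) = intersection_mult g' (P_germ f' g' (bar_map \<phi> ` BB))"
  "intersection_mult (f * g) (P_germ f g BB) = intersection_mult (f' * g') (P_germ f' g' (bar_map \<phi> ` BB))"
 using P_intersection[OF c] R.P_intersection[OF class_map(1)[OF c c'], unfolded class_map(3-5)[OF c c']]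
 by (auto simp: has_intersection_mult_def)

end

section \<open>Equivariant isometries\<close>

text \<open>Colour-preserving isometries, as relations; being functional and injective is part of being
 isometric, as \<open>contact ka mu = \<infinity>\<close> holds for \<open>ka = mu\<close> only.\<close>

definition isometry where
 "isometry c c' G S S' \<longleftrightarrow> Domain G = S \<and> Range G = S' \<and>
  (\<forall>ka ka'. (ka, ka') \<in> G --> c ka = c' ka') \<and>
  (\<forall>ka ka' mu mu'. (ka, ka') \<in> G --> (mu, mu') \<in> G --> contact ka mu = contact ka' mu')"

lemma isometryD:
 assumes "isometry c c' G S S'"
 shows "Domain G = S" "Range G = S'" "(ka, ka') \<in> G ==> c ka = c' ka'"
  "(ka, ka') \<in> G ==> (mu, mu') \<in> G ==> contact ka mu = contact ka' mu'"
  "(ka, ka') \<in> G ==> ka \<in> S" "(ka, ka') \<in> G ==> ka' \<in> S'"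
 using assms unfolding isometry_def by blast+

lemma isometry_converse: "isometry c c' G S S' ==> isometry c' c (G\<inverse>) S' S"
 unfolding isometry_def by auto

lemma isometry_comp:
 assumes G: "isometry c c' G S S'" and K: "isometry c' c'' K S' S''" shows "isometry c c'' (G O K) S S''"
 unfolding isometry_def
proof (intro conjI allI impI)
 show "Domain (G O K) = S" "Range (G O K) = S''"
  using isometryD(1,2)[OF G] isometryD(1,2)[OF K] by blast+
 show "c ka = c'' ka'" if "(ka, ka') \<in> G O K" for ka ka'
  using that isometryD(3)[OF G] isometryD(3)[OF K] by (auto elim!: relcompE)
 show "contact ka mu = contact ka' mu'" if GK: "(ka, ka') \<in> G O K" "(mu, mu') \<in> G O K" for ka ka' mu mu'
 proof -
  obtain \<nu> et where n: "(ka, \<nu>) \<in> G" "(\<nu>, ka') \<in> K" "(mu, et) \<in> G" "(et, mu') \<in> K" using GK by blast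
  show ?thesis using isometryD(4)[OF G n(1,3)] isometryD(4)[OF K n(2,4)] by simp
 qed
qed

lemma isometry_Id: "isometry c c (Id_on S) S S" unfolding isometry_def by auto

lemma isometry_union:
 assumes 1: "isometry c c' G S S'" and 2: "isometry c c' K T T'"
  and d: "!!ka mu. ka \<in> S ==> mu \<in> T ==> contact ka mu = h" "!!ka mu. ka \<in> S' ==> mu \<in> T' ==> contact ka mu = h"
 shows "isometry c c' (G \<union> K) (S \<union> T) (S' \<union> T')"
 unfolding isometry_def
proof (intro conjI allI impI)
 show "Domain (G \<union> K) = S \<union> T" "Range (G \<union> K) = S' \<union> T'"
  using isometryD(1,2)[OF 1] isometryD(1,2)[OF 2] by blast+
 show "c ka = c' ka'" if "(ka, ka') \<in> G \<union> K" for ka ka' using that isometryD(3)[OF 1] isometryD(3)[OF 2] by blast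
 have x: "contact ka mu = contact ka' mu'" if "(ka, ka') \<in> G" "(mu, mu') \<in> K" for ka ka' mu mu'
  using d(1)[of ka mu] d(2)[of ka' mu'] isometryD(5,6)[OF 1 that(1)] isometryD(5,6)[OF 2 that(2)] by simp
 show "contact ka mu = contact ka' mu'" if "(ka, ka') \<in> G \<union> K" "(mu, mu') \<in> G \<union> K" for ka ka' mu mu'
  using that isometryD(4)[OF 1, of ka ka' mu mu'] isometryD(4)[OF 2, of ka ka' mu mu'] x[of ka ka' mu mu'] x[of mu mu' ka ka']
   contact_commute[of ka mu] contact_commute[of ka' mu'] by auto
qed

text \<open>The isometry type of a coloured set.\<close>

definition shape where "shape c c' Y = {X. \<exists>G. isometry c c' G X Y}"

lemma shape_eq: assumes "isometry c' c'' K Y Z" shows "shape c c' Y = shape c c'' Z"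
 unfolding shape_def using isometry_comp assms isometry_converse[OF assms] by blast

lemma shape_isometry: assumes "shape c c Y = shape c c' Z" obtains G where "isometry c c' G Y Z"
proof -
 have "Y \<in> shape c c Y" unfolding shape_def using isometry_Id by blast
 thus ?thesis using that assms unfolding shape_def by blast
qed

lemma pcoeff_galois_funpow: "pcoeff ((galois ^^ k) a) r = cis (2 * pi * of_rat r) ^ k * pcoeff a r"
 by (induction k) (simp_all add: galois.rep_eq)

lemma contact_galois_funpow: "contact ((galois ^^ k) a) ((galois ^^ k) b) = contact a b"
 by (induction k) simp_all

lemma contact_level:
 assumes "Fin h <= contact ka mu" "pcoeff ka h ~= pcoeff mu h" shows "contact ka mu = Fin h"
proof (rule antisym[OF _ assms(1)], rule ccontr)
 assume "\<not> contact ka mu <= Fin h"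
 hence "pcoeff (ka - mu) h = 0" by (simp add: not_le yord_gt_iff lead_term_def)
 thus False using assms(2) by (simp add: pcoeff_simps)
qed

lemma contact_level_gt:
 assumes "Fin h <= contact ka mu" shows "pcoeff ka h = pcoeff mu h \<longleftrightarrow> Fin h < contact ka mu"
proof
 show "pcoeff ka h = pcoeff mu h" if "Fin h < contact ka mu"
 proof -
  have "pcoeff (ka - mu) h = 0" using that by (simp add: yord_gt_iff lead_term_def)
  thus ?thesis by (simp add: pcoeff_simps)
 qed
 assume "pcoeff ka h = pcoeff mu h"
 hence "pcoeff (ka - mu) h = 0" by (simp add: pcoeff_simps)
 thus "Fin h < contact ka mu" using assms by (auto simp: yord_ge_iff yord_gt_iff lead_term_def)
qed

definition fibre :: "puiseux set => rat => complex set => puiseux set" where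
 "fibre S h A = {ka\<in>S. pcoeff ka h \<in> A}"

locale conj_stable =
 fixes d :: nat and h :: rat and S :: "puiseux set"
 assumes finite_S: "finite S" and stable: "!!ka. ka \<in> S ==> (galois ^^ d) ka \<in> S"
  and level: "!!ka mu. ka \<in> S ==> mu \<in> S ==> Fin h <= contact ka mu"
begin

abbreviation \<tau> :: "puiseux => puiseux" where "\<tau> \<equiv> galois ^^ d"
abbreviation \<omega> :: complex where "\<omega> \<equiv> cis (2 * pi * of_rat h) ^ d"

lemma tau_eq: "(\<tau> ^^ k) ka = (galois ^^ (d * k)) ka"
 by (metis funpow_mult)

lemma pcoeff_tau: "pcoeff ((\<tau> ^^ k) ka) h = \<omega> ^ k * pcoeff ka h"
 by (simp add: tau_eq pcoeff_galois_funpow power_mult)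

lemma points_stable: assumes "a \<in> (%ka. pcoeff ka h) ` S" shows "\<omega> * a \<in> (%ka. pcoeff ka h) ` S"
proof -
 obtain ka where "ka \<in> S" "a = pcoeff ka h" using assms by blast
 thus ?thesis using stable by (intro image_eqI[of _ _ "\<tau> ka"]) (simp_all add: pcoeff_galois_funpow)
qed

lemma contact_tau: "contact ((\<tau> ^^ k) ka) ((\<tau> ^^ k) mu) = contact ka mu"
 by (simp only: tau_eq contact_galois_funpow)

lemma stable_funpow: "ka \<in> S ==> (\<tau> ^^ k) ka \<in> S"
 by (induction k) (auto intro: stable)

lemma inj_funpow: "inj ((\<tau> ^^ k))"
proof (rule injI)
 fix a b assume "(\<tau> ^^ k) a = (\<tau> ^^ k) b"
 hence "contact a b = Pinf" using contact_tau[of k a b] by simp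
 thus "a = b" using yord_Pinf by simp
qed

lemma funpow_onto: assumes "ka \<in> S" obtains mu where "mu \<in> S" "ka = (\<tau> ^^ k) mu"
proof -
 have "(\<tau> ^^ k) ` S = S" using stable_funpow inj_on_subset[OF inj_funpow]
  by (intro endo_inj_surj[OF finite_S]) auto
 thus ?thesis using assms that by blast
qed

lemma fibre_rotate: "fibre S h {\<omega> ^ k * a} = (\<tau> ^^ k) ` fibre S h {a}"
proof
 show "(\<tau> ^^ k) ` fibre S h {a} \<subseteq> fibre S h {\<omega> ^ k * a}" by (auto simp: fibre_def pcoeff_tau stable_funpow)
 show "fibre S h {\<omega> ^ k * a} \<subseteq> (\<tau> ^^ k) ` fibre S h {a}"
 proof
  fix ka assume k: "ka \<in> fibre S h {\<omega> ^ k * a}"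
  then obtain mu where m: "mu \<in> S" "ka = (\<tau> ^^ k) mu" using funpow_onto by (auto simp: fibre_def)
  hence "pcoeff mu h = a" using k by (simp add: fibre_def pcoeff_tau)
  thus "ka \<in> (\<tau> ^^ k) ` fibre S h {a}" using m by (auto simp: fibre_def)
 qed
qed

lemma fibre_orbit: "fibre S h (range (%j. \<omega> ^ j * a)) = (\<Union>j. (\<tau> ^^ j) ` fibre S h {a})"
 unfolding fibre_rotate[symmetric] by (auto simp: fibre_def)

text \<open>The conjugation is an isometry between fibres over points of one orbit.\<close>

lemma shape_orbit:
 assumes c: "!!ka. c' (galois ka) = c' ka" shows "shape c c' (fibre S h {\<omega> ^ k * a}) = shape c c' (fibre S h {a})"
proof -
 have ck: "c' ((galois ^^ n) ka) = c' ka" for n ka by (induction n) (simp_all add: c)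
 have "isometry c' c' {(ka, (\<tau> ^^ k) ka) | ka. ka \<in> fibre S h {a}} (fibre S h {a}) (fibre S h {\<omega> ^ k * a})"
  unfolding isometry_def fibre_rotate using contact_tau by (auto simp: tau_eq ck contact_galois_funpow)
 thus ?thesis by (rule shape_eq[symmetric])
qed

lemma period: assumes "a \<in> (%ka. pcoeff ka h) ` S" and d: "d > 0"
 obtains m where "m > 0" "\<omega> ^ m * a = a" "!!k. \<omega> ^ k * a = a ==> m dvd k"
proof -
 obtain ka where k: "ka \<in> S" "a = pcoeff ka h" using assms by blast
 obtain n where n: "has_denom n (pcoeff ka)" using denom_puiseux by blast
 hence "n > 0" by (simp add: has_denom_def)
 have "(galois ^^ (n * d)) ka = ka" using funpow_mod_period[OF galois_period[OF n], of "n * d"] by simp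
 hence "(\<tau> ^^ n) ka = ka" by (simp add: tau_eq mult.commute)
 hence ex: "\<exists>m>0. \<omega> ^ m * a = a" using pcoeff_tau[of n ka] k \<open>n > 0\<close> by auto
 define m where "m = (LEAST m. m > 0 \<and> \<omega> ^ m * a = a)"
 have m: "m > 0" "\<omega> ^ m * a = a" using LeastI_ex[OF ex] by (auto simp: m_def)
 have least: "m <= j" if "j > 0" "\<omega> ^ j * a = a" for j
  unfolding m_def using that by (intro Least_le conjI)
 have "m dvd k" if "\<omega> ^ k * a = a" for k
 proof -
  have q: "\<omega> ^ (m * q) * a = a" for q
  proof (induction q)
   case (Suc q)
   have "\<omega> ^ (m * Suc q) * a = \<omega> ^ m * (\<omega> ^ (m * q) * a)" by (simp add: power_add mult.assoc)
   thus ?case using Suc m by simp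
  qed simp
  have "\<omega> ^ k * a = \<omega> ^ (k mod m) * (\<omega> ^ (m * (k div m)) * a)"
   by (simp add: mult.assoc[symmetric] power_add[symmetric])
  hence r: "\<omega> ^ (k mod m) * a = a" using q that by simp
  have "\<not> k mod m > 0"
  proof
   assume "k mod m > 0"
   hence "m <= k mod m" using least r by blast
   thus False using mod_less_divisor[OF m(1), of k] by linarith
  qed
  thus ?thesis by (simp add: dvd_eq_mod_eq_0)
 qed
 thus ?thesis using that m by blast
qed

end

abbreviation conj_isometric where
 "conj_isometric c c' d S S' \<equiv> \<exists>H. isometry c c' H S S' \<and>
  (\<forall>ka ka'. (ka, ka') \<in> H --> ((galois ^^ d) ka, (galois ^^ d) ka') \<in> H)"

text \<open>An isometry of fibres that commutes with the stabiliser extends along the orbits.\<close>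

lemma saturate:
 assumes S: "conj_stable d h S" and S': "conj_stable d h S'"
  and c: "!!ka. c (galois ka) = c ka" "!!ka. c' (galois ka) = c' ka"
  and H: "isometry c c' H (fibre S h {a}) (fibre S' h {a'})"
  and eq: "!!ka ka'. (ka, ka') \<in> H ==> ((galois ^^ (d * m)) ka, (galois ^^ (d * m)) ka') \<in> H"
 defines "w \<equiv> cis (2 * pi * of_rat h) ^ d"
 assumes m: "!!k. w ^ k * a = a ==> m dvd k" and aa: "!!i j. w ^ i * a = w ^ j * a \<longleftrightarrow> w ^ i * a' = w ^ j * a'"
 shows "conj_isometric c c' d (fibre S h (range (%j. w ^ j * a))) (fibre S' h (range (%j. w ^ j * a')))"
proof -
 interpret S: conj_stable d h S by (rule S)
 interpret S': conj_stable d h S' by (rule S')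
 let ?t = "galois ^^ d"
 have w0: "w ^ j ~= 0" for j by (simp add: w_def)
 define K where "K = {((?t ^^ j) ka, (?t ^^ j) ka') | j ka ka'. (ka, ka') \<in> H}"
 have ck: "c ((galois ^^ n) ka) = c ka" "c' ((galois ^^ n) ka) = c' ka" for n ka by (induction n) (simp_all add: c)
 have Hm: "((?t ^^ (m * q)) ka, (?t ^^ (m * q)) ka') \<in> H" if "(ka, ka') \<in> H" for q ka ka'
 proof (induction q)
  case (Suc q)
  have "(galois ^^ (d * m)) ((?t ^^ (m * q)) x) = (?t ^^ (m * Suc q)) x" for x
   by (simp add: S.tau_eq funpow_add algebra_simps)
  thus ?case using eq[OF Suc] by simp
 qed (use that in simp)
 have HS: "ka \<in> S" "pcoeff ka h = a" "ka' \<in> S'" "pcoeff ka' h = a'" if "(ka, ka') \<in> H" for ka ka'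
  using isometryD(5,6)[OF H that] by (auto simp: fibre_def)
 have "Domain K = (\<Union>j. (?t ^^ j) ` Domain H)" "Range K = (\<Union>j. (?t ^^ j) ` Range H)" by (auto simp: K_def)
 hence dom: "Domain K = fibre S h (range (%j. w ^ j * a))" and ran: "Range K = fibre S' h (range (%j. w ^ j * a'))"
  by (simp_all add: isometryD(1,2)[OF H] S.fibre_orbit S'.fibre_orbit w_def)
 have same: "contact ((?t ^^ j) ka) ((?t ^^ i) mu) = contact ((?t ^^ j) ka') ((?t ^^ i) mu')"
  if k: "(ka, ka') \<in> H" "(mu, mu') \<in> H" and le: "i <= j" for i j ka ka' mu mu'
 proof (cases "w ^ j * a = w ^ i * a")
  case True
  have "w ^ i * (w ^ (j - i) * a) = w ^ i * a" using True le by (simp add: mult.assoc[symmetric] power_add[symmetric])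
  hence "w ^ (j - i) * a = a" unfolding mult_left_cancel[OF w0[of i]] .
  then obtain q where q: "j - i = m * q" using m by (auto elim: dvdE)
  have split: "(?t ^^ j) x = (?t ^^ i) ((?t ^^ (j - i)) x)" for x using le by (simp flip: funpow_add[THEN fun_cong, unfolded o_apply])
  show ?thesis unfolding split S.contact_tau q by (rule isometryD(4)[OF H Hm[OF k(1)] k(2)])
 next
  case False
  hence "w ^ j * a' ~= w ^ i * a'" using aa by blast
  hence "contact ((?t ^^ j) ka') ((?t ^^ i) mu') = Fin h"
   using HS[OF k(1)] HS[OF k(2)] S'.level S'.stable_funpow by (intro contact_level) (auto simp: S.pcoeff_tau w_def)
  moreover have "contact ((?t ^^ j) ka) ((?t ^^ i) mu) = Fin h"
   using False HS[OF k(1)] HS[OF k(2)] S.level S.stable_funpow by (intro contact_level) (auto simp: S.pcoeff_tau w_def)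
  ultimately show ?thesis by simp
 qed
 have "isometry c c' K (fibre S h (range (%j. w ^ j * a))) (fibre S' h (range (%j. w ^ j * a')))"
  unfolding isometry_def
 proof (intro conjI allI impI dom ran)
  show "c ka = c' ka'" if "(ka, ka') \<in> K" for ka ka'
   using that isometryD(3)[OF H] by (auto simp: K_def S.tau_eq ck)
  show "contact ka mu = contact ka' mu'" if K: "(ka, ka') \<in> K" "(mu, mu') \<in> K" for ka ka' mu mu'
  proof -
   obtain j ka0 ka1 where k: "(ka0, ka1) \<in> H" "ka = (?t ^^ j) ka0" "ka' = (?t ^^ j) ka1" using K(1) by (auto simp: K_def)
   obtain i mu0 mu1 where u: "(mu0, mu1) \<in> H" "mu = (?t ^^ i) mu0" "mu' = (?t ^^ i) mu1" using K(2) by (auto simp: K_def)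
   show ?thesis
   proof (cases "i <= j")
    case True thus ?thesis unfolding k(2,3) u(2,3) by (rule same[OF k(1) u(1)])
   next
    case False
    hence "contact mu ka = contact mu' ka'" unfolding k(2,3) u(2,3) by (intro same[OF u(1) k(1)]) simp
    thus ?thesis by (simp add: contact_commute)
   qed
  qed
 qed
 moreover have "(?t ka, ?t ka') \<in> K" if K: "(ka, ka') \<in> K" for ka ka'
 proof -
  obtain j ka0 ka1 where k: "(ka0, ka1) \<in> H" "ka = (?t ^^ j) ka0" "ka' = (?t ^^ j) ka1" using K by (auto simp: K_def)
  hence "?t ka = (?t ^^ Suc j) ka0" "?t ka' = (?t ^^ Suc j) ka1" by simp_all
  thus ?thesis using k(1) unfolding K_def by blast
 qed
 ultimately show ?thesis by blast
qed

text \<open>A first pair of orbits to be matched.  A point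
 other than \<open>0\<close> has to be matched with a point other than \<open>0\<close>; this is possible, as all
 orbits except \<open>{0}\<close> have the same number of elements.\<close>

lemma matching_point:
 fixes w :: complex and s :: "complex => 't"
 assumes fin: "finite A" "finite A'" and w0: "w ~= 0" and ne: "A ~= {}"
  and stab: "!!a. a \<in> A ==> w * a \<in> A" "!!a. a \<in> A' ==> w * a \<in> A'"
  and inv: "!!a. s (w * a) = s a" "!!a. s' (w * a) = s' a"
  and counts: "!!T. card {a\<in>A. s a = T} = card {a\<in>A'. s' a = T}"
 obtains a a' where "a \<in> A" "a' \<in> A'" "s a = s' a'" "!!i j. w ^ i * a = w ^ j * a \<longleftrightarrow> w ^ i * a' = w ^ j * a'"
proof -
 have fib: "finite {a\<in>A. s a = T}" "finite {a\<in>A'. s' a = T}" for T using fin by auto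
 have ex: "\<exists>a'\<in>A'. s' a' = s a" if "a \<in> A" for a
 proof -
  have "card {b\<in>A. s b = s a} ~= 0" using that fib(1) by auto
  thus ?thesis unfolding counts using fib(2) by auto
 qed
 have two: "card {x, w * x} = 2" if "w ~= 1" "x ~= 0" for x :: complex using that by simp
 show ?thesis
 proof (cases "w = 1")
  case True
  obtain a where a: "a \<in> A" using ne by blast
  then obtain a' where "a' \<in> A'" "s' a' = s a" using ex by blast
  thus ?thesis using that[of a a'] a True by simp
 next
  case w1: False
  show ?thesis
  proof (cases "\<exists>a\<in>A. a ~= 0")
   case True
   then obtain a where a: "a \<in> A" "a ~= 0" by blast
   have "\<exists>a'\<in>A'. s' a' = s a \<and> a' ~= 0"
   proof (rule ccontr)
    assume "\<not> ?thesis"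
    hence "{b\<in>A'. s' b = s a} \<subseteq> {0}" by blast
    hence "card {b\<in>A'. s' b = s a} <= 1" using card_mono[of "{0::complex}"] by simp
    moreover have "{a, w * a} \<subseteq> {b\<in>A. s b = s a}" using a stab inv by auto
    from card_mono[OF fib(1) this] have "2 <= card {b\<in>A. s b = s a}" unfolding two[OF w1 a(2)] .
    ultimately show False using counts[of "s a"] by simp
   qed
   then obtain a' where a': "a' \<in> A'" "s' a' = s a" "a' ~= 0" by blast
   have "w ^ i * a = w ^ j * a \<longleftrightarrow> w ^ i * a' = w ^ j * a'" for i j
    unfolding mult_right_cancel[OF a(2)] mult_right_cancel[OF a'(3)] by (rule refl)
   from that[OF a(1) a'(1) a'(2)[symmetric] this] show ?thesis by blast
  next
   case False
   hence A: "A = {0}" using ne by auto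
   obtain a' where a': "a' \<in> A'" "s' a' = s 0" using ex A by blast
   have "a' = 0"
   proof (rule ccontr)
    assume n: "a' ~= 0"
    have "{a', w * a'} \<subseteq> {b\<in>A'. s' b = s 0}" using a' stab inv by auto
    from card_mono[OF fib(2) this] have "2 <= card {b\<in>A'. s' b = s 0}" unfolding two[OF w1 n] .
    moreover have "{b\<in>A. s b = s 0} = {0}" using A by auto
    ultimately show False using counts[of "s 0"] by simp
   qed
   show ?thesis by (rule that[of 0 a']) (use A a' \<open>a' = 0\<close> in auto)
  qed
 qed
qed

lemma remove_orbit:
 fixes w :: complex
 assumes fin: "finite A" and w0: "w ~= 0" and stab: "!!b. b \<in> A ==> w * b \<in> A" and inv: "!!b. s (w * b) = s b" and a: "a \<in> A"
 defines "Ob \<equiv> range (%j. w ^ j * a)"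
 shows "Ob \<subseteq> A" "!!b. b \<in> A - Ob ==> w * b \<in> A - Ob"
  "card {b\<in>A. s b = T} = card {b\<in>A - Ob. s b = T} + (if s a = T then card Ob else 0)"
proof -
 have "w ^ j * a \<in> A \<and> s (w ^ j * a) = s a" for j
 proof (induction j)
  case (Suc j) thus ?case using stab[of "w ^ j * a"] inv[of "w ^ j * a"] by (simp add: mult.assoc)
 qed (use a in simp)
 hence sO: "!!b. b \<in> Ob ==> s b = s a \<and> b \<in> A" by (auto simp: Ob_def)
 thus sub: "Ob \<subseteq> A" by blast
 have fO: "finite Ob" using sub fin finite_subset by blast
 have "(*) w ` Ob \<subseteq> Ob"
 proof
  fix b assume "b \<in> (*) w ` Ob"
  then obtain j where "b = w ^ Suc j * a" by (auto simp: Ob_def mult.assoc)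
  thus "b \<in> Ob" unfolding Ob_def by blast
 qed
 hence Ob: "(*) w ` Ob = Ob" using w0 by (intro endo_inj_surj[OF fO]) (auto simp: inj_on_def)
 show "w * b \<in> A - Ob" if b: "b \<in> A - Ob" for b
 proof -
  have "w * b \<notin> Ob"
  proof
   assume "w * b \<in> Ob"
   then obtain b' where "b' \<in> Ob" "w * b = w * b'" using Ob by blast
   thus False using w0 b by simp
  qed
  thus ?thesis using stab b by blast
 qed
 have "{b\<in>A. s b = T} = {b\<in>A - Ob. s b = T} \<union> (if s a = T then Ob else {})" using sub sO by auto
 moreover have "card ({b\<in>A - Ob. s b = T} \<union> (if s a = T then Ob else {})) =
   card {b\<in>A - Ob. s b = T} + card (if s a = T then Ob else {})"
  using fin fO by (intro card_Un_disjoint) auto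
 ultimately show "card {b\<in>A. s b = T} = card {b\<in>A - Ob. s b = T} + (if s a = T then card Ob else 0)" by simp
qed

lemma card_image_cong:
 assumes "!!i j. i \<in> X ==> j \<in> X ==> F i = F j \<longleftrightarrow> G i = G j" shows "card (F ` X) = card (G ` X)"
proof (rule bij_betw_same_card, rule bij_betw_imageI)
 have "F (inv_into X F (F i)) = F i" "inv_into X F (F i) \<in> X" if "i \<in> X" for i
  using that by (simp_all add: f_inv_into_f inv_into_into)
 hence G: "G (inv_into X F (F i)) = G i" if "i \<in> X" for i using assms that by blast
 thus "inj_on (%b. G (inv_into X F b)) (F ` X)" using assms by (auto intro!: inj_onI)
 show "(%b. G (inv_into X F b)) ` F ` X = G ` X" unfolding image_image using G by (intro image_cong) auto
qed

lemma fibre_union: "fibre S h A \<union> fibre S h B = fibre S h (A \<union> B)" by (auto simp: fibre_def)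

lemma fibre_contact:
 assumes "conj_stable d h S" "A \<inter> B = {}" "ka \<in> fibre S h A" "mu \<in> fibre S h B" shows "contact ka mu = Fin h"
 using conj_stable.level[OF assms(1)] assms(2-4) by (intro contact_level) (auto simp: fibre_def)

text \<open>Match an orbit of points with one whose fibres have the same shape, replace an isometry of
 two fibres by one that commutes with their stabiliser, and spread it along the orbits.  Points
 of different fibres always have the contact order \<open>h\<close>, so that the pieces fit together.\<close>

lemma glue_fibres:
 fixes d :: nat and h :: rat and c c' :: "puiseux => 'c"
 defines "w \<equiv> cis (2 * pi * of_rat h) ^ d"
 assumes S: "conj_stable d h S" and S': "conj_stable d h S'" and d: "d > 0"
  and c: "!!ka. c (galois ka) = c ka" "!!ka. c' (galois ka) = c' ka"
  and fibres: "!!a a' m G. m > 0 ==> w ^ m * a = a ==> w ^ m * a' = a' ==> a \<in> (%ka. pcoeff ka h) ` S ==>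
   isometry c c' G (fibre S h {a}) (fibre S' h {a'}) ==>
   conj_isometric c c' (d * m) (fibre S h {a}) (fibre S' h {a'})"
  and A: "A \<subseteq> (%ka. pcoeff ka h) ` S" "A' \<subseteq> (%ka. pcoeff ka h) ` S'"
   "!!a. a \<in> A ==> w * a \<in> A" "!!a. a \<in> A' ==> w * a \<in> A'"
   "!!T. card {a\<in>A. shape c c (fibre S h {a}) = T} = card {a\<in>A'. shape c c' (fibre S' h {a}) = T}"
 shows "conj_isometric c c' d (fibre S h A) (fibre S' h A')"
 using A
proof (induction "card A" arbitrary: A A' rule: less_induct)
 case less
 interpret S: conj_stable d h S by (rule S)
 interpret S': conj_stable d h S' by (rule S')
 let ?s = "%a. shape c c (fibre S h {a})" and ?s' = "%a. shape c c' (fibre S' h {a})"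
 have w0: "w ~= 0" by (simp add: w_def)
 have inv: "?s (w * a) = ?s a" "?s' (w * a) = ?s' a" for a
  using S.shape_orbit[of c c 1 a, OF c(1)] S'.shape_orbit[of c' c 1 a, OF c(2)] by (simp_all add: w_def)
 have fin: "finite A" "finite A'" using less.prems(1,2) S.finite_S S'.finite_S by (meson finite_imageI finite_subset)+
 show ?case
 proof (cases "A = {}")
  case True
  have "A' = {}"
  proof (rule equals0I)
   fix a assume a: "a \<in> A'"
   have "card {b\<in>A'. ?s' b = ?s' a} = 0" using less.prems(5)[of "?s' a"] True by simp
   thus False using a fin(2) by auto
  qed
  thus ?thesis using True by (intro exI[of _ "{}"]) (simp add: isometry_def fibre_def)
 next
  case False
  obtain a a' where a: "a \<in> A" "a' \<in> A'" "?s a = ?s' a'" and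
   aa: "!!i j. w ^ i * a = w ^ j * a \<longleftrightarrow> w ^ i * a' = w ^ j * a'"
   using matching_point[OF fin w0 False less.prems(3,4) inv less.prems(5)] by blast
  define Ob where "Ob = range (%j. w ^ j * a)"
  define Ob' where "Ob' = range (%j. w ^ j * a')"
  note r = remove_orbit[where s = ?s, OF fin(1) w0 less.prems(3) inv(1) a(1), folded Ob_def]
  note r' = remove_orbit[where s = ?s', OF fin(2) w0 less.prems(4) inv(2) a(2), folded Ob'_def]
  have cO: "card Ob = card Ob'" unfolding Ob_def Ob'_def using aa by (intro card_image_cong)
  have aO: "a \<in> Ob" unfolding Ob_def by (rule range_eqI[of _ _ 0]) simp
  have lt: "card (A - Ob) < card A" using aO a(1) fin(1) by (intro psubset_card_mono) auto
  have cnt: "card {b\<in>A - Ob. ?s b = T} = card {b\<in>A' - Ob'. ?s' b = T}" for T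
   using r(3)[of T] r'(3)[of T] less.prems(5)[of T] cO a(3) by (auto split: if_splits)
  obtain H1 where H1: "isometry c c' H1 (fibre S h (A - Ob)) (fibre S' h (A' - Ob'))"
   "!!ka ka'. (ka, ka') \<in> H1 ==> ((galois ^^ d) ka, (galois ^^ d) ka') \<in> H1"
   using less.hyps[OF lt _ _ r(2) r'(2) cnt] less.prems(1,2) by blast
  obtain m where m: "m > 0" "w ^ m * a = a" "!!k. w ^ k * a = a ==> m dvd k"
   using S.period[of a] d a(1) less.prems(1) unfolding w_def by blast
  have m': "w ^ m * a' = a'" using aa[of m 0] m(2) by simp
  obtain G where G: "isometry c c' G (fibre S h {a}) (fibre S' h {a'})" using shape_isometry[OF a(3)] by blast
  obtain H2 where H2: "isometry c c' H2 (fibre S h {a}) (fibre S' h {a'})"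
   "!!ka ka'. (ka, ka') \<in> H2 ==> ((galois ^^ (d * m)) ka, (galois ^^ (d * m)) ka') \<in> H2"
   using fibres[OF m(1,2) m' _ G] a(1) less.prems(1) by blast
  note sat = saturate[where m = m, OF S S' c H2(1), folded w_def Ob_def Ob'_def]
  have "conj_isometric c c' d (fibre S h Ob) (fibre S' h Ob')" by (rule sat, erule H2(2), erule m(3), rule aa)
  then obtain K where K: "isometry c c' K (fibre S h Ob) (fibre S' h Ob')"
   "!!ka ka'. (ka, ka') \<in> K ==> ((galois ^^ d) ka, (galois ^^ d) ka') \<in> K" by blast
  have "isometry c c' (H1 \<union> K) (fibre S h (A - Ob) \<union> fibre S h Ob) (fibre S' h (A' - Ob') \<union> fibre S' h Ob')"
   by (rule isometry_union[OF H1(1) K(1)]) (rule fibre_contact[OF S] fibre_contact[OF S'], auto)+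
  moreover have "A - Ob \<union> Ob = A" "A' - Ob' \<union> Ob' = A'" using r(1) r'(1) by auto
  ultimately have "isometry c c' (H1 \<union> K) (fibre S h A) (fibre S' h A')" by (simp add: fibre_union)
  thus ?thesis using H1(2) K(2) by (intro exI[of _ "H1 \<union> K"]) blast
 qed
qed

text \<open>Induction on the number of points.  The terms \<open>y\<^sup>h\<close> at the lowest level \<open>h\<close> split the set
 into fibres, which the conjugation permutes and whose stabilisers are again generated by a power
 of the conjugation.\<close>

theorem equivariant_isometry:
 fixes c c' :: "puiseux => 'c"
 assumes c: "!!ka. c (galois ka) = c ka" "!!ka. c' (galois ka) = c' ka"
  and "d > 0" "finite S" "finite S'" "!!ka. ka \<in> S ==> (galois ^^ d) ka \<in> S" "!!ka. ka \<in> S' ==> (galois ^^ d) ka \<in> S'"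
  and "isometry c c' G S S'"
 shows "conj_isometric c c' d S S'"
 using assms(3-)
proof (induction "card S" arbitrary: S S' d G rule: less_induct)
 case less
 note d = less.prems(1) and fin = less.prems(2,3) and st = less.prems(4,5) and G = less.prems(6)
 show ?case
 proof (cases "\<exists>ka\<in>S. \<exists>mu\<in>S. ka ~= mu")
  case False
  have one: "ka = mu" if km: "ka \<in> S'" "mu \<in> S'" for ka mu
  proof -
   obtain x y where xy: "(x, ka) \<in> G" "(y, mu) \<in> G" using km isometryD(2)[OF G] by blast
   hence "x = y" using False isometryD(5)[OF G] by blast
   hence "contact ka mu = Pinf" using isometryD(4)[OF G xy] by simp
   thus ?thesis using yord_Pinf by simp
  qed
  have "((galois ^^ d) ka, (galois ^^ d) ka') \<in> G" if "(ka, ka') \<in> G" for ka ka'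
  proof -
   have "(galois ^^ d) ka = ka" using False st(1) isometryD(5)[OF G that] by blast
   moreover have "(galois ^^ d) ka' = ka'" using one st(2) isometryD(6)[OF G that] by blast
   ultimately show ?thesis using that by simp
  qed
  thus ?thesis using G by blast
 next
  case True
  define V where "V = {r. \<exists>ka\<in>S. \<exists>mu\<in>S. contact ka mu = Fin r}"
  have fV: "finite V" unfolding V_def using finite_contacts[of S S] fin(1) by simp
  have "V ~= {}"
  proof -
   obtain ka mu where k: "ka \<in> S" "mu \<in> S" "ka ~= mu" using True by blast
   then obtain r where "contact ka mu = Fin r" using contact_Fin by blast
   thus ?thesis using k by (auto simp: V_def)
  qed
  define h where "h = Min V"
  have "h \<in> V" unfolding h_def by (rule Min_in[OF fV \<open>V ~= {}\<close>])
  then obtain ka0 mu0 where k0: "ka0 \<in> S" "mu0 \<in> S" "contact ka0 mu0 = Fin h" by (auto simp: V_def)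
  have lev: "Fin h <= contact ka mu" if "ka \<in> S" "mu \<in> S" for ka mu
  proof (cases "ka = mu")
   case False
   then obtain r where r: "contact ka mu = Fin r" using contact_Fin by blast
   hence "r \<in> V" using that by (auto simp: V_def)
   thus ?thesis using Min_le[OF fV] r by (simp add: h_def)
  qed simp
  have lev': "Fin h <= contact ka mu" if km: "ka \<in> S'" "mu \<in> S'" for ka mu
  proof -
   obtain x y where xy: "(x, ka) \<in> G" "(y, mu) \<in> G" using km isometryD(2)[OF G] by blast
   thus ?thesis using isometryD(4)[OF G xy] lev isometryD(5)[OF G] by metis
  qed
  have S: "conj_stable d h S" and S': "conj_stable d h S'"
   by (unfold_locales; use fin st lev lev' in blast)+
  interpret S: conj_stable d h S by (rule S)
  interpret S': conj_stable d h S' by (rule S')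
  let ?p = "%ka. pcoeff ka h" and ?w = "cis (2 * pi * of_rat h) ^ d"
  have p: "?p ka = ?p mu \<longleftrightarrow> ?p ka' = ?p mu'" if g: "(ka, ka') \<in> G" "(mu, mu') \<in> G" for ka ka' mu mu'
   using contact_level_gt[OF lev, of ka mu] contact_level_gt[OF lev', of ka' mu'] isometryD(4)[OF G g]
    isometryD(5,6)[OF G g(1)] isometryD(5,6)[OF G g(2)] by simp
  have fibres: "conj_isometric c c' (d * m) (fibre S h {a}) (fibre S' h {a'})"
   if m: "m > 0" "?w ^ m * a = a" "?w ^ m * a' = a'" and K: "isometry c c' K (fibre S h {a}) (fibre S' h {a'})" for a a' m K
  proof (rule less.hyps)
   have "\<not> (ka0 \<in> fibre S h {a} \<and> mu0 \<in> fibre S h {a})"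
    using contact_level_gt[OF lev[OF k0(1,2)]] k0(3) by (auto simp: fibre_def)
   hence "fibre S h {a} \<subset> S" using k0 by (auto simp: fibre_def)
   thus "card (fibre S h {a}) < card S" by (rule psubset_card_mono[OF fin(1)])
   show "(galois ^^ (d * m)) ka \<in> fibre S h {a}" if "ka \<in> fibre S h {a}" for ka
    using that m(2) S.stable_funpow[of ka m] S.pcoeff_tau[of m ka] by (auto simp: fibre_def S.tau_eq)
   show "(galois ^^ (d * m)) ka \<in> fibre S' h {a'}" if "ka \<in> fibre S' h {a'}" for ka
    using that m(3) S'.stable_funpow[of ka m] S.pcoeff_tau[of m ka] by (auto simp: fibre_def S.tau_eq)
  qed (use d m(1) fin K in \<open>auto simp: fibre_def\<close>)
  have "\<forall>ka\<in>S. \<exists>ka'. (ka, ka') \<in> G" using isometryD(1)[OF G] by blast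
  then obtain \<phi> where phi: "!!ka. ka \<in> S ==> (ka, \<phi> ka) \<in> G" by metis
  have "\<phi> ka = ka'" if "(ka, ka') \<in> G" for ka ka'
   using isometryD(4)[OF G that phi, of ka] isometryD(5)[OF G that] yord_Pinf[of "ka' - \<phi> ka"] by simp
  hence S'_eq: "S' = \<phi> ` S" using isometryD(1,2)[OF G] by (auto simp: image_iff)
  have shape: "shape c c (fibre S h {?p mu}) = shape c c' (fibre S' h {?p (\<phi> mu)})" if m: "mu \<in> S" for mu
  proof (rule shape_eq[where K = "{(ka, ka') \<in> G. ?p ka = ?p mu}"])
   have iff: "?p ka = ?p mu \<longleftrightarrow> ?p ka' = ?p (\<phi> mu)" if "(ka, ka') \<in> G" for ka ka' by (rule p[OF that phi[OF m]])
   show "isometry c c' {(ka, ka') \<in> G. ?p ka = ?p mu} (fibre S h {?p mu}) (fibre S' h {?p (\<phi> mu)})"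
    unfolding isometry_def
   proof (intro conjI allI impI)
    show "Domain {(ka, ka') \<in> G. ?p ka = ?p mu} = fibre S h {?p mu}" using isometryD(1)[OF G] by (auto simp: fibre_def)
    show "Range {(ka, ka') \<in> G. ?p ka = ?p mu} = fibre S' h {?p (\<phi> mu)}"
     using isometryD(2)[OF G] iff by (auto simp: fibre_def)
   qed (use isometryD(3,4)[OF G] in auto)
  qed
  have counts: "card {a\<in>?p ` S. shape c c (fibre S h {a}) = T} = card {a\<in>?p ` S'. shape c c' (fibre S' h {a}) = T}" for T
  proof -
   let ?X = "{ka\<in>S. shape c c (fibre S h {?p ka}) = T}"
   have "card (?p ` ?X) = card ((%ka. ?p (\<phi> ka)) ` ?X)" using p[OF phi phi] by (intro card_image_cong) auto
   moreover have "{a\<in>?p ` S. shape c c (fibre S h {a}) = T} = ?p ` ?X"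
    "{a\<in>?p ` S'. shape c c' (fibre S' h {a}) = T} = (%ka. ?p (\<phi> ka)) ` ?X"
    using shape by (auto simp: S'_eq)
   ultimately show ?thesis by simp
  qed
  have "conj_isometric c c' d (fibre S h (?p ` S)) (fibre S' h (?p ` S'))"
  proof (rule glue_fibres[where c = c and c' = c', OF S S' d c])
   show "?w * a \<in> ?p ` S" if "a \<in> ?p ` S" for a using S.points_stable[OF that] .
   show "?w * a \<in> ?p ` S'" if "a \<in> ?p ` S'" for a using S'.points_stable[OF that] .
  qed (use fibres counts in auto)
  moreover have "fibre S h (?p ` S) = S" "fibre S' h (?p ` S') = S'" by (auto simp: fibre_def)
  ultimately show ?thesis by simp
 qed
qed

text \<open>All data attached to the bars containing a root, as one colour of the root.  Equivalences are
 then just the isometries that preserve colours.\<close>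

definition colour :: "germ => germ => puiseux => (rat => nat \<times> nat) \<times> bool \<times> bool" where
 "colour f g ka = (%h. let B = (h, {mu \<in> np_roots f \<union> np_roots g. Fin h <= contact ka mu}); a = pcoeff ka h in
  if ka \<in> np_roots f \<union> np_roots g \<and> B \<in> bars f g \<and> \<not> collinear_bar f g B
  then (total_mero_mult f g B, if a \<in> collinear_points f g B then mero_mult f g B a else 0) else (0, 0),
  ka \<in> np_roots f, ka \<in> np_roots g)"

context curve_pair
begin

lemma colour_bar:
 assumes k: "ka \<in> Lam"
 shows "fst (colour f g ka) h = (if is_bar (h, ball ka h) \<and> \<not> collinear_bar f g (h, ball ka h)
  then (total_mero_mult f g (h, ball ka h), if pcoeff ka h \<in> collinear_points f g (h, ball ka h)
   then mero_mult f g (h, ball ka h) (pcoeff ka h) else 0) else (0, 0))"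
 unfolding colour_def Let_def ball_def[symmetric] bars_eq using k by simp

end

lemma (in tree_equiv) colour_eq: assumes k: "ka \<in> Lam" shows "colour f' g' (\<phi> ka) = colour f g ka"
proof -
 have k': "\<phi> ka \<in> R.Lam" using image_Lam k by blast
 have "fst (colour f' g' (\<phi> ka)) h = fst (colour f g ka) h" for h
 proof -
  let ?B = "(h, ball ka h)"
  have m: "(h, R.ball (\<phi> ka) h) = bar_map \<phi> ?B" by (simp add: bar_map_def image_ball[OF k])
  show ?thesis
  proof (cases "is_bar ?B")
   case True
   have kB: "ka \<in> bar_roots ?B" using ball_self[OF k] by simp
   have mv: "move ?B (pcoeff ka h) = pcoeff (\<phi> ka) h" using move_eq[OF True kB] by simp
   have p: "pcoeff ka h \<in> points ?B" using kB by (auto simp: points_def)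
   have c: "pcoeff (\<phi> ka) h \<in> collinear_points f' g' (bar_map \<phi> ?B) \<longleftrightarrow> pcoeff ka h \<in> collinear_points f g ?B"
    unfolding collinear_points_map[OF True] mv[symmetric]
    using inj_on_image_mem_iff[OF bij_betw_imp_inj_on[OF bij_move[OF True]] p] collinear_points_eq[OF True] by blast
   show ?thesis unfolding colour_bar[OF k] R.colour_bar[OF k'] m
    using True is_bar_map[OF True] collinear_map[OF True] total_eq[OF True] zero_eq[OF True, of "pcoeff ka h"] mv c by simp
  next
   case False
   have "\<not> R.is_bar (bar_map \<phi> ?B)"
   proof
    assume "R.is_bar (bar_map \<phi> ?B)"
    then obtain C where C: "is_bar C" "bar_map \<phi> ?B = bar_map \<phi> C" using is_bar_map_onto by blast
    have "ball ka h \<subseteq> Lam" by (auto simp: ball_def)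
    hence "C = ?B" using C(2) is_bar_roots[OF C(1)] inj_on_image_eq_iff[OF inj_phi] by (auto simp: bar_map_def prod_eq_iff)
    thus False using C(1) False by simp
   qed
   thus ?thesis unfolding colour_bar[OF k] R.colour_bar[OF k'] m using False by simp
  qed
 qed
 moreover have "\<phi> ka \<in> np_roots f' \<longleftrightarrow> ka \<in> np_roots f" "\<phi> ka \<in> np_roots g' \<longleftrightarrow> ka \<in> np_roots g"
  unfolding image_f[symmetric] image_g[symmetric] using inj_on_image_mem_iff[OF inj_phi k] by auto
 ultimately show ?thesis by (simp add: prod_eq_iff fun_eq_iff) (simp add: colour_def)
qed

lemma (in tree_map) coloured_tree_equiv:
 assumes c: "!!ka. ka \<in> Lam ==> colour f' g' (\<phi> ka) = colour f g ka" shows "tree_equiv f g f' g' \<phi>"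
proof unfold_locales
 have eq: "total_mero_mult f' g' (bar_map \<phi> B) = total_mero_mult f g B \<and>
   (pcoeff ka (ht B) \<in> collinear_points f g B -->
    mero_mult f' g' (bar_map \<phi> B) (move B (pcoeff ka (ht B))) = mero_mult f g B (pcoeff ka (ht B)))"
  if B: "is_bar B" "\<not> collinear_bar f g B" and kB: "ka \<in> bar_roots B" for B ka
 proof -
  have k: "ka \<in> Lam" using is_bar_roots[OF B(1)] kB by blast
  hence k': "\<phi> ka \<in> R.Lam" using image_Lam by blast
  let ?h = "ht B"
  have b: "(?h, ball ka ?h) = B" using is_bar_ball[OF B(1) kB] by (simp add: prod_eq_iff)
  have b': "(?h, R.ball (\<phi> ka) ?h) = bar_map \<phi> B"
   using is_bar_ball[OF B(1) kB] image_ball[OF k] by (simp add: bar_map_def)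
  have mv: "pcoeff (\<phi> ka) ?h = move B (pcoeff ka ?h)" using move_eq[OF B(1) kB] by simp
  have "pcoeff ka ?h \<in> collinear_points f g B --> move B (pcoeff ka ?h) \<in> collinear_points f' g' (bar_map \<phi> B)"
   unfolding collinear_points_map[OF B(1)] by blast
  thus ?thesis
   using arg_cong[OF c[OF k], of "%x. fst x ?h"] unfolding colour_bar[OF k] R.colour_bar[OF k'] b b' mv
   using B is_bar_map[OF B(1)] collinear_map[OF B(1)] by (simp split: if_splits)
 qed
 fix B assume B: "is_bar B" "\<not> collinear_bar f g B"
 obtain ka where "ka \<in> bar_roots B" using is_bar_nonempty[OF B(1)] by blast
 thus "total_mero_mult f' g' (bar_map \<phi> B) = total_mero_mult f g B" using eq[OF B] by blast
 fix p assume p: "p \<in> collinear_points f g B"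
 obtain mu where "mu \<in> bar_roots B" "p = pcoeff mu (ht B)"
  using collinear_pointD(1)[OF B(1) p] by (auto simp: points_def)
 thus "mero_mult f' g' (bar_map \<phi> B) (move B p) = mero_mult f g B p" using eq[OF B, of mu] p by simp
qed

lemma (in tree_equiv) tree_equivalence: "tree_equivalence f g f' g' \<phi>"
proof -
 have "mero_mult f g B (trunk_point B T) = mero_mult f' g' (bar_map \<phi> B) (trunk_point (bar_map \<phi> B) (\<phi> ` T))"
  if B: "is_bar B" "\<not> collinear_bar f g B" and T: "T \<in> trunks B" "Delta f g B T = 0" for B T
 proof -
  obtain a where a: "a \<in> points B" "T = trunk_at B a" using T(1) trunks_eq[OF B(1)] by blast
  have "move B a \<in> R.points (bar_map \<phi> B)" using bij_move[OF B(1)] a(1) by (auto simp: bij_betw_def)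
  hence "trunk_point (bar_map \<phi> B) (\<phi> ` T) = move B a"
   using trunk_at_move[OF B(1) a(1)] R.trunk_point_at a(2) by metis
  thus ?thesis using zero_eq[OF B, of a] a T(2) collinear_points_eq[OF B(1)] by (simp add: trunk_point_at)
 qed
 thus ?thesis
  unfolding tree_equivalence_def bars_eq
  using bij_f bij_g contacts nu_ground_f nu_ground_g total_eq by auto
qed

lemma (in curve_pair) colour_galois: "colour f g (galois ka) = colour f g ka"
proof (cases "ka \<in> Lam")
 case True
 thus ?thesis using tree_equiv.colour_eq[OF galois_tree_equiv] by blast
next
 case False
 hence "galois ka \<notin> Lam" by (simp add: galois_np_roots_iff)
 thus ?thesis using False by (simp add: colour_def fun_eq_iff)
qed

text \<open>Colours are invariant under conjugation, by \<open>galois_tree_equiv\<close>; so an isometry that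
 preserves them can be made equivariant.\<close>

lemma (in tree_equiv) equivariant_equivalence:
 obtains \<psi> where "tree_equiv f g f' g' \<psi>" "!!ka. ka \<in> Lam ==> \<psi> (galois ka) = galois (\<psi> ka)"
proof -
 let ?c = "colour f g" and ?c' = "colour f' g'"
 have iso: "isometry ?c ?c' {(ka, \<phi> ka) | ka. ka \<in> Lam} Lam R.Lam"
  unfolding isometry_def image_Lam[symmetric] using colour_eq contacts by auto
 have "\<exists>H. isometry ?c ?c' H Lam R.Lam \<and>
   (\<forall>ka ka'. (ka, ka') \<in> H --> ((galois ^^ 1) ka, (galois ^^ 1) ka') \<in> H)"
  by (rule equivariant_isometry[OF colour_galois R.colour_galois _ finite_Lam R.finite_Lam _ _ iso])
   (auto simp: galois_np_roots_iff)
 then obtain H where H: "isometry ?c ?c' H Lam R.Lam"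
  "\<forall>ka ka'. (ka, ka') \<in> H --> ((galois ^^ 1) ka, (galois ^^ 1) ka') \<in> H" by blast
 have fn: "ka' = mu'" if "(ka, ka') \<in> H" "(ka, mu') \<in> H" for ka ka' mu'
  using isometryD(4)[OF H(1) that, symmetric] yord_Pinf by simp
 define \<psi> where "\<psi> ka = (THE ka'. (ka, ka') \<in> H)" for ka
 have graph: "\<psi> ka = ka'" if "(ka, ka') \<in> H" for ka ka' unfolding \<psi>_def using that fn by blast
 have inH: "(ka, \<psi> ka) \<in> H" if "ka \<in> Lam" for ka
 proof -
  obtain ka' where "(ka, ka') \<in> H" using isometryD(1)[OF H(1)] \<open>ka \<in> Lam\<close> by blast
  thus ?thesis using graph by simp
 qed
 have con: "contact (\<psi> ka) (\<psi> mu) = contact ka mu" if "ka \<in> Lam" "mu \<in> Lam" for ka mu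
  using isometryD(4)[OF H(1) inH[OF that(1)] inH[OF that(2)]] by simp
 have col: "?c' (\<psi> ka) = ?c ka" if "ka \<in> Lam" for ka using isometryD(3)[OF H(1) inH[OF that]] by simp
 have inj: "inj_on \<psi> Lam"
 proof (rule inj_onI)
  fix ka mu assume "ka \<in> Lam" "mu \<in> Lam" "\<psi> ka = \<psi> mu"
  hence "contact ka mu = Pinf" using con[of ka mu] by simp
  thus "ka = mu" using yord_Pinf by simp
 qed
 have im: "\<psi> ` Lam = R.Lam"
 proof
  show "\<psi> ` Lam \<subseteq> R.Lam" using isometryD(6)[OF H(1) inH] by blast
  show "R.Lam \<subseteq> \<psi> ` Lam"
  proof
   fix ka' assume "ka' \<in> R.Lam"
   then obtain ka where k: "(ka, ka') \<in> H" using isometryD(2)[OF H(1)] by blast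
   show "ka' \<in> \<psi> ` Lam" using graph[OF k] isometryD(5)[OF H(1) k] by blast
  qed
 qed
 have kind: "\<psi> ka \<in> np_roots f' \<longleftrightarrow> ka \<in> np_roots f" "\<psi> ka \<in> np_roots g' \<longleftrightarrow> ka \<in> np_roots g" if "ka \<in> Lam" for ka
  using col[OF that] by (simp_all add: colour_def)
 interpret T: tree_map f g f' g' \<psi>
 proof unfold_locales
  have "\<psi> ` A = A'" if A: "A \<subseteq> Lam" "A' \<subseteq> R.Lam" "!!ka. ka \<in> Lam ==> \<psi> ka \<in> A' \<longleftrightarrow> ka \<in> A" for A A'
  proof
   show "\<psi> ` A \<subseteq> A'" using A(1,3) by (intro image_subsetI) blast
   show "A' \<subseteq> \<psi> ` A"
   proof
    fix ka' assume k': "ka' \<in> A'"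
    hence "ka' \<in> \<psi> ` Lam" unfolding im using A(2) by (rule subsetD[rotated])
    then obtain ka where "ka \<in> Lam" "ka' = \<psi> ka" by (rule imageE)
    thus "ka' \<in> \<psi> ` A" using A(3)[of ka] k' by simp
   qed
  qed
  from this[OF _ _ kind(1)] this[OF _ _ kind(2)]
  have "\<psi> ` np_roots f = np_roots f'" "\<psi> ` np_roots g = np_roots g'" by simp_all
  thus "bij_betw \<psi> (np_roots f) (np_roots f')" "bij_betw \<psi> (np_roots g) (np_roots g')"
   using inj by (auto simp: bij_betw_def intro: inj_on_subset)
 qed (use con nu_ground_f nu_ground_g in auto)
 show ?thesis
 proof (rule that)
  show "tree_equiv f g f' g' \<psi>" by (rule T.coloured_tree_equiv) (rule col)
  show "\<psi> (galois ka) = galois (\<psi> ka)" if "ka \<in> Lam" for ka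
   by (rule graph) (use H(2) inH[OF that] in simp)
 qed
qed

text \<open>A class is an orbit of bars under conjugation.\<close>

lemma (in tree_equiv) classes_bij:
 assumes e: "!!ka. ka \<in> Lam ==> \<phi> (galois ka) = galois (\<phi> ka)"
 shows "bij_betw ((`) (bar_map \<phi>)) (bar_classes f g) (bar_classes f' g')"
proof -
 have comm: "bar_map \<phi> ((conj_bar ^^ i) B) = (conj_bar ^^ i) (bar_map \<phi> B)" if B: "is_bar B" for i B
 proof (induction i)
  case (Suc i)
  have "bar_map \<phi> (conj_bar C) = conj_bar (bar_map \<phi> C)" if "is_bar C" for C
   using e is_bar_roots[OF that] by (auto simp: bar_map_def image_image intro!: image_cong)
  from this[OF is_bar_funpow[OF B]] show ?case using Suc by simp
 qed simp
 have funpow: "(conj_bar ^^ i) B \<in> BB" if "BB \<in> bar_classes f g" "B \<in> BB" for B BB i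
  using that classD(3) by (induction i) auto
 have funpow': "(conj_bar ^^ i) B \<in> BB" if "BB \<in> bar_classes f' g'" "B \<in> BB" for B BB i
  using that R.classD(3) by (induction i) auto
 have img: "bar_map \<phi> ` BB = CC" if c: "BB \<in> bar_classes f g" "B \<in> BB" "CC \<in> bar_classes f' g'" "bar_map \<phi> B \<in> CC" for BB CC B
 proof
  note b = classD(2)[OF c(1,2)]
  show "bar_map \<phi> ` BB \<subseteq> CC"
   using classD(4)[OF c(1,2)] comm[OF b] funpow'[OF c(3,4)] by fastforce
  show "CC \<subseteq> bar_map \<phi> ` BB"
   using R.classD(4)[OF c(3,4)] comm[OF b, symmetric] funpow[OF c(1,2)] by (force simp: image_iff)
 qed
 show ?thesis
 proof (rule bij_betw_imageI)
  show "inj_on ((`) (bar_map \<phi>)) (bar_classes f g)"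
  proof (rule inj_onI)
   fix BB CC assume c: "BB \<in> bar_classes f g" "CC \<in> bar_classes f g" "bar_map \<phi> ` BB = bar_map \<phi> ` CC"
   have "BB \<subseteq> {B. is_bar B}" "CC \<subseteq> {B. is_bar B}" using classD(2) c by auto
   thus "BB = CC" using inj_on_image_eq_iff[OF inj_bar_map] c(3) by blast
  qed
  show "(`) (bar_map \<phi>) ` bar_classes f g = bar_classes f' g'"
  proof
   show "(`) (bar_map \<phi>) ` bar_classes f g \<subseteq> bar_classes f' g'"
   proof clarify
    fix BB assume c: "BB \<in> bar_classes f g"
    obtain B where B: "B \<in> BB" using classD(1)[OF c] by blast
    obtain CC where "CC \<in> bar_classes f' g'" "bar_map \<phi> B \<in> CC" using R.class_exists[OF is_bar_map[OF classD(2)[OF c B]]] by blast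
    thus "bar_map \<phi> ` BB \<in> bar_classes f' g'" using img[OF c B] by simp
   qed
   show "bar_classes f' g' \<subseteq> (`) (bar_map \<phi>) ` bar_classes f g"
   proof
    fix CC assume c: "CC \<in> bar_classes f' g'"
    obtain C where C: "C \<in> CC" using R.classD(1)[OF c] by blast
    obtain B where B: "is_bar B" "C = bar_map \<phi> B" using is_bar_map_onto[OF R.classD(2)[OF c C]] by blast
    obtain BB where "BB \<in> bar_classes f g" "B \<in> BB" using class_exists[OF B(1)] by blast
    thus "CC \<in> (`) (bar_map \<phi>) ` bar_classes f g" using img[of BB B CC] c C B(2) by blast
   qed
  qed
 qed
qed

section \<open>Orders and intersection numbers as tree-invariants\<close>

theorem theoremI:
  fixes f g :: germ
  assumes "np_pair f g"
  shows
    "(\<forall>\<BB>\<in>noncollinear_classes f g.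
        has_intersection_mult f (P_germ f g \<BB>)
          (class_nu f \<BB> * of_nat (class_pure_mero_mult f g \<BB>)) \<and>
        has_intersection_mult g (P_germ f g \<BB>)
          (class_nu g \<BB> * of_nat (class_pure_mero_mult f g \<BB>)) \<and>
        has_intersection_mult (f * g) (P_germ f g \<BB>)
          ((class_nu f \<BB> + class_nu g \<BB>) * of_nat (class_pure_mero_mult f g \<BB>))) \<and>
     (\<forall>\<BB>\<in>noncollinear_classes f g. P_series f g \<BB> \<in> range germ_embed) \<and>
     (\<forall>\<BB>\<in>noncollinear_classes f g. class_height \<BB> > 0 \<longrightarrow> Q_series f g \<BB> \<in> range germ_embed) \<and>
     Q_ground_series f g \<in> range germ_embed \<and>
     (\<exists>u E. u dvd 1 \<and>
        jacobian_germ f g = u * germ_y ^ E * Q_ground_germ f g *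
          (\<Prod>\<BB>\<in>{\<BB> \<in> noncollinear_classes f g. class_height \<BB> > 0}. P_germ f g \<BB> * Q_germ f g \<BB>)) \<and>
     (\<forall>f' g'. np_pair f' g' \<and> (\<exists>\<phi>. tree_equivalence f g f' g' \<phi>) \<longrightarrow>
        (\<exists>\<phi>. tree_equivalence f g f' g' \<phi> \<and>
           bij_betw ((`) (bar_map \<phi>)) (bar_classes f g) (bar_classes f' g')) \<and>
        (\<forall>\<phi> \<BB> \<BB>'. tree_equivalence f g f' g' \<phi> \<and> \<BB> \<in> noncollinear_classes f g \<and>
           \<BB>' \<in> bar_classes f' g' \<and> \<BB>' = bar_map \<phi> ` \<BB> \<longrightarrow>
             intersection_mult f (P_germ f g \<BB>) = intersection_mult f' (P_germ f' g' \<BB>') \<and>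
             intersection_mult g (P_germ f g \<BB>) = intersection_mult g' (P_germ f' g' \<BB>') \<and>
             intersection_mult (f * g) (P_germ f g \<BB>) =
               intersection_mult (f' * g') (P_germ f' g' \<BB>') \<and>
             x_order (P_germ f g \<BB>) = x_order (P_germ f' g' \<BB>') \<and>
             (class_height \<BB> > 0 \<longrightarrow> x_order (Q_germ f g \<BB>) = x_order (Q_germ f' g' \<BB>'))) \<and>
        (\<not> collinear_bar f g (ground_bar f g) \<or> polar_count f g = polar_count f' g' \<longrightarrow>
           x_order (Q_ground_germ f g) = x_order (Q_ground_germ f' g')))"
proof -
 interpret curve_pair f g by (rule curve_pair.intro[OF assms])
 have invariants: "(\<exists>\<phi>. tree_equivalence f g f' g' \<phi> \<and> bij_betw ((`) (bar_map \<phi>)) (bar_classes f g) (bar_classes f' g'))"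
  "tree_equivalence f g f' g' \<phi> \<and> BB \<in> noncollinear_classes f g \<and> BB' \<in> bar_classes f' g' \<and> BB' = bar_map \<phi> ` BB ==>
   intersection_mult f (P_germ f g BB) = intersection_mult f' (P_germ f' g' BB') \<and>
   intersection_mult g (P_germ f g BB) = intersection_mult g' (P_germ f' g' BB') \<and>
   intersection_mult (f * g) (P_germ f g BB) = intersection_mult (f' * g') (P_germ f' g' BB') \<and>
   x_order (P_germ f g BB) = x_order (P_germ f' g' BB') \<and>
   (class_height BB > 0 --> x_order (Q_germ f g BB) = x_order (Q_germ f' g' BB'))"
  "\<not> collinear_bar f g (ground_bar f g) \<or> polar_count f g = polar_count f' g' ==>
   x_order (Q_ground_germ f g) = x_order (Q_ground_germ f' g')"
  if np': "np_pair f' g'" and ex: "\<exists>\<phi>. tree_equivalence f g f' g' \<phi>" for f' g' \<phi> BB BB'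
 proof -
  obtain \<psi> where "tree_equivalence f g f' g' \<psi>" using ex by blast
  then interpret T: tree_equiv f g f' g' \<psi> by (rule tree_equivI[OF assms np'])
  show "\<exists>\<phi>. tree_equivalence f g f' g' \<phi> \<and> bij_betw ((`) (bar_map \<phi>)) (bar_classes f g) (bar_classes f' g')"
  proof -
   obtain \<theta> where x: "tree_equiv f g f' g' \<theta>" "!!ka. ka \<in> Lam ==> \<theta> (galois ka) = galois (\<theta> ka)"
    using T.equivariant_equivalence by metis
   show ?thesis using tree_equiv.tree_equivalence[OF x(1)] tree_equiv.classes_bij[OF x(1) x(2)] by blast
  qed
  show "x_order (Q_ground_germ f g) = x_order (Q_ground_germ f' g')"
   if "\<not> collinear_bar f g (ground_bar f g) \<or> polar_count f g = polar_count f' g'"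
   using T.ground_count_eq[OF that] Q_ground_props(3) T.R.Q_ground_props(3)
   by (simp add: ground_root_conj T.R.ground_root_conj)
  assume a: "tree_equivalence f g f' g' \<phi> \<and> BB \<in> noncollinear_classes f g \<and> BB' \<in> bar_classes f' g' \<and> BB' = bar_map \<phi> ` BB"
  then interpret E: tree_equiv f g f' g' \<phi> using tree_equivI[OF assms np'] by blast
  have c: "BB \<in> noncollinear_classes f g" "bar_map \<phi> ` BB \<in> bar_classes f' g'" "BB' = bar_map \<phi> ` BB" using a by auto
  show "intersection_mult f (P_germ f g BB) = intersection_mult f' (P_germ f' g' BB') \<and>
   intersection_mult g (P_germ f g BB) = intersection_mult g' (P_germ f' g' BB') \<and>
   intersection_mult (f * g) (P_germ f g BB) = intersection_mult (f' * g') (P_germ f' g' BB') \<and>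
   x_order (P_germ f g BB) = x_order (P_germ f' g' BB') \<and>
   (class_height BB > 0 --> x_order (Q_germ f g BB) = x_order (Q_germ f' g' BB'))"
   using E.intersections_eq[OF c(1,2)] E.x_orders_eq[OF c(1,2)] c(3) by simp
 qed
 have Q_ground: "Q_ground_series f g \<in> range emb" by (rule Q_ground_props(1)) (simp add: ground_root_conj)
 obtain u E where uE: "u dvd 1" "Jac = u * germ_y ^ E * Q_ground_germ f g *
   (\<Prod>BB\<in>{BB \<in> noncollinear_classes f g. class_height BB > 0}. P_germ f g BB * Q_germ f g BB)"
  using jacobian_decomposition by blast
 show ?thesis
 proof (intro conjI)
  show "\<exists>u E. u dvd 1 \<and> Jac = u * germ_y ^ E * Q_ground_germ f g *
    (\<Prod>BB\<in>{BB \<in> noncollinear_classes f g. class_height BB > 0}. P_germ f g BB * Q_germ f g BB)"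
   using uE by blast
 qed (use P_intersection P_germ_props(1) Q_germ_props(1) Q_ground invariants in \<open>blast+\<close>)
qed

end
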